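(* Let $\varphi:A\to X$ be a smooth map of smooth spaces. If $k\ge2$, then the sequence $$0\to\varphi^*\widehat H^{k-1}_{\mathrm{flat}}(X;\mathbb Z)\to\widehat H^{k-1}(A;\mathbb Z)\xrightarrow{\breve\imath}\widehat H^k_\varphi(X,A;\mathbb Z)\xrightarrow{\breve p}\widehat H^k(X;\mathbb Z)\xrightarrow{\varphi^*\circ c}\varphi^*H^k(X;\mathbb Z)\to0$$ is exact (the first map being the inclusion). If $k=0$ or $k=1$, then the sequence $$0\to\widehat H^k_\varphi(X,A;\mathbb Z)\xrightarrow{\breve p}\widehat H^k(X;\mathbb Z)\xrightarrow{\varphi^*\circ c}\varphi^*H^k(X;\mathbb Z)\to0$$ is exact.
   Context: **Smooth spaces.** A differential space (Sikorski) is a topological space $X$ with a set $C^\infty(X)$ of continuous real functions such that $X$ carries the initial topology, $C^\infty(X)$ is local and closed under composition with smooth functions of several variables; forms $\Omega^*(X)$, integration over smooth singular chains and Stokes' theorem are available. A *smooth space* is a differential space for which: (i) smooth and continuous singular (co)homology agree; (ii) the de Rham theorem holds; (iii) pushing forward fundamental cycles gives an isomorphism from bordism of oriented $p$-stratifolds (in the sense of Kreck, *Differential Algebraic Topology* ) to integral smooth singular homology. Manifolds are smooth spaces. **Differential characters.** $C_n\supset Z_n$ denote smooth singular chains and cycles. For $k\ge1$, $\widehat H^k(X;\mathbb Z)$ is the abelian group of homomorphisms $h:Z_{k-1}(X;\mathbb Z)\to \mathrm U(1)$ for which there is a (unique) form $\mathrm{curv}(h)\in\Omega^k(X)$ with $h(\partial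 c)=\exp(2\pi i\int_c\mathrm{curv}(h))$ for all $c\in C_k(X;\mathbb Z)$; it is closed with integral periods. $c(h)\in H^k(X;\mathbb Z)$ is the class of $x\mapsto\int_x\mathrm{curv}(h)-\tilde h(\partial x)$, $\tilde h$ any real-valued homomorphism on $Z_{k-1}(X;\mathbb Z)$ with $h=\exp(2\pi i\tilde h)$. $\varphi^*h:=h\circ\varphi_*$. $\widehat H^k_{\mathrm{flat}}(X;\mathbb Z):=\{h:\mathrm{curv}(h)=0\}$. $\widehat H^0(X;\mathbb Z):=H^0(X;\mathbb Z)$ with $c=\mathrm{id}$. $\varphi^*\widehat H^{k-1}_{\mathrm{flat}}(X;\mathbb Z)\subset\widehat H^{k-1}(A;\mathbb Z)$ and $\varphi^*H^k(X;\mathbb Z)\subset H^k(A;\mathbb Z)$ denote the images under $\varphi^*$. **Relative differential characters.** The mapping cone complex is $C_k^\varphi(X,A;\mathbb Z):=C_k(X;\mathbb Z)\times C_{k-1}(A;\mathbb Z)$ with $\partial_\varphi(s,t):=(\partial s+\varphi_*t,-\partial t)$; its cycles are $Z_k^\varphi(X,A;\mathbb Z)$ and its cohomology is $H_\varphi^k(X,A;\mathbb Z)$. For $k\ge1$, $\widehat H^k_\varphi(X,A;\mathbb Z)$ is the group of homomorphisms $f:Z_{k-1}^\varphi(X,A;\mathbb Z)\to\mathrm U(1)$ for which there is a pair $(\omega,\vartheta)\in\Omega^k(X)\times\Omega^{k-1}(A)$ with $f(\partial_\varphi(x,y))=\exp[2\pi i(\int_x\omega+\int_y\vartheta)]$ for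 all $(x,y)\in C_k^\varphi(X,A;\mathbb Z)$. $\widehat H_\varphi^0(X,A;\mathbb Z):=H^0_\varphi(X,A;\mathbb Z)$. The maps are $\breve\imath(g)(s,t):=g(t)$ for $g\in\widehat H^{k-1}(A;\mathbb Z)$ ($k\ge2$) and $\breve p(f)(z):=f(z,0)$ for $k\ge1$; for $k=0$, $\breve p$ is the natural map $H^0_\varphi(X,A;\mathbb Z)\to H^0(X;\mathbb Z)$. *)

theory Defs
  imports "HOL-Analysis.Analysis" "HOL-Homology.Homology"
begin

section \<open>Smooth functions on subsets of Euclidean space\<close>

text \<open>
  The space \<open>\<real>\<^sup>n\<close> is the library's \<^const>\<open>Euclidean_space\<close>: sequences of reals vanishing from
  index \<open>n\<close> on.
\<close>

definition partial_deriv :: "nat \<Rightarrow> ((nat \<Rightarrow> real) \<Rightarrow> real) \<Rightarrow> (nat \<Rightarrow> real) \<Rightarrow> real" where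
  "partial_deriv i f x = deriv (\<lambda>t. f (x(i := t))) (x i)"

text \<open>\<open>C\<^sup>\<infinity>\<close> on an open set: all iterated partial derivatives exist and are continuous.\<close>

definition smooth_on_open :: "nat \<Rightarrow> (nat \<Rightarrow> real) set \<Rightarrow> ((nat \<Rightarrow> real) \<Rightarrow> real) \<Rightarrow> bool" where
  "smooth_on_open n U f \<longleftrightarrow>
     openin (Euclidean_space n) U \<and>
     (\<forall>is. set is \<subseteq> {..<n} \<longrightarrow>
        continuous_map (subtopology (Euclidean_space n) U) euclideanreal (foldr partial_deriv is f) \<and>
        (\<forall>i<n. \<forall>x\<in>U. (\<lambda>t. foldr partial_deriv is f (x(i := t))) differentiable at (x i)))"

text \<open>Smoothness on an arbitrary subset means local extendability to smooth functions on open sets.\<close>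

definition smooth_on :: "nat \<Rightarrow> (nat \<Rightarrow> real) set \<Rightarrow> ((nat \<Rightarrow> real) \<Rightarrow> real) \<Rightarrow> bool" where
  "smooth_on n S f \<longleftrightarrow>
     (\<forall>x\<in>S. \<exists>U g. x \<in> U \<and> smooth_on_open n U g \<and> (\<forall>y\<in>U \<inter> S. g y = f y))"

text \<open>
  The partial derivative of a function on \<open>S\<close>, computed from any local smooth extension.  This is
  used for convex \<open>S\<close> with nonempty interior only; there it does not depend on the extension, also at
  boundary points of \<open>S\<close>.
\<close>

definition partial_deriv_on ::
    "nat \<Rightarrow> (nat \<Rightarrow> real) set \<Rightarrow> nat \<Rightarrow> ((nat \<Rightarrow> real) \<Rightarrow> real) \<Rightarrow> (nat \<Rightarrow> real) \<Rightarrow> real" where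
  "partial_deriv_on n S i f x =
     (THE D. \<exists>U g. x \<in> U \<and> smooth_on_open n U g \<and> (\<forall>y\<in>U \<inter> S. g y = f y) \<and> D = partial_deriv i g x)"


section \<open>Differential spaces\<close>

text \<open>
  Smooth functions are normalised to be \<^const>\<open>extensional\<close>, so that they are honest functions on
  the space.
\<close>

record 'a dspace =
  dtop :: "'a topology"
  dfun :: "('a \<Rightarrow> real) set"

abbreviation dpoints :: "'a dspace \<Rightarrow> 'a set" where
  "dpoints X \<equiv> topspace (dtop X)"

definition differential_space :: "'a dspace \<Rightarrow> bool" where
  "differential_space X \<longleftrightarrow>
     dfun X \<subseteq> extensional (dpoints X) \<and>
     dtop X = topology_generated_by {{x \<in> dpoints X. f x \<in> V} | f V. f \<in> dfun X \<and> open V} \<and>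
     (\<forall>f \<in> extensional (dpoints X).
        (\<forall>x\<in>dpoints X. \<exists>U g. openin (dtop X) U \<and> x \<in> U \<and> g \<in> dfun X \<and> (\<forall>y\<in>U. f y = g y))
        \<longrightarrow> f \<in> dfun X) \<and>
     (\<forall>n F fs. smooth_on_open n (topspace (Euclidean_space n)) F \<and> (\<forall>i<n. fs i \<in> dfun X) \<longrightarrow>
        restrict (\<lambda>x. F (\<lambda>i. if i < n then fs i x else 0)) (dpoints X) \<in> dfun X)"

definition smooth_map :: "'a dspace \<Rightarrow> 'b dspace \<Rightarrow> ('a \<Rightarrow> 'b) \<Rightarrow> bool" where
  "smooth_map X Y \<phi> \<longleftrightarrow>
     \<phi> \<in> dpoints X \<rightarrow> dpoints Y \<and> (\<forall>f\<in>dfun Y. restrict (f \<circ> \<phi>) (dpoints X) \<in> dfun X)"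

definition diffeo :: "'a dspace \<Rightarrow> 'b dspace \<Rightarrow> ('a \<Rightarrow> 'b) \<Rightarrow> bool" where
  "diffeo X Y \<phi> \<longleftrightarrow>
     bij_betw \<phi> (dpoints X) (dpoints Y) \<and> smooth_map X Y \<phi> \<and>
     smooth_map Y X (inv_into (dpoints X) \<phi>)"

definition dsubspace :: "'a dspace \<Rightarrow> 'a set \<Rightarrow> 'a dspace" where
  "dsubspace X S =
     \<lparr>dtop = subtopology (dtop X) S,
      dfun = {f \<in> extensional (dpoints X \<inter> S).
                \<forall>x \<in> dpoints X \<inter> S. \<exists>U g. openin (dtop X) U \<and> x \<in> U \<and> g \<in> dfun X \<and>
                   (\<forall>y \<in> U \<inter> S. f y = g y)}\<rparr>"

definition dproduct :: "'a dspace \<Rightarrow> 'b dspace \<Rightarrow> ('a \<times> 'b) dspace" where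
  "dproduct X Y =
     \<lparr>dtop = prod_topology (dtop X) (dtop Y),
      dfun = {h \<in> extensional (dpoints X \<times> dpoints Y).
                \<forall>z \<in> dpoints X \<times> dpoints Y. \<exists>U n F fs.
                  openin (prod_topology (dtop X) (dtop Y)) U \<and> z \<in> U \<and>
                  smooth_on_open n (topspace (Euclidean_space n)) F \<and>
                  (\<forall>i<n. (\<exists>f\<in>dfun X. fs i = f \<circ> fst) \<or> (\<exists>g\<in>dfun Y. fs i = g \<circ> snd)) \<and>
                  (\<forall>w\<in>U. h w = F (\<lambda>i. if i < n then fs i w else 0))}\<rparr>"

definition euclidean_dspace :: "nat \<Rightarrow> (nat \<Rightarrow> real) set \<Rightarrow> (nat \<Rightarrow> real) dspace" where
  "euclidean_dspace n S =
     \<lparr>dtop = subtopology (Euclidean_space n) S, dfun = {f \<in> extensional S. smooth_on n S f}\<rparr>"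

definition half_line :: "real dspace" where
  "half_line =
     \<lparr>dtop = top_of_set {0..},
      dfun = {f \<in> extensional {0..}.
                smooth_on 1 {x \<in> topspace (Euclidean_space 1). 0 \<le> x 0} (\<lambda>x. f (x 0))}\<rparr>"


section \<open>Chain complexes, homology and cohomology\<close>

text \<open>
  A complex in nonnegative degrees; \<open>cbd K p\<close> maps degree \<open>p\<close> to degree \<open>p - 1\<close> and is zero for
  \<open>p = 0\<close>.
\<close>

record 'c chain_complex =
  chains :: "nat \<Rightarrow> 'c set"
  cbd :: "nat \<Rightarrow> 'c \<Rightarrow> 'c"

definition cycles :: "('c::ab_group_add) chain_complex \<Rightarrow> nat \<Rightarrow> 'c set" where
  "cycles K p = {c \<in> chains K p. cbd K p c = 0}"

definition boundaries :: "('c::ab_group_add) chain_complex \<Rightarrow> nat \<Rightarrow> 'c set" where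
  "boundaries K p = cbd K (Suc p) ` chains K (Suc p)"

definition cycle_group :: "('c::ab_group_add) chain_complex \<Rightarrow> nat \<Rightarrow> 'c monoid" where
  "cycle_group K p = \<lparr>carrier = cycles K p, mult = (+), one = 0\<rparr>"

definition homology :: "('c::ab_group_add) chain_complex \<Rightarrow> nat \<Rightarrow> 'c set monoid" where
  "homology K p = cycle_group K p Mod boundaries K p"

text \<open>Cochains with values in \<open>'g\<close> are normalised to be \<open>0\<close> off the chain group.\<close>

definition cochains ::
    "('c::ab_group_add) chain_complex \<Rightarrow> nat \<Rightarrow> ('c \<Rightarrow> 'g::ab_group_add) set" where
  "cochains K p = {u. (\<forall>x\<in>chains K p. \<forall>y\<in>chains K p. u (x + y) = u x + u y) \<and>
                      (\<forall>x. x \<notin> chains K p \<longrightarrow> u x = 0)}"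

definition coboundary ::
    "('c::ab_group_add) chain_complex \<Rightarrow> nat \<Rightarrow> ('c \<Rightarrow> 'g::ab_group_add) \<Rightarrow> 'c \<Rightarrow> 'g" where
  "coboundary K p u = (\<lambda>c. if c \<in> chains K (Suc p) then u (cbd K (Suc p) c) else 0)"

definition cocycles ::
    "('c::ab_group_add) chain_complex \<Rightarrow> nat \<Rightarrow> ('c \<Rightarrow> 'g::ab_group_add) set" where
  "cocycles K p = {u \<in> cochains K p. coboundary K p u = (\<lambda>_. 0)}"

definition coboundaries ::
    "('c::ab_group_add) chain_complex \<Rightarrow> nat \<Rightarrow> ('c \<Rightarrow> 'g::ab_group_add) set" where
  "coboundaries K p = (case p of 0 \<Rightarrow> {\<lambda>_. 0} | Suc q \<Rightarrow> coboundary K q ` cochains K q)"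

definition cocycle_group ::
    "('c::ab_group_add) chain_complex \<Rightarrow> nat \<Rightarrow> ('c \<Rightarrow> 'g::ab_group_add) monoid" where
  "cocycle_group K p = \<lparr>carrier = cocycles K p, mult = (\<lambda>u v c. u c + v c), one = (\<lambda>_. 0)\<rparr>"

definition cohomology ::
    "('c::ab_group_add) chain_complex \<Rightarrow> nat \<Rightarrow> ('c \<Rightarrow> 'g::ab_group_add) set monoid" where
  "cohomology K p = cocycle_group K p Mod coboundaries K p"

definition cohomology_class ::
    "('c::ab_group_add) chain_complex \<Rightarrow> nat \<Rightarrow> ('c \<Rightarrow> 'g::ab_group_add) \<Rightarrow> ('c \<Rightarrow> 'g) set" where
  "cohomology_class K p u = coboundaries K p #>\<^bsub>cocycle_group K p\<^esub> u"

definition homology_class :: "('c::ab_group_add) chain_complex \<Rightarrow> nat \<Rightarrow> 'c \<Rightarrow> 'c set" where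
  "homology_class K p z = boundaries K p #>\<^bsub>cycle_group K p\<^esub> z"

text \<open>
  The map induced on cohomology by a chain map \<open>m\<close> from \<open>K\<close> to \<open>L\<close>.  A map out of a quotient group
  is given by the union of the values on all representatives, which are one and the same coset
  whenever the map is well defined.
\<close>

definition cohomology_map ::
    "('c::ab_group_add) chain_complex \<Rightarrow> (nat \<Rightarrow> 'c \<Rightarrow> 'd::ab_group_add) \<Rightarrow> nat
      \<Rightarrow> ('d \<Rightarrow> 'g::ab_group_add) set \<Rightarrow> ('c \<Rightarrow> 'g) set" where
  "cohomology_map K m p cls =
     (\<Union>u\<in>cls. cohomology_class K p (\<lambda>c. if c \<in> chains K p then u (m p c) else 0))"

definition singular_complex :: "'a topology \<Rightarrow> 'a chain chain_complex" where
  "singular_complex T = \<lparr>chains = (\<lambda>p. {c. singular_chain p T c}), cbd = chain_boundary\<rparr>"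

text \<open>Smooth simplices are smooth maps on the differential space \<open>\<Delta>\<^sup>p \<subseteq> \<real>\<^sup>p\<^sup>+\<^sup>1\<close>.\<close>

definition smooth_simplex :: "nat \<Rightarrow> 'a dspace \<Rightarrow> ((nat \<Rightarrow> real) \<Rightarrow> 'a) \<Rightarrow> bool" where
  "smooth_simplex p X \<sigma> \<longleftrightarrow>
     singular_simplex p (dtop X) \<sigma> \<and>
     smooth_map (euclidean_dspace (Suc p) (standard_simplex p)) X \<sigma>"

definition smooth_complex :: "'a dspace \<Rightarrow> 'a chain chain_complex" where
  "smooth_complex X =
     \<lparr>chains = (\<lambda>p. {c. Poly_Mapping.keys c \<subseteq> Collect (smooth_simplex p X)}), cbd = chain_boundary\<rparr>"

text \<open>In degree \<open>0\<close> the second component of a cone chain lies in \<open>C\<^sub>-\<^sub>1 = 0\<close>.\<close>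

definition cone_complex ::
    "('a \<Rightarrow> 'b) \<Rightarrow> 'b dspace \<Rightarrow> 'a dspace \<Rightarrow> ('b chain \<times> 'a chain) chain_complex" where
  "cone_complex \<phi> X A =
     \<lparr>chains = (\<lambda>p. {(s, t). s \<in> chains (smooth_complex X) p \<and>
                       (case p of 0 \<Rightarrow> t = 0 | Suc q \<Rightarrow> t \<in> chains (smooth_complex A) q)}),
      cbd = (\<lambda>p (s, t). (chain_boundary p s + chain_map (p - 1) \<phi> t, - chain_boundary (p - 1) t))\<rparr>"


section \<open>Differential forms and integration\<close>

text \<open>
  A form is represented by its pullbacks along plots, i.e. along smooth maps defined on convex
  subsets with nonempty interior of Euclidean spaces: \<open>\<omega> n S p x I\<close> is the coefficient
  \<open>(p\<^sup>*\<omega>)\<^sub>x(e\<^bsub>I!0\<^esub>, \<dots>, e\<^bsub>I!(k-1)\<^esub>)\<close> for a plot \<open>p : S \<rightarrow> X\<close> with \<open>S \<subseteq> \<real>\<^sup>n\<close>.  The \<open>k\<close>-forms are those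
  families which, locally on \<open>X\<close>, are finite sums of terms \<open>f\<^sub>0 df\<^sub>1 \<and> \<dots> \<and> df\<^sub>k\<close> with smooth functions
  \<open>f\<^sub>i\<close> on \<open>X\<close>.  In particular two such sums are identified if they agree along all plots; this is what
  makes the exterior derivative well defined on a general differential space.
\<close>

type_synonym 'a form =
  "nat \<Rightarrow> (nat \<Rightarrow> real) set \<Rightarrow> ((nat \<Rightarrow> real) \<Rightarrow> 'a) \<Rightarrow> (nat \<Rightarrow> real) \<Rightarrow> nat list \<Rightarrow> real"

definition plot :: "'a dspace \<Rightarrow> nat \<Rightarrow> (nat \<Rightarrow> real) set \<Rightarrow> ((nat \<Rightarrow> real) \<Rightarrow> 'a) \<Rightarrow> bool" where
  "plot X n S p \<longleftrightarrow>
     S \<subseteq> topspace (Euclidean_space n) \<and>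
     (\<forall>x\<in>S. \<forall>y\<in>S. \<forall>t\<in>{0..1}. (\<lambda>i. (1 - t) * x i + t * y i) \<in> S) \<and>
     Euclidean_space n interior_of S \<noteq> {} \<and>
     p \<in> extensional S \<and> smooth_map (euclidean_dspace n S) X p"

definition indices :: "nat \<Rightarrow> nat \<Rightarrow> nat list set" where
  "indices k n = {I. length I = k \<and> set I \<subseteq> {..<n}}"

text \<open>The coefficient of the pullback of \<open>f\<^sub>0 df\<^sub>1 \<and> \<dots> \<and> df\<^sub>k\<close> along a plot.\<close>

definition monomial_form :: "nat \<Rightarrow> (nat \<Rightarrow> 'a \<Rightarrow> real) \<Rightarrow> 'a form" where
  "monomial_form k f n S p x I =
     f 0 (p x) *
     (\<Sum>\<pi> | \<pi> permutes {..<k}.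
        of_int (sign \<pi>) * (\<Prod>l<k. partial_deriv_on n S (I ! l) (f (Suc (\<pi> l)) \<circ> p) x))"

definition forms :: "'a dspace \<Rightarrow> nat \<Rightarrow> 'a form set" where
  "forms X k =
     {\<omega>. (\<forall>a\<in>dpoints X. \<exists>U N f. openin (dtop X) U \<and> a \<in> U \<and>
             (\<forall>r<N. \<forall>j\<le>k. f r j \<in> dfun X) \<and>
             (\<forall>n S p. plot X n S p \<longrightarrow>
                (\<forall>x\<in>S. p x \<in> U \<longrightarrow> (\<forall>I\<in>indices k n.
                   \<omega> n S p x I = (\<Sum>r<(N::nat). monomial_form k (f r) n S p x I))))) \<and>
         (\<forall>n S p x I. \<not> (plot X n S p \<and> x \<in> S \<and> I \<in> indices k n) \<longrightarrow> \<omega> n S p x I = 0)}"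

definition zero_form :: "'a form" where
  "zero_form = (\<lambda>n S p x I. 0)"

definition ext_deriv :: "'a dspace \<Rightarrow> nat \<Rightarrow> 'a form \<Rightarrow> 'a form" where
  "ext_deriv X k \<omega> n S p x I =
     (if plot X n S p \<and> x \<in> S \<and> I \<in> indices (Suc k) n
      then \<Sum>j\<le>k. (-1) ^ j *
             partial_deriv_on n S (I ! j) (\<lambda>y. \<omega> n S p y (take j I @ drop (Suc j) I)) x
      else 0)"

definition closed_form_group :: "'a dspace \<Rightarrow> nat \<Rightarrow> 'a form monoid" where
  "closed_form_group X k =
     \<lparr>carrier = {\<omega> \<in> forms X k. ext_deriv X k \<omega> = zero_form},
      mult = (\<lambda>\<omega> \<eta> n S p x I. \<omega> n S p x I + \<eta> n S p x I), one = zero_form\<rparr>"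

definition exact_forms :: "'a dspace \<Rightarrow> nat \<Rightarrow> 'a form set" where
  "exact_forms X k = (case k of 0 \<Rightarrow> {zero_form} | Suc q \<Rightarrow> ext_deriv X q ` forms X q)"

definition de_rham_cohomology :: "'a dspace \<Rightarrow> nat \<Rightarrow> 'a form set monoid" where
  "de_rham_cohomology X k = closed_form_group X k Mod exact_forms X k"

text \<open>
  For integration, \<open>\<Delta>\<^sup>p\<close> is parametrised by the barycentric coordinates belonging to the vertices
  \<open>1, \<dots>, p\<close>; this is the orientation for which Stokes' theorem holds without sign.  Lebesgue measure
  on \<open>\<real>\<^sup>p\<close> is \<^term>\<open>PiM {..<p} (\<lambda>_. lborel)\<close>, whose points are \<open>undefined\<close> off \<open>{..<p}\<close>.
\<close>

definition corner_simplex :: "nat \<Rightarrow> (nat \<Rightarrow> real) set" where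
  "corner_simplex p = {x \<in> topspace (Euclidean_space p). (\<forall>i<p. 0 \<le> x i) \<and> (\<Sum>i<p. x i) \<le> 1}"

definition corner_param :: "nat \<Rightarrow> (nat \<Rightarrow> real) \<Rightarrow> nat \<Rightarrow> real" where
  "corner_param p x = (\<lambda>i. case i of 0 \<Rightarrow> 1 - (\<Sum>j<p. x j) | Suc j \<Rightarrow> if j < p then x j else 0)"

definition simplex_integral :: "nat \<Rightarrow> 'a form \<Rightarrow> ((nat \<Rightarrow> real) \<Rightarrow> 'a) \<Rightarrow> real" where
  "simplex_integral p \<omega> \<sigma> =
     (LINT y | PiM {..<p} (\<lambda>_. lborel).
        (let x = (\<lambda>i. if i < p then y i else 0)
         in if x \<in> corner_simplex p
            then \<omega> p (corner_simplex p) (restrict (\<sigma> \<circ> corner_param p) (corner_simplex p)) x [0..<p]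
            else 0))"

definition chain_integral :: "nat \<Rightarrow> 'a form \<Rightarrow> 'a chain \<Rightarrow> real" where
  "chain_integral p \<omega> c =
     (\<Sum>\<sigma>\<in>Poly_Mapping.keys c. of_int (Poly_Mapping.lookup c \<sigma>) * simplex_integral p \<omega> \<sigma>)"


section \<open>Stratifolds\<close>

text \<open>
  Manifolds, stratifolds and bordisms have at most the cardinality of the continuum, so up to
  isomorphism they all occur with carrier a subset of the type \<^typ>\<open>nat \<Rightarrow> real\<close>.  The carriers are
  bare sets: they are not assumed to be embedded.
\<close>

type_synonym space = "(nat \<Rightarrow> real) dspace"

definition half_space :: "nat \<Rightarrow> (nat \<Rightarrow> real) set" where
  "half_space n = {x \<in> topspace (Euclidean_space n). 0 \<le> x 0}"

definition chart :: "nat \<Rightarrow> space \<Rightarrow> (nat \<Rightarrow> real) set \<Rightarrow> ((nat \<Rightarrow> real) \<Rightarrow> nat \<Rightarrow> real) \<Rightarrow> bool" where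
  "chart n W U \<psi> \<longleftrightarrow>
     openin (dtop W) U \<and>
     (\<exists>V. openin (subtopology (Euclidean_space n) (half_space n)) V \<and>
          diffeo (dsubspace W U) (euclidean_dspace n V) \<psi>)"

definition manifold_with_boundary :: "nat \<Rightarrow> space \<Rightarrow> bool" where
  "manifold_with_boundary n W \<longleftrightarrow>
     differential_space W \<and> Hausdorff_space (dtop W) \<and> second_countable (dtop W) \<and>
     (\<forall>w\<in>dpoints W. \<exists>U \<psi>. w \<in> U \<and> chart n W U \<psi>)"

definition manifold_boundary :: "nat \<Rightarrow> space \<Rightarrow> (nat \<Rightarrow> real) set" where
  "manifold_boundary n W = {w \<in> dpoints W. 0 < n \<and> (\<exists>U \<psi>. w \<in> U \<and> chart n W U \<psi> \<and> \<psi> w 0 = 0)}"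

text \<open>
  A collar is a map \<open>c\<close> on an open neighbourhood \<open>U\<close> of \<open>B \<times> {0}\<close> in \<open>B \<times> [0, \<infinity>)\<close>.
  A function is compatible with it if it is constant along the collar lines near \<open>B\<close>.
\<close>

definition collar_nbhd :: "space \<Rightarrow> ((nat \<Rightarrow> real) \<times> real) set \<Rightarrow> bool" where
  "collar_nbhd B U \<longleftrightarrow>
     openin (prod_topology (dtop B) (top_of_set {0..})) U \<and> dpoints B \<times> {0} \<subseteq> U"

definition collar_compatible ::
    "space \<Rightarrow> ((nat \<Rightarrow> real) \<times> real) set \<Rightarrow> ((nat \<Rightarrow> real) \<times> real \<Rightarrow> nat \<Rightarrow> real)
      \<Rightarrow> ((nat \<Rightarrow> real) \<Rightarrow> real) \<Rightarrow> bool" where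
  "collar_compatible B U c g \<longleftrightarrow>
     (\<exists>V. collar_nbhd B V \<and> V \<subseteq> U \<and> (\<forall>(x, t)\<in>V. g (c (x, t)) = g x))"

definition manifold_collar ::
    "nat \<Rightarrow> space \<Rightarrow> ((nat \<Rightarrow> real) \<times> real) set \<Rightarrow> ((nat \<Rightarrow> real) \<times> real \<Rightarrow> nat \<Rightarrow> real) \<Rightarrow> bool" where
  "manifold_collar n W U c \<longleftrightarrow>
     (let B = dsubspace W (manifold_boundary n W) in
        collar_nbhd B U \<and> openin (dtop W) (c ` U) \<and>
        diffeo (dsubspace (dproduct B half_line) U) (dsubspace W (c ` U)) c \<and>
        (\<forall>x\<in>dpoints B. c (x, 0) = x))"

text \<open>
  \<open>S'\<close> arises from \<open>S \<subseteq> S'\<close> by attaching the \<open>n\<close>-dimensional manifold \<open>W\<close> with boundary along a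
  proper smooth map \<open>\<partial>W \<rightarrow> S\<close>.  Here \<open>q : W \<rightarrow> S'\<close> is the characteristic map, so that the attaching
  map is its restriction to \<open>\<partial>W\<close>.
\<close>

definition attaching ::
    "nat \<Rightarrow> space \<Rightarrow> space \<Rightarrow> ((nat \<Rightarrow> real) \<times> real) set \<Rightarrow> ((nat \<Rightarrow> real) \<times> real \<Rightarrow> nat \<Rightarrow> real)
      \<Rightarrow> ((nat \<Rightarrow> real) \<Rightarrow> nat \<Rightarrow> real) \<Rightarrow> space \<Rightarrow> bool" where
  "attaching n S W U c q S' \<longleftrightarrow>
     (let bW = manifold_boundary n W;
          B = dsubspace W bW;
          W0 = dsubspace W (dpoints W - bW)
      in
        manifold_with_boundary n W \<and> manifold_collar n W U c \<and>
        dpoints S \<subseteq> dpoints S' \<and>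
        smooth_map B S q \<and> proper_map (dtop B) (dtop S) q \<and>
        bij_betw q (dpoints W0) (dpoints S' - dpoints S) \<and>
        (\<forall>V \<subseteq> dpoints S'. openin (dtop S') V \<longleftrightarrow>
           openin (dtop S) (V \<inter> dpoints S) \<and> openin (dtop W) {w \<in> dpoints W. q w \<in> V}) \<and>
        dfun S' = {g \<in> extensional (dpoints S').
                     restrict g (dpoints S) \<in> dfun S \<and>
                     restrict (g \<circ> q) (dpoints W0) \<in> dfun W0 \<and>
                     collar_compatible B U c (g \<circ> q)})"

text \<open>
  Parametrised stratifolds (p-stratifolds) of dimension \<open>n\<close>: start from a \<open>0\<close>-manifold and attach
  manifolds (possibly empty) of dimension \<open>1, \<dots>, n\<close>.  The last argument records the strata.
\<close>

inductive p_stratifold :: "nat \<Rightarrow> space \<Rightarrow> (nat \<Rightarrow> (nat \<Rightarrow> real) set) \<Rightarrow> bool" where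
  zero: "manifold_with_boundary 0 S \<Longrightarrow> p_stratifold 0 S (\<lambda>i. if i = 0 then dpoints S else {})"
| attach: "p_stratifold n S st \<Longrightarrow> attaching (Suc n) S W U c q S' \<Longrightarrow>
     p_stratifold (Suc n) S' (st(Suc n := dpoints S' - dpoints S))"

text \<open>
  A collared \<open>(n+1)\<close>-dimensional p-stratifold \<open>T\<close> with interior \<open>J\<close> and boundary \<open>B\<close>; \<open>stJ\<close> and \<open>stB\<close>
  are the strata of \<open>J\<close> and \<open>B\<close>.
\<close>

definition p_stratifold_with_boundary ::
    "nat \<Rightarrow> space \<Rightarrow> space \<Rightarrow> (nat \<Rightarrow> (nat \<Rightarrow> real) set) \<Rightarrow> space \<Rightarrow> (nat \<Rightarrow> (nat \<Rightarrow> real) set) \<Rightarrow> bool" where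
  "p_stratifold_with_boundary n T J stJ B stB \<longleftrightarrow>
     p_stratifold (Suc n) J stJ \<and> p_stratifold n B stB \<and> Hausdorff_space (dtop T) \<and>
     closedin (dtop T) (dpoints B) \<and>
     dtop B = subtopology (dtop T) (dpoints B) \<and>
     dtop J = subtopology (dtop T) (dpoints T - dpoints B) \<and>
     (\<exists>U c. let U0 = {(x, t) \<in> U. 0 < t} in
        collar_nbhd B U \<and> openin (dtop T) (c ` U) \<and>
        homeomorphic_map (subtopology (prod_topology (dtop B) (top_of_set {0..})) U)
                         (subtopology (dtop T) (c ` U)) c \<and>
        (\<forall>x\<in>dpoints B. c (x, 0) = x) \<and>
        diffeo (dsubspace (dproduct B half_line) U0) (dsubspace J (c ` U0)) c \<and>
        dfun T = {g \<in> extensional (dpoints T).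
                    restrict g (dpoints J) \<in> dfun J \<and> restrict g (dpoints B) \<in> dfun B \<and>
                    collar_compatible B U c g})"


section \<open>Bordism of oriented stratifolds\<close>

text \<open>
  An orientation of an \<open>n\<close>-manifold is a locally consistent choice of generators of the local homology
  groups \<open>H\<^sub>n(N, N - x)\<close>.
\<close>

type_synonym orientation = "(nat \<Rightarrow> real) \<Rightarrow> (nat \<Rightarrow> real) chain set"

definition orientation :: "nat \<Rightarrow> (nat \<Rightarrow> real) topology \<Rightarrow> orientation \<Rightarrow> bool" where
  "orientation n N \<mu> \<longleftrightarrow>
     (\<forall>x\<in>topspace N.
        \<mu> x \<in> carrier (relative_homology_group (int n) N (topspace N - {x})) \<and>
        generate (relative_homology_group (int n) N (topspace N - {x})) {\<mu> x}
          = carrier (relative_homology_group (int n) N (topspace N - {x})) \<and>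
        (\<exists>U \<alpha>. openin N U \<and> x \<in> U \<and> \<alpha> \<in> carrier (relative_homology_group (int n) N (topspace N - U)) \<and>
           (\<forall>y\<in>U. hom_induced (int n) N (topspace N - U) N (topspace N - {y}) id \<alpha> = \<mu> y)))"

text \<open>\<open>z\<close> represents the given orientation at all points of the top stratum \<open>N\<close> of \<open>M\<close>.\<close>

definition represents_orientation ::
    "nat \<Rightarrow> (nat \<Rightarrow> real) topology \<Rightarrow> (nat \<Rightarrow> real) set \<Rightarrow> orientation \<Rightarrow> (nat \<Rightarrow> real) chain \<Rightarrow> bool" where
  "represents_orientation n M N \<mu> z \<longleftrightarrow>
     (\<forall>x\<in>N. homologous_rel_set n M (topspace M - {x}) z
        = hom_induced (int n) (subtopology M N) (N - {x}) M (topspace M - {x}) id (\<mu> x))"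

text \<open>
  A singular oriented stratifold in \<open>X\<close>: a compact \<open>n\<close>-dimensional p-stratifold without stratum of
  codimension one (together with its strata), an orientation of its top stratum, and a smooth map
  to \<open>X\<close>.
\<close>

type_synonym 'a singular_stratifold =
  "space \<times> (nat \<Rightarrow> (nat \<Rightarrow> real) set) \<times> orientation \<times> ((nat \<Rightarrow> real) \<Rightarrow> 'a)"

definition singular_stratifolds :: "nat \<Rightarrow> 'a dspace \<Rightarrow> 'a singular_stratifold set" where
  "singular_stratifolds n X =
     {(M, st, \<mu>, f). p_stratifold n M st \<and> compact_space (dtop M) \<and>
        (0 < n \<longrightarrow> st (n - 1) = {}) \<and> orientation n (subtopology (dtop M) (st n)) \<mu> \<and>
        smooth_map M X f}"

fun fundamental_cycle :: "nat \<Rightarrow> 'a singular_stratifold \<Rightarrow> (nat \<Rightarrow> real) chain \<Rightarrow> bool" where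
  "fundamental_cycle n (M, st, \<mu>, f) z \<longleftrightarrow>
     z \<in> cycles (smooth_complex M) n \<and> represents_orientation n (dtop M) (st n) \<mu> z"

text \<open>\<open>B\<close> is the disjoint union of \<open>M\<close> and \<open>M'\<close>, embedded by \<open>j\<close> and \<open>j'\<close>.\<close>

definition disjoint_union ::
    "space \<Rightarrow> space \<Rightarrow> ((nat \<Rightarrow> real) \<Rightarrow> nat \<Rightarrow> real) \<Rightarrow> ((nat \<Rightarrow> real) \<Rightarrow> nat \<Rightarrow> real) \<Rightarrow> space \<Rightarrow> bool" where
  "disjoint_union M M' j j' B \<longleftrightarrow>
     diffeo M (dsubspace B (j ` dpoints M)) j \<and> diffeo M' (dsubspace B (j' ` dpoints M')) j' \<and>
     openin (dtop B) (j ` dpoints M) \<and> openin (dtop B) (j' ` dpoints M') \<and>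
     j ` dpoints M \<inter> j' ` dpoints M' = {} \<and> j ` dpoints M \<union> j' ` dpoints M' = dpoints B"

text \<open>
  A bordism between \<open>M\<close> and \<open>M'\<close> is a compact oriented \<open>T\<close> with \<open>\<partial>T \<cong> M \<squnion> -M'\<close>.  Compatibility of the
  orientations is expressed by the boundary of a relative fundamental cycle \<open>w\<close> of \<open>(T, \<partial>T)\<close>.
\<close>

fun bordant :: "nat \<Rightarrow> 'a dspace \<Rightarrow> 'a singular_stratifold \<Rightarrow> 'a singular_stratifold \<Rightarrow> bool" where
  "bordant n X (M, st, \<mu>, f) (M', st', \<mu>', f') \<longleftrightarrow>
     (\<exists>T J stJ B stB \<nu> F j j' w z z'.
        p_stratifold_with_boundary n T J stJ B stB \<and> compact_space (dtop T) \<and> stJ n = {} \<and>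
        orientation (Suc n) (subtopology (dtop T) (stJ (Suc n))) \<nu> \<and>
        smooth_map T X F \<and> disjoint_union M M' j j' B \<and>
        (\<forall>x\<in>dpoints M. F (j x) = f x) \<and> (\<forall>x\<in>dpoints M'. F (j' x) = f' x) \<and>
        w \<in> chains (smooth_complex T) (Suc n) \<and>
        represents_orientation (Suc n) (dtop T) (stJ (Suc n)) \<nu> w \<and>
        fundamental_cycle n (M, st, \<mu>, f) z \<and> fundamental_cycle n (M', st', \<mu>', f') z' \<and>
        chain_boundary (Suc n) w = chain_map n j z - chain_map n j' z')"

fun oriented_sum ::
    "nat \<Rightarrow> 'a singular_stratifold \<Rightarrow> 'a singular_stratifold \<Rightarrow> 'a singular_stratifold \<Rightarrow> bool" where
  "oriented_sum n (M, st, \<mu>, f) (M', st', \<mu>', f') (M'', st'', \<mu>'', f'') \<longleftrightarrow>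
     (\<exists>j j' z z'. disjoint_union M M' j j' M'' \<and>
        (\<forall>x\<in>dpoints M. f'' (j x) = f x) \<and> (\<forall>x\<in>dpoints M'. f'' (j' x) = f' x) \<and>
        fundamental_cycle n (M, st, \<mu>, f) z \<and> fundamental_cycle n (M', st', \<mu>', f') z' \<and>
        fundamental_cycle n (M'', st'', \<mu>'', f'') (chain_map n j z + chain_map n j' z'))"

definition bordism_rel :: "nat \<Rightarrow> 'a dspace \<Rightarrow> 'a singular_stratifold rel" where
  "bordism_rel n X =
     {(P, Q). P \<in> singular_stratifolds n X \<and> Q \<in> singular_stratifolds n X \<and> bordant n X P Q}"

definition bordism_group :: "nat \<Rightarrow> 'a dspace \<Rightarrow> 'a singular_stratifold set monoid" where
  "bordism_group n X =
     \<lparr>carrier = singular_stratifolds n X // bordism_rel n X,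
      mult = (\<lambda>C D. \<Union>P\<in>C. \<Union>Q\<in>D.
                \<Union>R \<in> {R \<in> singular_stratifolds n X. oriented_sum n P Q R}. bordism_rel n X `` {R}),
      one = (\<Union>P \<in> {P \<in> singular_stratifolds n X. dpoints (fst P) = {}}. bordism_rel n X `` {P})\<rparr>"

definition fundamental_class_map :: "nat \<Rightarrow> 'a dspace \<Rightarrow> 'a singular_stratifold set \<Rightarrow> 'a chain set" where
  "fundamental_class_map n X C =
     (\<Union>(M, st, \<mu>, f) \<in> C. \<Union>z \<in> {z. fundamental_cycle n (M, st, \<mu>, f) z}.
        homology_class (smooth_complex X) n (chain_map n f z))"


section \<open>Smooth spaces\<close>

definition smooth_singular_agrees :: "'a dspace \<Rightarrow> bool" where
  "smooth_singular_agrees X \<longleftrightarrow>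
     (\<forall>p.
       (\<lambda>cls. \<Union>z\<in>cls. homologous_rel_set p (dtop X) {} z)
         \<in> iso (homology (smooth_complex X) p) (homology_group (int p) (dtop X)) \<and>
       cohomology_map (smooth_complex X) (\<lambda>_ c. c) p
         \<in> iso (cohomology (singular_complex (dtop X)) p :: ('a chain \<Rightarrow> int) set monoid)
               (cohomology (smooth_complex X) p) \<and>
       cohomology_map (smooth_complex X) (\<lambda>_ c. c) p
         \<in> iso (cohomology (singular_complex (dtop X)) p :: ('a chain \<Rightarrow> real) set monoid)
               (cohomology (smooth_complex X) p))"

definition de_rham_theorem :: "'a dspace \<Rightarrow> bool" where
  "de_rham_theorem X \<longleftrightarrow>
     (\<forall>p. (\<lambda>cls. \<Union>\<omega>\<in>cls. cohomology_class (smooth_complex X) p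
              (\<lambda>c. if c \<in> chains (smooth_complex X) p then chain_integral p \<omega> c else 0))
          \<in> iso (de_rham_cohomology X p)
                (cohomology (smooth_complex X) p :: ('a chain \<Rightarrow> real) set monoid))"

definition stratifold_bordism_is_homology :: "'a dspace \<Rightarrow> bool" where
  "stratifold_bordism_is_homology X \<longleftrightarrow>
     (\<forall>n. fundamental_class_map n X \<in> iso (bordism_group n X) (homology (smooth_complex X) n))"

definition smooth_space :: "'a dspace \<Rightarrow> bool" where
  "smooth_space X \<longleftrightarrow>
     differential_space X \<and> smooth_singular_agrees X \<and> de_rham_theorem X \<and>
     stratifold_bordism_is_homology X"


section \<open>Differential characters\<close>

definition exp2pi :: "real \<Rightarrow> complex" where
  "exp2pi r = exp (2 * of_real pi * \<i> * of_real r)"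

text \<open>Homomorphisms from a group \<open>Z\<close> to \<open>U(1)\<close>, normalised to be \<open>1\<close> off \<open>Z\<close>.\<close>

definition U1_homs :: "('c::ab_group_add) set \<Rightarrow> ('c \<Rightarrow> complex) set" where
  "U1_homs Z = {h. (\<forall>x\<in>Z. cmod (h x) = 1) \<and> (\<forall>x\<in>Z. \<forall>y\<in>Z. h (x + y) = h x * h y) \<and>
                   (\<forall>x. x \<notin> Z \<longrightarrow> h x = 1)}"

definition is_curvature :: "'a dspace \<Rightarrow> nat \<Rightarrow> ('a chain \<Rightarrow> complex) \<Rightarrow> 'a form \<Rightarrow> bool" where
  "is_curvature X k h \<omega> \<longleftrightarrow>
     \<omega> \<in> forms X k \<and>
     (\<forall>c\<in>chains (smooth_complex X) k. h (chain_boundary k c) = exp2pi (chain_integral k \<omega> c))"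

text \<open>
  Differential characters of degree \<open>k \<ge> 1\<close>.  In degree \<open>0\<close> their place is taken by
  \<open>integral_cohomology X 0\<close>, with the identity as characteristic class.
\<close>

definition diff_chars :: "'a dspace \<Rightarrow> nat \<Rightarrow> ('a chain \<Rightarrow> complex) monoid" where
  "diff_chars X k =
     \<lparr>carrier = {h \<in> U1_homs (cycles (smooth_complex X) (k - 1)). \<exists>\<omega>. is_curvature X k h \<omega>},
      mult = (\<lambda>h h' z. h z * h' z), one = (\<lambda>_. 1)\<rparr>"

definition curv :: "'a dspace \<Rightarrow> nat \<Rightarrow> ('a chain \<Rightarrow> complex) \<Rightarrow> 'a form" where
  "curv X k h = (THE \<omega>. is_curvature X k h \<omega>)"

definition flat_chars :: "'a dspace \<Rightarrow> nat \<Rightarrow> ('a chain \<Rightarrow> complex) set" where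
  "flat_chars X k = {h \<in> carrier (diff_chars X k). curv X k h = zero_form}"

definition char_class ::
    "'a dspace \<Rightarrow> nat \<Rightarrow> ('a chain \<Rightarrow> complex) \<Rightarrow> ('a chain \<Rightarrow> int) set" where
  "char_class X k h =
     (THE cls. \<exists>h' u.
        (\<forall>x\<in>cycles (smooth_complex X) (k - 1). \<forall>y\<in>cycles (smooth_complex X) (k - 1).
           h' (x + y) = h' x + h' y) \<and>
        (\<forall>x\<in>cycles (smooth_complex X) (k - 1). h x = exp2pi (h' x)) \<and>
        u \<in> cocycles (smooth_complex X) k \<and>
        (\<forall>x\<in>chains (smooth_complex X) k.
           real_of_int (u x) = chain_integral k (curv X k h) x - h' (chain_boundary k x)) \<and>
        cls = cohomology_class (smooth_complex X) k u)"

definition char_pullback ::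
    "'a dspace \<Rightarrow> ('a \<Rightarrow> 'b) \<Rightarrow> nat \<Rightarrow> ('b chain \<Rightarrow> complex) \<Rightarrow> 'a chain \<Rightarrow> complex" where
  "char_pullback A \<phi> k h =
     (\<lambda>z. if z \<in> cycles (smooth_complex A) (k - 1) then h (chain_map (k - 1) \<phi> z) else 1)"

definition integral_cohomology :: "'a dspace \<Rightarrow> nat \<Rightarrow> ('a chain \<Rightarrow> int) set monoid" where
  "integral_cohomology X k = cohomology (smooth_complex X) k"

definition cohomology_pullback ::
    "'a dspace \<Rightarrow> ('a \<Rightarrow> 'b) \<Rightarrow> nat \<Rightarrow> ('b chain \<Rightarrow> int) set \<Rightarrow> ('a chain \<Rightarrow> int) set" where
  "cohomology_pullback A \<phi> k = cohomology_map (smooth_complex A) (\<lambda>p. chain_map p \<phi>) k"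

definition pulled_back_flat_chars ::
    "'b dspace \<Rightarrow> 'a dspace \<Rightarrow> ('a \<Rightarrow> 'b) \<Rightarrow> nat \<Rightarrow> ('a chain \<Rightarrow> complex) monoid" where
  "pulled_back_flat_chars X A \<phi> k =
     (diff_chars A k)\<lparr>carrier := char_pullback A \<phi> k ` flat_chars X k\<rparr>"

definition pulled_back_cohomology ::
    "'b dspace \<Rightarrow> 'a dspace \<Rightarrow> ('a \<Rightarrow> 'b) \<Rightarrow> nat \<Rightarrow> ('a chain \<Rightarrow> int) set monoid" where
  "pulled_back_cohomology X A \<phi> k =
     (integral_cohomology A k)
       \<lparr>carrier := cohomology_pullback A \<phi> k ` carrier (integral_cohomology X k)\<rparr>"


section \<open>Relative differential characters\<close>

definition rel_diff_chars ::
    "('a \<Rightarrow> 'b) \<Rightarrow> 'b dspace \<Rightarrow> 'a dspace \<Rightarrow> nat \<Rightarrow> ('b chain \<times> 'a chain \<Rightarrow> complex) monoid" where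
  "rel_diff_chars \<phi> X A k =
     \<lparr>carrier = {f \<in> U1_homs (cycles (cone_complex \<phi> X A) (k - 1)).
        \<exists>\<omega>\<in>forms X k. \<exists>\<theta>\<in>forms A (k - 1). \<forall>(x, y)\<in>chains (cone_complex \<phi> X A) k.
          f (cbd (cone_complex \<phi> X A) k (x, y))
            = exp2pi (chain_integral k \<omega> x + chain_integral (k - 1) \<theta> y)},
      mult = (\<lambda>f f' z. f z * f' z), one = (\<lambda>_. 1)\<rparr>"

definition rel_cohomology ::
    "('a \<Rightarrow> 'b) \<Rightarrow> 'b dspace \<Rightarrow> 'a dspace \<Rightarrow> nat \<Rightarrow> ('b chain \<times> 'a chain \<Rightarrow> int) set monoid" where
  "rel_cohomology \<phi> X A k = cohomology (cone_complex \<phi> X A) k"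

definition i_breve ::
    "('a \<Rightarrow> 'b) \<Rightarrow> 'b dspace \<Rightarrow> 'a dspace \<Rightarrow> nat
      \<Rightarrow> ('a chain \<Rightarrow> complex) \<Rightarrow> 'b chain \<times> 'a chain \<Rightarrow> complex" where
  "i_breve \<phi> X A k g =
     (\<lambda>(s, t). if (s, t) \<in> cycles (cone_complex \<phi> X A) (k - 1) then g t else 1)"

definition p_breve ::
    "'b dspace \<Rightarrow> nat \<Rightarrow> ('b chain \<times> 'a chain \<Rightarrow> complex) \<Rightarrow> 'b chain \<Rightarrow> complex" where
  "p_breve X k f = (\<lambda>z. if z \<in> cycles (smooth_complex X) (k - 1) then f (z, 0) else 1)"

text \<open>The map in degree \<open>0\<close>, where differential characters are cohomology classes.\<close>

definition p_breve_0 ::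
    "'b dspace \<Rightarrow> ('b chain \<times> 'a chain \<Rightarrow> int) set \<Rightarrow> ('b chain \<Rightarrow> int) set" where
  "p_breve_0 X = cohomology_map (smooth_complex X) (\<lambda>_ s. (s, 0)) 0"


section \<open>Exactness\<close>

text \<open>
  Exactness of \<open>G \<rightarrow> H \<rightarrow> K\<close> at \<open>H\<close>.  (The library's \<^const>\<open>exact_seq\<close> requires all groups to live on
  one type.)
\<close>

definition exact_at ::
    "'a monoid \<Rightarrow> ('a \<Rightarrow> 'b) \<Rightarrow> 'b monoid \<Rightarrow> ('b \<Rightarrow> 'c) \<Rightarrow> 'c monoid \<Rightarrow> bool" where
  "exact_at G f H g K \<longleftrightarrow>
     comm_group G \<and> comm_group H \<and> comm_group K \<and> f \<in> hom G H \<and> g \<in> hom H K \<and>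
     f ` carrier G = kernel H K g"

definition trivial :: "unit monoid" where
  "trivial = singleton_group ()"

definition from_trivial :: "'a monoid \<Rightarrow> unit \<Rightarrow> 'a" where
  "from_trivial G = (\<lambda>_. \<one>\<^bsub>G\<^esub>)"

definition to_trivial :: "'a \<Rightarrow> unit" where
  "to_trivial = (\<lambda>_. ())"

end

theory Submission
  imports Defs
begin

text \<open>
  A form whose integrals over all smooth simplices are integers vanishes, because these integrals tend
  to zero on small simplices.  Hence curvatures are unique, and Stokes' theorem applied to a relative
  character with forms \<open>(\<omega>, \<theta>)\<close> yields \<open>\<phi>\<^sup>*\<omega> = d\<theta>\<close>, so that the class of \<open>p_breve f\<close> pulls back to zero.
  Conversely, if the class of \<open>h\<close> pulls back to zero, then \<open>\<phi>\<^sup>*curv h\<close> is exact by the de Rham theorem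
  on \<open>A\<close>, and a primitive together with a real lift of \<open>h\<close> gives a relative character that restricts
  to \<open>h\<close>.  Exactness at the other places amounts to extending homomorphisms into \<open>U(1)\<close> from
  subgroups of chain groups, which is possible since \<open>U(1)\<close> is divisible.
\<close>

section \<open>Calculus in coordinates\<close>

text \<open>Two reductions keep the analysis small. The faces of a simplex and the small simplices
  that detect a form are affine in the coordinates of a plot, so naturality of forms under affine
  substitutions suffices; such substitutions have no second derivatives, and the exterior derivative
  can be treated term by term. Domains of plots, such as a simplex, contain boundary points, so
  derivatives there must first be shown independent of the chosen extension. The algebra rests on
  lifts \<open>G\<close> of a character that are additive on all chains rather than on cycles only.
  Two lifts differ on cycles by an integral homomorphism, which must be extended to an integral
  cochain; this is what makes the characteristic class well defined and what makes it pull back to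
  zero for the restriction of a relative character. Surjectivity of the characteristic class uses
  the de Rham theorem on \<open>X\<close>: an integral cocycle is integration over a form plus a
  real coboundary, and the primitive of the latter, with reversed sign, is the lift of the desired
  character.\<close>

abbreviation eucl :: "nat \<Rightarrow> (nat \<Rightarrow> real) set" where
  "eucl n \<equiv> {x. \<forall>i\<ge>n. x i = 0}"

lemma Euclidean_space_eq: "Euclidean_space n = top_of_set (eucl n)"
  by (simp add: Euclidean_space_def euclidean_product_topology)

text \<open>Points of \<open>eucl n\<close> agree in all coordinates from \<open>n\<close> on, so
  only the first \<open>n\<close> factors of a basic open box are a constraint, and the minimum of
  finitely many radii is positive.\<close>

lemma open_fun_box:
  fixes W :: "(nat \<Rightarrow> real) set"
  assumes "open W" "x \<in> W"
  shows "\<exists>d>0. \<forall>y\<in>eucl n. x \<in> eucl n \<longrightarrow> (\<forall>i<n. \<bar>y i - x i\<bar> < d) \<longrightarrow> y \<in> W"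
proof -
  have "openin (product_topology (\<lambda>_. euclidean) UNIV) W"
    using assms by (simp add: euclidean_product_topology)
  from product_topology_open_contains_basis[OF this \<open>x \<in> W\<close>]
  obtain B where B: "x \<in> (\<Pi>\<^sub>E i\<in>UNIV. B i)" "\<And>i. open (B i)" "(\<Pi>\<^sub>E i\<in>UNIV. B i) \<subseteq> W"
    by auto
  have "\<exists>e>0. \<forall>s. \<bar>s - x i\<bar> < e \<longrightarrow> s \<in> B i" for i
    using B(1) B(2)[of i] unfolding open_dist dist_real_def by (auto simp: PiE_iff)
  then obtain e where e: "\<And>i. e i > 0" "\<And>i s. \<bar>s - x i\<bar> < e i \<Longrightarrow> s \<in> B i"
    by metis
  define d where "d = Min (insert 1 (e ` {..<n}))"
  have d: "d > 0" using e(1) by (auto simp: d_def)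
  have de: "d \<le> e i" if "i < n" for i
    unfolding d_def using that by (intro Min_le) auto
  have "y \<in> W" if "y \<in> eucl n" "x \<in> eucl n" "\<forall>i<n. \<bar>y i - x i\<bar> < d" for y
  proof -
    have "y i \<in> B i" for i
    proof (cases "i < n")
      case True
      with that de have "\<bar>y i - x i\<bar> < e i" by force
      then show ?thesis using e by blast
    next
      case False
      then show ?thesis using that e by auto
    qed
    then show ?thesis using B(3) by (auto simp: PiE_iff)
  qed
  with d show ?thesis by blast
qed

lemma openin_eucl_box:
  assumes "openin (Euclidean_space n) U" "x \<in> U"
  obtains d where "d > 0" "\<And>y. y \<in> eucl n \<Longrightarrow> (\<And>i. i < n \<Longrightarrow> \<bar>y i - x i\<bar> < d) \<Longrightarrow> y \<in> U"
proof -
  from assms(1) obtain W where W: "open W" "U = eucl n \<inter> W"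
    unfolding Euclidean_space_eq openin_open by blast
  with assms(2) open_fun_box[of W x n] that show thesis by auto
qed

lemma openin_eucl_subset: "openin (Euclidean_space n) U \<Longrightarrow> U \<subseteq> eucl n"
  using openin_subset topspace_Euclidean_space by blast

lemma eventually_upd_in_open:
  assumes "openin (Euclidean_space n) U" "x \<in> U" "i < n"
  shows "eventually (\<lambda>t. x(i := t) \<in> U) (nhds (x i))"
proof -
  obtain d where d: "d > 0" "\<And>y. y \<in> eucl n \<Longrightarrow> (\<And>i. i < n \<Longrightarrow> \<bar>y i - x i\<bar> < d) \<Longrightarrow> y \<in> U"
    using openin_eucl_box assms by blast
  have "x \<in> eucl n" using assms openin_eucl_subset by blast
  have "eventually (\<lambda>t. dist t (x i) < d) (nhds (x i))"
    using d(1) by (rule eventually_nhds_metric[THEN iffD2, OF exI[of _ d], OF conjI]) auto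
  then show ?thesis
  proof eventually_elim
    case (elim t)
    show ?case using d \<open>x \<in> eucl n\<close> assms(3) elim by (intro d(2)) (auto simp: dist_real_def)
  qed
qed

section \<open>Partial derivatives and the total derivative\<close>

definition partial_diff :: "nat \<Rightarrow> ((nat \<Rightarrow> real) \<Rightarrow> real) \<Rightarrow> (nat \<Rightarrow> real) \<Rightarrow> bool" where
  "partial_diff i f x \<longleftrightarrow> (\<lambda>t. f (x(i := t))) differentiable at (x i)"

lemma partial_deriv_cong:
  fixes f g :: "(nat \<Rightarrow> real) \<Rightarrow> real"
  assumes "openin (Euclidean_space n) U" "x \<in> U" "i < n" "\<And>y. y \<in> U \<Longrightarrow> f y = g y"
  shows "partial_deriv i f x = partial_deriv i g x"
  unfolding partial_deriv_def
  by (rule deriv_cong_ev)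
     (use eventually_upd_in_open[OF assms(1-3)] assms(4) in \<open>auto elim: eventually_mono\<close>)

lemma partial_diffI:
  "((\<lambda>t. f (x(i := t))) has_real_derivative D) (at (x i)) \<Longrightarrow> partial_diff i f x"
  unfolding partial_diff_def real_differentiable_def by blast

lemma partial_deriv_DERIV:
  "partial_diff i f x \<Longrightarrow> ((\<lambda>t. f (x(i := t))) has_real_derivative partial_deriv i f x) (at (x i))"
  unfolding partial_deriv_def partial_diff_def by (simp only: DERIV_deriv_iff_real_differentiable)

lemma partial_diff_cong:
  assumes "openin (Euclidean_space n) U" "x \<in> U" "i < n" "\<And>y. y \<in> U \<Longrightarrow> f y = g y"
    and "partial_diff i f x"
  shows "partial_diff i g x"
proof (rule partial_diffI)
  have ev: "eventually (\<lambda>t. f (x(i := t)) = g (x(i := t))) (nhds (x i))"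
    using eventually_upd_in_open[OF assms(1-3)] by (rule eventually_mono) (rule assms(4))
  show "((\<lambda>t. g (x(i := t))) has_real_derivative partial_deriv i f x) (at (x i))"
    using DERIV_cong_ev[OF refl ev refl] partial_deriv_DERIV[OF assms(5)] by (rule iffD1)
qed

lemma partial_derivI:
  "((\<lambda>t. f (x(i := t))) has_real_derivative D) (at (x i)) \<Longrightarrow> partial_deriv i f x = D"
  unfolding partial_deriv_def by (rule DERIV_imp_deriv)

text \<open>Continuous partial derivatives give the total derivative: go from \<open>x\<close> to
  \<open>x + v\<close> one coordinate at a time. On each segment the mean value inequality is
  applied to \<open>g\<close> minus its linear part at \<open>x\<close>, whose derivative is at most
  \<open>e\<close> by continuity of the partial derivatives.\<close>

lemma frechet_from_partials:
  assumes U: "openin (Euclidean_space n) U" and x: "x \<in> U"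
    and diff: "\<And>j y. j < n \<Longrightarrow> y \<in> U \<Longrightarrow> partial_diff j g y"
    and cont: "\<And>j. j < n \<Longrightarrow> continuous_on U (partial_deriv j g)"
    and e: "e > 0"
  obtains d where "d > 0"
    "\<And>v. v \<in> eucl n \<Longrightarrow> (\<And>j. j < n \<Longrightarrow> \<bar>v j\<bar> < d) \<Longrightarrow>
       \<bar>g (\<lambda>i. x i + v i) - g x - (\<Sum>j<n. v j * partial_deriv j g x)\<bar> \<le> e * (\<Sum>j<n. \<bar>v j\<bar>)"
proof -
  have xe: "x \<in> eucl n" using U x openin_eucl_subset by blast
  obtain d0 where d0: "d0 > 0" "\<And>y. y \<in> eucl n \<Longrightarrow> (\<And>i. i < n \<Longrightarrow> \<bar>y i - x i\<bar> < d0) \<Longrightarrow> y \<in> U"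
    using openin_eucl_box[OF U x] by blast
  have "\<exists>d. j < n \<longrightarrow> d > 0 \<and> (\<forall>y\<in>eucl n. (\<forall>i<n. \<bar>y i - x i\<bar> < d) \<longrightarrow>
          \<bar>partial_deriv j g y - partial_deriv j g x\<bar> \<le> e)" for j
  proof (cases "j < n")
    case j: True
    let ?W = "U \<inter> partial_deriv j g -` ball (partial_deriv j g x) e"
    have "openin (top_of_set U) ?W"
      using cont[OF j] continuous_openin_preimage_gen open_ball by blast
    then have "openin (Euclidean_space n) ?W"
      using U openin_trans unfolding Euclidean_space_eq by blast
    then obtain d where d: "d > 0" "\<And>y. y \<in> eucl n \<Longrightarrow> (\<And>i. i < n \<Longrightarrow> \<bar>y i - x i\<bar> < d) \<Longrightarrow> y \<in> ?W"
      using openin_eucl_box[of n ?W x] x e by auto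
    have "\<bar>partial_deriv j g y - partial_deriv j g x\<bar> \<le> e"
      if "y \<in> eucl n" "\<forall>i<n. \<bar>y i - x i\<bar> < d" for y
      using d(2)[of y] that by (auto simp: dist_real_def)
    with d(1) show ?thesis by blast
  qed blast
  then obtain d1 where d1': "\<forall>j. j < n \<longrightarrow> d1 j > 0 \<and> (\<forall>y\<in>eucl n. (\<forall>i<n. \<bar>y i - x i\<bar> < d1 j) \<longrightarrow>
          \<bar>partial_deriv j g y - partial_deriv j g x\<bar> \<le> e)"
    using choice[of "\<lambda>j d. j < n \<longrightarrow> d > 0 \<and> (\<forall>y\<in>eucl n. (\<forall>i<n. \<bar>y i - x i\<bar> < d) \<longrightarrow>
          \<bar>partial_deriv j g y - partial_deriv j g x\<bar> \<le> e)"] by blast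
  then have d1: "\<And>j. j < n \<Longrightarrow> d1 j > 0"
    "\<And>j y. j < n \<Longrightarrow> y \<in> eucl n \<Longrightarrow> (\<And>i. i < n \<Longrightarrow> \<bar>y i - x i\<bar> < d1 j) \<Longrightarrow>
       \<bar>partial_deriv j g y - partial_deriv j g x\<bar> \<le> e"
    by blast+
  define d where "d = Min (insert d0 (d1 ` {..<n}))"
  have d: "d > 0" using d0 d1 by (auto simp: d_def)
  have dd: "d \<le> d0" "\<And>j. j < n \<Longrightarrow> d \<le> d1 j" by (auto simp: d_def intro: Min_le)
  show thesis
  proof (rule that[OF d])
    fix v assume v: "v \<in> eucl n" "\<And>j. j < n \<Longrightarrow> \<bar>v j\<bar> < d"
    \<comment> \<open>The corners of the path from \<open>x\<close> to \<open>x + v\<close>: in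
      \<open>y m\<close> the first \<open>m\<close> coordinates have been moved.\<close>
    define y where "y m = (\<lambda>i. if i < m then x i + v i else x i)" for m
    have step: "\<bar>g (y (Suc m)) - g (y m) - v m * partial_deriv m g x\<bar> \<le> e * \<bar>v m\<bar>" if m: "m < n" for m
    proof -
      define S where "S = closed_segment (x m) (x m + v m)"
      have pt: "(y m)(m := t) \<in> eucl n" "\<And>i. i < n \<Longrightarrow> \<bar>((y m)(m := t)) i - x i\<bar> < d" if "t \<in> S" for t
      proof -
        show "(y m)(m := t) \<in> eucl n" using xe m by (auto simp: y_def)
        have "\<bar>t - x m\<bar> \<le> \<bar>v m\<bar>"
          using that by (auto simp: S_def closed_segment_eq_real_ivl split: if_splits)
        then show "\<And>i. i < n \<Longrightarrow> \<bar>((y m)(m := t)) i - x i\<bar> < d"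
          using v(2) d m by (auto simp: y_def intro: le_less_trans)
      qed
      have "norm ((g ((y m)(m := x m + v m)) - (x m + v m) * partial_deriv m g x)
             - (g ((y m)(m := x m)) - x m * partial_deriv m g x)) \<le> e * norm ((x m + v m) - x m)"
      proof (rule field_differentiable_bound[where S = S and
            f = "\<lambda>t. g ((y m)(m := t)) - t * partial_deriv m g x" and
            f' = "\<lambda>t. partial_deriv m g ((y m)(m := t)) - partial_deriv m g x"])
        show "convex S" by (simp add: S_def)
        fix t assume t: "t \<in> S"
        have "(y m)(m := t) \<in> U"
          using d0(2)[OF pt(1)[OF t]] pt(2)[OF t] dd(1) by (meson less_le_trans)
        from partial_deriv_DERIV[OF diff[OF m this]]
         have "((\<lambda>s. g ((y m)(m := s))) has_real_derivative partial_deriv m g ((y m)(m := t))) (at t)"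
          unfolding fun_upd_upd fun_upd_same .
        then show "((\<lambda>t. g ((y m)(m := t)) - t * partial_deriv m g x) has_real_derivative
            partial_deriv m g ((y m)(m := t)) - partial_deriv m g x) (at t within S)"
        proof (rule has_field_derivative_at_within[OF DERIV_diff])
          show "((\<lambda>t. t * partial_deriv m g x) has_real_derivative partial_deriv m g x) (at t)"
            using DERIV_cmult_right[OF DERIV_ident] by simp
        qed
        show "norm (partial_deriv m g ((y m)(m := t)) - partial_deriv m g x) \<le> e"
          using d1(2)[OF m pt(1)[OF t]] pt(2)[OF t] dd(2)[OF m] by (auto intro: less_le_trans)
      qed (auto simp: S_def)
      moreover have "(y m)(m := x m) = y m" "(y m)(m := x m + v m) = y (Suc m)"
        by (auto simp: y_def fun_eq_iff less_Suc_eq)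
      ultimately show ?thesis by (simp add: algebra_simps)
    qed
    have "y n = (\<lambda>i. x i + v i)" "y 0 = x" using v(1) by (auto simp: y_def fun_eq_iff)
    then have "g (\<lambda>i. x i + v i) - g x - (\<Sum>j<n. v j * partial_deriv j g x)
        = (\<Sum>m<n. g (y (Suc m)) - g (y m) - v m * partial_deriv m g x)"
      using sum_lessThan_telescope[of "\<lambda>m. g (y m)" n] by (simp add: sum_subtractf)
    also have "\<bar>\<dots>\<bar> \<le> (\<Sum>m<n. e * \<bar>v m\<bar>)"
      by (rule order_trans[OF sum_abs]) (auto intro: sum_mono step)
    finally show "\<bar>g (\<lambda>i. x i + v i) - g x - (\<Sum>j<n. v j * partial_deriv j g x)\<bar> \<le> e * (\<Sum>j<n. \<bar>v j\<bar>)"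
      by (simp add: sum_distrib_left)
  qed
qed

section \<open>Affine maps and the chain rule\<close>

definition aff :: "nat \<Rightarrow> nat \<Rightarrow> (nat \<Rightarrow> real) \<Rightarrow> (nat \<Rightarrow> nat \<Rightarrow> real) \<Rightarrow> (nat \<Rightarrow> real) \<Rightarrow> nat \<Rightarrow> real" where
  "aff n m b M x = (\<lambda>j. if j < n then b j + (\<Sum>i<m. M j i * x i) else 0)"

lemma aff_in_eucl [simp]: "aff n m b M x \<in> eucl n"
  by (auto simp: aff_def)

lemma continuous_on_aff: "continuous_on S (aff n m b M)"
proof (rule continuous_on_coordinatewise_then_product)
  fix j
  show "continuous_on S (\<lambda>x. aff n m b M x j)"
    unfolding aff_def
    by (cases "j < n")
       (auto intro!: continuous_intros continuous_on_subset[OF continuous_on_product_coordinates])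
qed

lemma aff_upd:
  assumes "i < m"
  shows "aff n m b M (x(i := t)) = (\<lambda>j. aff n m b M x j + (if j < n then (t - x i) * M j i else 0))"
proof -
  have "(\<Sum>k<m. M j k * (x(i := t)) k) = (\<Sum>k<m. M j k * x k) + (t - x i) * M j i" for j
  proof -
    have "(\<Sum>k<m. M j k * (x(i := t)) k) = M j i * t + (\<Sum>k\<in>{..<m} - {i}. M j k * x k)"
      using assms by (subst sum.remove[of _ i]) auto
    moreover have "(\<Sum>k<m. M j k * x k) = M j i * x i + (\<Sum>k\<in>{..<m} - {i}. M j k * x k)"
      using assms by (subst sum.remove[of _ i]) auto
    ultimately show ?thesis by (simp add: algebra_simps)
  qed
  then show ?thesis by (auto simp: aff_def fun_eq_iff)
qed

lemma openin_aff_vimage: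
  assumes "openin (Euclidean_space n) U"
  shows "openin (Euclidean_space m) {x \<in> eucl m. aff n m b M x \<in> U}"
proof -
  from assms obtain W where W: "open W" "U = eucl n \<inter> W"
    unfolding Euclidean_space_eq openin_open by blast
  have "{x \<in> eucl m. aff n m b M x \<in> U} = eucl m \<inter> aff n m b M -` W"
    using W aff_in_eucl by blast
  moreover have "open (aff n m b M -` W)"
    using W(1) continuous_on_aff[of UNIV n m b M] continuous_on_open_vimage[OF open_UNIV] by auto
  ultimately show ?thesis
    unfolding Euclidean_space_eq openin_open by blast
qed

text \<open>Moving coordinate \<open>i\<close> by \<open>h\<close> moves the image by
  \<open>h\<close> times column \<open>i\<close> of \<open>M\<close>, so the estimate for the total
  derivative applies with this vector as \<open>v\<close>.\<close>

lemma DERIV_aff: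
  assumes U: "openin (Euclidean_space n) U" and x: "aff n m b M x \<in> U" and i: "i < m"
    and diff: "\<And>j y. j < n \<Longrightarrow> y \<in> U \<Longrightarrow> partial_diff j g y"
    and cont: "\<And>j. j < n \<Longrightarrow> continuous_on U (partial_deriv j g)"
  shows "((\<lambda>t. g (aff n m b M (x(i := t)))) has_real_derivative
           (\<Sum>j<n. M j i * partial_deriv j g (aff n m b M x))) (at (x i))"
proof -
  let ?a = "aff n m b M x"
  define D where "D = (\<Sum>j<n. M j i * partial_deriv j g ?a)"
  define C where "C = (\<Sum>j<n. \<bar>M j i\<bar>)"
  have C0: "C \<ge> 0" by (auto simp: C_def sum_nonneg)
  have Cj: "\<bar>M j i\<bar> \<le> C" if "j < n" for j
    unfolding C_def using that by (intro member_le_sum) auto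
  have "(\<lambda>h. (g (aff n m b M (x(i := x i + h))) - g ?a) / h) \<midarrow>0\<rightarrow> D"
  proof (rule LIM_I)
    fix r :: real assume r: "r > 0"
    \<comment> \<open>\<open>C\<close> is the sum of the absolute values in column \<open>i\<close>.
      This \<open>e\<close> makes the error per unit of \<open>h\<close> at most
      \<open>r / 2\<close>, and steps below \<open>d / (C + 1)\<close> keep every coordinate of the
      displacement below \<open>d\<close>; adding 1 covers the case of a zero column.\<close>
    define e where "e = r / (2 * (C + 1))"
    have e: "e > 0" using r C0 by (auto simp: e_def)
    obtain d where d: "d > 0"
      "\<And>v. v \<in> eucl n \<Longrightarrow> (\<And>j. j < n \<Longrightarrow> \<bar>v j\<bar> < d) \<Longrightarrow>
         \<bar>g (\<lambda>i. ?a i + v i) - g ?a - (\<Sum>j<n. v j * partial_deriv j g ?a)\<bar> \<le> e * (\<Sum>j<n. \<bar>v j\<bar>)"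
      using frechet_from_partials[OF U x diff cont e] by blast
    show "\<exists>s>0. \<forall>h. h \<noteq> 0 \<and> norm (h - 0) < s \<longrightarrow>
        norm ((g (aff n m b M (x(i := x i + h))) - g ?a) / h - D) < r"
    proof (intro exI[of _ "d / (C + 1)"] conjI allI impI)
      show "d / (C + 1) > 0" using d C0 by auto
      fix h :: real assume h: "h \<noteq> 0 \<and> norm (h - 0) < d / (C + 1)"
      define v where "v = (\<lambda>j. if j < n then h * M j i else 0)"
      have "\<bar>v j\<bar> < d" if "j < n" for j
      proof -
        have "\<bar>v j\<bar> \<le> \<bar>h\<bar> * C" using that Cj[OF that] by (auto simp: v_def abs_mult mult_left_mono)
        also have "\<dots> \<le> \<bar>h\<bar> * (C + 1)" by (simp add: mult_left_mono)
        also have "\<dots> < d" using h C0 by (auto simp: pos_less_divide_eq)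
        finally show ?thesis .
      qed
      then have "\<bar>g (\<lambda>i. ?a i + v i) - g ?a - (\<Sum>j<n. v j * partial_deriv j g ?a)\<bar> \<le> e * (\<Sum>j<n. \<bar>v j\<bar>)"
        by (intro d(2)) (auto simp: v_def)
      moreover have "(\<lambda>i. ?a i + v i) = aff n m b M (x(i := x i + h))"
        using i by (auto simp: aff_upd v_def fun_eq_iff)
      moreover have "(\<Sum>j<n. v j * partial_deriv j g ?a) = h * D"
        by (simp add: v_def D_def sum_distrib_left mult.assoc)
      moreover have "(\<Sum>j<n. \<bar>v j\<bar>) = \<bar>h\<bar> * C"
        by (simp add: v_def C_def sum_distrib_left abs_mult)
      ultimately have *: "\<bar>g (aff n m b M (x(i := x i + h))) - g ?a - h * D\<bar> \<le> e * (\<bar>h\<bar> * C)"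
        by simp
      have "norm ((g (aff n m b M (x(i := x i + h))) - g ?a) / h - D)
          = \<bar>g (aff n m b M (x(i := x i + h))) - g ?a - h * D\<bar> / \<bar>h\<bar>"
        using h by (simp add: abs_divide[symmetric] diff_divide_distrib)
      also have "\<dots> \<le> e * C" using * h by (simp add: divide_simps mult.commute mult.left_commute)
      also have "\<dots> \<le> e * (C + 1)" using e by simp
      also have "\<dots> = r / 2" using C0 unfolding e_def by (simp add: field_simps)
      also have "\<dots> < r" using r by simp
      finally show "norm ((g (aff n m b M (x(i := x i + h))) - g ?a) / h - D) < r" .
    qed
  qed
  then show ?thesis by (simp add: DERIV_def D_def)
qed

section \<open>Smooth functions on open sets\<close>

lemma partial_diff_const: "partial_diff i (\<lambda>_. c) x"
  by (simp add: partial_diff_def)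

lemma DERIV_partial_add:
  assumes "partial_diff i f x" "partial_diff i g x"
  shows "((\<lambda>t. f (x(i := t)) + g (x(i := t))) has_real_derivative
           partial_deriv i f x + partial_deriv i g x) (at (x i))"
  by (intro DERIV_add partial_deriv_DERIV assms)

lemma DERIV_partial_mult:
  assumes "partial_diff i f x" "partial_diff i g x"
  shows "((\<lambda>t. f (x(i := t)) * g (x(i := t))) has_real_derivative
           partial_deriv i f x * g x + partial_deriv i g x * f x) (at (x i))"
  using DERIV_mult[OF partial_deriv_DERIV[OF assms(1)] partial_deriv_DERIV[OF assms(2)]]
  by simp

lemma partial_diff_add: "partial_diff i f x \<Longrightarrow> partial_diff i g x \<Longrightarrow> partial_diff i (\<lambda>x. f x + g x) x"
  by (rule partial_diffI[where f = "\<lambda>x. f x + g x"], rule DERIV_partial_add)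

lemma partial_diff_mult: "partial_diff i f x \<Longrightarrow> partial_diff i g x \<Longrightarrow> partial_diff i (\<lambda>x. f x * g x) x"
  by (rule partial_diffI[where f = "\<lambda>x. f x * g x"], rule DERIV_partial_mult)

text \<open>The smoothness condition quantifies over lists of indices; recursion on the order
  replaces this by a property suited to induction. Order 0 already contains the existence of the
  first partial derivatives, because \<open>smooth_on_open\<close> asks for it after each
  list.\<close>

primrec Ck_open :: "nat \<Rightarrow> nat \<Rightarrow> (nat \<Rightarrow> real) set \<Rightarrow> ((nat \<Rightarrow> real) \<Rightarrow> real) \<Rightarrow> bool" where
  "Ck_open 0 n U f \<longleftrightarrow> continuous_on U f \<and>
     (\<forall>i<n. \<forall>x\<in>U. partial_diff i f x)"
| "Ck_open (Suc N) n U f \<longleftrightarrow> (continuous_on U f \<and>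
     (\<forall>i<n. \<forall>x\<in>U. partial_diff i f x)) \<and>
     (\<forall>i<n. Ck_open N n U (partial_deriv i f))"

lemma Ck_open_iff_lists:
  "Ck_open N n U f \<longleftrightarrow> (\<forall>is. length is \<le> N \<longrightarrow> set is \<subseteq> {..<n} \<longrightarrow> Ck_open 0 n U (foldr partial_deriv is f))"
proof (induction N arbitrary: f)
  case (Suc N)
  show ?case (is "?l \<longleftrightarrow> ?r")
  proof
    assume l: ?l
    show ?r
    proof (intro allI impI)
      fix "is" assume *: "length is \<le> Suc N" "set is \<subseteq> {..<n}"
      show "Ck_open 0 n U (foldr partial_deriv is f)"
      \<comment> \<open>\<open>foldr\<close> differentiates first in the last index of the list, so
        the list is split at its end.\<close>
      proof (cases "is" rule: rev_cases)
        case (snoc js i)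
        with * l have "Ck_open N n U (partial_deriv i f)" by auto
        with snoc * show ?thesis unfolding Suc.IH by auto
      qed (use l in auto)
    qed
  next
    assume r: ?r
    have "Ck_open 0 n U f" using r[rule_format, of "[]"] by simp
    moreover have "Ck_open N n U (partial_deriv i f)" if "i < n" for i
      unfolding Suc.IH
    proof (intro allI impI)
      fix "is" assume "length is \<le> N" "set is \<subseteq> {..<n}"
      with r[rule_format, of "is @ [i]"] that show "Ck_open 0 n U (foldr partial_deriv is (partial_deriv i f))"
        by simp
    qed
    ultimately show ?l by simp
  qed
qed auto

lemma smooth_on_open_iff: "smooth_on_open n U f \<longleftrightarrow> openin (Euclidean_space n) U \<and> (\<forall>N. Ck_open N n U f)"
proof (cases "openin (Euclidean_space n) U")
  case True
  then have "eucl n \<inter> U = U" using openin_eucl_subset by blast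
  then show ?thesis
    unfolding smooth_on_open_def Ck_open_iff_lists[of _ n U f] partial_diff_def[symmetric]
    by (auto simp: Euclidean_space_eq subtopology_subtopology) blast
qed (simp add: smooth_on_open_def)

lemma Ck_open_0: "Ck_open N n U f \<Longrightarrow> Ck_open 0 n U f"
  by (cases N) auto

lemma Ck_open_SucD: "Ck_open (Suc N) n U f \<Longrightarrow> Ck_open N n U f"
  by (induction N arbitrary: f) auto

lemma Ck_open_cong:
  assumes "openin (Euclidean_space n) U" "\<And>y. y \<in> U \<Longrightarrow> f y = g y" "Ck_open N n U f"
  shows "Ck_open N n U g"
  using assms(2,3)
proof (induction N arbitrary: f g)
  case 0
  then show ?case
    using partial_diff_cong[OF assms(1), of _ _ f g] by (auto cong: continuous_on_cong)
next
  case (Suc N)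
  have "Ck_open 0 n U g"
    using Suc.prems partial_diff_cong[OF assms(1), of _ _ f g] by (auto cong: continuous_on_cong)
  moreover have "Ck_open N n U (partial_deriv i g)" if "i < n" for i
  proof (rule Suc.IH)
    show "Ck_open N n U (partial_deriv i f)" using Suc.prems(2) that by simp
    show "partial_deriv i f y = partial_deriv i g y" if "y \<in> U" for y
      using assms(1) \<open>y \<in> U\<close> \<open>i < n\<close> Suc.prems(1) by (rule partial_deriv_cong)
  qed
  ultimately show ?case by simp
qed

lemma Ck_open_const: "Ck_open N n U (\<lambda>_. c)"
proof (induction N arbitrary: c)
  case (Suc N)
  have "partial_deriv i (\<lambda>_. c) = (\<lambda>_. 0)" for i
    by (auto simp: fun_eq_iff partial_deriv_def)
  with Suc show ?case by (simp add: partial_diff_const)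
qed (simp add: partial_diff_const)

lemma Ck_open_add:
  assumes "openin (Euclidean_space n) U" "Ck_open N n U f" "Ck_open N n U g"
  shows "Ck_open N n U (\<lambda>x. f x + g x)"
  using assms(2,3)
proof (induction N arbitrary: f g)
  case (Suc N)
  have "Ck_open N n U (partial_deriv i (\<lambda>x. f x + g x))" if i: "i < n" for i
  proof (rule Ck_open_cong[OF assms(1)])
    show "Ck_open N n U (\<lambda>x. partial_deriv i f x + partial_deriv i g x)"
      using Suc i by simp
    fix y assume "y \<in> U"
    then show "partial_deriv i f y + partial_deriv i g y = partial_deriv i (\<lambda>x. f x + g x) y"
      using Suc.prems i
      by (intro partial_derivI[symmetric] DERIV_partial_add) auto
  qed
  moreover have "Ck_open 0 n U f" "Ck_open 0 n U g" using Suc.prems Ck_open_0 by blast+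
  ultimately show ?case
    using partial_diff_add by (auto intro!: continuous_intros)
qed (use partial_diff_add in \<open>auto intro!: continuous_intros\<close>)

lemma Ck_open_mult:
  assumes "openin (Euclidean_space n) U" "Ck_open N n U f" "Ck_open N n U g"
  shows "Ck_open N n U (\<lambda>x. f x * g x)"
  using assms(2,3)
proof (induction N arbitrary: f g)
  case (Suc N)
  have "Ck_open N n U (partial_deriv i (\<lambda>x. f x * g x))" if i: "i < n" for i
  proof (rule Ck_open_cong[OF assms(1)])
    show "Ck_open N n U (\<lambda>x. partial_deriv i f x * g x + partial_deriv i g x * f x)"
      using Suc i Ck_open_SucD by (intro Ck_open_add[OF assms(1)] Suc.IH) auto
    fix y assume "y \<in> U"
    then show "partial_deriv i f y * g y + partial_deriv i g y * f y = partial_deriv i (\<lambda>x. f x * g x) y"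
      using Suc.prems i
      by (intro partial_derivI[symmetric] DERIV_partial_mult) auto
  qed
  moreover have "Ck_open 0 n U f" "Ck_open 0 n U g" using Suc.prems Ck_open_0 by blast+
  ultimately show ?case
    using partial_diff_mult by (auto intro!: continuous_intros)
qed (use partial_diff_mult in \<open>auto intro!: continuous_intros\<close>)

lemma Ck_open_sum:
  assumes "openin (Euclidean_space n) U" "\<And>a. a \<in> F \<Longrightarrow> Ck_open N n U (f a)"
  shows "Ck_open N n U (\<lambda>x. \<Sum>a\<in>F. f a x)"
  using assms(2)
proof (induction F rule: infinite_finite_induct)
  case (insert a F)
  then show ?case using Ck_open_add[OF assms(1)] by simp
qed (auto intro: Ck_open_const)

lemma partial_deriv_aff:
  assumes "openin (Euclidean_space n) U" "Ck_open (Suc 0) n U g" "aff n m b M x \<in> U" "i < m"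
  shows "partial_deriv i (\<lambda>x. g (aff n m b M x)) x = (\<Sum>j<n. M j i * partial_deriv j g (aff n m b M x))"
  using assms by (intro partial_derivI DERIV_aff[where U = U]) auto

text \<open>One order is lost because the chain rule asks for continuous first partial derivatives,
  while \<open>Ck_open 0\<close> gives only their existence. For smooth functions this costs
  nothing.\<close>

lemma Ck_open_aff:
  assumes U: "openin (Euclidean_space n) U" and "Ck_open (Suc N) n U g"
  shows "Ck_open N m {x \<in> eucl m. aff n m b M x \<in> U} (\<lambda>x. g (aff n m b M x))"
  using assms(2)
proof (induction N arbitrary: g)
  let ?V = "{x \<in> eucl m. aff n m b M x \<in> U}"
  note V = openin_aff_vimage[OF U, of m b M]
  have base: "Ck_open 0 m ?V (\<lambda>x. g (aff n m b M x))" if "Ck_open (Suc 0) n U g" for g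
  proof -
    have "continuous_on ?V (\<lambda>x. g (aff n m b M x))"
      by (rule continuous_on_compose2[of U g]) (use that continuous_on_aff in auto)
    moreover have "partial_diff i (\<lambda>x. g (aff n m b M x)) x" if "x \<in> ?V" "i < m" for x i
      by (rule partial_diffI, rule DERIV_aff[OF U]) (use \<open>Ck_open (Suc 0) n U g\<close> that in auto)
    ultimately show ?thesis by auto
  qed
  {
    case 0
    then show ?case using base by simp
  next
    case (Suc N)
    have g1: "Ck_open (Suc 0) n U g"
      using Suc.prems Ck_open_0[of "Suc N" n U] by auto
    have "Ck_open N m ?V (partial_deriv i (\<lambda>x. g (aff n m b M x)))" if i: "i < m" for i
    proof (rule Ck_open_cong[OF V])
      show "Ck_open N m ?V (\<lambda>x. \<Sum>j<n. M j i * partial_deriv j g (aff n m b M x))"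
        using Suc by (intro Ck_open_sum Ck_open_mult Ck_open_const V) auto
    qed (use partial_deriv_aff[OF U g1] i in auto)
    then show ?case using base[OF g1] by simp
  }
qed

lemma smooth_on_open_partial:
  "smooth_on_open n U f \<Longrightarrow> i < n \<Longrightarrow> smooth_on_open n U (partial_deriv i f)"
  unfolding smooth_on_open_iff using Ck_open.simps(2) by blast

lemma smooth_on_open_const: "openin (Euclidean_space n) U \<Longrightarrow> smooth_on_open n U (\<lambda>_. c)"
  unfolding smooth_on_open_iff using Ck_open_const by blast

lemma smooth_on_open_add:
  "smooth_on_open n U f \<Longrightarrow> smooth_on_open n U g \<Longrightarrow> smooth_on_open n U (\<lambda>x. f x + g x)"
  unfolding smooth_on_open_iff using Ck_open_add by blast

lemma smooth_on_open_mult: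
  "smooth_on_open n U f \<Longrightarrow> smooth_on_open n U g \<Longrightarrow> smooth_on_open n U (\<lambda>x. f x * g x)"
  unfolding smooth_on_open_iff using Ck_open_mult by blast

lemma smooth_on_open_aff:
  "smooth_on_open n U g \<Longrightarrow>
   smooth_on_open m {x \<in> eucl m. aff n m b M x \<in> U} (\<lambda>x. g (aff n m b M x))"
  unfolding smooth_on_open_iff using Ck_open_aff openin_aff_vimage by blast

lemma Ck_open_mono:
  assumes "Ck_open N n U f" "V \<subseteq> U"
  shows "Ck_open N n V f"
  using assms(1)
proof (induction N arbitrary: f)
  case 0 then show ?case using assms(2) continuous_on_subset by auto
next
  case (Suc N) then show ?case using assms(2) continuous_on_subset by auto
qed

lemma smooth_on_open_subset:
  "smooth_on_open n U f \<Longrightarrow> openin (Euclidean_space n) V \<Longrightarrow> V \<subseteq> U \<Longrightarrow> smooth_on_open n V f"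
  unfolding smooth_on_open_iff using Ck_open_mono by blast

lemma smooth_on_open_DERIV:
  "smooth_on_open n U f \<Longrightarrow> x \<in> U \<Longrightarrow> i < n \<Longrightarrow>
    ((\<lambda>t. f (x(i := t))) has_real_derivative partial_deriv i f x) (at (x i))"
  unfolding smooth_on_open_iff using partial_deriv_DERIV[of i f x] Ck_open.simps(1)[of n U f] by blast

lemma smooth_on_open_continuous: "smooth_on_open n U f \<Longrightarrow> continuous_on U f"
  unfolding smooth_on_open_iff using Ck_open.simps(1) by blast

section \<open>Domains of plots and derivatives at their boundary points\<close>

definition plot_domain :: "nat \<Rightarrow> (nat \<Rightarrow> real) set \<Rightarrow> bool" where
  "plot_domain n S \<longleftrightarrow>
     S \<subseteq> topspace (Euclidean_space n) \<and>
     (\<forall>x\<in>S. \<forall>y\<in>S. \<forall>t\<in>{0..1}. (\<lambda>i. (1 - t) * x i + t * y i) \<in> S) \<and>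
     Euclidean_space n interior_of S \<noteq> {}"

lemma plot_domain_subset: "plot_domain n S \<Longrightarrow> S \<subseteq> eucl n"
  by (simp add: plot_domain_def topspace_Euclidean_space)

lemma aff_scale:
  "aff n n b (\<lambda>j i. if i = j then c else 0) x = (\<lambda>j. if j < n then b j + c * x j else 0)"
proof -
  have "(\<Sum>i<n. (if i = j then c else 0) * x i) = (if j < n then c * x j else 0)" for j
    by (simp add: if_distrib[of "\<lambda>z. z * _"] sum.delta cong: if_cong)
  then show ?thesis by (auto simp: aff_def fun_eq_iff)
qed

text \<open>The segment from \<open>x\<close> to an interior point \<open>a\<close> enters the
  interior at once: the contraction with centre \<open>x\<close> and ratio \<open>t\<close> maps the
  interior onto an open set around \<open>\<gamma> t\<close>, and convexity keeps this set inside
  \<open>S\<close>.\<close>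

lemma plot_domain_path:
  assumes "plot_domain n S" "x \<in> S"
  obtains \<gamma> :: "real \<Rightarrow> nat \<Rightarrow> real"
  where "continuous_on UNIV \<gamma>" "\<gamma> 0 = x" "\<And>t. 0 < t \<Longrightarrow> t \<le> 1 \<Longrightarrow> \<gamma> t \<in> Euclidean_space n interior_of S"
proof -
  let ?V = "Euclidean_space n interior_of S"
  obtain a where a: "a \<in> ?V" using assms(1) by (auto simp: plot_domain_def)
  have VS: "?V \<subseteq> S" by (rule interior_of_subset)
  note SE = plot_domain_subset[OF assms(1)]
  define \<gamma> where "\<gamma> t = (\<lambda>i. (1 - t) * x i + t * a i)" for t
  have "\<gamma> t \<in> ?V" if t: "0 < t" "t \<le> 1" for t
  proof -
    \<comment> \<open>With this \<open>b\<close>, the map \<open>\<alpha>\<close> sends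
      \<open>y\<close> to \<open>(y - (1 - t) x) / t\<close>; it is the inverse of the contraction,
      so the image of the interior can be written as a preimage.\<close>
    define b where "b = (\<lambda>i. - ((1 - t) / t) * x i)"
    define \<alpha> where "\<alpha> = aff n n b (\<lambda>j i. if i = j then 1 / t else 0)"
    have \<alpha>: "\<alpha> y = (\<lambda>j. if j < n then b j + (1 / t) * y j else 0)" for y
      by (simp only: \<alpha>_def aff_scale)
    have "openin (Euclidean_space n) {y \<in> eucl n. \<alpha> y \<in> ?V}"
      unfolding \<alpha>_def by (intro openin_aff_vimage) simp
    moreover have "{y \<in> eucl n. \<alpha> y \<in> ?V} \<subseteq> S"
    proof clarify
      fix y assume y: "\<forall>i\<ge>n. y i = 0" "\<alpha> y \<in> ?V"
      have "(\<lambda>i. (1 - t) * x i + t * \<alpha> y i) \<in> S"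
        using assms t y VS by (auto simp: plot_domain_def)
      moreover have "(\<lambda>i. (1 - t) * x i + t * \<alpha> y i) = y"
        using y(1) assms(2) SE t by (auto simp: \<alpha> b_def fun_eq_iff field_simps)
      ultimately show "y \<in> S" by simp
    qed
    moreover have "\<gamma> t \<in> {y \<in> eucl n. \<alpha> y \<in> ?V}"
    proof -
      have "\<alpha> (\<gamma> t) = a"
        using a VS SE t by (auto simp: \<alpha> b_def \<gamma>_def fun_eq_iff field_simps subset_iff)
      moreover have "a \<in> eucl n" "x \<in> eucl n" using a VS SE assms(2) by blast+
      then have "\<gamma> t \<in> eucl n" by (simp add: \<gamma>_def)
      ultimately show ?thesis using a by simp
    qed
    ultimately show ?thesis using interior_of_maximal by blast
  qed
  moreover have "continuous_on UNIV \<gamma>"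
    unfolding \<gamma>_def by (intro continuous_on_coordinatewise_then_product continuous_intros)
  moreover have "\<gamma> 0 = x" by (simp add: \<gamma>_def)
  ultimately show thesis using that by blast
qed

text \<open>Every point of \<open>S\<close> is a limit of interior points along a path that stays in
  \<open>W\<close> for a short time, so continuity carries the zeros over. This serves both to
  compare two extensions at the boundary and to test a form at interior points only.\<close>

lemma eq_0_from_interior:
  fixes D :: "(nat \<Rightarrow> real) \<Rightarrow> real"
  assumes "plot_domain n S" and x: "x \<in> W"
    and W: "openin (top_of_set S) W" and D: "continuous_on W D"
    and 0: "\<And>y. y \<in> W \<Longrightarrow> y \<in> Euclidean_space n interior_of S \<Longrightarrow> D y = 0"
  shows "D x = 0"
proof -
  have "x \<in> S" using x W openin_subset by fastforce
  from plot_domain_path[OF assms(1) this] obtain \<gamma> :: "real \<Rightarrow> nat \<Rightarrow> real"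
    where \<gamma>: "continuous_on UNIV \<gamma>" "\<gamma> 0 = x"
      "\<And>t. 0 < t \<Longrightarrow> t \<le> 1 \<Longrightarrow> \<gamma> t \<in> Euclidean_space n interior_of S"
    by blast
  have \<gamma>S: "\<gamma> t \<in> S" if "0 \<le> t" "t \<le> 1" for t
    using \<gamma>(2) \<gamma>(3)[of t] that \<open>x \<in> S\<close> interior_of_subset[of "Euclidean_space n" S]
    by (cases "t = 0") auto
  obtain O' where O': "open O'" "W = S \<inter> O'" using W by (auto simp: openin_open)
  have "open (\<gamma> -` O')" using \<gamma>(1) O'(1) continuous_on_open_vimage[OF open_UNIV] by auto
  moreover have "0 \<in> \<gamma> -` O'" using \<gamma>(2) x O'(2) by simp
  ultimately obtain d where d: "d > 0" "\<And>t. \<bar>t\<bar> < d \<Longrightarrow> \<gamma> t \<in> O'"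
    unfolding open_dist by (force simp: dist_real_def)
  define e where "e = min 1 (d / 2)"
  have e: "e > 0" "e \<le> 1" "e < d" using d(1) by (auto simp: e_def)
  have \<gamma>W: "\<gamma> t \<in> W" if "0 \<le> t" "t \<le> e" for t
    using that e d(2)[of t] \<gamma>S[of t] O'(2) by auto
  have cl: "closure {0<..e} = {0..e}" using e by simp
  have "(D \<circ> \<gamma>) 0 = 0"
  proof (rule continuous_constant_on_closure[where S = "{0<..e}" and f = "D \<circ> \<gamma>"])
    show "continuous_on (closure {0<..e}) (D \<circ> \<gamma>)"
      unfolding cl
    proof (rule continuous_on_compose)
      show "continuous_on {0..e} \<gamma>" using \<gamma>(1) continuous_on_subset by blast
      show "continuous_on (\<gamma> ` {0..e}) D" using \<gamma>W by (intro continuous_on_subset[OF D]) auto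
    qed
    show "(D \<circ> \<gamma>) t = 0" if "t \<in> {0<..e}" for t
      using that 0[of "\<gamma> t"] \<gamma>W[of t] \<gamma>(3)[of t] e by auto
    show "0 \<in> closure {0<..e}" unfolding cl using e by simp
  qed
  then show ?thesis using \<gamma>(2) by simp
qed

lemma openin_eucl_Int:
  assumes "openin (Euclidean_space n) U" "S \<subseteq> eucl n"
  shows "openin (top_of_set S) (U \<inter> S)"
  using assms unfolding Euclidean_space_eq openin_open by blast

text \<open>The definite description denotes: two local extensions agree on an open set inside
  \<open>S\<close>, hence so do their partial derivatives there, and the difference of these
  continuous functions vanishes at \<open>x\<close> as well.\<close>

lemma partial_deriv_on_eq:
  assumes S: "plot_domain n S" and x: "x \<in> S" "x \<in> U" and i: "i < n"
    and g: "smooth_on_open n U g" "\<And>y. y \<in> U \<Longrightarrow> y \<in> S \<Longrightarrow> g y = f y"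
  shows "partial_deriv_on n S i f x = partial_deriv i g x"
  unfolding partial_deriv_on_def
proof (rule the_equality)
  show "\<exists>U g'. x \<in> U \<and> smooth_on_open n U g' \<and> (\<forall>y\<in>U \<inter> S. g' y = f y) \<and>
      partial_deriv i g x = partial_deriv i g' x"
    using x g by blast
  fix D assume "\<exists>U g. x \<in> U \<and> smooth_on_open n U g \<and> (\<forall>y\<in>U \<inter> S. g y = f y) \<and> D = partial_deriv i g x"
  then obtain U' g' where g': "x \<in> U'" "smooth_on_open n U' g'" "\<And>y. y \<in> U' \<inter> S \<Longrightarrow> g' y = f y"
    "D = partial_deriv i g' x"
    by blast
  let ?I = "Euclidean_space n interior_of S" and ?O = "U \<inter> U'"
  have opens: "openin (Euclidean_space n) ?O" "openin (Euclidean_space n) (?O \<inter> ?I)"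
    using g(1) g'(2) by (auto simp: smooth_on_open_def)
  have "partial_deriv i g' x - partial_deriv i g x = 0"
  proof (rule eq_0_from_interior[OF S, where W = "?O \<inter> S" and D = "\<lambda>x. partial_deriv i g' x - partial_deriv i g x"])
    show "x \<in> ?O \<inter> S" using x g' by simp
    show "openin (top_of_set S) (?O \<inter> S)"
      using opens plot_domain_subset[OF S] openin_eucl_Int by blast
    show "continuous_on (?O \<inter> S) (\<lambda>x. partial_deriv i g' x - partial_deriv i g x)"
    proof (rule continuous_on_diff)
      show "continuous_on (?O \<inter> S) (partial_deriv i g')"
        using smooth_on_open_continuous[OF smooth_on_open_partial[OF g'(2) i]]
        by (rule continuous_on_subset) blast
      show "continuous_on (?O \<inter> S) (partial_deriv i g)"
        using smooth_on_open_continuous[OF smooth_on_open_partial[OF g(1) i]]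
        by (rule continuous_on_subset) blast
    qed
    fix y assume "y \<in> ?O \<inter> S" "y \<in> ?I"
    then have y: "y \<in> ?O \<inter> ?I" by blast
    have "g' z = g z" if "z \<in> ?O \<inter> ?I" for z
    proof -
      have "z \<in> U" "z \<in> U'" "z \<in> S"
        using that interior_of_subset[of "Euclidean_space n" S] by blast+
      with g(2)[of z] g'(3)[of z] show ?thesis by simp
    qed
    with opens(2) y i have "partial_deriv i g' y = partial_deriv i g y" by (rule partial_deriv_cong)
    then show "partial_deriv i g' y - partial_deriv i g y = 0" by simp
  qed
  then show "D = partial_deriv i g x" using g'(4) by simp
qed

lemma smooth_onE:
  assumes "smooth_on n S f" "x \<in> S"
  obtains U g where "x \<in> U" "smooth_on_open n U g" "\<And>y. y \<in> U \<Longrightarrow> y \<in> S \<Longrightarrow> g y = f y"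
proof -
  from assms have "\<exists>U g. x \<in> U \<and> smooth_on_open n U g \<and> (\<forall>y\<in>U \<inter> S. g y = f y)"
    unfolding smooth_on_def by blast
  then obtain U g where "x \<in> U" "smooth_on_open n U g" "\<forall>y\<in>U \<inter> S. g y = f y" by blast
  then show thesis using that[of U g] by simp
qed

lemma smooth_on2E:
  assumes "smooth_on n S f" "smooth_on n S f'" "x \<in> S"
  obtains U g g' where "x \<in> U" "smooth_on_open n U g" "\<And>y. y \<in> U \<Longrightarrow> y \<in> S \<Longrightarrow> g y = f y"
    "smooth_on_open n U g'" "\<And>y. y \<in> U \<Longrightarrow> y \<in> S \<Longrightarrow> g' y = f' y"
proof -
  obtain U g where g: "x \<in> U" "smooth_on_open n U g" "\<And>y. y \<in> U \<Longrightarrow> y \<in> S \<Longrightarrow> g y = f y"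
    using smooth_onE[OF assms(1,3)] by blast
  obtain U' g' where g': "x \<in> U'" "smooth_on_open n U' g'" "\<And>y. y \<in> U' \<Longrightarrow> y \<in> S \<Longrightarrow> g' y = f' y"
    using smooth_onE[OF assms(2,3)] by blast
  have "openin (Euclidean_space n) (U \<inter> U')" using g g' by (auto simp: smooth_on_open_def)
  show thesis
  proof (rule that[of "U \<inter> U'" g g'])
    show "smooth_on_open n (U \<inter> U') g" "smooth_on_open n (U \<inter> U') g'"
      using smooth_on_open_subset[OF g(2) \<open>openin _ _\<close>] smooth_on_open_subset[OF g'(2) \<open>openin _ _\<close>]
      by simp_all
  qed (use g g' in simp_all)
qed

lemma smooth_on_const: "S \<subseteq> eucl n \<Longrightarrow> smooth_on n S (\<lambda>_. c)"
  unfolding smooth_on_def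
  by (intro ballI exI[of _ "topspace (Euclidean_space n)"] exI[of _ "\<lambda>_. c"])
     (auto simp: topspace_Euclidean_space intro!: smooth_on_open_const simp flip: topspace_Euclidean_space)

lemma smooth_on_add:
  assumes "smooth_on n S f" "smooth_on n S g"
  shows "smooth_on n S (\<lambda>x. f x + g x)"
  unfolding smooth_on_def
proof
  fix x assume "x \<in> S"
  obtain U f' g' where "x \<in> U"
    "smooth_on_open n U f'" "\<And>y. y \<in> U \<Longrightarrow> y \<in> S \<Longrightarrow> f' y = f y"
    "smooth_on_open n U g'" "\<And>y. y \<in> U \<Longrightarrow> y \<in> S \<Longrightarrow> g' y = g y"
    by (rule smooth_on2E[OF assms \<open>x \<in> S\<close>]) (rule that)
  then show "\<exists>U h. x \<in> U \<and> smooth_on_open n U h \<and> (\<forall>y\<in>U \<inter> S. h y = f y + g y)"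
    using smooth_on_open_add[of n U f' g'] by (intro exI[of _ U] exI[of _ "\<lambda>x. f' x + g' x"]) auto
qed

lemma smooth_on_mult:
  assumes "smooth_on n S f" "smooth_on n S g"
  shows "smooth_on n S (\<lambda>x. f x * g x)"
  unfolding smooth_on_def
proof
  fix x assume "x \<in> S"
  obtain U f' g' where "x \<in> U"
    "smooth_on_open n U f'" "\<And>y. y \<in> U \<Longrightarrow> y \<in> S \<Longrightarrow> f' y = f y"
    "smooth_on_open n U g'" "\<And>y. y \<in> U \<Longrightarrow> y \<in> S \<Longrightarrow> g' y = g y"
    by (rule smooth_on2E[OF assms \<open>x \<in> S\<close>]) (rule that)
  then show "\<exists>U h. x \<in> U \<and> smooth_on_open n U h \<and> (\<forall>y\<in>U \<inter> S. h y = f y * g y)"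
    using smooth_on_open_mult[of n U f' g'] by (intro exI[of _ U] exI[of _ "\<lambda>x. f' x * g' x"]) auto
qed

lemma smooth_on_sum:
  "S \<subseteq> eucl n \<Longrightarrow> (\<And>a. a \<in> F \<Longrightarrow> smooth_on n S (f a)) \<Longrightarrow> smooth_on n S (\<lambda>x. \<Sum>a\<in>F. f a x)"
  by (induction F rule: infinite_finite_induct) (auto intro: smooth_on_const smooth_on_add)

lemma smooth_on_prod:
  "S \<subseteq> eucl n \<Longrightarrow> (\<And>a. a \<in> F \<Longrightarrow> smooth_on n S (f a)) \<Longrightarrow> smooth_on n S (\<lambda>x. \<Prod>a\<in>F. f a x)"
  by (induction F rule: infinite_finite_induct) (auto intro: smooth_on_const smooth_on_mult)

lemma smooth_on_cong: "(\<And>x. x \<in> S \<Longrightarrow> f x = g x) \<Longrightarrow> smooth_on n S f \<longleftrightarrow> smooth_on n S g"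
  unfolding smooth_on_def by (metis Int_iff)

text \<open>Smoothness may be tested on relatively open pieces of \<open>S\<close>. This is the form
  in which it is met for differential forms, whose expression by smooth functions is available only
  near each point of the space.\<close>

lemma smooth_on_local:
  assumes "S \<subseteq> eucl n"
    and "\<And>x. x \<in> S \<Longrightarrow> \<exists>W g. openin (top_of_set S) W \<and> x \<in> W \<and> smooth_on n S g \<and> (\<forall>y\<in>W. g y = f y)"
  shows "smooth_on n S f"
  unfolding smooth_on_def
proof
  fix x assume "x \<in> S"
  from assms(2)[OF this] obtain W g where W: "openin (top_of_set S) W" "x \<in> W" "smooth_on n S g" "\<forall>y\<in>W. g y = f y"
    by blast
  obtain U h where h: "x \<in> U" "smooth_on_open n U h" "\<And>y. y \<in> U \<Longrightarrow> y \<in> S \<Longrightarrow> h y = g y"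
    using smooth_onE[OF W(3) \<open>x \<in> S\<close>] by blast
  obtain O' where O': "open O'" "W = S \<inter> O'" using W(1) by (auto simp: openin_open)
  have "openin (Euclidean_space n) (U \<inter> O')"
    using h(2) O'(1) by (auto simp: smooth_on_open_def Euclidean_space_eq openin_open Int_assoc)
  then have "smooth_on_open n (U \<inter> O') h" using h(2) smooth_on_open_subset by blast
  then show "\<exists>U g. x \<in> U \<and> smooth_on_open n U g \<and> (\<forall>y\<in>U \<inter> S. g y = f y)"
    using h O' W by (intro exI[of _ "U \<inter> O'"] exI[of _ h]) auto
qed

lemma smooth_on_continuous:
  assumes "smooth_on n S f" "S \<subseteq> eucl n"
  shows "continuous_on S f"
  unfolding continuous_on_def
proof
  fix x assume x: "x \<in> S"
  obtain U g where g: "x \<in> U" "smooth_on_open n U g" "\<And>y. y \<in> U \<Longrightarrow> y \<in> S \<Longrightarrow> g y = f y"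
    using smooth_onE[OF assms(1) x] by blast
  obtain O' where O': "open O'" "U \<inter> S = S \<inter> O'"
    using openin_eucl_Int[OF _ assms(2), of U] g(2) by (auto simp: smooth_on_open_def openin_open)
  have "continuous_on (U \<inter> S) f"
    using continuous_on_subset[OF smooth_on_open_continuous[OF g(2)], of "U \<inter> S"] g(3)
    by (auto intro: continuous_on_eq)
  then have "(f \<longlongrightarrow> f x) (at x within (U \<inter> S))"
    using g(1) x by (auto simp: continuous_on_def)
  moreover have "at x within (U \<inter> S) = at x within S"
    by (rule at_within_nhd[where S = O']) (use O' g(1) x in auto)
  ultimately show "(f \<longlongrightarrow> f x) (at x within S)" by simp
qed

lemma smooth_on_aff:
  assumes "smooth_on n S f" "T \<subseteq> eucl m" "aff n m b M ` T \<subseteq> S"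
  shows "smooth_on m T (\<lambda>x. f (aff n m b M x))"
  unfolding smooth_on_def
proof
  fix x assume x: "x \<in> T"
  obtain U g where g: "aff n m b M x \<in> U" "smooth_on_open n U g" "\<And>y. y \<in> U \<Longrightarrow> y \<in> S \<Longrightarrow> g y = f y"
    using smooth_onE[OF assms(1), of "aff n m b M x"] x assms(3) by blast
  then show "\<exists>U g. x \<in> U \<and> smooth_on_open m U g \<and> (\<forall>y\<in>U \<inter> T. g y = f (aff n m b M y))"
    using smooth_on_open_aff[OF g(2), of m b M] x assms
    by (intro exI[of _ "{x \<in> eucl m. aff n m b M x \<in> U}"] exI[of _ "\<lambda>x. g (aff n m b M x)"]) auto
qed

text \<open>A local extension of \<open>f\<close> composed with the affine map is a local extension
  of the composite, so the chain rule on open sets also covers boundary points.\<close>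

lemma partial_deriv_on_aff:
  assumes S: "plot_domain n S" and T: "plot_domain m T" and f: "smooth_on n S f"
    and TS: "aff n m b M ` T \<subseteq> S" and x: "x \<in> T" and i: "i < m"
  shows "partial_deriv_on m T i (\<lambda>x. f (aff n m b M x)) x
       = (\<Sum>j<n. M j i * partial_deriv_on n S j f (aff n m b M x))"
proof -
  let ?a = "aff n m b M x"
  have aS: "?a \<in> S" using x TS by blast
  have xm: "x \<in> eucl m" using x plot_domain_subset[OF T] by blast
  obtain U g where g: "?a \<in> U" "smooth_on_open n U g" "\<And>y. y \<in> U \<Longrightarrow> y \<in> S \<Longrightarrow> g y = f y"
    using smooth_onE[OF f aS] by blast
  have "partial_deriv_on m T i (\<lambda>x. f (aff n m b M x)) x = partial_deriv i (\<lambda>x. g (aff n m b M x)) x"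
    by (rule partial_deriv_on_eq[OF T x _ i smooth_on_open_aff[OF g(2)]]) (use xm g TS in auto)
  also have "\<dots> = (\<Sum>j<n. M j i * partial_deriv j g ?a)"
    by (rule partial_deriv_aff) (use g i in \<open>auto simp: smooth_on_open_iff simp del: Ck_open.simps\<close>)
  also have "\<dots> = (\<Sum>j<n. M j i * partial_deriv_on n S j f ?a)"
    using partial_deriv_on_eq[OF S aS g(1) _ g(2,3)] by (intro sum.cong) auto
  finally show ?thesis .
qed

text \<open>The partial derivative of a local extension is itself a local extension of the partial
  derivative.\<close>

lemma smooth_on_partial_deriv_on:
  assumes S: "plot_domain n S" and f: "smooth_on n S f" and i: "i < n"
  shows "smooth_on n S (partial_deriv_on n S i f)"
  unfolding smooth_on_def
proof
  fix x assume "x \<in> S"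
  then obtain U g where g: "x \<in> U" "smooth_on_open n U g" "\<And>y. y \<in> U \<Longrightarrow> y \<in> S \<Longrightarrow> g y = f y"
    using smooth_onE[OF f] by blast
  show "\<exists>U h. x \<in> U \<and> smooth_on_open n U h \<and> (\<forall>y\<in>U \<inter> S. h y = partial_deriv_on n S i f y)"
  proof (intro exI conjI ballI)
    show "x \<in> U" by fact
    show "smooth_on_open n U (partial_deriv i g)" using g(2) i by (rule smooth_on_open_partial)
    fix y assume "y \<in> U \<inter> S"
    then show "partial_deriv i g y = partial_deriv_on n S i f y"
      using partial_deriv_on_eq[OF S _ _ i g(2,3), of y] by simp
  qed
qed

lemma partial_deriv_on_cong:
  assumes "\<And>y. y \<in> S \<Longrightarrow> f y = g y"
  shows "partial_deriv_on n S i f x = partial_deriv_on n S i g x"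
proof -
  have "(\<forall>y\<in>U \<inter> S. h y = f y) \<longleftrightarrow> (\<forall>y\<in>U \<inter> S. h y = g y)" for U h using assms by auto
  then show ?thesis unfolding partial_deriv_on_def by simp
qed

lemma partial_deriv_on_const:
  assumes "plot_domain n S" "x \<in> S" "i < n"
  shows "partial_deriv_on n S i (\<lambda>_. c) x = 0"
proof -
  have "smooth_on_open n (topspace (Euclidean_space n)) (\<lambda>_. c)" by (intro smooth_on_open_const) simp
  then have "partial_deriv_on n S i (\<lambda>_. c) x = partial_deriv i (\<lambda>_. c) x"
    using assms by (intro partial_deriv_on_eq[where U = "topspace (Euclidean_space n)"])
      (auto simp: plot_domain_def)
  then show ?thesis by (simp add: partial_deriv_def)
qed

lemma partial_deriv_on_add:
  assumes S: "plot_domain n S" "x \<in> S" "i < n" and fg: "smooth_on n S f" "smooth_on n S g"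
  shows "partial_deriv_on n S i (\<lambda>x. f x + g x) x = partial_deriv_on n S i f x + partial_deriv_on n S i g x"
proof -
  obtain U f' g' where h: "x \<in> U"
    "smooth_on_open n U f'" "\<And>y. y \<in> U \<Longrightarrow> y \<in> S \<Longrightarrow> f' y = f y"
    "smooth_on_open n U g'" "\<And>y. y \<in> U \<Longrightarrow> y \<in> S \<Longrightarrow> g' y = g y"
    by (rule smooth_on2E[OF fg S(2)]) (rule that)
  have "partial_deriv_on n S i (\<lambda>x. f x + g x) x = partial_deriv i (\<lambda>x. f' x + g' x) x"
    by (rule partial_deriv_on_eq[OF S(1,2) h(1) S(3) smooth_on_open_add[OF h(2,4)]]) (simp add: h)
  also have "\<dots> = partial_deriv i f' x + partial_deriv i g' x"
    by (intro partial_derivI DERIV_add smooth_on_open_DERIV[OF h(2,1) S(3)] smooth_on_open_DERIV[OF h(4,1) S(3)])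
  finally show ?thesis
    using partial_deriv_on_eq[OF S(1,2) h(1) S(3) h(2,3)] partial_deriv_on_eq[OF S(1,2) h(1) S(3) h(4,5)]
    by simp
qed

lemma partial_deriv_on_cmult:
  assumes S: "plot_domain n S" "x \<in> S" "i < n" and f: "smooth_on n S f"
  shows "partial_deriv_on n S i (\<lambda>x. c * f x) x = c * partial_deriv_on n S i f x"
proof -
  obtain U g where g: "x \<in> U" "smooth_on_open n U g" "\<And>y. y \<in> U \<Longrightarrow> y \<in> S \<Longrightarrow> g y = f y"
    using smooth_onE[OF f S(2)] by blast
  have "smooth_on_open n U (\<lambda>x. c * g x)"
    using g(2) by (intro smooth_on_open_mult smooth_on_open_const) (auto simp: smooth_on_open_def)
  from partial_deriv_on_eq[OF S(1,2) g(1) S(3) this, of "\<lambda>x. c * f x"]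
  have "partial_deriv_on n S i (\<lambda>x. c * f x) x = partial_deriv i (\<lambda>x. c * g x) x"
    by (simp add: g)
  also have "\<dots> = c * partial_deriv i g x"
    by (intro partial_derivI DERIV_cmult smooth_on_open_DERIV[OF g(2,1) S(3)])
  finally show ?thesis using partial_deriv_on_eq[OF S(1,2) g(1) S(3) g(2,3)] by simp
qed

lemma partial_deriv_on_sum:
  assumes S: "plot_domain n S" "x \<in> S" "i < n" and "finite F" "\<And>a. a \<in> F \<Longrightarrow> smooth_on n S (f a)"
  shows "partial_deriv_on n S i (\<lambda>x. \<Sum>a\<in>F. f a x) x = (\<Sum>a\<in>F. partial_deriv_on n S i (f a) x)"
  using assms(4,5)
proof (induction F rule: finite_induct)
  case (insert a F)
  have "smooth_on n S (\<lambda>x. \<Sum>a\<in>F. f a x)"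
    using insert plot_domain_subset[OF S(1)] by (intro smooth_on_sum) auto
  with insert S show ?case by (simp add: partial_deriv_on_add)
qed (use partial_deriv_on_const S in simp)

text \<open>At a boundary point only a derivative within the slice of \<open>S\<close> is available,
  possibly one-sided. The fundamental theorem of calculus on a closed interval accepts it in this
  form.\<close>

lemma partial_deriv_on_DERIV:
  assumes S: "plot_domain n S" "x \<in> S" "i < n" and f: "smooth_on n S f"
  shows "((\<lambda>t. f (x(i := t))) has_real_derivative partial_deriv_on n S i f x)
           (at (x i) within {t. x(i := t) \<in> S})"
proof -
  obtain U g where g: "x \<in> U" "smooth_on_open n U g" "\<And>y. y \<in> U \<Longrightarrow> y \<in> S \<Longrightarrow> g y = f y"
    using smooth_onE[OF f S(2)] by blast
  have "eventually (\<lambda>t. x(i := t) \<in> U) (nhds (x i))"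
    using g S by (intro eventually_upd_in_open[where n = n]) (auto simp: smooth_on_open_def)
  then have ev: "eventually (\<lambda>t. t \<in> {t. x(i := t) \<in> S} \<longrightarrow> g (x(i := t)) = f (x(i := t))) (nhds (x i))"
    by (rule eventually_mono) (simp add: g(3))
  have "((\<lambda>t. g (x(i := t))) has_real_derivative partial_deriv_on n S i f x)
           (at (x i) within {t. x(i := t) \<in> S})"
    using has_field_derivative_at_within[OF smooth_on_open_DERIV[OF g(2,1) S(3)]]
      partial_deriv_on_eq[OF S(1,2) g(1) S(3) g(2,3)] by simp
  moreover have "x i \<in> {t. x(i := t) \<in> S}" using S(2) by simp
  ultimately show ?thesis
    using has_field_derivative_cong_ev[OF refl ev refl refl] by blast
qed

section \<open>Differential forms\<close>

lemma plot_altdef: "plot X n S p \<longleftrightarrow>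
    plot_domain n S \<and> p \<in> extensional S \<and> smooth_map (euclidean_dspace n S) X p"
  by (auto simp: plot_def plot_domain_def)

lemma smooth_map_euclidean:
  assumes "S \<subseteq> eucl n"
  shows "smooth_map (euclidean_dspace n S) X p \<longleftrightarrow>
           p \<in> S \<rightarrow> dpoints X \<and> (\<forall>f\<in>dfun X. smooth_on n S (f \<circ> p))"
proof -
  have pts: "dpoints (euclidean_dspace n S) = S"
    using assms by (auto simp: euclidean_dspace_def topspace_Euclidean_space)
  have "smooth_on n S (restrict (f \<circ> p) S) \<longleftrightarrow> smooth_on n S (f \<circ> p)" for f :: "'a \<Rightarrow> real"
    by (rule smooth_on_cong) simp
  then show ?thesis
    unfolding smooth_map_def pts by (simp add: euclidean_dspace_def)
qed

lemma differential_space_topology: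
  assumes "differential_space X"
  shows "dtop X = topology_generated_by {{x \<in> dpoints X. f x \<in> V} | f V. f \<in> dfun X \<and> open V}"
  using assms unfolding differential_space_def by blast

lemma openin_dfun_vimage:
  assumes "differential_space X" "f \<in> dfun X" "open V"
  shows "openin (dtop X) {x \<in> dpoints X. f x \<in> V}"
  by (subst differential_space_topology[OF assms(1)], rule topology_generated_by_Basis)
     (use assms in auto)

text \<open>A differential space carries the initial topology, so preimages of the generating sets
  decide continuity.\<close>

lemma continuous_map_into_differential_space:
  assumes "differential_space X" "\<phi> ` topspace T \<subseteq> dpoints X"
    and "\<And>f V. f \<in> dfun X \<Longrightarrow> open V \<Longrightarrow> openin T {x \<in> topspace T. f (\<phi> x) \<in> V}"
  shows "continuous_map T (dtop X) \<phi>"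
proof -
  let ?B = "{{x \<in> dpoints X. f x \<in> V} | f V. f \<in> dfun X \<and> open V}"
  note top = differential_space_topology[OF assms(1)]
  have "continuous_map T (topology_generated_by ?B) \<phi>"
  proof (rule continuous_on_generated_topo)
    fix U assume "U \<in> ?B"
    then obtain f V where U: "U = {x \<in> dpoints X. f x \<in> V}" "f \<in> dfun X" "open V" by blast
    have "\<phi> -` U \<inter> topspace T = {x \<in> topspace T. f (\<phi> x) \<in> V}" using assms(2) U by auto
    then show "openin T (\<phi> -` U \<inter> topspace T)" using assms(3) U by simp
  next
    have "\<Union>?B = dpoints X" by (metis (no_types, lifting) top topology_generated_by_topspace)
    then show "\<phi> ` topspace T \<subseteq> \<Union>?B" using assms(2) by simp
  qed
  then show ?thesis using top by simp
qed

lemma smooth_map_imp_continuous_map: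
  assumes "differential_space A" "differential_space X" "smooth_map A X \<phi>"
  shows "continuous_map (dtop A) (dtop X) \<phi>"
proof (rule continuous_map_into_differential_space[OF assms(2)])
  show "\<phi> ` dpoints A \<subseteq> dpoints X" using assms(3) by (auto simp: smooth_map_def)
  fix f and V :: "real set" assume "f \<in> dfun X" "open V"
  then have "restrict (f \<circ> \<phi>) (dpoints A) \<in> dfun A" using assms(3) by (auto simp: smooth_map_def)
  from openin_dfun_vimage[OF assms(1) this \<open>open V\<close>]
  show "openin (dtop A) {x \<in> dpoints A. f (\<phi> x) \<in> V}"
    by (rule back_subst[where P = "openin (dtop A)"]) auto
qed

lemma smooth_map_euclidean_continuous:
  assumes X: "differential_space X" and S: "S \<subseteq> eucl n" and p: "smooth_map (euclidean_dspace n S) X p"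
  shows "continuous_map (top_of_set S) (dtop X) p"
proof (rule continuous_map_into_differential_space[OF X])
  show "p ` topspace (top_of_set S) \<subseteq> dpoints X"
    using p by (auto simp: smooth_map_euclidean[OF S])
  fix f and V :: "real set" assume fV: "f \<in> dfun X" "open V"
  have "\<forall>f\<in>dfun X. smooth_on n S (f \<circ> p)"
    using p unfolding smooth_map_euclidean[OF S] by (rule conjunct2)
  then have "smooth_on n S (f \<circ> p)" using fV(1) by (rule bspec)
  then have "continuous_on S (f \<circ> p)" using S by (rule smooth_on_continuous)
  then have "openin (top_of_set S) (S \<inter> (f \<circ> p) -` V)"
    using fV(2) continuous_openin_preimage_gen by blast
  then show "openin (top_of_set S) {x \<in> topspace (top_of_set S). f (p x) \<in> V}"
    by (rule back_subst[where P = "openin (top_of_set S)"]) auto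
qed

lemma plot_openin_vimage:
  assumes "differential_space X" "plot X n S p" "openin (dtop X) U"
  shows "openin (top_of_set S) {x \<in> S. p x \<in> U}"
  using smooth_map_euclidean_continuous[OF assms(1) plot_domain_subset, of n S p] assms(2,3)
    openin_continuous_map_preimage[of "top_of_set S" "dtop X" p U]
  by (simp add: plot_altdef)

lemma plot_in: "plot X n S p \<Longrightarrow> x \<in> S \<Longrightarrow> p x \<in> dpoints X"
  using smooth_map_euclidean[OF plot_domain_subset, of n S X p] by (auto simp: plot_altdef)

lemma plot_smooth: "plot X n S p \<Longrightarrow> f \<in> dfun X \<Longrightarrow> smooth_on n S (f \<circ> p)"
  using smooth_map_euclidean[OF plot_domain_subset, of n S X p] by (auto simp: plot_altdef)

lemma plot_aff:
  assumes "plot X n S q" "plot_domain m T" "aff n m b M ` T \<subseteq> S"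
  shows "plot X m T (restrict (q \<circ> aff n m b M) T)"
proof -
  have "smooth_on m T (f \<circ> restrict (q \<circ> aff n m b M) T)" if "f \<in> dfun X" for f
  proof -
    have "smooth_on m T (\<lambda>x. (f \<circ> q) (aff n m b M x))"
      using smooth_on_aff[OF plot_smooth[OF assms(1) that] plot_domain_subset[OF assms(2)] assms(3)] .
    then show ?thesis by (rule smooth_on_cong[THEN iffD1, rotated]) simp
  qed
  moreover have "restrict (q \<circ> aff n m b M) T \<in> T \<rightarrow> dpoints X"
    using plot_in[OF assms(1)] assms(3) by auto
  ultimately show ?thesis
    using assms(2) by (simp add: plot_altdef smooth_map_euclidean[OF plot_domain_subset])
qed

lemma plot_compose:
  assumes "smooth_map A X \<phi>" "plot A n S p"
  shows "plot X n S (restrict (\<phi> \<circ> p) S)"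
proof -
  note S = plot_domain_subset[of n S]
  have "smooth_on n S (f \<circ> restrict (\<phi> \<circ> p) S)" if "f \<in> dfun X" for f
  proof -
    have "smooth_on n S (restrict (f \<circ> \<phi>) (dpoints A) \<circ> p)"
      using plot_smooth[OF assms(2)] assms(1) that by (auto simp: smooth_map_def)
    then show ?thesis
      by (rule smooth_on_cong[THEN iffD1, rotated]) (use plot_in[OF assms(2)] in simp)
  qed
  moreover have "restrict (\<phi> \<circ> p) S \<in> S \<rightarrow> dpoints X"
    using plot_in[OF assms(2)] assms(1) by (auto simp: smooth_map_def)
  ultimately show ?thesis
    using assms(2) by (simp add: plot_altdef smooth_map_euclidean[OF S])
qed

section \<open>Local expressions and smoothness of coefficients\<close>

lemma finite_indices: "finite (indices k n)"
proof -
  have "indices k n = {I. set I \<subseteq> {..<n} \<and> length I = k}" by (auto simp: indices_def)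
  then show ?thesis using finite_lists_length_eq[of "{..<n}" k] by simp
qed

lemma formsE:
  assumes "\<omega> \<in> forms X k" "a \<in> dpoints X"
  obtains U N f where "openin (dtop X) U" "a \<in> U" "\<And>r j. r < N \<Longrightarrow> j \<le> k \<Longrightarrow> f r j \<in> dfun X"
    "\<And>n S p x I. plot X n S p \<Longrightarrow> x \<in> S \<Longrightarrow> p x \<in> U \<Longrightarrow> I \<in> indices k n \<Longrightarrow>
        \<omega> n S p x I = (\<Sum>r<(N::nat). monomial_form k (f r) n S p x I)"
proof -
  from assms have "\<exists>U N f. openin (dtop X) U \<and> a \<in> U \<and> (\<forall>r<N. \<forall>j\<le>k. f r j \<in> dfun X) \<and>
      (\<forall>n S p. plot X n S p \<longrightarrow> (\<forall>x\<in>S. p x \<in> U \<longrightarrow> (\<forall>I\<in>indices k n.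
         \<omega> n S p x I = (\<Sum>r<(N::nat). monomial_form k (f r) n S p x I))))"
    unfolding forms_def by blast
  then obtain U N f where *: "openin (dtop X) U" "a \<in> U" "\<forall>r<N. \<forall>j\<le>k. f r j \<in> dfun X"
    "\<forall>n S p. plot X n S p \<longrightarrow> (\<forall>x\<in>S. p x \<in> U \<longrightarrow> (\<forall>I\<in>indices k n.
         \<omega> n S p x I = (\<Sum>r<(N::nat). monomial_form k (f r) n S p x I)))"
    by blast
  show thesis by (rule that[of U N f]) (use * in auto)
qed

lemma forms_outside:
  "\<omega> \<in> forms X k \<Longrightarrow> \<not> (plot X n S p \<and> x \<in> S \<and> I \<in> indices k n) \<Longrightarrow> \<omega> n S p x I = 0"
proof -
  assume "\<omega> \<in> forms X k"
  then have "\<forall>n S p x I. \<not> (plot X n S p \<and> x \<in> S \<and> I \<in> indices k n) \<longrightarrow> \<omega> n S p x I = 0"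
    unfolding forms_def mem_Collect_eq by (rule conjunct2)
  then show "\<not> (plot X n S p \<and> x \<in> S \<and> I \<in> indices k n) \<Longrightarrow> \<omega> n S p x I = 0"
    by (elim allE) (rule mp)
qed

lemma indices_nth: "I \<in> indices k n \<Longrightarrow> l < k \<Longrightarrow> I ! l < n"
  by (auto simp: indices_def subset_iff)

lemma permutes_less: "\<pi> permutes {..<k} \<Longrightarrow> l < k \<Longrightarrow> \<pi> l < k"
  using permutes_in_image[of \<pi> "{..<k}" l] by simp

lemma monomial_form_smooth:
  assumes S: "plot X n S q" and f: "\<And>j. j \<le> k \<Longrightarrow> f j \<in> dfun X" and I: "I \<in> indices k n"
  shows "smooth_on n S (\<lambda>x. monomial_form k f n S q x I)"
proof -
  have dom: "plot_domain n S" using S by (simp add: plot_altdef)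
  have f0: "smooth_on n S (\<lambda>x. f 0 (q x))" using plot_smooth[OF S f] by (auto simp: comp_def)
  show ?thesis
    unfolding monomial_form_def
  proof (intro smooth_on_mult f0 smooth_on_sum smooth_on_prod smooth_on_const plot_domain_subset[OF dom])
    fix \<pi> l assume "\<pi> \<in> {\<pi>. \<pi> permutes {..<k}}" "l \<in> {..<k}"
    then have "\<pi> l < k" using permutes_less by auto
    then have "smooth_on n S (f (Suc (\<pi> l)) \<circ> q)" using plot_smooth[OF S f] by simp
    from smooth_on_partial_deriv_on[OF dom this indices_nth[OF I]] \<open>l \<in> {..<k}\<close>
    show "smooth_on n S (\<lambda>x. partial_deriv_on n S (I ! l) (f (Suc (\<pi> l)) \<circ> q) x)" by simp
  qed
qed

lemma form_smooth:
  assumes X: "differential_space X" and \<omega>: "\<omega> \<in> forms X k" and S: "plot X n S q" and I: "I \<in> indices k n"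
  shows "smooth_on n S (\<lambda>x. \<omega> n S q x I)"
proof -
  have dom: "plot_domain n S" using S by (simp add: plot_altdef)
  show ?thesis
  proof (rule smooth_on_local[OF plot_domain_subset[OF dom]])
    fix x assume x: "x \<in> S"
    obtain U N f where U: "openin (dtop X) U" "q x \<in> U" "\<And>r j. r < N \<Longrightarrow> j \<le> k \<Longrightarrow> f r j \<in> dfun X"
      "\<And>n S p x I. plot X n S p \<Longrightarrow> x \<in> S \<Longrightarrow> p x \<in> U \<Longrightarrow> I \<in> indices k n \<Longrightarrow>
        \<omega> n S p x I = (\<Sum>r<(N::nat). monomial_form k (f r) n S p x I)"
      by (rule formsE[OF \<omega> plot_in[OF S x]]) (rule that)
    let ?g = "\<lambda>x. \<Sum>r<N. monomial_form k (f r) n S q x I"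
    have "smooth_on n S ?g"
      by (intro smooth_on_sum plot_domain_subset[OF dom] monomial_form_smooth[OF S _ I] U(3)) auto
    then show "\<exists>W g. openin (top_of_set S) W \<and> x \<in> W \<and> smooth_on n S g \<and> (\<forall>y\<in>W. g y = \<omega> n S q y I)"
      using plot_openin_vimage[OF X S U(1)] U(2) U(4)[OF S _ _ I] x
      by (intro exI[of _ "{x \<in> S. q x \<in> U}"] exI[of _ ?g]) auto
  qed
qed

section \<open>Antisymmetry of forms\<close>

lemma nth_swap_adjacent:
  assumes "l < length (xs @ a # b # zs)"
  shows "(xs @ b # a # zs) ! l = (xs @ a # b # zs) ! (Transposition.transpose (length xs) (Suc (length xs)) l)"
proof -
  consider "l = length xs" | "l = Suc (length xs)" | "l < length xs" | "l > Suc (length xs)" by linarith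
  then show ?thesis
  proof cases
    case 4
    then obtain m where "l = Suc (Suc (length xs + m))" using less_iff_Suc_add by auto
    then show ?thesis by (simp add: nth_append)
  qed (simp_all add: nth_append)
qed

text \<open>As for determinants: composing the summation variable with the adjacent transposition
  \<open>\<tau>\<close> restores the old product and reverses the sign.\<close>

lemma monomial_form_alternating:
  assumes "length (xs @ a # b # zs) = k"
  shows "monomial_form k f n S q x (xs @ b # a # zs) = - monomial_form k f n S q x (xs @ a # b # zs)"
proof -
  define \<tau> where "\<tau> = Transposition.transpose (length xs) (Suc (length xs))"
  define G where "G i j = partial_deriv_on n S i (f (Suc j) \<circ> q) x" for i j
  let ?I = "xs @ a # b # zs" and ?P = "{\<pi>. \<pi> permutes {..<k}}"
  have \<tau>: "\<tau> permutes {..<k}" unfolding \<tau>_def using assms by (intro permutes_swap_id) auto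
  have \<tau>\<tau>: "\<tau> (\<tau> l) = l" for l by (simp add: \<tau>_def)
  have "(\<Sum>\<pi>\<in>?P. of_int (sign \<pi>) * (\<Prod>l<k. G ((xs @ b # a # zs) ! l) (\<pi> l)))
      = (\<Sum>\<pi>\<in>?P. of_int (sign \<pi>) * (\<Prod>l<k. G (?I ! \<tau> l) (\<pi> l)))"
    using nth_swap_adjacent[of _ xs a b zs] assms by (auto simp: \<tau>_def intro!: sum.cong prod.cong)
  also have "\<dots> = (\<Sum>\<pi>\<in>?P. of_int (sign (\<pi> \<circ> \<tau>)) * (\<Prod>l<k. G (?I ! \<tau> l) ((\<pi> \<circ> \<tau>) l)))"
    by (rule sum_permutations_compose_right[OF \<tau>])
  also have "\<dots> = (\<Sum>\<pi>\<in>?P. - (of_int (sign \<pi>) * (\<Prod>l<k. G (?I ! l) (\<pi> l))))"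
  proof (rule sum.cong[OF refl])
    fix \<pi> assume "\<pi> \<in> ?P"
    then have perm: "permutation \<pi>" "permutation \<tau>"
      using \<tau> permutation_permutes by (metis finite_lessThan mem_Collect_eq)+
    have "(\<Prod>l<k. G (?I ! \<tau> l) ((\<pi> \<circ> \<tau>) l)) = (\<Prod>l<k. G (?I ! l) (\<pi> l))"
      using prod.reindex_bij_betw[OF permutes_imp_bij[OF \<tau>], of "\<lambda>l. G (?I ! l) (\<pi> l)"] by simp
    moreover have "sign (\<pi> \<circ> \<tau>) = - sign \<pi>"
      using sign_compose[OF perm] by (simp add: \<tau>_def sign_swap_id)
    ultimately show "of_int (sign (\<pi> \<circ> \<tau>)) * (\<Prod>l<k. G (?I ! \<tau> l) ((\<pi> \<circ> \<tau>) l))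
        = - (of_int (sign \<pi>) * (\<Prod>l<k. G (?I ! l) (\<pi> l)))"
      by simp
  qed
  finally show ?thesis
    unfolding monomial_form_def G_def by (simp add: sum_negf)
qed

lemma form_alternating:
  assumes \<omega>: "\<omega> \<in> forms X k"
  shows "\<omega> n S q x (xs @ b # a # zs) = - \<omega> n S q x (xs @ a # b # zs)"
proof (cases "plot X n S q \<and> x \<in> S \<and> xs @ a # b # zs \<in> indices k n")
  case True
  then have I: "xs @ b # a # zs \<in> indices k n" "length (xs @ a # b # zs) = k"
    by (auto simp: indices_def)
  obtain U N f where U: "openin (dtop X) U" "q x \<in> U" "\<And>r j. r < N \<Longrightarrow> j \<le> k \<Longrightarrow> f r j \<in> dfun X"
      "\<And>n S p x I. plot X n S p \<Longrightarrow> x \<in> S \<Longrightarrow> p x \<in> U \<Longrightarrow> I \<in> indices k n \<Longrightarrow>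
        \<omega> n S p x I = (\<Sum>r<(N::nat). monomial_form k (f r) n S p x I)"
    by (rule formsE[OF \<omega> plot_in[of X n S q x]]) (use True in blast, use True in blast, rule that)
  show ?thesis
    using True I U(2) by (simp add: U(4) monomial_form_alternating[OF I(2)] sum_negf)
next
  case False
  then have "\<not> (plot X n S q \<and> x \<in> S \<and> xs @ b # a # zs \<in> indices k n)" by (auto simp: indices_def)
  then show ?thesis using False forms_outside[OF \<omega>] by simp
qed

text \<open>The left copy of \<open>a\<close> moves to the right by adjacent swaps until it meets
  the other copy; there the value equals its own negative.\<close>

lemma form_repeated:
  assumes "\<omega> \<in> forms X k"
  shows "\<omega> n S q x (xs @ a # ys @ a # zs) = 0"
proof (induction ys arbitrary: xs)
  case Nil
  show ?case using form_alternating[OF assms, of n S q x xs a a zs] by simp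
next
  case (Cons b ys)
  show ?case
    using form_alternating[OF assms, of n S q x xs b a "ys @ a # zs"] Cons[of "xs @ [b]"] by simp
qed

lemma form_move_front:
  assumes "\<omega> \<in> forms X k"
  shows "\<omega> n S q x (xs @ a # zs) = (-1) ^ length xs * \<omega> n S q x (a # xs @ zs)"
proof (induction xs arbitrary: zs rule: rev_induct)
  case (snoc b xs)
  show ?case
    using form_alternating[OF assms, of n S q x xs b a zs] snoc[of "b # zs"] by simp
qed simp

section \<open>Multi-indices and naturality under affine substitutions\<close>

definition list_del :: "nat \<Rightarrow> 'a list \<Rightarrow> 'a list" where
  "list_del i xs = take i xs @ drop (Suc i) xs"

definition list_ins :: "nat \<Rightarrow> 'a \<Rightarrow> 'a list \<Rightarrow> 'a list" where
  "list_ins i a xs = take i xs @ a # drop i xs"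

lemma list_del_indices: "I \<in> indices (Suc k) n \<Longrightarrow> i \<le> k \<Longrightarrow> list_del i I \<in> indices k n"
  by (auto simp: indices_def list_del_def dest: in_set_takeD in_set_dropD)

lemma list_ins_simps:
  assumes "length xs = k" "i \<le> k"
  shows "list_ins i a xs ! i = a" "list_del i (list_ins i a xs) = xs" "length (list_ins i a xs) = Suc k"
  using assms by (auto simp: list_ins_def list_del_def nth_append)

text \<open>Splits a multi-index into its entry at position \<open>i\<close> and the rest. In the
  exterior derivative the sum over the direction of differentiation and the sum over the remaining
  indices thereby merge into one sum over multi-indices.\<close>

lemma bij_betw_list_ins:
  assumes "i \<le> k"
  shows "bij_betw (\<lambda>(a, J). list_ins i a J) ({..<n} \<times> indices k n) (indices (Suc k) n)"
proof (rule bij_betw_byWitness[where f' = "\<lambda>J. (J ! i, list_del i J)"])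
  show "\<forall>z\<in>{..<n} \<times> indices k n. (\<lambda>J. (J ! i, list_del i J)) ((\<lambda>(a, J). list_ins i a J) z) = z"
    using assms by (auto simp: indices_def list_ins_simps)
  show "\<forall>J\<in>indices (Suc k) n. (\<lambda>(a, J). list_ins i a J) (J ! i, list_del i J) = J"
    using assms by (auto simp: indices_def list_ins_def list_del_def min_def Cons_nth_drop_Suc)
  show "(\<lambda>(a, J). list_ins i a J) ` ({..<n} \<times> indices k n) \<subseteq> indices (Suc k) n"
    using assms by (auto simp: indices_def list_ins_simps)
      (auto simp: list_ins_def dest: in_set_takeD in_set_dropD)
  show "(\<lambda>J. (J ! i, list_del i J)) ` indices (Suc k) n \<subseteq> {..<n} \<times> indices k n"
    using list_del_indices[OF _ assms] indices_nth[of _ "Suc k" n i] assms by auto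
qed

lemma prod_list_ins:
  fixes M :: "'a \<Rightarrow> 'b \<Rightarrow> 'c :: comm_monoid_mult"
  assumes J: "length J = k" and I: "length I = Suc k" and i: "i \<le> k"
  shows "(\<Prod>l<Suc k. M (list_ins i a J ! l) (I ! l)) = M a (I ! i) * (\<Prod>l<k. M (J ! l) (list_del i I ! l))"
proof -
  have conv: "(\<Prod>l<m. M (xs ! l) (ys ! l)) = prod_list (map2 M xs ys)"
    if "length xs = m" "length ys = m" for m xs ys
    using that by (simp add: prod.list_conv_set_nth atLeast0LessThan)
  obtain A c B where A: "I = A @ c # B" "length A = i"
    using id_take_nth_drop[of i I] I i by (metis length_take less_Suc_eq_le min.absorb2 less_imp_le)
  obtain A' B' where A': "J = A' @ B'" "length A' = i"
    using J i by (metis append_take_drop_id length_take min.absorb2)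
  have "map2 M (list_ins i a J) I = map2 M A' A @ M a (I ! i) # map2 M B' B"
    "map2 M J (list_del i I) = map2 M A' A @ map2 M B' B"
    using A A' by (simp_all add: list_ins_def list_del_def nth_append)
  moreover have "length (list_del i I) = k" using I i by (simp add: list_del_def)
  ultimately show ?thesis
    using I J list_ins_simps(3)[OF J i, of a] by (simp add: conv mult_ac del: prod.lessThan_Suc)
qed

lemma prod_sum_indices:
  fixes a :: "nat \<Rightarrow> nat \<Rightarrow> 'a :: comm_semiring_1"
  shows "(\<Prod>l<k. \<Sum>j<n. a l j) = (\<Sum>J\<in>indices k n. \<Prod>l<k. a l (J ! l))"
proof (induction k)
  case 0
  have "indices 0 n = {[]}" by (auto simp: indices_def)
  then show ?case by simp
next
  case (Suc k)
  have "(\<Prod>l<Suc k. \<Sum>j<n. a l j) = (\<Sum>j<n. \<Sum>J\<in>indices k n. a k j * (\<Prod>l<k. a l (J ! l)))"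
    by (simp add: Suc sum_product mult.commute)
  also have "\<dots> = (\<Sum>(j, J)\<in>{..<n} \<times> indices k n. a k j * (\<Prod>l<k. a l (J ! l)))"
    by (simp add: sum.cartesian_product)
  also have "\<dots> = (\<Sum>z\<in>{..<n} \<times> indices k n. \<Prod>l<Suc k. a l ((\<lambda>(j, J). list_ins k j J) z ! l))"
  proof (rule sum.cong[OF refl], clarify)
    fix j J assume "J \<in> indices k n"
    then have len: "length J = k" by (simp add: indices_def)
    have "(\<Prod>l<k. a l (list_ins k j J ! l)) = (\<Prod>l<k. a l (J ! l))"
      using len by (intro prod.cong) (auto simp: list_ins_def nth_append)
    then show "a k j * (\<Prod>l<k. a l (J ! l)) = (\<Prod>l<Suc k. a l (list_ins k j J ! l))"
      using len by (simp add: list_ins_simps mult.commute)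
  qed
  also have "\<dots> = (\<Sum>J\<in>indices (Suc k) n. \<Prod>l<Suc k. a l (J ! l))"
    by (rule sum.reindex_bij_betw[OF bij_betw_list_ins]) simp
  finally show ?case .
qed

text \<open>What forms and exterior derivatives of forms have in common, so that both can be integrated
  over affine simplices in a plot.\<close>

definition natural_form :: "'a dspace \<Rightarrow> nat \<Rightarrow> 'a form \<Rightarrow> bool" where
  "natural_form X k \<omega> \<longleftrightarrow>
     (\<forall>n S q. plot X n S q \<longrightarrow>
        (\<forall>I\<in>indices k n. continuous_on S (\<lambda>x. \<omega> n S q x I)) \<and>
        (\<forall>m T b M. plot_domain m T \<longrightarrow> aff n m b M ` T \<subseteq> S \<longrightarrow>
           (\<forall>x\<in>T. \<forall>I\<in>indices k m. \<omega> m T (restrict (q \<circ> aff n m b M) T) x I =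
              (\<Sum>J\<in>indices k n. (\<Prod>l<k. M (J ! l) (I ! l)) * \<omega> n S q (aff n m b M x) J))))"

lemma natural_form_continuous:
  "natural_form X k \<omega> \<Longrightarrow> plot X n S q \<Longrightarrow> I \<in> indices k n \<Longrightarrow> continuous_on S (\<lambda>x. \<omega> n S q x I)"
  unfolding natural_form_def by blast

lemma natural_form_aff:
  "natural_form X k \<omega> \<Longrightarrow> plot X n S q \<Longrightarrow> plot_domain m T \<Longrightarrow> aff n m b M ` T \<subseteq> S \<Longrightarrow> x \<in> T \<Longrightarrow>
   I \<in> indices k m \<Longrightarrow>
   \<omega> m T (restrict (q \<circ> aff n m b M) T) x I =
     (\<Sum>J\<in>indices k n. (\<Prod>l<k. M (J ! l) (I ! l)) * \<omega> n S q (aff n m b M x) J)"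
  unfolding natural_form_def by blast

text \<open>The chain rule turns each factor into a sum over directions; the product of these sums
  is expanded over multi-indices, and the matrix entries factor out since they do not depend on the
  permutation.\<close>

lemma monomial_form_aff:
  assumes q: "plot X n S q" and T: "plot_domain m T" and TS: "aff n m b M ` T \<subseteq> S"
    and x: "x \<in> T" and I: "I \<in> indices k m" and f: "\<And>j. j \<le> k \<Longrightarrow> f j \<in> dfun X"
  shows "monomial_form k f m T (restrict (q \<circ> aff n m b M) T) x I =
     (\<Sum>J\<in>indices k n. (\<Prod>l<k. M (J ! l) (I ! l)) * monomial_form k f n S q (aff n m b M x) J)"
proof -
  let ?\<alpha> = "aff n m b M" let ?q = "restrict (q \<circ> ?\<alpha>) T"
  let ?P = "{\<pi>. \<pi> permutes {..<k}}"
  have S: "plot_domain n S" using q by (simp add: plot_altdef)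
  define G where "G j r = partial_deriv_on n S j (f (Suc r) \<circ> q) (?\<alpha> x)" for j r
  have chain: "partial_deriv_on m T i (f (Suc r) \<circ> ?q) x = (\<Sum>j<n. M j i * G j r)"
    if "i < m" "r < k" for i r
  proof -
    have "partial_deriv_on m T i (f (Suc r) \<circ> ?q) x = partial_deriv_on m T i (\<lambda>y. (f (Suc r) \<circ> q) (?\<alpha> y)) x"
      by (rule partial_deriv_on_cong) simp
    also have "\<dots> = (\<Sum>j<n. M j i * G j r)"
      unfolding G_def using that f by (intro partial_deriv_on_aff[OF S T plot_smooth[OF q] TS x]) auto
    finally show ?thesis .
  qed
  have "monomial_form k f m T ?q x I
      = f 0 (q (?\<alpha> x)) * (\<Sum>\<pi>\<in>?P. of_int (sign \<pi>) * (\<Prod>l<k. \<Sum>j<n. M j (I ! l) * G j (\<pi> l)))"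
    unfolding monomial_form_def using x chain[OF indices_nth[OF I] permutes_less]
    by (auto intro!: sum.cong prod.cong)
  also have "\<dots> = f 0 (q (?\<alpha> x)) * (\<Sum>\<pi>\<in>?P. of_int (sign \<pi>) *
      (\<Sum>J\<in>indices k n. (\<Prod>l<k. M (J ! l) (I ! l)) * (\<Prod>l<k. G (J ! l) (\<pi> l))))"
    by (simp add: prod_sum_indices prod.distrib)
  also have "\<dots> = (\<Sum>\<pi>\<in>?P. \<Sum>J\<in>indices k n. (\<Prod>l<k. M (J ! l) (I ! l)) *
      (f 0 (q (?\<alpha> x)) * (of_int (sign \<pi>) * (\<Prod>l<k. G (J ! l) (\<pi> l)))))"
    by (simp add: sum_distrib_left mult_ac)
  also have "\<dots> = (\<Sum>J\<in>indices k n. \<Sum>\<pi>\<in>?P. (\<Prod>l<k. M (J ! l) (I ! l)) *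
      (f 0 (q (?\<alpha> x)) * (of_int (sign \<pi>) * (\<Prod>l<k. G (J ! l) (\<pi> l)))))"
    by (rule sum.swap)
  also have "\<dots> = (\<Sum>J\<in>indices k n. (\<Prod>l<k. M (J ! l) (I ! l)) * monomial_form k f n S q (?\<alpha> x) J)"
    unfolding monomial_form_def G_def by (simp only: sum_distrib_left)
  finally show ?thesis .
qed

lemma natural_form_form:
  assumes X: "differential_space X" and \<omega>: "\<omega> \<in> forms X k"
  shows "natural_form X k \<omega>"
  unfolding natural_form_def
proof (intro allI impI conjI ballI)
  fix n S and q :: "(nat \<Rightarrow> real) \<Rightarrow> 'a" assume q: "plot X n S q"
  then have S: "plot_domain n S" by (simp add: plot_altdef)
  show "continuous_on S (\<lambda>x. \<omega> n S q x I)" if "I \<in> indices k n" for I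
    using form_smooth[OF X \<omega> q that] plot_domain_subset[OF S] by (rule smooth_on_continuous)
  fix m T b M x I
  assume T: "plot_domain m T" and TS: "aff n m b M ` T \<subseteq> S" and x: "x \<in> T" and I: "I \<in> indices k m"
  let ?\<alpha> = "aff n m b M"
  have \<alpha>x: "?\<alpha> x \<in> S" using x TS by blast
  obtain U N f where U: "openin (dtop X) U" "q (?\<alpha> x) \<in> U" "\<And>r j. r < N \<Longrightarrow> j \<le> k \<Longrightarrow> f r j \<in> dfun X"
      "\<And>n S p x I. plot X n S p \<Longrightarrow> x \<in> S \<Longrightarrow> p x \<in> U \<Longrightarrow> I \<in> indices k n \<Longrightarrow>
        \<omega> n S p x I = (\<Sum>r<(N::nat). monomial_form k (f r) n S p x I)"
    by (rule formsE[OF \<omega> plot_in[OF q \<alpha>x]]) (rule that)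
  have "\<omega> m T (restrict (q \<circ> ?\<alpha>) T) x I = (\<Sum>r<N. monomial_form k (f r) m T (restrict (q \<circ> ?\<alpha>) T) x I)"
    using U(2) x by (intro U(4)[OF plot_aff[OF q T TS] x _ I]) simp
  also have "\<dots> = (\<Sum>r<N. \<Sum>J\<in>indices k n. (\<Prod>l<k. M (J ! l) (I ! l)) * monomial_form k (f r) n S q (?\<alpha> x) J)"
    using U(3) by (intro sum.cong refl monomial_form_aff[OF q T TS x I]) auto
  also have "\<dots> = (\<Sum>J\<in>indices k n. (\<Prod>l<k. M (J ! l) (I ! l)) * (\<Sum>r<N. monomial_form k (f r) n S q (?\<alpha> x) J))"
    by (subst sum.swap) (simp add: sum_distrib_left)
  also have "\<dots> = (\<Sum>J\<in>indices k n. (\<Prod>l<k. M (J ! l) (I ! l)) * \<omega> n S q (?\<alpha> x) J)"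
    using U(4)[OF q \<alpha>x U(2)] by (intro sum.cong) auto
  finally show "\<omega> m T (restrict (q \<circ> ?\<alpha>) T) x I
      = (\<Sum>J\<in>indices k n. (\<Prod>l<k. M (J ! l) (I ! l)) * \<omega> n S q (?\<alpha> x) J)" .
qed

text \<open>For a general substitution the terms of the exterior derivative would produce second
  derivatives that cancel only in the alternating sum. An affine substitution has a constant matrix,
  so already each single term transforms correctly; this is \<open>termwise\<close>.\<close>

lemma natural_form_ext_deriv:
  assumes X: "differential_space X" and \<omega>: "\<omega> \<in> forms X k"
  shows "natural_form X (Suc k) (ext_deriv X k \<omega>)"
  unfolding natural_form_def
proof (intro allI impI conjI ballI)
  note nat = natural_form_form[OF X \<omega>]
  fix n S and q :: "(nat \<Rightarrow> real) \<Rightarrow> 'a" assume q: "plot X n S q"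
  then have S: "plot_domain n S" by (simp add: plot_altdef)
  have ext: "ext_deriv X k \<omega> n S q x I = (\<Sum>i\<le>k. (-1) ^ i * partial_deriv_on n S (I ! i) (\<lambda>y. \<omega> n S q y (list_del i I)) x)"
    if "plot X n S q" "x \<in> S" "I \<in> indices (Suc k) n" for n S and q :: "(nat \<Rightarrow> real) \<Rightarrow> 'a" and x I
    using that by (simp add: ext_deriv_def list_del_def)
  show "continuous_on S (\<lambda>x. ext_deriv X k \<omega> n S q x I)" if I: "I \<in> indices (Suc k) n" for I
  proof -
    have "smooth_on n S (partial_deriv_on n S (I ! i) (\<lambda>y. \<omega> n S q y (list_del i I)))" if "i \<le> k" for i
      using indices_nth[OF I] list_del_indices[OF I] that
      by (intro smooth_on_partial_deriv_on[OF S] form_smooth[OF X \<omega> q]) auto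
    then have "continuous_on S (\<lambda>x. \<Sum>i\<le>k. (-1) ^ i * partial_deriv_on n S (I ! i) (\<lambda>y. \<omega> n S q y (list_del i I)) x)"
      using plot_domain_subset[OF S] by (intro continuous_intros smooth_on_continuous[of n]) auto
    then show ?thesis by (rule continuous_on_eq) (simp add: ext[OF q _ I])
  qed
  fix m T b M x I
  assume T: "plot_domain m T" and TS: "aff n m b M ` T \<subseteq> S" and x: "x \<in> T" and I: "I \<in> indices (Suc k) m"
  let ?\<alpha> = "aff n m b M" let ?q = "restrict (q \<circ> ?\<alpha>) T"
  have \<alpha>x: "?\<alpha> x \<in> S" using x TS by blast
  have len: "length I = Suc k" using I by (simp add: indices_def)
  have termwise: "partial_deriv_on m T (I ! i) (\<lambda>y. \<omega> m T ?q y (list_del i I)) x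
      = (\<Sum>J\<in>indices (Suc k) n. (\<Prod>l<Suc k. M (J ! l) (I ! l)) *
           partial_deriv_on n S (J ! i) (\<lambda>y. \<omega> n S q y (list_del i J)) (?\<alpha> x))" if i: "i \<le> k" for i
  proof -
    define P where "P J = (\<Prod>l<k. M (J ! l) (list_del i I ! l))" for J
    have Ii: "I ! i < m" using indices_nth[OF I] i by simp
    have sm: "smooth_on m T (\<lambda>y. \<omega> n S q (?\<alpha> y) J)" if "J \<in> indices k n" for J
      using smooth_on_aff[OF form_smooth[OF X \<omega> q that] plot_domain_subset[OF T] TS] .
    have "partial_deriv_on m T (I ! i) (\<lambda>y. \<omega> m T ?q y (list_del i I)) x
        = partial_deriv_on m T (I ! i) (\<lambda>y. \<Sum>J\<in>indices k n. P J * \<omega> n S q (?\<alpha> y) J) x"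
      unfolding P_def
      by (rule partial_deriv_on_cong) (rule natural_form_aff[OF nat q T TS _ list_del_indices[OF I i]])
    also have "\<dots> = (\<Sum>J\<in>indices k n. partial_deriv_on m T (I ! i) (\<lambda>y. P J * \<omega> n S q (?\<alpha> y) J) x)"
      by (rule partial_deriv_on_sum[OF T x Ii finite_indices])
         (intro smooth_on_mult smooth_on_const plot_domain_subset[OF T] sm)
    also have "\<dots> = (\<Sum>J\<in>indices k n. P J * (\<Sum>j<n. M j (I ! i) * partial_deriv_on n S j (\<lambda>y. \<omega> n S q y J) (?\<alpha> x)))"
      using partial_deriv_on_aff[OF S T form_smooth[OF X \<omega> q] TS x Ii]
      by (intro sum.cong refl) (simp add: partial_deriv_on_cmult[OF T x Ii sm])
    also have "\<dots> = (\<Sum>J\<in>indices k n. \<Sum>j<n. M j (I ! i) * P J * partial_deriv_on n S j (\<lambda>y. \<omega> n S q y J) (?\<alpha> x))"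
      by (simp add: sum_distrib_left mult_ac)
    also have "\<dots> = (\<Sum>(j, J)\<in>{..<n} \<times> indices k n. M j (I ! i) * P J * partial_deriv_on n S j (\<lambda>y. \<omega> n S q y J) (?\<alpha> x))"
      by (subst sum.swap) (simp add: sum.cartesian_product)
    also have "\<dots> = (\<Sum>z\<in>{..<n} \<times> indices k n. (\<lambda>J. (\<Prod>l<Suc k. M (J ! l) (I ! l)) *
           partial_deriv_on n S (J ! i) (\<lambda>y. \<omega> n S q y (list_del i J)) (?\<alpha> x)) ((\<lambda>(j, J). list_ins i j J) z))"
    proof (rule sum.cong[OF refl], clarify)
      fix j J assume "J \<in> indices k n"
      then have J: "length J = k" by (simp add: indices_def)
      show "M j (I ! i) * P J * partial_deriv_on n S j (\<lambda>y. \<omega> n S q y J) (?\<alpha> x)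
         = (\<Prod>l<Suc k. M (list_ins i j J ! l) (I ! l)) *
           partial_deriv_on n S (list_ins i j J ! i) (\<lambda>y. \<omega> n S q y (list_del i (list_ins i j J))) (?\<alpha> x)"
        by (simp only: prod_list_ins[OF J len i] list_ins_simps[OF J i] P_def)
    qed
    also have "\<dots> = (\<Sum>J\<in>indices (Suc k) n. (\<Prod>l<Suc k. M (J ! l) (I ! l)) *
           partial_deriv_on n S (J ! i) (\<lambda>y. \<omega> n S q y (list_del i J)) (?\<alpha> x))"
      by (rule sum.reindex_bij_betw[OF bij_betw_list_ins[OF i]])
    finally show ?thesis .
  qed
  have "ext_deriv X k \<omega> m T ?q x I = (\<Sum>i\<le>k. (-1) ^ i * (\<Sum>J\<in>indices (Suc k) n. (\<Prod>l<Suc k. M (J ! l) (I ! l)) *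
           partial_deriv_on n S (J ! i) (\<lambda>y. \<omega> n S q y (list_del i J)) (?\<alpha> x)))"
    by (simp add: ext[OF plot_aff[OF q T TS] x I] termwise del: prod.lessThan_Suc)
  also have "\<dots> = (\<Sum>J\<in>indices (Suc k) n. (\<Prod>l<Suc k. M (J ! l) (I ! l)) *
           (\<Sum>i\<le>k. (-1) ^ i * partial_deriv_on n S (J ! i) (\<lambda>y. \<omega> n S q y (list_del i J)) (?\<alpha> x)))"
    unfolding sum_distrib_left by (subst sum.swap) (simp only: mult_ac)
  also have "\<dots> = (\<Sum>J\<in>indices (Suc k) n. (\<Prod>l<Suc k. M (J ! l) (I ! l)) * ext_deriv X k \<omega> n S q (?\<alpha> x) J)"
    by (intro sum.cong refl) (simp only: ext[OF q \<alpha>x])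
  finally show "ext_deriv X k \<omega> m T ?q x I
      = (\<Sum>J\<in>indices (Suc k) n. (\<Prod>l<Suc k. M (J ! l) (I ! l)) * ext_deriv X k \<omega> n S q (?\<alpha> x) J)" .
qed

lemma natural_form_diff:
  assumes "natural_form X k \<omega>" "natural_form X k \<eta>"
  shows "natural_form X k (\<lambda>n S p x I. \<omega> n S p x I - \<eta> n S p x I)"
  unfolding natural_form_def
proof (intro allI impI conjI ballI)
  fix n S and q :: "(nat \<Rightarrow> real) \<Rightarrow> 'a" assume q: "plot X n S q"
  show "continuous_on S (\<lambda>x. \<omega> n S q x I - \<eta> n S q x I)" if "I \<in> indices k n" for I
    using natural_form_continuous[OF assms(1) q that] natural_form_continuous[OF assms(2) q that]
    by (rule continuous_on_diff)
  fix m T b M x I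
  assume *: "plot_domain m T" "aff n m b M ` T \<subseteq> S" "x \<in> T" "I \<in> indices k m"
  show "\<omega> m T (restrict (q \<circ> aff n m b M) T) x I - \<eta> m T (restrict (q \<circ> aff n m b M) T) x I =
      (\<Sum>J\<in>indices k n. (\<Prod>l<k. M (J ! l) (I ! l)) * (\<omega> n S q (aff n m b M x) J - \<eta> n S q (aff n m b M x) J))"
    unfolding natural_form_aff[OF assms(1) q *] natural_form_aff[OF assms(2) q *]
    by (simp add: sum_subtractf right_diff_distrib)
qed

section \<open>Sums, multiples and pullbacks of forms\<close>

definition form_add :: "'a form \<Rightarrow> 'a form \<Rightarrow> 'a form" where
  "form_add \<omega> \<eta> = (\<lambda>n S p x I. \<omega> n S p x I + \<eta> n S p x I)"

definition form_cmult :: "real \<Rightarrow> 'a form \<Rightarrow> 'a form" where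
  "form_cmult c \<omega> = (\<lambda>n S p x I. c * \<omega> n S p x I)"

definition form_pullback :: "'a dspace \<Rightarrow> ('a \<Rightarrow> 'b) \<Rightarrow> nat \<Rightarrow> 'b form \<Rightarrow> 'a form" where
  "form_pullback A \<phi> k \<omega> = (\<lambda>n S p x I.
     if plot A n S p \<and> x \<in> S \<and> I \<in> indices k n then \<omega> n S (restrict (\<phi> \<circ> p) S) x I else 0)"

lemma formsI:
  assumes "\<And>a. a \<in> dpoints X \<Longrightarrow> \<exists>U N f. openin (dtop X) U \<and> a \<in> U \<and> (\<forall>r<N. \<forall>j\<le>k. f r j \<in> dfun X) \<and>
      (\<forall>n S p. plot X n S p \<longrightarrow> (\<forall>x\<in>S. p x \<in> U \<longrightarrow> (\<forall>I\<in>indices k n.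
         \<omega> n S p x I = (\<Sum>r<(N::nat). monomial_form k (f r) n S p x I))))"
    and "\<And>n S p x I. \<not> (plot X n S p \<and> x \<in> S \<and> I \<in> indices k n) \<Longrightarrow> \<omega> n S p x I = 0"
  shows "\<omega> \<in> forms X k"
  unfolding forms_def using assms by blast

lemma form_add_forms:
  assumes "\<omega> \<in> forms X k" "\<eta> \<in> forms X k"
  shows "form_add \<omega> \<eta> \<in> forms X k"
proof (rule formsI)
  fix a assume a: "a \<in> dpoints X"
  obtain U N f where U: "openin (dtop X) U" "a \<in> U" "\<And>r j. r < N \<Longrightarrow> j \<le> k \<Longrightarrow> f r j \<in> dfun X"
      "\<And>n S p x I. plot X n S p \<Longrightarrow> x \<in> S \<Longrightarrow> p x \<in> U \<Longrightarrow> I \<in> indices k n \<Longrightarrow>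
        \<omega> n S p x I = (\<Sum>r<(N::nat). monomial_form k (f r) n S p x I)"
    by (rule formsE[OF assms(1) a]) (rule that)
  obtain U' N' f' where U': "openin (dtop X) U'" "a \<in> U'" "\<And>r j. r < N' \<Longrightarrow> j \<le> k \<Longrightarrow> f' r j \<in> dfun X"
      "\<And>n S p x I. plot X n S p \<Longrightarrow> x \<in> S \<Longrightarrow> p x \<in> U' \<Longrightarrow> I \<in> indices k n \<Longrightarrow>
        \<eta> n S p x I = (\<Sum>r<(N'::nat). monomial_form k (f' r) n S p x I)"
    by (rule formsE[OF assms(2) a]) (rule that)
  define g where "g r = (if r < N then f r else f' (r - N))" for r
  have sum_g: "(\<Sum>r<N + N'. h (g r)) = (\<Sum>r<N. h (f r)) + (\<Sum>r<N'. h (f' r))" for h :: "_ \<Rightarrow> real"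
  proof -
    have "(\<Sum>r<N + N'. h (g r)) = (\<Sum>r<N. h (g r)) + (\<Sum>r<N'. h (g (r + N)))"
      by (induction N') (simp_all add: add_ac)
    then show ?thesis by (simp add: g_def)
  qed
  show "\<exists>U N f. openin (dtop X) U \<and> a \<in> U \<and> (\<forall>r<N. \<forall>j\<le>k. f r j \<in> dfun X) \<and>
      (\<forall>n S p. plot X n S p \<longrightarrow> (\<forall>x\<in>S. p x \<in> U \<longrightarrow> (\<forall>I\<in>indices k n.
         form_add \<omega> \<eta> n S p x I = (\<Sum>r<(N::nat). monomial_form k (f r) n S p x I))))"
  proof (intro exI conjI allI impI ballI)
    show "openin (dtop X) (U \<inter> U')" "a \<in> U \<inter> U'" using U U' by auto
    show "g r j \<in> dfun X" if "r < N + N'" "j \<le> k" for r j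
      using that U(3) U'(3) by (auto simp: g_def)
    fix n S x I and p :: "(nat \<Rightarrow> real) \<Rightarrow> 'a"
    assume "plot X n S p" "x \<in> S" "p x \<in> U \<inter> U'" "I \<in> indices k n"
    then show "form_add \<omega> \<eta> n S p x I = (\<Sum>r<N + N'. monomial_form k (g r) n S p x I)"
      using sum_g[of "\<lambda>f. monomial_form k f n S p x I"] by (simp add: form_add_def U(4) U'(4))
  qed
qed (use forms_outside[OF assms(1)] forms_outside[OF assms(2)] in \<open>simp add: form_add_def\<close>)

text \<open>Scaling as a smooth function of one variable: closure of a differential space under
  composition then yields real multiples of its functions.\<close>

lemma smooth_on_open_coordinate:
  assumes "openin (Euclidean_space n) U"
  shows "smooth_on_open n U (\<lambda>x. c * x j)"
proof -
  have D: "((\<lambda>t. c * (x(i := t)) j) has_real_derivative (if i = j then c else 0)) (at (x i))"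
    for i and x :: "nat \<Rightarrow> real"
    by (cases "i = j") (auto intro!: derivative_eq_intros)
  have "partial_deriv i (\<lambda>x. c * x j) = (\<lambda>_. if i = j then c else 0)" for i
    by (rule ext) (rule partial_derivI[OF D])
  moreover have "partial_diff i (\<lambda>x. c * x j) x" for i x
    by (rule partial_diffI[where f = "\<lambda>x. c * x j", OF D])
  moreover have "continuous_on U (\<lambda>x. c * x j)"
    by (intro continuous_intros continuous_on_subset[OF continuous_on_product_coordinates]) auto
  ultimately have "Ck_open N n U (\<lambda>x. c * x j)" for N
    by (cases N) (simp_all add: Ck_open_const)
  then show ?thesis using assms by (simp add: smooth_on_open_iff)
qed

lemma differential_space_compose:
  assumes "differential_space X" "smooth_on_open n (topspace (Euclidean_space n)) F" "\<forall>i<n. fs i \<in> dfun X"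
  shows "restrict (\<lambda>x. F (\<lambda>i. if i < n then fs i x else 0)) (dpoints X) \<in> dfun X"
proof -
  have "\<forall>n F fs. smooth_on_open n (topspace (Euclidean_space n)) F \<and> (\<forall>i<n. fs i \<in> dfun X) \<longrightarrow>
      restrict (\<lambda>x. F (\<lambda>i. if i < n then fs i x else 0)) (dpoints X) \<in> dfun X"
    using assms(1) unfolding differential_space_def by (elim conjE)
  from this[rule_format, OF conjI, OF assms(2,3)] show ?thesis .
qed

lemma dfun_cmult:
  assumes "differential_space X" "f \<in> dfun X"
  shows "restrict (\<lambda>x. c * f x) (dpoints X) \<in> dfun X"
proof -
  have "smooth_on_open 1 (topspace (Euclidean_space 1)) (\<lambda>x. c * x 0)"
    by (rule smooth_on_open_coordinate) simp
  from differential_space_compose[OF assms(1) this, of "\<lambda>_. f"] assms(2) show ?thesis by simp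
qed

lemma form_cmult_forms:
  assumes X: "differential_space X" and \<omega>: "\<omega> \<in> forms X k"
  shows "form_cmult c \<omega> \<in> forms X k"
proof (rule formsI)
  fix a assume a: "a \<in> dpoints X"
  obtain U N f where U: "openin (dtop X) U" "a \<in> U" "\<And>r j. r < N \<Longrightarrow> j \<le> k \<Longrightarrow> f r j \<in> dfun X"
      "\<And>n S p x I. plot X n S p \<Longrightarrow> x \<in> S \<Longrightarrow> p x \<in> U \<Longrightarrow> I \<in> indices k n \<Longrightarrow>
        \<omega> n S p x I = (\<Sum>r<(N::nat). monomial_form k (f r) n S p x I)"
    by (rule formsE[OF \<omega> a]) (rule that)
  \<comment> \<open>The scalar is absorbed into the leading function of each summand, restricted
    again because smooth functions are extensional.\<close>
  define g where "g r = (f r)(0 := restrict (\<lambda>x. c * f r 0 x) (dpoints X))" for r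
  show "\<exists>U N f. openin (dtop X) U \<and> a \<in> U \<and> (\<forall>r<N. \<forall>j\<le>k. f r j \<in> dfun X) \<and>
      (\<forall>n S p. plot X n S p \<longrightarrow> (\<forall>x\<in>S. p x \<in> U \<longrightarrow> (\<forall>I\<in>indices k n.
         form_cmult c \<omega> n S p x I = (\<Sum>r<(N::nat). monomial_form k (f r) n S p x I))))"
  proof (intro exI conjI allI impI ballI)
    show "openin (dtop X) U" "a \<in> U" by fact+
    show "g r j \<in> dfun X" if "r < N" "j \<le> k" for r j
      using that U(3) dfun_cmult[OF X] by (simp add: g_def)
    fix n S x I and p :: "(nat \<Rightarrow> real) \<Rightarrow> 'a"
    assume *: "plot X n S p" "x \<in> S" "p x \<in> U" "I \<in> indices k n"
    have "monomial_form k (g r) n S p x I = c * monomial_form k (f r) n S p x I" for r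
      using plot_in[OF *(1,2)] by (simp add: monomial_form_def g_def)
    then show "form_cmult c \<omega> n S p x I = (\<Sum>r<N. monomial_form k (g r) n S p x I)"
      using * by (simp add: form_cmult_def U(4) sum_distrib_left)
  qed
qed (use forms_outside[OF \<omega>] in \<open>simp add: form_cmult_def\<close>)

lemma zero_form_forms: "zero_form \<in> forms X k"
proof (rule formsI)
  fix a assume "a \<in> dpoints X"
  then show "\<exists>U N f. openin (dtop X) U \<and> a \<in> U \<and> (\<forall>r<N. \<forall>j\<le>k. f r j \<in> dfun X) \<and>
      (\<forall>n S p. plot X n S p \<longrightarrow> (\<forall>x\<in>S. p x \<in> U \<longrightarrow> (\<forall>I\<in>indices k n.
         zero_form n S p x I = (\<Sum>r<(N::nat). monomial_form k (f r) n S p x I))))"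
    by (intro exI[of _ "dpoints X"] exI[of _ 0]) (simp add: zero_form_def)
qed (simp add: zero_form_def)

text \<open>The functions of a local expression are pulled back one by one. The plot
  \<open>\<phi> \<circ> p\<close> has the same domain as \<open>p\<close>, so the partial
  derivatives are taken of the same functions on that domain.\<close>

lemma form_pullback_forms:
  assumes A: "differential_space A" and X: "differential_space X" and \<phi>: "smooth_map A X \<phi>"
    and \<omega>: "\<omega> \<in> forms X k"
  shows "form_pullback A \<phi> k \<omega> \<in> forms A k"
proof (rule formsI)
  fix a assume a: "a \<in> dpoints A"
  have "\<phi> a \<in> dpoints X" using a \<phi> by (auto simp: smooth_map_def)
  obtain U N f where U: "openin (dtop X) U" "\<phi> a \<in> U" "\<And>r j. r < N \<Longrightarrow> j \<le> k \<Longrightarrow> f r j \<in> dfun X"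
      "\<And>n S p x I. plot X n S p \<Longrightarrow> x \<in> S \<Longrightarrow> p x \<in> U \<Longrightarrow> I \<in> indices k n \<Longrightarrow>
        \<omega> n S p x I = (\<Sum>r<(N::nat). monomial_form k (f r) n S p x I)"
    by (rule formsE[OF \<omega> \<open>\<phi> a \<in> _\<close>]) (rule that)
  define g where "g r j = restrict (f r j \<circ> \<phi>) (dpoints A)" for r j
  show "\<exists>U N f. openin (dtop A) U \<and> a \<in> U \<and> (\<forall>r<N. \<forall>j\<le>k. f r j \<in> dfun A) \<and>
      (\<forall>n S p. plot A n S p \<longrightarrow> (\<forall>x\<in>S. p x \<in> U \<longrightarrow> (\<forall>I\<in>indices k n.
         form_pullback A \<phi> k \<omega> n S p x I = (\<Sum>r<(N::nat). monomial_form k (f r) n S p x I))))"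
  proof (intro exI conjI allI impI ballI)
    show "openin (dtop A) {x \<in> dpoints A. \<phi> x \<in> U}"
      using smooth_map_imp_continuous_map[OF A X \<phi>] U(1) by (rule openin_continuous_map_preimage)
    show "a \<in> {x \<in> dpoints A. \<phi> x \<in> U}" using a U by simp
    show "g r j \<in> dfun A" if "r < N" "j \<le> k" for r j
      using that U(3) \<phi> by (simp add: g_def smooth_map_def)
    fix n S x I and p :: "(nat \<Rightarrow> real) \<Rightarrow> 'a"
    assume *: "plot A n S p" "x \<in> S" "p x \<in> {x \<in> dpoints A. \<phi> x \<in> U}" "I \<in> indices k n"
    have "monomial_form k (g r) n S p x I = monomial_form k (f r) n S (restrict (\<phi> \<circ> p) S) x I" for r
    proof -
      have "partial_deriv_on n S i (g r j \<circ> p) x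
          = partial_deriv_on n S i (f r j \<circ> restrict (\<phi> \<circ> p) S) x" for i j
        using plot_in[OF *(1)] by (intro partial_deriv_on_cong) (simp add: g_def)
      then show ?thesis using * by (simp add: monomial_form_def g_def)
    qed
    then show "form_pullback A \<phi> k \<omega> n S p x I = (\<Sum>r<N. monomial_form k (g r) n S p x I)"
      using * U(4)[OF plot_compose[OF \<phi> *(1)] *(2) _ *(4)] by (simp add: form_pullback_def)
  qed
qed (unfold form_pullback_def, rule if_not_P)

lemma ext_deriv_zero_form: "ext_deriv X k zero_form = zero_form"
proof -
  have "ext_deriv X k zero_form n S p x I = 0" for n S p x I
  proof (cases "plot X n S p \<and> x \<in> S \<and> I \<in> indices (Suc k) n")
    case True
    then have "partial_deriv_on n S (I ! j) (\<lambda>y. 0) x = 0" if "j \<le> k" for j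
      using that indices_nth[of I "Suc k" n j] by (intro partial_deriv_on_const) (auto simp: plot_altdef)
    then show ?thesis by (simp add: ext_deriv_def zero_form_def)
  qed (auto simp: ext_deriv_def)
  then show ?thesis by (simp add: zero_form_def fun_eq_iff)
qed

section \<open>Integration over simplices and Stokes' theorem\<close>

lemma corner_simplex_iff:
  "x \<in> corner_simplex p \<longleftrightarrow> x \<in> eucl p \<and> (\<forall>i<p. 0 \<le> x i) \<and> (\<Sum>i<p. x i) \<le> 1"
  by (auto simp: corner_simplex_def topspace_Euclidean_space)

lemma corner_simplex_le_1: "x \<in> corner_simplex p \<Longrightarrow> i < p \<Longrightarrow> x i \<le> 1"
  using member_le_sum[of i "{..<p}" x] by (auto simp: corner_simplex_iff)

lemma continuous_on_coordinate: "continuous_on S (\<lambda>x :: nat \<Rightarrow> real. x i)"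
  by (intro continuous_on_subset[OF continuous_on_product_coordinates]) auto

lemma plot_domain_corner_simplex: "plot_domain p (corner_simplex p)"
proof -
  let ?O = "eucl p \<inter> ((\<Inter>i\<in>{..<p}. {x. 0 < x i}) \<inter> {x. (\<Sum>i<p. x i) < 1})"
  have "open ((\<Inter>i\<in>{..<p}. {x. 0 < x i}) \<inter> {x :: nat \<Rightarrow> real. (\<Sum>i<p. x i) < 1})"
    by (intro open_Int open_INT ballI open_Collect_less continuous_intros continuous_on_coordinate) auto
  then have "openin (Euclidean_space p) ?O" unfolding Euclidean_space_eq openin_open by blast
  moreover have "?O \<subseteq> corner_simplex p" by (auto simp: corner_simplex_iff less_imp_le)
  ultimately have O: "?O \<subseteq> Euclidean_space p interior_of corner_simplex p"
    by (intro interior_of_maximal)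
  \<comment> \<open>The barycentre, where all \<open>p + 1\<close> barycentric coordinates are
    equal, is an interior point.\<close>
  have "(\<Sum>i<p. 1 / (real p + 1)) < 1" by simp
  then have "(\<lambda>i. if i < p then 1 / (real p + 1) else 0) \<in> ?O" by simp
  then have "(\<lambda>i. if i < p then 1 / (real p + 1) else 0) \<in> Euclidean_space p interior_of corner_simplex p"
    by (rule subsetD[OF O])
  then have "Euclidean_space p interior_of corner_simplex p \<noteq> {}"
    by (metis empty_iff)
  moreover have "(\<lambda>i. (1 - t) * x i + t * y i) \<in> corner_simplex p"
    if xy: "x \<in> corner_simplex p" "y \<in> corner_simplex p" "t \<in> {0..1}" for x y t
  proof -
    have "(\<Sum>i<p. (1 - t) * x i + t * y i) = (1 - t) * (\<Sum>i<p. x i) + t * (\<Sum>i<p. y i)"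
      by (simp add: sum.distrib sum_distrib_left)
    also have "\<dots> \<le> (1 - t) * 1 + t * 1"
      using xy by (intro add_mono mult_left_mono) (auto simp: corner_simplex_iff)
    finally show ?thesis using xy by (auto simp: corner_simplex_iff)
  qed
  ultimately show ?thesis
    by (auto simp: plot_domain_def) (auto simp: corner_simplex_def)
qed

text \<open>Drops the barycentric coordinate of vertex 0; on the two simplices this is the inverse
  of \<open>corner_param\<close>.\<close>

definition simplex_coords :: "nat \<Rightarrow> (nat \<Rightarrow> real) \<Rightarrow> nat \<Rightarrow> real" where
  "simplex_coords p y = (\<lambda>j. if j < p then y (Suc j) else 0)"

lemma simplex_coords_aff:
  "simplex_coords p = aff p (Suc p) (\<lambda>_. 0) (\<lambda>j i. if i = Suc j then 1 else 0)"
proof -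
  have "(\<Sum>i<Suc p. (if i = Suc j then 1 else 0) * y i) = y (Suc j)" if "j < p" for j and y :: "nat \<Rightarrow> real"
    using that by (simp add: if_distrib[of "\<lambda>z. z * _"] sum.delta cong: if_cong del: sum.lessThan_Suc)
  then show ?thesis by (auto simp: simplex_coords_def aff_def fun_eq_iff)
qed

lemma corner_param_aff:
  "corner_param p = aff (Suc p) p (\<lambda>j. if j = 0 then 1 else 0)
     (\<lambda>j i. if j = 0 then -1 else if j = Suc i then 1 else 0)"
proof (intro ext)
  fix x :: "nat \<Rightarrow> real" and j
  have "(\<Sum>i<p. (if j = i then 1 else 0) * x i) = (\<Sum>i<p. if j = i then x i else 0)" for j
    by (rule sum.cong) auto
  then have "(\<Sum>i<p. (if j = i then 1 else 0) * x i) = (if j < p then x j else 0)" for j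
    by (simp add: sum.delta')
  then show "corner_param p x j = aff (Suc p) p (\<lambda>j. if j = 0 then 1 else 0)
     (\<lambda>j i. if j = 0 then -1 else if j = Suc i then 1 else 0) x j"
    by (cases j) (auto simp: corner_param_def aff_def sum_negf)
qed

lemma simplex_coords_corner_param: "x \<in> eucl p \<Longrightarrow> simplex_coords p (corner_param p x) = x"
  by (auto simp: simplex_coords_def corner_param_def fun_eq_iff)

lemma standard_simplex_sum: "y \<in> standard_simplex p \<Longrightarrow> y 0 + (\<Sum>i<p. y (Suc i)) = 1"
  by (simp add: standard_simplex_def sum.atMost_shift)

lemma corner_param_simplex_coords: "y \<in> standard_simplex p \<Longrightarrow> corner_param p (simplex_coords p y) = y"
  using standard_simplex_sum[of y p]
  by (auto simp: simplex_coords_def corner_param_def fun_eq_iff standard_simplex_def split: nat.split)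

lemma simplex_coords_in: "y \<in> standard_simplex p \<Longrightarrow> simplex_coords p y \<in> corner_simplex p"
  using standard_simplex_sum[of y p]
  by (auto simp: corner_simplex_iff simplex_coords_def standard_simplex_def)
     (metis add.commute le_add_same_cancel1)

lemma corner_param_in: "x \<in> corner_simplex p \<Longrightarrow> corner_param p x \<in> standard_simplex p"
proof -
  assume x: "x \<in> corner_simplex p"
  have "(\<Sum>i\<le>p. corner_param p x i) = 1"
    by (simp add: corner_param_def sum.atMost_shift)
  moreover have "0 \<le> corner_param p x i \<and> corner_param p x i \<le> 1" for i
    using x corner_simplex_le_1[OF x] sum_nonneg[of "{..<p}" x]
    by (auto simp: corner_param_def corner_simplex_iff split: nat.split)
  ultimately show ?thesis
    by (auto simp: standard_simplex_def corner_param_def split: nat.split)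
qed

lemma standard_simplex_eucl: "standard_simplex p \<subseteq> eucl (Suc p)"
  by (auto simp: standard_simplex_def)

lemma smooth_simplex_plot:
  assumes "smooth_simplex p X \<sigma>"
  shows "plot X p (corner_simplex p) (restrict (\<sigma> \<circ> corner_param p) (corner_simplex p))"
proof -
  let ?C = "corner_simplex p" let ?q = "restrict (\<sigma> \<circ> corner_param p) ?C"
  have \<sigma>: "\<sigma> \<in> standard_simplex p \<rightarrow> dpoints X" "\<And>f. f \<in> dfun X \<Longrightarrow> smooth_on (Suc p) (standard_simplex p) (f \<circ> \<sigma>)"
    using assms by (simp_all add: smooth_simplex_def smooth_map_euclidean[OF standard_simplex_eucl])
  have "smooth_on p ?C (f \<circ> ?q)" if "f \<in> dfun X" for f
  proof -
    have "smooth_on p ?C (\<lambda>x. (f \<circ> \<sigma>) (corner_param p x))"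
      unfolding corner_param_aff
      by (rule smooth_on_aff[OF \<sigma>(2)[OF that] plot_domain_subset[OF plot_domain_corner_simplex]])
         (use corner_param_in in \<open>auto simp flip: corner_param_aff\<close>)
    then show ?thesis by (rule smooth_on_cong[THEN iffD1, rotated]) simp
  qed
  moreover have "?q \<in> ?C \<rightarrow> dpoints X" using \<sigma>(1) corner_param_in by auto
  ultimately show ?thesis
    by (simp add: plot_altdef plot_domain_corner_simplex
        smooth_map_euclidean[OF plot_domain_subset[OF plot_domain_corner_simplex]])
qed

text \<open>The singular simplex whose expression in corner coordinates is
  \<open>q \<circ> \<alpha>\<close>. Faces of smooth simplices and the small simplices that detect a
  form are both of this kind.\<close>

definition affine_simplex ::
    "nat \<Rightarrow> ((nat \<Rightarrow> real) \<Rightarrow> 'a) \<Rightarrow> ((nat \<Rightarrow> real) \<Rightarrow> nat \<Rightarrow> real) \<Rightarrow> (nat \<Rightarrow> real) \<Rightarrow> 'a" where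
  "affine_simplex p q \<alpha> = restrict (\<lambda>y. q (\<alpha> (simplex_coords p y))) (standard_simplex p)"

lemma smooth_simplex_affine_simplex:
  assumes X: "differential_space X" and q: "plot X n S q" and \<alpha>: "aff n p b M ` corner_simplex p \<subseteq> S"
  shows "smooth_simplex p X (affine_simplex p q (aff n p b M))"
proof -
  let ?C = "corner_simplex p" and ?D = "standard_simplex p" and ?\<alpha> = "aff n p b M"
  let ?\<sigma> = "affine_simplex p q ?\<alpha>"
  have "smooth_on (Suc p) ?D (f \<circ> ?\<sigma>)" if "f \<in> dfun X" for f
  proof -
    have "smooth_on p ?C (\<lambda>x. (f \<circ> q) (?\<alpha> x))"
      by (rule smooth_on_aff[OF plot_smooth[OF q that] plot_domain_subset[OF plot_domain_corner_simplex] \<alpha>])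
    then have "smooth_on (Suc p) ?D (\<lambda>y. (f \<circ> q) (?\<alpha> (simplex_coords p y)))"
      unfolding simplex_coords_aff
      by (rule smooth_on_aff[OF _ standard_simplex_eucl])
         (use simplex_coords_in in \<open>auto simp flip: simplex_coords_aff\<close>)
    then show ?thesis by (rule smooth_on_cong[THEN iffD1, rotated]) (simp add: affine_simplex_def)
  qed
  moreover have "?\<sigma> \<in> ?D \<rightarrow> dpoints X"
    using plot_in[OF q] \<alpha> simplex_coords_in by (fastforce simp: affine_simplex_def)
  ultimately have sm: "smooth_map (euclidean_dspace (Suc p) ?D) X ?\<sigma>"
    by (simp add: smooth_map_euclidean[OF standard_simplex_eucl])
  then have "continuous_map (top_of_set ?D) (dtop X) ?\<sigma>"
    by (rule smooth_map_euclidean_continuous[OF X standard_simplex_eucl])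
  then have "singular_simplex p (dtop X) ?\<sigma>"
    by (simp add: singular_simplex_def euclidean_product_topology affine_simplex_def)
  with sm show ?thesis by (simp add: smooth_simplex_def)
qed

lemma affine_simplex_corner:
  "restrict (affine_simplex p q \<alpha> \<circ> corner_param p) (corner_simplex p) = restrict (q \<circ> \<alpha>) (corner_simplex p)"
proof
  fix x
  show "restrict (affine_simplex p q \<alpha> \<circ> corner_param p) (corner_simplex p) x = restrict (q \<circ> \<alpha>) (corner_simplex p) x"
  proof (cases "x \<in> corner_simplex p")
    case True
    then have "simplex_coords p (corner_param p x) = x"
      by (intro simplex_coords_corner_param) (simp add: corner_simplex_iff)
    then show ?thesis using True corner_param_in[OF True] by (simp add: affine_simplex_def)
  qed simp
qed

section \<open>Integrals over the corner simplex\<close>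

definition pad :: "nat \<Rightarrow> (nat \<Rightarrow> real) \<Rightarrow> nat \<Rightarrow> real" where
  "pad p y = (\<lambda>i. if i < p then y i else 0)"

text \<open>The integrand extended by zero. \<open>pad\<close> translates points of the product
  measure space, which are \<open>undefined\<close> from \<open>p\<close> on, into sequences that
  vanish there.\<close>

definition on_corner :: "nat \<Rightarrow> ((nat \<Rightarrow> real) \<Rightarrow> real) \<Rightarrow> (nat \<Rightarrow> real) \<Rightarrow> real" where
  "on_corner p c y = (if pad p y \<in> corner_simplex p then c (pad p y) else 0)"

definition corner_integral :: "nat \<Rightarrow> ((nat \<Rightarrow> real) \<Rightarrow> real) \<Rightarrow> real" where
  "corner_integral p c = integral\<^sup>L (PiM {..<p} (\<lambda>_. lborel)) (on_corner p c)"

lemma simplex_integral_eq: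
  "simplex_integral p \<omega> \<sigma> = corner_integral p
     (\<lambda>x. \<omega> p (corner_simplex p) (restrict (\<sigma> \<circ> corner_param p) (corner_simplex p)) x [0..<p])"
  unfolding simplex_integral_def corner_integral_def on_corner_def pad_def Let_def ..

lemma corner_integral_cong:
  "(\<And>x. x \<in> corner_simplex p \<Longrightarrow> f x = g x) \<Longrightarrow> corner_integral p f = corner_integral p g"
  unfolding corner_integral_def on_corner_def by (rule arg_cong[of _ _ "integral\<^sup>L _"]) auto

interpretation lborel_PiM: product_sigma_finite "\<lambda>_ :: nat. lborel :: real measure" ..

text \<open>Compactness is inherited from the standard simplex through the affine change of
  coordinates.\<close>

lemma compact_corner_simplex: "compact (corner_simplex p)"
proof -
  have "compactin (powertop_real UNIV) (standard_simplex p)" by (rule compactin_standard_simplex)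
  then have "compact (standard_simplex p)" by (simp add: euclidean_product_topology)
  then have "compact (simplex_coords p ` standard_simplex p)"
    by (rule compact_continuous_image[rotated]) (simp add: simplex_coords_aff continuous_on_aff)
  moreover have "simplex_coords p ` standard_simplex p = corner_simplex p"
    using simplex_coords_in corner_param_in simplex_coords_corner_param
    by (auto simp: corner_simplex_iff image_iff) (metis corner_simplex_iff mem_Collect_eq)
  ultimately show ?thesis by simp
qed

lemma measurable_pad: "pad p \<in> borel_measurable (PiM {..<p} (\<lambda>_. lborel))"
proof (rule measurable_coordinatewise_then_product)
  fix i
  show "(\<lambda>y. pad p y i) \<in> borel_measurable (PiM {..<p} (\<lambda>_. lborel))"
    by (cases "i < p") (simp_all add: pad_def measurable_component_singleton)
qed

text \<open>A continuous function on the compact simplex is bounded, and its extension by zero is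
  supported in the unit cube, which has finite measure.\<close>

lemma integrable_on_corner:
  assumes "continuous_on (corner_simplex p) c"
  shows "integrable (PiM {..<p} (\<lambda>_. lborel)) (on_corner p c)"
proof -
  let ?C = "corner_simplex p"
  have "?C \<in> sets borel"
    using compact_corner_simplex[of p] compact_imp_closed by (intro borel_closed) blast
  from borel_measurable_continuous_on_indicator[OF this assms]
  have "(\<lambda>y. indicator ?C (pad p y) *\<^sub>R c (pad p y)) \<in> borel_measurable (PiM {..<p} (\<lambda>_. lborel))"
    by (rule measurable_compose[OF measurable_pad])
  then have meas: "on_corner p c \<in> borel_measurable (PiM {..<p} (\<lambda>_. lborel))"
    by (rule back_subst[where P = "\<lambda>f. f \<in> _"]) (auto simp: on_corner_def fun_eq_iff)
  have "bounded (c ` ?C)"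
    using compact_continuous_image[OF assms compact_corner_simplex] by (rule compact_imp_bounded)
  then obtain B where B: "\<And>x. x \<in> ?C \<Longrightarrow> \<bar>c x\<bar> \<le> B" "B > 0"
    by (auto simp: bounded_pos)
  let ?A = "PiE {..<p} (\<lambda>_. {0..1::real})"
  show ?thesis
  proof (rule integrableI_bounded_set[where A = ?A and B = B])
    show "?A \<in> sets (PiM {..<p} (\<lambda>_. lborel))" by (intro sets_PiM_I_finite) auto
    show "emeasure (PiM {..<p} (\<lambda>_. lborel)) ?A < \<infinity>"
      by (subst lborel_PiM.emeasure_PiM) auto
    show "AE x in PiM {..<p} (\<lambda>_. lborel). x \<in> ?A \<longrightarrow> norm (on_corner p c x) \<le> B"
      using B by (intro AE_I2) (auto simp: on_corner_def less_imp_le)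
    show "AE x in PiM {..<p} (\<lambda>_. lborel). x \<notin> ?A \<longrightarrow> on_corner p c x = 0"
    proof (intro AE_I2 impI)
      fix x :: "nat \<Rightarrow> real" assume x: "x \<in> space (PiM {..<p} (\<lambda>_. lborel))" "x \<notin> ?A"
      then obtain i where "i < p" "x i \<notin> {0..1}" by (auto simp: space_PiM PiE_iff)
      then have "pad p x \<notin> ?C"
        using corner_simplex_le_1[of "pad p x" p i] by (auto simp: corner_simplex_iff pad_def)
      then show "on_corner p c x = 0" by (simp add: on_corner_def)
    qed
  qed (fact meas)
qed

lemma corner_integral_add:
  assumes "continuous_on (corner_simplex p) f" "continuous_on (corner_simplex p) g"
  shows "corner_integral p (\<lambda>x. f x + g x) = corner_integral p f + corner_integral p g"
proof -
  have "on_corner p (\<lambda>x. f x + g x) = (\<lambda>y. on_corner p f y + on_corner p g y)"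
    by (auto simp: on_corner_def)
  then show ?thesis
    using integrable_on_corner[OF assms(1)] integrable_on_corner[OF assms(2)]
    by (simp add: corner_integral_def)
qed

lemma corner_integral_cmult: "corner_integral p (\<lambda>x. a * f x) = a * corner_integral p f"
proof -
  have "on_corner p (\<lambda>x. a * f x) = (\<lambda>y. a * on_corner p f y)"
    by (auto simp: on_corner_def)
  then show ?thesis by (simp add: corner_integral_def)
qed

lemma corner_integral_0: "corner_integral p (\<lambda>_. 0) = 0"
  using corner_integral_cmult[of p 0 "\<lambda>_. 0"] by simp

lemma corner_integral_diff:
  assumes "continuous_on (corner_simplex p) f" "continuous_on (corner_simplex p) g"
  shows "corner_integral p (\<lambda>x. f x - g x) = corner_integral p f - corner_integral p g"
  using corner_integral_add[OF assms(1), of "\<lambda>x. (-1) * g x"] corner_integral_cmult[of p "-1" g] assms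
  by (simp add: continuous_on_minus)

lemma corner_integral_sum:
  "(\<And>a. a \<in> F \<Longrightarrow> continuous_on (corner_simplex p) (f a)) \<Longrightarrow>
    corner_integral p (\<lambda>x. \<Sum>a\<in>F. f a x) = (\<Sum>a\<in>F. corner_integral p (f a))"
  by (induction F rule: infinite_finite_induct)
     (auto simp: corner_integral_0 corner_integral_add continuous_on_sum)

lemma corner_integral_mono:
  assumes "continuous_on (corner_simplex p) f" "continuous_on (corner_simplex p) g"
    and "\<And>x. x \<in> corner_simplex p \<Longrightarrow> f x \<le> g x"
  shows "corner_integral p f \<le> corner_integral p g"
  unfolding corner_integral_def
  by (rule integral_mono[OF integrable_on_corner[OF assms(1)] integrable_on_corner[OF assms(2)]])
     (use assms(3) in \<open>auto simp: on_corner_def\<close>)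

text \<open>Positivity of the volume is all that is used later, so a cube of edge
  \<open>1 / (p + 1)\<close> inside the simplex replaces the computation of the exact value.\<close>

lemma corner_integral_1_pos: "corner_integral p (\<lambda>_. 1) > 0"
proof -
  let ?\<mu> = "PiM {..<p} (\<lambda>_. lborel :: real measure)"
  let ?e = "1 / (real p + 1)"
  let ?A = "PiE {..<p} (\<lambda>_. {0..?e})"
  have A: "?A \<in> sets ?\<mu>" by (intro sets_PiM_I_finite) auto
  have em: "emeasure ?\<mu> ?A = ennreal (?e ^ p)"
    by (subst lborel_PiM.emeasure_PiM) (auto simp: prod_constant ennreal_power)
  then have m: "measure ?\<mu> ?A = ?e ^ p" by (simp add: measure_def)
  have "measure ?\<mu> ?A = integral\<^sup>L ?\<mu> (indicator ?A)"
    using A by simp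
  also have "\<dots> \<le> integral\<^sup>L ?\<mu> (on_corner p (\<lambda>_. 1))"
  proof (rule integral_mono[OF _ integrable_on_corner])
    show "integrable ?\<mu> (indicator ?A :: _ \<Rightarrow> real)" using A em by simp
    fix y assume "y \<in> space ?\<mu>"
    have "pad p y \<in> corner_simplex p" if y: "y \<in> ?A"
    proof -
      have "(\<Sum>i<p. pad p y i) \<le> (\<Sum>i<p. ?e)"
        using y by (intro sum_mono) (auto simp: pad_def PiE_iff)
      also have "\<dots> \<le> 1" by (simp add: divide_simps)
      finally show ?thesis using y by (auto simp: corner_simplex_iff pad_def PiE_iff)
    qed
    then show "indicator ?A y \<le> on_corner p (\<lambda>_. 1) y"
      by (auto simp: on_corner_def indicator_def)
  qed simp
  finally show ?thesis using m unfolding corner_integral_def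
    by (smt (verit) of_nat_0_le_iff zero_less_divide_1_iff zero_less_power)
qed

section \<open>Integrals of forms over affine simplices\<close>

lemma aff_corner_continuous:
  assumes "continuous_on S f" "aff n p b M ` corner_simplex p \<subseteq> S"
  shows "continuous_on (corner_simplex p) (\<lambda>x. f (aff n p b M x))"
  using continuous_on_compose2[OF assms(1) continuous_on_aff assms(2)] .

lemma upt_indices: "[0..<p] \<in> indices p p"
  by (auto simp: indices_def)

lemma simplex_integral_affine_simplex:
  assumes \<omega>: "natural_form X p \<omega>" and q: "plot X n S q" and \<alpha>: "aff n p b M ` corner_simplex p \<subseteq> S"
  shows "simplex_integral p \<omega> (affine_simplex p q (aff n p b M))
    = corner_integral p (\<lambda>x. \<Sum>J\<in>indices p n. (\<Prod>l<p. M (J ! l) l) * \<omega> n S q (aff n p b M x) J)"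
  unfolding simplex_integral_eq affine_simplex_corner
proof (rule corner_integral_cong)
  fix x assume "x \<in> corner_simplex p"
  from natural_form_aff[OF \<omega> q plot_domain_corner_simplex \<alpha> this upt_indices]
  show "\<omega> p (corner_simplex p) (restrict (q \<circ> aff n p b M) (corner_simplex p)) x [0..<p]
      = (\<Sum>J\<in>indices p n. (\<Prod>l<p. M (J ! l) l) * \<omega> n S q (aff n p b M x) J)"
    by (simp cong: prod.cong_simp)
qed

lemma simplex_integral_continuous_coefficient:
  assumes "natural_form X p \<omega>" "smooth_simplex p X \<sigma>"
  shows "continuous_on (corner_simplex p)
    (\<lambda>x. \<omega> p (corner_simplex p) (restrict (\<sigma> \<circ> corner_param p) (corner_simplex p)) x [0..<p])"
  using natural_form_continuous[OF assms(1) smooth_simplex_plot[OF assms(2)] upt_indices] .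

text \<open>A form with integral periods over all simplices vanishes: the integral over a simplex of edge
  length \<open>\<epsilon>\<close> spanned by coordinate vectors is close to \<open>\<epsilon> ^ k\<close> times a multiple of its coefficient.\<close>

lemma natural_form_integral_eq_0:
  assumes X: "differential_space X" and \<omega>: "natural_form X k \<omega>" and k: "1 \<le> k"
    and int: "\<And>\<sigma>. smooth_simplex k X \<sigma> \<Longrightarrow> simplex_integral k \<omega> \<sigma> \<in> \<int>"
    and q: "plot X n S q" and x: "x \<in> S" and I: "I \<in> indices k n"
  shows "\<omega> n S q x I = 0"
proof -
  let ?C = "corner_simplex k"
  have S: "plot_domain n S" using q by (simp add: plot_altdef)
  note cont = natural_form_continuous[OF \<omega> q I]
  show ?thesis
  proof (rule eq_0_from_interior[OF S x _ cont])
    show "openin (top_of_set S) S" by simp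
    fix x0 assume x0: "x0 \<in> S" "x0 \<in> Euclidean_space n interior_of S"
    define a where "a = \<omega> n S q x0 I"
    define V where "V = corner_integral k (\<lambda>_. 1)"
    have V: "V > 0" unfolding V_def by (rule corner_integral_1_pos)
    show "\<omega> n S q x0 I = 0"
    proof (rule ccontr)
      assume "\<omega> n S q x0 I \<noteq> 0"
      then have a: "a \<noteq> 0" by (simp add: a_def)
      let ?O = "Euclidean_space n interior_of S"
      let ?W = "?O \<inter> (\<lambda>x. \<omega> n S q x I) -` ball a (\<bar>a\<bar> / 2)"
      have OS: "?O \<subseteq> S" by (rule interior_of_subset)
      have "openin (top_of_set ?O) ?W"
        using continuous_on_subset[OF cont OS] continuous_openin_preimage_gen open_ball by blast
      then have "openin (Euclidean_space n) ?W"
        using openin_interior_of[of "Euclidean_space n" S] openin_trans unfolding Euclidean_space_eq by blast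
      moreover have "x0 \<in> ?W" using x0 a by (simp add: a_def)
      ultimately obtain d where d: "d > 0" "\<And>y. y \<in> eucl n \<Longrightarrow> (\<And>i. i < n \<Longrightarrow> \<bar>y i - x0 i\<bar> < d) \<Longrightarrow> y \<in> ?W"
        using openin_eucl_box by blast
      \<comment> \<open>\<open>e < d\<close> keeps the small simplex inside \<open>?W\<close>, where
        the coefficient differs from \<open>a\<close> by less than half of its size. The last bound
        makes the integral smaller than 1 in absolute value.\<close>
      define e where "e = min (d / 2) (min 1 (1 / (2 * (\<bar>a\<bar> * V + 1))))"
      have aV: "\<bar>a\<bar> * V > 0" using a V by simp
      have e: "e > 0" "e < d" "e \<le> 1" "e \<le> 1 / (2 * (\<bar>a\<bar> * V + 1))"
        using d(1) aV unfolding e_def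
        by (simp_all add: min_less_iff_disj) (rule min.coboundedI2, simp)
      \<comment> \<open>The edges of the small simplex are \<open>e\<close> times the coordinate
        vectors named by \<open>I\<close>. In the expansion over multi-indices the product of
        entries then vanishes except at \<open>I\<close> itself, where it is
        \<open>e ^ k\<close>.\<close>
      define M where "M j l = (if j = I ! l then e else 0)" for j l
      define \<alpha> where "\<alpha> = aff n k x0 M"
      have \<alpha>W: "\<alpha> y \<in> ?W" if y: "y \<in> ?C" for y
      proof (rule d(2))
        show "\<alpha> y \<in> eucl n" unfolding \<alpha>_def by (rule aff_in_eucl)
        fix i assume "i < n"
        then have "\<bar>\<alpha> y i - x0 i\<bar> = \<bar>\<Sum>l<k. M i l * y l\<bar>" by (simp add: \<alpha>_def aff_def)
        also have "\<dots> \<le> (\<Sum>l<k. e * y l)"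
          using y e(1) by (intro order_trans[OF sum_abs] sum_mono) (auto simp: M_def corner_simplex_iff)
        also have "\<dots> \<le> e * 1"
          unfolding sum_distrib_left[symmetric] using y e(1)
          by (intro mult_left_mono) (auto simp: corner_simplex_iff)
        finally show "\<bar>\<alpha> y i - x0 i\<bar> < d" using e(2) by simp
      qed
      then have \<alpha>S: "aff n k x0 M ` ?C \<subseteq> S" using OS by (auto simp: \<alpha>_def)
      \<comment> \<open>Division by \<open>a\<close> normalises the coefficient to values between
        1/2 and 3/2, whatever the sign of \<open>a\<close>.\<close>
      define h where "h y = \<omega> n S q (\<alpha> y) I / a" for y
      have ch: "continuous_on ?C h"
        unfolding h_def \<alpha>_def using a by (intro continuous_intros aff_corner_continuous[OF cont \<alpha>S]) auto
      have "(\<Sum>J\<in>indices k n. (\<Prod>l<k. M (J ! l) l) * \<omega> n S q (\<alpha> y) J) = e ^ k * a * h y" for y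
      proof -
        have "(\<Prod>l<k. M (J ! l) l) = (if J = I then e ^ k else 0)" if "J \<in> indices k n" for J
        proof (cases "J = I")
          case False
          moreover have "length J = k" "length I = k" using that I by (simp_all add: indices_def)
          ultimately obtain l where "l < k" "J ! l \<noteq> I ! l"
            using nth_equalityI[of J I] by auto
          then show ?thesis using False by (auto simp: M_def intro!: prod_zero)
        qed (simp add: M_def)
        then have "(\<Sum>J\<in>indices k n. (\<Prod>l<k. M (J ! l) l) * \<omega> n S q (\<alpha> y) J)
            = (\<Sum>J\<in>indices k n. if J = I then e ^ k * \<omega> n S q (\<alpha> y) J else 0)"
          by (intro sum.cong) auto
        also have "\<dots> = e ^ k * \<omega> n S q (\<alpha> y) I"
          using I by (simp add: sum.delta finite_indices)
        finally show ?thesis using a by (simp add: h_def)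
      qed
      then have "simplex_integral k \<omega> (affine_simplex k q \<alpha>) = corner_integral k (\<lambda>y. e ^ k * a * h y)"
        unfolding \<alpha>_def simplex_integral_affine_simplex[OF \<omega> q \<alpha>S] by simp
      then have I_eq: "simplex_integral k \<omega> (affine_simplex k q \<alpha>) = e ^ k * a * corner_integral k h"
        by (simp add: corner_integral_cmult)
      have hb: "1 / 2 \<le> h y \<and> h y \<le> 3 / 2" if "y \<in> ?C" for y
      proof -
        have "\<bar>\<omega> n S q (\<alpha> y) I - a\<bar> < \<bar>a\<bar> / 2" using \<alpha>W[OF that] by (auto simp: dist_real_def abs_minus_commute)
        moreover have "h y - 1 = (\<omega> n S q (\<alpha> y) I - a) / a"
          using a by (simp add: h_def diff_divide_distrib)
        ultimately have "\<bar>h y - 1\<bar> < 1 / 2"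
          using a by (simp add: pos_divide_less_eq)
        then show ?thesis by linarith
      qed
      have "corner_integral k (\<lambda>_. 1 / 2) \<le> corner_integral k h" "corner_integral k h \<le> corner_integral k (\<lambda>_. 3 / 2)"
        using hb ch by (auto intro!: corner_integral_mono)
      moreover have "corner_integral k (\<lambda>_. c) = c * V" for c
        using corner_integral_cmult[of k c "\<lambda>_. 1"] by (simp add: V_def)
      ultimately have hV: "V / 2 \<le> corner_integral k h" "corner_integral k h \<le> 3 / 2 * V" by auto
      \<comment> \<open>Here the degree must be positive: the integral has to shrink with the
        simplex.\<close>
      have "e ^ k \<le> e" using e k power_decreasing[of 1 k e] by simp
      then have "\<bar>e ^ k * a * corner_integral k h\<bar> \<le> e * \<bar>a\<bar> * (3 / 2 * V)"
      proof -
        have "\<bar>e ^ k * a * corner_integral k h\<bar> = (e ^ k * \<bar>a\<bar>) * corner_integral k h"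
          using hV V e(1) by (simp add: abs_mult)
        also have "\<dots> \<le> (e * \<bar>a\<bar>) * (3 / 2 * V)"
          using hV V e(1) \<open>e ^ k \<le> e\<close> by (intro mult_mono[OF mult_right_mono]) auto
        finally show ?thesis .
      qed
      also have "\<dots> \<le> (1 / (2 * (\<bar>a\<bar> * V + 1))) * (\<bar>a\<bar> * (3 / 2 * V))"
        using e(4) V unfolding mult.assoc by (intro mult_right_mono) auto
      also have "\<dots> < 1" using aV by (simp add: field_simps)
      finally have "\<bar>simplex_integral k \<omega> (affine_simplex k q \<alpha>)\<bar> < 1" by (simp add: I_eq)
      moreover have "simplex_integral k \<omega> (affine_simplex k q \<alpha>) \<in> \<int>"
        unfolding \<alpha>_def by (intro int smooth_simplex_affine_simplex[OF X q \<alpha>S])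
      ultimately have "simplex_integral k \<omega> (affine_simplex k q \<alpha>) = 0"
        using Ints_nonzero_abs_less1 by blast
      then show False using I_eq a e(1) hV(1) V by auto
    qed
  qed
qed

section \<open>Integration along coordinate fibres\<close>

definition ins :: "nat \<Rightarrow> real \<Rightarrow> (nat \<Rightarrow> real) \<Rightarrow> nat \<Rightarrow> real" where
  "ins j t x = (\<lambda>i. if i < j then x i else if i = j then t else x (i - 1))"

lemma sum_ins:
  assumes "j \<le> m"
  shows "(\<Sum>i<Suc m. ins j t x i) = t + (\<Sum>i<m. x i)"
  using assms
proof (induction m)
  case (Suc m)
  show ?case
  proof (cases "j = Suc m")
    case True
    then have "(\<Sum>i<Suc m. ins j t x i) = (\<Sum>i<Suc m. x i)"
      by (intro sum.cong) (auto simp: ins_def)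
    then show ?thesis using True by (simp add: ins_def)
  next
    case False
    then have "ins j t x (Suc m) = x m" using Suc.prems by (simp add: ins_def)
    then show ?thesis using Suc False by simp
  qed
qed (simp add: ins_def)

text \<open>The fibre in direction \<open>j\<close> over a point \<open>x\<close> of the smaller
  simplex is an interval, whose length is the barycentric coordinate of \<open>x\<close> at vertex
  0.\<close>

lemma ins_in_corner_simplex:
  assumes "j \<le> m" "x \<in> eucl m"
  shows "ins j t x \<in> corner_simplex (Suc m) \<longleftrightarrow> x \<in> corner_simplex m \<and> 0 \<le> t \<and> t \<le> 1 - (\<Sum>i<m. x i)"
proof -
  have "(\<forall>i<Suc m. 0 \<le> ins j t x i) \<longleftrightarrow> (\<forall>i<m. 0 \<le> x i) \<and> 0 \<le> t"
  proof safe
    assume *: "\<forall>i<Suc m. 0 \<le> ins j t x i"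
    show "0 \<le> t" using *[rule_format, of j] assms by (simp add: ins_def)
    fix i assume "i < m"
    then show "0 \<le> x i"
      using *[rule_format, of i] *[rule_format, of "Suc i"] by (auto simp: ins_def split: if_splits)
  qed (use assms in \<open>auto simp: ins_def less_Suc_eq_le\<close>)
  moreover have "ins j t x \<in> eucl (Suc m)" using assms by (auto simp: ins_def)
  ultimately show ?thesis
    using assms sum_ins[OF assms(1), of t x] by (auto simp: corner_simplex_iff simp del: sum.lessThan_Suc)
qed

lemma ins_upd: "(ins j t x)(j := s) = ins j s x"
  by (auto simp: ins_def)

lemma continuous_on_ins:
  assumes "continuous_on S f" "continuous_on S t"
  shows "continuous_on S (\<lambda>x. ins j (t x) (f x))"
proof (rule continuous_on_coordinatewise_then_product)
  fix i
  show "continuous_on S (\<lambda>x. ins j (t x) (f x) i)"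
    unfolding ins_def
    by (cases "i < j"; cases "i = j")
       (auto intro!: assms continuous_on_product_then_coordinatewise[OF assms(1)])
qed

text \<open>Over the index set \<open>{..<m}\<close>, \<open>product_integral_insert\<close> splits
  off the new coordinate \<open>m\<close>. Permuting coordinates allows any position
  \<open>j\<close> to be split off instead.\<close>

lemma PiM_lborel_reindex:
  assumes \<pi>: "bij_betw \<pi> {..<n} {..<n::nat}"
  shows "distr (PiM {..<n} (\<lambda>_. lborel :: real measure)) (PiM {..<n} (\<lambda>_. lborel)) (\<lambda>y. \<lambda>i\<in>{..<n}. y (\<pi> i))
    = PiM {..<n} (\<lambda>_. lborel)"
    (is "distr ?M ?M ?f = ?M")
proof (rule lborel_PiM.PiM_eqI)
  have f: "?f \<in> measurable ?M ?M"
    using bij_betwE[OF \<pi>] by (intro measurable_restrict measurable_component_singleton) auto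
  fix A :: "nat \<Rightarrow> real set" assume A: "\<And>i. i \<in> {..<n} \<Longrightarrow> A i \<in> sets lborel"
  let ?\<rho> = "inv_into {..<n} \<pi>"
  have \<rho>: "?\<rho> l < n" "\<pi> (?\<rho> l) = l" if "l < n" for l
    using that \<pi> bij_betw_inv_into_right[OF \<pi>, of l] bij_betwE[OF bij_betw_inv_into[OF \<pi>]] by auto
  have \<rho>\<pi>: "?\<rho> (\<pi> i) = i" if "i < n" for i
    using that bij_betw_inv_into_left[OF \<pi>] by auto
  have \<pi>n: "\<pi> i < n" if "i < n" for i using bij_betwE[OF \<pi>] that by auto
  have vim: "?f -` (PiE {..<n} A) \<inter> space ?M = PiE {..<n} (\<lambda>l. A (?\<rho> l))"
  proof (intro equalityI subsetI)
    fix y assume y: "y \<in> ?f -` (PiE {..<n} A) \<inter> space ?M"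
    show "y \<in> PiE {..<n} (\<lambda>l. A (?\<rho> l))"
    proof (rule PiE_I)
      fix l assume l: "l \<in> {..<n}"
      have "?f y (?\<rho> l) \<in> A (?\<rho> l)" using y \<rho>(1)[of l] l by (auto simp: PiE_iff)
      then show "y l \<in> A (?\<rho> l)" using \<rho>[of l] l by simp
    qed (use y in \<open>auto simp: space_PiM PiE_iff extensional_def\<close>)
  next
    fix y assume y: "y \<in> PiE {..<n} (\<lambda>l. A (?\<rho> l))"
    have "y (\<pi> i) \<in> A i" if "i < n" for i
    proof -
      have "y (\<pi> i) \<in> A (?\<rho> (\<pi> i))" using y \<pi>n[OF that] by (simp add: PiE_iff)
      then show ?thesis by (simp only: \<rho>\<pi>[OF that])
    qed
    then show "y \<in> ?f -` (PiE {..<n} A) \<inter> space ?M" using y by (auto simp: space_PiM PiE_iff)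
  qed
  have "emeasure (distr ?M ?M ?f) (PiE {..<n} A) = emeasure ?M (PiE {..<n} (\<lambda>l. A (?\<rho> l)))"
    using A by (subst emeasure_distr[OF f]) (auto simp: vim intro!: sets_PiM_I_finite)
  also have "\<dots> = (\<Prod>l<n. emeasure lborel (A (?\<rho> l)))"
    using A \<rho>(1) by (intro lborel_PiM.emeasure_PiM) auto
  also have "\<dots> = (\<Prod>i<n. emeasure lborel (A i))"
    by (rule prod.reindex_bij_betw[OF bij_betw_inv_into[OF \<pi>]])
  finally show "emeasure (distr ?M ?M ?f) (PiE {..<n} A) = (\<Prod>i<n. emeasure lborel (A i))" .
qed simp_all

lemma corner_integral_Fubini:
  assumes F: "continuous_on (corner_simplex (Suc m)) F" and j: "j \<le> m"
  shows "corner_integral (Suc m) F = (LINT x|PiM {..<m} (\<lambda>_. lborel). LINT t|lborel.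
     (if ins j t (pad m x) \<in> corner_simplex (Suc m) then F (ins j t (pad m x)) else 0))"
proof -
  let ?M = "PiM {..<Suc m} (\<lambda>_. lborel :: real measure)"
  \<comment> \<open>Entry \<open>i\<close> of \<open>ins j t x\<close> is entry
    \<open>\<pi> i\<close> of \<open>x(m := t)\<close>.\<close>
  define \<pi> where "\<pi> i = (if i < j then i else if i = j then m else i - 1)" for i
  have \<pi>: "bij_betw \<pi> {..<Suc m} {..<Suc m}"
    by (rule bij_betw_byWitness[where f' = "\<lambda>l. if l < j then l else if l = m then j else Suc l"])
       (use j in \<open>auto simp: \<pi>_def\<close>)
  let ?f = "\<lambda>y. \<lambda>i\<in>{..<Suc m}. y (\<pi> i) :: real"
  have f: "?f \<in> measurable ?M ?M"
    using bij_betwE[OF \<pi>] by (intro measurable_restrict measurable_component_singleton) auto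
  note int = integrable_on_corner[OF F]
  have "corner_integral (Suc m) F = integral\<^sup>L (distr ?M ?M ?f) (on_corner (Suc m) F)"
    unfolding PiM_lborel_reindex[OF \<pi>] corner_integral_def ..
  also have "\<dots> = (LINT y|?M. on_corner (Suc m) F (?f y))"
    using int by (intro integral_distr[OF f]) auto
  also have "\<dots> = (LINT x|PiM {..<m} (\<lambda>_. lborel). LINT t|lborel. on_corner (Suc m) F (?f (x(m := t))))"
    unfolding lessThan_Suc
  proof (rule lborel_PiM.product_integral_insert)
    have "integrable (distr ?M ?M ?f) (on_corner (Suc m) F)"
      unfolding PiM_lborel_reindex[OF \<pi>] by (rule int)
    then have "integrable ?M (\<lambda>y. on_corner (Suc m) F (?f y))"
      using int by (subst (asm) integrable_distr_eq[OF f]) auto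
    then show "integrable (PiM (insert m {..<m}) (\<lambda>_. lborel))
        (\<lambda>y. on_corner (Suc m) F (\<lambda>i\<in>insert m {..<m}. y (\<pi> i)))"
      unfolding lessThan_Suc .
  qed auto
  also have "\<dots> = (LINT x|PiM {..<m} (\<lambda>_. lborel). LINT t|lborel.
     (if ins j t (pad m x) \<in> corner_simplex (Suc m) then F (ins j t (pad m x)) else 0))"
  proof -
    have "pad (Suc m) (?f (x(m := t))) = ins j t (pad m x)" for x t
      using j by (auto simp: pad_def ins_def \<pi>_def fun_eq_iff)
    then show ?thesis by (simp only: on_corner_def)
  qed
  finally show ?thesis .
qed

lemma pad_in_eucl: "pad m x \<in> eucl m"
  by (simp add: pad_def)

lemma continuous_on_slant:
  assumes g: "continuous_on (corner_simplex (Suc m)) g" and j: "j \<le> m"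
  shows "continuous_on (corner_simplex m) (\<lambda>x. g (ins j (1 - (\<Sum>i<m. x i)) x))"
proof (rule continuous_on_compose2[OF g])
  show "continuous_on (corner_simplex m) (\<lambda>x. ins j (1 - (\<Sum>i<m. x i)) x)"
    by (intro continuous_on_ins continuous_intros continuous_on_coordinate)
  show "(\<lambda>x. ins j (1 - (\<Sum>i<m. x i)) x) ` corner_simplex m \<subseteq> corner_simplex (Suc m)"
    by (rule image_subsetI, subst ins_in_corner_simplex[OF j]) (auto simp: corner_simplex_iff)
qed

text \<open>Fubini in direction \<open>j\<close>, and the fundamental theorem of calculus on each
  fibre. The fibres end on the slanted face opposite the origin and start on the face where
  coordinate \<open>j\<close> is 0.\<close>

lemma corner_integral_partial_deriv:
  assumes g: "smooth_on (Suc m) (corner_simplex (Suc m)) g" and j: "j \<le> m"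
  shows "corner_integral (Suc m) (partial_deriv_on (Suc m) (corner_simplex (Suc m)) j g)
    = corner_integral m (\<lambda>x. g (ins j (1 - (\<Sum>i<m. x i)) x)) - corner_integral m (\<lambda>x. g (ins j 0 x))"
proof -
  let ?C = "corner_simplex (Suc m)" and ?c = "corner_simplex m"
  let ?D = "partial_deriv_on (Suc m) ?C j g"
  let ?L = "\<lambda>x. 1 - (\<Sum>i<m. x i) :: real"
  note dom = plot_domain_corner_simplex[of "Suc m"]
  note eucl = plot_domain_subset[OF dom]
  have cD: "continuous_on ?C ?D"
    using j by (intro smooth_on_continuous[OF smooth_on_partial_deriv_on[OF dom g] eucl]) simp
  have cg: "continuous_on ?C g" by (rule smooth_on_continuous[OF g eucl])
  have fiber: "(LINT t|lborel. (if ins j t x \<in> ?C then ?D (ins j t x) else 0))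
      = (if x \<in> ?c then g (ins j (?L x) x) - g (ins j 0 x) else 0)" if xe: "x \<in> eucl m" for x
  proof (cases "x \<in> ?c")
    case False
    then have "ins j t x \<notin> ?C" for t using ins_in_corner_simplex[OF j xe] by blast
    then show ?thesis using False by simp
  next
    case True
    note iff = ins_in_corner_simplex[OF j xe]
    have L: "0 \<le> ?L x" using True by (simp add: corner_simplex_iff)
    \<comment> \<open>Identifies the slice along which the derivative exists with the interval of
      integration, so that one-sided derivatives at its ends are of the required kind.\<close>
    have fib: "{s. ins j s x \<in> ?C} = {0..?L x}" unfolding iff using True by auto
    have "(LINT t|lborel. indicator {0..?L x} t *\<^sub>R ?D (ins j t x)) = g (ins j (?L x) x) - g (ins j 0 x)"
    proof (rule integral_FTC_Icc[OF L])
      fix t assume t: "0 \<le> t" "t \<le> ?L x"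
      then have "ins j t x \<in> ?C" using True iff by blast
      from partial_deriv_on_DERIV[OF dom this _ g, of j] j
      have "((\<lambda>s. g ((ins j t x)(j := s))) has_real_derivative ?D (ins j t x))
          (at (ins j t x j) within {s. (ins j t x)(j := s) \<in> ?C})" by (simp only: less_Suc_eq_le)
      moreover have "ins j t x j = t" by (simp add: ins_def)
      ultimately show "((\<lambda>s. g (ins j s x)) has_vector_derivative ?D (ins j t x)) (at t within {0..?L x})"
        unfolding ins_upd fib has_real_derivative_iff_has_vector_derivative by simp
    next
      have "continuous_on {0..?L x} (\<lambda>t. ins j t x)" by (intro continuous_on_ins continuous_intros)
      then show "continuous_on {0..?L x} (\<lambda>t. ?D (ins j t x))"
        by (rule continuous_on_compose2[OF cD]) (use fib in blast)
    qed
    moreover have "indicator {0..?L x} t *\<^sub>R ?D (ins j t x) = (if ins j t x \<in> ?C then ?D (ins j t x) else 0)" for t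
      using fib by (auto simp: indicator_def)
    ultimately show ?thesis using True by simp
  qed
  have "corner_integral (Suc m) ?D = (LINT x|PiM {..<m} (\<lambda>_. lborel).
      on_corner m (\<lambda>x. g (ins j (?L x) x) - g (ins j 0 x)) x)"
    unfolding corner_integral_Fubini[OF cD j] on_corner_def fiber[OF pad_in_eucl] ..
  also have "\<dots> = corner_integral m (\<lambda>x. g (ins j (?L x) x) - g (ins j 0 x))"
    by (simp add: corner_integral_def)
  also have "\<dots> = corner_integral m (\<lambda>x. g (ins j (?L x) x)) - corner_integral m (\<lambda>x. g (ins j 0 x))"
  proof (rule corner_integral_diff)
    show "continuous_on ?c (\<lambda>x. g (ins j (?L x) x))"
      by (rule continuous_on_slant[OF cg j])
    show "continuous_on ?c (\<lambda>x. g (ins j 0 x))"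
    proof (rule continuous_on_compose2[OF cg])
      show "continuous_on ?c (\<lambda>x. ins j 0 x)" by (intro continuous_on_ins continuous_intros)
      show "(\<lambda>x. ins j 0 x) ` ?c \<subseteq> ?C"
        by (rule image_subsetI, subst ins_in_corner_simplex[OF j]) (auto simp: corner_simplex_iff)
    qed
  qed
  finally show ?thesis .
qed

text \<open>The affine involution of the corner simplex that interchanges the vertices 0 and
  \<open>i + 1\<close>, that is, the barycentric coordinates belonging to them.\<close>

definition reflect :: "nat \<Rightarrow> nat \<Rightarrow> (nat \<Rightarrow> real) \<Rightarrow> nat \<Rightarrow> real" where
  "reflect m i x = x(i := 1 - (\<Sum>l<m. x l))"

lemma reflect_sum: "i < m \<Longrightarrow> (\<Sum>l<m. reflect m i x l) = 1 - x i"
proof -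
  assume i: "i < m"
  have "(\<Sum>l<m. reflect m i x l) = (1 - (\<Sum>l<m. x l)) + (\<Sum>l\<in>{..<m} - {i}. x l)"
    using i by (subst sum.remove[of _ i]) (auto simp: reflect_def)
  moreover have "(\<Sum>l<m. x l) = x i + (\<Sum>l\<in>{..<m} - {i}. x l)"
    using i by (subst sum.remove[of _ i]) auto
  ultimately show ?thesis by simp
qed

lemma reflect_in:
  assumes "i < m" "x \<in> corner_simplex m"
  shows "reflect m i x \<in> corner_simplex m"
proof -
  have "(\<Sum>l<m. reflect m i x l) \<le> 1" "\<forall>l<m. 0 \<le> reflect m i x l" "reflect m i x \<in> eucl m"
    using assms reflect_sum[OF assms(1)] by (auto simp: corner_simplex_iff reflect_def)
  then show ?thesis by (simp add: corner_simplex_iff)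
qed

lemma reflect_ins:
  assumes "i \<le> m"
  shows "reflect (Suc m) i (ins i t x) = ins i ((1 - (\<Sum>l<m. x l)) - t) x"
  unfolding reflect_def sum_ins[OF assms] by (auto simp: ins_def)

text \<open>On each fibre in direction \<open>i\<close> the map reverses the interval,
  \<open>t\<close> going to \<open>L - t\<close>, and Lebesgue measure is invariant under
  this.\<close>

lemma corner_integral_reflect:
  assumes h: "continuous_on (corner_simplex m) h" and i: "i < m"
  shows "corner_integral m (\<lambda>x. h (reflect m i x)) = corner_integral m h"
proof -
  obtain n where m: "m = Suc n" using i by (cases m) auto
  then have i': "i \<le> n" using i by simp
  let ?C = "corner_simplex (Suc n)"
  have "continuous_on S (reflect m i)" for S
    unfolding reflect_def fun_upd_def
  proof (rule continuous_on_coordinatewise_then_product)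
    fix l show "continuous_on S (\<lambda>x. if l = i then 1 - (\<Sum>l<m. x l) else x l)"
      by (cases "l = i") (auto intro!: continuous_intros continuous_on_coordinate)
  qed
  then have hc: "continuous_on ?C (\<lambda>x. h (reflect (Suc n) i x))"
    using reflect_in[OF i] m by (intro continuous_on_compose2[OF h]) auto
  have hC: "continuous_on ?C h" using h m by simp
  have "(LINT t|lborel. (if ins i t x \<in> ?C then h (reflect (Suc n) i (ins i t x)) else 0))
      = (LINT t|lborel. (if ins i t x \<in> ?C then h (ins i t x) else 0))" if x: "x \<in> eucl n" for x
  proof -
    let ?L = "1 - (\<Sum>l<n. x l)"
    let ?\<phi> = "\<lambda>t. if ins i t x \<in> ?C then h (ins i t x) else 0"
    have iff: "ins i (?L - t) x \<in> ?C \<longleftrightarrow> ins i t x \<in> ?C" for t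
      using ins_in_corner_simplex[OF i' x] by auto
    have "(LINT t|lborel. ?\<phi> t) = \<bar>-1\<bar> *\<^sub>R (LINT t|lborel. ?\<phi> (?L + (-1) * t))"
      by (rule lborel_integral_real_affine) simp
    also have "(\<lambda>t. ?\<phi> (?L + (-1) * t)) = (\<lambda>t. if ins i t x \<in> ?C then h (reflect (Suc n) i (ins i t x)) else 0)"
    proof
      fix t
      show "?\<phi> (?L + (-1) * t) = (if ins i t x \<in> ?C then h (reflect (Suc n) i (ins i t x)) else 0)"
        using iff[of t] by (simp only: reflect_ins[OF i']) simp
    qed
    also have "\<bar>-1\<bar> *\<^sub>R (LINT t|lborel. (if ins i t x \<in> ?C then h (reflect (Suc n) i (ins i t x)) else 0))
        = (LINT t|lborel. (if ins i t x \<in> ?C then h (reflect (Suc n) i (ins i t x)) else 0))"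
      by simp
    finally show ?thesis ..
  qed
  then show ?thesis
    unfolding m corner_integral_Fubini[OF hc i'] corner_integral_Fubini[OF hC i'] using pad_in_eucl by simp
qed

lemma ins_reflect:
  assumes "j < m"
  shows "ins j (1 - (\<Sum>i<m. reflect m j x i)) (reflect m j x) = ins (Suc j) (1 - (\<Sum>i<m. x i)) x"
proof
  fix i
  consider "i < j" | "i = j" | "i = Suc j" | "i > Suc j" by linarith
  then show "ins j (1 - (\<Sum>i<m. reflect m j x i)) (reflect m j x) i = ins (Suc j) (1 - (\<Sum>i<m. x i)) x i"
    unfolding reflect_sum[OF assms] by cases (auto simp: ins_def reflect_def)
qed

text \<open>The slanted face can be parametrised by leaving out any one coordinate. Leaving out
  \<open>j\<close> or \<open>j + 1\<close> gives parametrisations that differ by a reflection, so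
  all have the same integral as the one for 0, which is the singular face with number 0.\<close>

lemma corner_integral_slant:
  assumes g: "continuous_on (corner_simplex (Suc m)) g" and j: "j \<le> m"
  shows "corner_integral m (\<lambda>x. g (ins j (1 - (\<Sum>i<m. x i)) x))
    = corner_integral m (\<lambda>x. g (ins 0 (1 - (\<Sum>i<m. x i)) x))"
  using j
proof (induction j)
  case (Suc j)
  then have "corner_integral m (\<lambda>x. g (ins (Suc j) (1 - (\<Sum>i<m. x i)) x))
      = corner_integral m (\<lambda>x. g (ins j (1 - (\<Sum>i<m. x i)) x))"
    using corner_integral_reflect[OF continuous_on_slant[OF g, of j], of j] by (simp add: ins_reflect)
  then show ?case using Suc by simp
qed simp

section \<open>Faces of a simplex in corner coordinates\<close>

lemma singular_face_affine_simplex: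
  assumes \<sigma>: "smooth_simplex (Suc k) X \<sigma>" and i: "i \<le> Suc k"
    and \<alpha>: "\<And>y. y \<in> standard_simplex k \<Longrightarrow> \<alpha> (simplex_coords k y) = simplex_coords (Suc k) (simplical_face i y)"
  shows "singular_face (Suc k) i \<sigma>
    = affine_simplex k (restrict (\<sigma> \<circ> corner_param (Suc k)) (corner_simplex (Suc k))) \<alpha>"
proof
  fix y
  show "singular_face (Suc k) i \<sigma> y
    = affine_simplex k (restrict (\<sigma> \<circ> corner_param (Suc k)) (corner_simplex (Suc k))) \<alpha> y"
  proof (cases "y \<in> standard_simplex k")
    case True
    then have "simplical_face i y \<in> standard_simplex (Suc k)"
      using i by (intro simplical_face_in_standard_simplex) auto
    then show ?thesis
      using True \<alpha>[OF True]
      by (simp add: singular_face_def affine_simplex_def simplex_coords_in corner_param_simplex_coords)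
  qed (simp add: singular_face_def affine_simplex_def)
qed

lemma simplex_coords_face_Suc:
  "y \<in> standard_simplex k \<Longrightarrow> j \<le> k \<Longrightarrow>
    ins j 0 (simplex_coords k y) = simplex_coords (Suc k) (simplical_face (Suc j) y)"
  by (auto simp: ins_def simplex_coords_def simplical_face_def fun_eq_iff)

lemma simplex_coords_face_0:
  assumes "y \<in> standard_simplex k"
  shows "ins 0 (1 - (\<Sum>i<k. simplex_coords k y i)) (simplex_coords k y) = simplex_coords (Suc k) (simplical_face 0 y)"
proof -
  have "(\<Sum>i<k. simplex_coords k y i) = (\<Sum>i<k. y (Suc i))" by (simp add: simplex_coords_def)
  then show ?thesis
    using standard_simplex_sum[OF assms] by (auto simp: ins_def simplex_coords_def simplical_face_def fun_eq_iff)
qed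

lemma list_del_upt: "list_del j [0..<Suc k] = map (\<lambda>i. if i < j then i else Suc i) [0..<k]" if "j \<le> k"
proof (rule nth_equalityI)
  show "length (list_del j [0..<Suc k]) = length (map (\<lambda>i. if i < j then i else Suc i) [0..<k])"
    using that by (simp add: list_del_def del: upt_Suc)
  fix i assume "i < length (list_del j [0..<Suc k])"
  then have "i < k" using that by (simp add: list_del_def del: upt_Suc)
  then show "list_del j [0..<Suc k] ! i = map (\<lambda>i. if i < j then i else Suc i) [0..<k] ! i"
    using that by (auto simp: list_del_def nth_append min_def simp del: upt_Suc)
qed

lemma list_split2:
  assumes "a < b" "b < length J" "J ! a = J ! b"
  obtains xs c ys zs where "J = xs @ c # ys @ c # zs"
proof -
  have "J = take b J @ J ! b # drop (Suc b) J" using assms by (intro id_take_nth_drop)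
  moreover have "take b J = take a (take b J) @ take b J ! a # drop (Suc a) (take b J)"
    using assms by (intro id_take_nth_drop) simp
  ultimately show thesis using that assms by (metis append.assoc append_Cons nth_take)
qed

text \<open>The linear inclusion of the face where coordinate \<open>j\<close> vanishes: column
  \<open>i\<close> is the coordinate vector of the \<open>i\<close>-th index different from
  \<open>j\<close>.\<close>

definition face_matrix :: "nat \<Rightarrow> nat \<Rightarrow> nat \<Rightarrow> real" where
  "face_matrix j l i = (if l = (if i < j then i else Suc i) then 1 else 0)"

text \<open>Together with \<open>slant_base\<close> this parametrises the face opposite the origin:
  the base point is the vertex \<open>e_0\<close>, and column \<open>i\<close> is
  \<open>e_(i+1) - e_0\<close>.\<close>

definition slant_matrix :: "nat \<Rightarrow> nat \<Rightarrow> real" where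
  "slant_matrix l i = (if l = 0 then -1 else if l = Suc i then 1 else 0)"

definition slant_base :: "nat \<Rightarrow> real" where
  "slant_base l = (if l = 0 then 1 else 0)"

lemma aff_ins_0:
  assumes "x \<in> eucl k" "j \<le> k"
  shows "aff (Suc k) k (\<lambda>_. 0) (face_matrix j) x = ins j 0 x"
  unfolding face_matrix_def
proof
  fix l
  have "(\<Sum>i<k. (if l = (if i < j then i else Suc i) then 1 else 0) * x i) = ins j 0 x l" if "l < Suc k"
  proof (cases "l = j")
    case False
    define i0 where "i0 = (if l < j then l else l - 1)"
    have "(\<Sum>i<k. (if l = (if i < j then i else Suc i) then 1 else 0) * x i) = (\<Sum>i<k. if i = i0 then x i else 0)"
      using False by (intro sum.cong) (auto simp: i0_def)
    also have "\<dots> = x i0" using that False assms(2) by (auto simp: i0_def sum.delta)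
    finally show ?thesis using False by (simp add: ins_def i0_def)
  qed (auto simp: ins_def intro!: sum.neutral)
  then show "aff (Suc k) k (\<lambda>_. 0) (\<lambda>l i. if l = (if i < j then i else Suc i) then 1 else 0) x l = ins j 0 x l"
    using assms by (auto simp: aff_def ins_def)
qed

lemma aff_slant:
  assumes "x \<in> eucl k"
  shows "aff (Suc k) k slant_base slant_matrix x = ins 0 (1 - (\<Sum>i<k. x i)) x"
  unfolding slant_base_def slant_matrix_def
proof
  fix l
  have "(\<Sum>i<k. (if l = Suc i then 1 else 0) * x i) = (\<Sum>i<k. if i = l - 1 then x i else 0)" if "0 < l"
    using that by (intro sum.cong) auto
  then show "aff (Suc k) k (\<lambda>l. if l = 0 then 1 else 0) (\<lambda>l i. if l = 0 then -1 else if l = Suc i then 1 else 0) x l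
    = ins 0 (1 - (\<Sum>i<k. x i)) x l"
    using assms by (cases "l = 0") (auto simp: aff_def ins_def sum_negf sum.delta)
qed

lemma singular_face_Suc_affine:
  fixes X :: "'a dspace"
  assumes \<sigma>: "smooth_simplex (Suc k) X \<sigma>" and j: "j \<le> k"
  shows "aff (Suc k) k (\<lambda>_. 0) (face_matrix j) ` corner_simplex k \<subseteq> corner_simplex (Suc k)"
    and "singular_face (Suc k) (Suc j) \<sigma>
      = affine_simplex k (restrict (\<sigma> \<circ> corner_param (Suc k)) (corner_simplex (Suc k)))
          (aff (Suc k) k (\<lambda>_. 0) (face_matrix j))"
proof -
  let ?\<alpha> = "aff (Suc k) k (\<lambda>_. 0) (face_matrix j)"
  have \<alpha>: "?\<alpha> x = ins j 0 x" if "x \<in> eucl k" for x by (rule aff_ins_0[OF that j])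
  show "?\<alpha> ` corner_simplex k \<subseteq> corner_simplex (Suc k)"
  proof (rule image_subsetI)
    fix x assume x: "x \<in> corner_simplex k"
    then have xe: "x \<in> eucl k" by (simp add: corner_simplex_iff)
    show "?\<alpha> x \<in> corner_simplex (Suc k)"
      unfolding \<alpha>[OF xe] ins_in_corner_simplex[OF j xe] using x by (simp add: corner_simplex_iff)
  qed
  show "singular_face (Suc k) (Suc j) \<sigma>
      = affine_simplex k (restrict (\<sigma> \<circ> corner_param (Suc k)) (corner_simplex (Suc k))) ?\<alpha>"
  proof (rule singular_face_affine_simplex[OF \<sigma>])
    fix y assume "y \<in> standard_simplex k"
    then show "?\<alpha> (simplex_coords k y) = simplex_coords (Suc k) (simplical_face (Suc j) y)"
      using simplex_coords_face_Suc[of y k j] j by (subst \<alpha>) (simp_all add: simplex_coords_def)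
  qed (use j in simp)
qed

lemma singular_face_0_affine:
  fixes X :: "'a dspace"
  assumes \<sigma>: "smooth_simplex (Suc k) X \<sigma>"
  shows "aff (Suc k) k slant_base slant_matrix ` corner_simplex k \<subseteq> corner_simplex (Suc k)"
    and "singular_face (Suc k) 0 \<sigma>
      = affine_simplex k (restrict (\<sigma> \<circ> corner_param (Suc k)) (corner_simplex (Suc k)))
          (aff (Suc k) k slant_base slant_matrix)"
proof -
  let ?\<alpha> = "aff (Suc k) k slant_base slant_matrix"
  have \<alpha>: "?\<alpha> x = ins 0 (1 - (\<Sum>i<k. x i)) x" if "x \<in> eucl k" for x by (rule aff_slant[OF that])
  show "?\<alpha> ` corner_simplex k \<subseteq> corner_simplex (Suc k)"
  proof (rule image_subsetI)
    fix x assume x: "x \<in> corner_simplex k"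
    then have xe: "x \<in> eucl k" by (simp add: corner_simplex_iff)
    show "?\<alpha> x \<in> corner_simplex (Suc k)"
      unfolding \<alpha>[OF xe] ins_in_corner_simplex[OF le0 xe] using x by (simp add: corner_simplex_iff)
  qed
  show "singular_face (Suc k) 0 \<sigma>
      = affine_simplex k (restrict (\<sigma> \<circ> corner_param (Suc k)) (corner_simplex (Suc k))) ?\<alpha>"
  proof (rule singular_face_affine_simplex[OF \<sigma>])
    fix y assume "y \<in> standard_simplex k"
    then show "?\<alpha> (simplex_coords k y) = simplex_coords (Suc k) (simplical_face 0 y)"
      using simplex_coords_face_0[of y k] by (subst \<alpha>) (simp_all add: simplex_coords_def)
  qed simp
qed

text \<open>A face is an affine simplex in the plot given by the simplex itself, and affine
  simplices in plots are smooth.\<close>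

lemma smooth_simplex_face:
  assumes X: "differential_space X" and \<sigma>: "smooth_simplex (Suc k) X \<sigma>" and i: "i \<le> Suc k"
  shows "smooth_simplex k X (singular_face (Suc k) i \<sigma>)"
proof (cases i)
  case 0
  show ?thesis
    unfolding 0 singular_face_0_affine(2)[OF \<sigma>]
    by (rule smooth_simplex_affine_simplex[OF X smooth_simplex_plot[OF \<sigma>] singular_face_0_affine(1)[OF \<sigma>]])
next
  case (Suc j)
  with i have j: "j \<le> k" by simp
  show ?thesis
    unfolding Suc singular_face_Suc_affine(2)[OF \<sigma> j]
    by (rule smooth_simplex_affine_simplex[OF X smooth_simplex_plot[OF \<sigma>] singular_face_Suc_affine(1)[OF \<sigma> j]])
qed

text \<open>The left hand side is the coefficient of an alternating form on the vectors
  \<open>e\<^sub>1 - e\<^sub>0, \<dots>, e\<^sub>k - e\<^sub>0\<close>, which span the face opposite to the origin.\<close>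

lemma alternating_slant:
  fixes c :: "nat list \<Rightarrow> real"
  assumes rep: "\<And>xs a ys zs. c (xs @ a # ys @ a # zs) = 0"
    and front: "\<And>xs a zs. c (xs @ a # zs) = (-1) ^ length xs * c (a # xs @ zs)"
  shows "(\<Sum>J\<in>indices k (Suc k). (\<Prod>l<k. if J ! l = 0 then -1 else if J ! l = Suc l then 1 else 0) * c J)
    = (\<Sum>j\<le>k. (-1) ^ j * c (list_del j [0..<Suc k]))"
proof -
  let ?P = "\<lambda>J. \<Prod>l<k. if J ! l = 0 then -1 else if J ! l = Suc l then 1 else (0::real)"
  define B where "B = map Suc [0..<k]"
  have lenB: "length B = k" and nthB: "\<And>l. l < k \<Longrightarrow> B ! l = Suc l" by (simp_all add: B_def)
  \<comment> \<open>Column \<open>l\<close> offers only \<open>e_(l+1)\<close> and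
    \<open>- e_0\<close>. Choosing \<open>e_0\<close> twice is killed by \<open>rep\<close>, so what
    survives is \<open>B\<close>, where it is never chosen, and the lists where it is chosen exactly
    once.\<close>
  let ?S = "insert B ((\<lambda>m. B[m := 0]) ` {..<k})"
  have SI: "?S \<subseteq> indices k (Suc k)"
  proof -
    have "set (B[m := 0]) \<subseteq> {..<Suc k}" for m
      using set_update_subset_insert[of B m 0] by (auto simp: B_def)
    then show ?thesis by (auto simp: indices_def lenB) (auto simp: B_def)
  qed
  have zero: "?P J * c J = 0" if J: "J \<in> indices k (Suc k) - ?S" for J
  proof (cases "\<exists>l<k. J ! l \<noteq> 0 \<and> J ! l \<noteq> Suc l")
    case True
    then show ?thesis by (auto intro!: prod_zero)
  next
    case False
    have lenJ: "length J = k" using J by (simp add: indices_def)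
    have "J \<noteq> B" using J by simp
    then obtain m where m: "m < k" "J ! m = 0"
      using False nth_equalityI[of J B] lenJ lenB nthB by metis
    have "J \<noteq> B[m := 0]" using J m(1) by blast
    then obtain m' where m': "m' < k" "J ! m' \<noteq> B[m := 0] ! m'"
      using nth_equalityI[of J "B[m := 0]"] lenJ lenB by auto
    have mm': "m' \<noteq> m" using m m' lenB by auto
    then have "J ! m' = 0" using m' False nthB by auto
    then have "\<exists>a b. a < b \<and> b < length J \<and> J ! a = J ! b"
      using m m'(1) mm' lenJ by (metis linorder_neqE_nat)
    then obtain xs a ys zs where "J = xs @ a # ys @ a # zs" using list_split2 by metis
    then show ?thesis using rep by simp
  qed
  have inj: "inj_on (\<lambda>m. B[m := 0]) {..<k}"
  proof (rule inj_onI)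
    fix m m' assume *: "m \<in> {..<k}" "m' \<in> {..<k}" "B[m := 0] = B[m' := 0]"
    show "m = m'"
    proof (rule ccontr)
      assume "m \<noteq> m'"
      then have "B[m' := 0] ! m = Suc m" using * nthB by simp
      then show False using * lenB by (metis lessThan_iff nat.distinct(1) nth_list_update_eq)
    qed
  qed
  have notin: "B \<notin> (\<lambda>m. B[m := 0]) ` {..<k}"
  proof
    assume "B \<in> (\<lambda>m. B[m := 0]) ` {..<k}"
    then obtain m where "m < k" "B = B[m := 0]" by auto
    then show False using lenB nthB by (metis nat.distinct(1) nth_list_update_eq)
  qed
  have PB: "?P B = 1" using nthB by simp
  have Pm: "?P (B[m := 0]) = -1" if "m < k" for m
  proof -
    have "?P (B[m := 0]) = (\<Prod>l<k. if l = m then -1 else 1)"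
      using nthB lenB by (intro prod.cong) (auto simp: nth_list_update)
    then show ?thesis using that by (simp add: prod.delta)
  qed
  \<comment> \<open>Moving the 0 at position \<open>m\<close> to the front costs
    \<open>(-1) ^ m\<close> and leaves the increasing list without \<open>m + 1\<close>. Together
    with the factor -1 from \<open>Pm\<close> this is the term for \<open>j = m + 1\<close>.\<close>
  have cm: "c (B[m := 0]) = (-1) ^ m * c (list_del (Suc m) [0..<Suc k])" if "m < k" for m
  proof -
    have upt: "[0..<Suc k] = 0 # B" by (simp add: B_def map_Suc_upt upt_conv_Cons del: upt_Suc)
    have "c (B[m := 0]) = c (take m B @ 0 # drop (Suc m) B)"
      using that lenB by (simp add: upd_conv_take_nth_drop)
    also have "\<dots> = (-1) ^ m * c (0 # take m B @ drop (Suc m) B)"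
      using front[of "take m B"] that lenB by simp
    finally show ?thesis by (simp add: list_del_def upt del: upt_Suc)
  qed
  have B0: "B = list_del 0 [0..<Suc k]"
    by (simp add: B_def list_del_def map_Suc_upt upt_conv_Cons del: upt_Suc)
  have "(\<Sum>J\<in>indices k (Suc k). ?P J * c J) = (\<Sum>J\<in>?S. ?P J * c J)"
    using zero SI by (intro sum.mono_neutral_right finite_indices) auto
  also have "\<dots> = c B + (\<Sum>m<k. ?P (B[m := 0]) * c (B[m := 0]))"
    using inj notin PB by (simp add: sum.reindex)
  also have "\<dots> = c B + (\<Sum>m<k. (-1) ^ Suc m * c (list_del (Suc m) [0..<Suc k]))"
    using Pm cm by (simp del: upt_Suc)
  also have "\<dots> = (\<Sum>j\<le>k. (-1) ^ j * c (list_del j [0..<Suc k]))"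
    unfolding sum.atMost_shift using B0 by (simp del: upt_Suc)
  finally show ?thesis .
qed

text \<open>Term \<open>j\<close> of the exterior derivative, integrated in direction
  \<open>j\<close>, leaves its coefficient on the slanted face minus the same coefficient on the
  face where coordinate \<open>j\<close> is 0. The slanted contributions add up to face 0. The
  others are the faces \<open>j + 1\<close>, whose sign in the boundary is opposite to
  \<open>(-1) ^ j\<close>.\<close>

lemma simplex_stokes:
  assumes X: "differential_space X" and \<omega>: "\<omega> \<in> forms X k" and \<sigma>: "smooth_simplex (Suc k) X \<sigma>"
  shows "simplex_integral (Suc k) (ext_deriv X k \<omega>) \<sigma>
    = (\<Sum>i\<le>Suc k. (-1) ^ i * simplex_integral k \<omega> (singular_face (Suc k) i \<sigma>))"
proof -
  let ?C = "corner_simplex (Suc k)" and ?c = "corner_simplex k"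
  define q where "q = restrict (\<sigma> \<circ> corner_param (Suc k)) ?C"
  have q: "plot X (Suc k) ?C q" unfolding q_def by (rule smooth_simplex_plot[OF \<sigma>])
  note nat = natural_form_form[OF X \<omega>]
  define g where "g j x = \<omega> (Suc k) ?C q x (list_del j [0..<Suc k])" for j x
  let ?s = "\<lambda>x. ins 0 (1 - (\<Sum>i<k. x i)) x"
  note ind = list_del_indices[OF upt_indices[of "Suc k"]]
  have g: "smooth_on (Suc k) ?C (g j)" if "j \<le> k" for j
    unfolding g_def by (rule form_smooth[OF X \<omega> q ind[OF that]])
  have gc: "continuous_on ?C (g j)" if "j \<le> k" for j
    by (rule smooth_on_continuous[OF g[OF that] plot_domain_subset[OF plot_domain_corner_simplex]])

  have face_Suc: "simplex_integral k \<omega> (singular_face (Suc k) (Suc j) \<sigma>) = corner_integral k (\<lambda>x. g j (ins j 0 x))"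
    if j: "j \<le> k" for j
  proof -
    let ?M = "face_matrix j"
    let ?\<alpha> = "aff (Suc k) k (\<lambda>_. 0) ?M"
    note \<alpha> = aff_ins_0[OF _ j]
    note \<alpha>C = singular_face_Suc_affine(1)[OF \<sigma> j]
    have "singular_face (Suc k) (Suc j) \<sigma> = affine_simplex k q ?\<alpha>"
      unfolding q_def by (rule singular_face_Suc_affine(2)[OF \<sigma> j])
    then have "simplex_integral k \<omega> (singular_face (Suc k) (Suc j) \<sigma>)
        = corner_integral k (\<lambda>x. \<Sum>J\<in>indices k (Suc k). (\<Prod>l<k. ?M (J ! l) l) * \<omega> (Suc k) ?C q (?\<alpha> x) J)"
      using simplex_integral_affine_simplex[OF nat q \<alpha>C] by simp
    also have "\<dots> = corner_integral k (\<lambda>x. g j (ins j 0 x))"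
    proof (rule corner_integral_cong)
      fix x assume "x \<in> ?c"
      then have x: "x \<in> eucl k" by (simp add: corner_simplex_iff)
      let ?J = "list_del j [0..<Suc k]"
      have nthJ: "?J ! l = (if l < j then l else Suc l)" if "l < k" for l
        using that by (simp add: list_del_upt[OF j] del: upt_Suc)
      \<comment> \<open>The columns of the face matrix are coordinate vectors, so a single
        multi-index survives, the increasing one that omits \<open>j\<close>.\<close>
      have "(\<Prod>l<k. ?M (J ! l) l) = (if J = ?J then 1 else 0)" if J: "J \<in> indices k (Suc k)" for J
      proof (cases "J = ?J")
        case True then show ?thesis using nthJ by (simp add: face_matrix_def del: upt_Suc)
      next
        case False
        moreover have "length J = k" "length ?J = k" using J ind[OF j] by (simp_all add: indices_def)
        ultimately obtain l where "l < k" "J ! l \<noteq> ?J ! l" using nth_equalityI[of J ?J] by auto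
        then have "?M (J ! l) l = 0" using nthJ[of l] by (simp add: face_matrix_def)
        then have "(\<Prod>l<k. ?M (J ! l) l) = 0" using \<open>l < k\<close> by (intro prod_zero) auto
        then show ?thesis using False by simp
      qed
      then have "(\<Sum>J\<in>indices k (Suc k). (\<Prod>l<k. ?M (J ! l) l) * \<omega> (Suc k) ?C q (?\<alpha> x) J)
          = (\<Sum>J\<in>indices k (Suc k). if J = ?J then \<omega> (Suc k) ?C q (?\<alpha> x) J else 0)"
        by (intro sum.cong) auto
      also have "\<dots> = g j (ins j 0 x)"
        using ind[OF j] by (simp add: sum.delta finite_indices g_def \<alpha>[OF x] del: upt_Suc)
      finally show "(\<Sum>J\<in>indices k (Suc k). (\<Prod>l<k. ?M (J ! l) l) * \<omega> (Suc k) ?C q (?\<alpha> x) J) = g j (ins j 0 x)" .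
    qed
    finally show ?thesis .
  qed

  have face_0: "simplex_integral k \<omega> (singular_face (Suc k) 0 \<sigma>) = (\<Sum>j\<le>k. (-1) ^ j * corner_integral k (\<lambda>x. g j (?s x)))"
  proof -
    let ?M = slant_matrix
    let ?\<alpha> = "aff (Suc k) k slant_base ?M"
    note \<alpha>C = singular_face_0_affine(1)[OF \<sigma>]
    have "singular_face (Suc k) 0 \<sigma> = affine_simplex k q ?\<alpha>"
      unfolding q_def by (rule singular_face_0_affine(2)[OF \<sigma>])
    then have "simplex_integral k \<omega> (singular_face (Suc k) 0 \<sigma>)
        = corner_integral k (\<lambda>x. \<Sum>J\<in>indices k (Suc k). (\<Prod>l<k. ?M (J ! l) l) * \<omega> (Suc k) ?C q (?\<alpha> x) J)"
      using simplex_integral_affine_simplex[OF nat q \<alpha>C] by simp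
    also have "\<dots> = corner_integral k (\<lambda>x. \<Sum>j\<le>k. (-1) ^ j * g j (?s x))"
    proof (rule corner_integral_cong)
      fix x assume "x \<in> ?c"
      then have x: "x \<in> eucl k" by (simp add: corner_simplex_iff)
      show "(\<Sum>J\<in>indices k (Suc k). (\<Prod>l<k. ?M (J ! l) l) * \<omega> (Suc k) ?C q (?\<alpha> x) J) = (\<Sum>j\<le>k. (-1) ^ j * g j (?s x))"
        unfolding g_def aff_slant[OF x] slant_matrix_def
        by (rule alternating_slant) (rule form_repeated[OF \<omega>], rule form_move_front[OF \<omega>])
    qed
    also have "\<dots> = (\<Sum>j\<le>k. (-1) ^ j * corner_integral k (\<lambda>x. g j (?s x)))"
    proof (subst corner_integral_sum)
      show "continuous_on ?c (\<lambda>x. (-1) ^ j * g j (?s x))" if "j \<in> {..k}" for j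
        using that by (intro continuous_intros continuous_on_slant gc) auto
    qed (simp add: corner_integral_cmult)
    finally show ?thesis .
  qed

  have "simplex_integral (Suc k) (ext_deriv X k \<omega>) \<sigma>
      = corner_integral (Suc k) (\<lambda>x. \<Sum>j\<le>k. (-1) ^ j * partial_deriv_on (Suc k) ?C j (g j) x)"
    unfolding simplex_integral_eq q_def[symmetric]
  proof (rule corner_integral_cong)
    fix x assume x: "x \<in> ?C"
    show "ext_deriv X k \<omega> (Suc k) ?C q x [0..<Suc k] = (\<Sum>j\<le>k. (-1) ^ j * partial_deriv_on (Suc k) ?C j (g j) x)"
      using q x upt_indices[of "Suc k"]
      by (simp add: ext_deriv_def g_def[abs_def] list_del_def nth_upt less_Suc_eq_le del: upt_Suc)
  qed
  also have "\<dots> = (\<Sum>j\<le>k. (-1) ^ j * corner_integral (Suc k) (partial_deriv_on (Suc k) ?C j (g j)))"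
  proof (subst corner_integral_sum)
    show "continuous_on ?C (\<lambda>x. (-1) ^ j * partial_deriv_on (Suc k) ?C j (g j) x)" if "j \<in> {..k}" for j
      using that smooth_on_continuous[OF smooth_on_partial_deriv_on[OF plot_domain_corner_simplex g, of j j]
          plot_domain_subset[OF plot_domain_corner_simplex]]
      by (intro continuous_intros) auto
  qed (simp add: corner_integral_cmult)
  also have "\<dots> = (\<Sum>j\<le>k. (-1) ^ j * corner_integral k (\<lambda>x. g j (?s x)) - (-1) ^ j * corner_integral k (\<lambda>x. g j (ins j 0 x)))"
  proof (rule sum.cong[OF refl])
    fix j assume "j \<in> {..k}"
    then have j: "j \<le> k" by simp
    show "(-1) ^ j * corner_integral (Suc k) (partial_deriv_on (Suc k) ?C j (g j))
      = (-1) ^ j * corner_integral k (\<lambda>x. g j (?s x)) - (-1) ^ j * corner_integral k (\<lambda>x. g j (ins j 0 x))"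
      unfolding corner_integral_partial_deriv[OF g[OF j] j] corner_integral_slant[OF gc[OF j] j]
      by (rule right_diff_distrib)
  qed
  also have "\<dots> = (\<Sum>i\<le>Suc k. (-1) ^ i * simplex_integral k \<omega> (singular_face (Suc k) i \<sigma>))"
    unfolding sum.atMost_Suc_shift by (simp add: face_0 face_Suc sum_subtractf sum_negf)
  finally show ?thesis .
qed

section \<open>Extending homomorphisms on free abelian groups\<close>

definition add_subgroup :: "'c::ab_group_add set \<Rightarrow> bool" where
  "add_subgroup H \<longleftrightarrow> 0 \<in> H \<and> (\<forall>x\<in>H. \<forall>y\<in>H. x - y \<in> H)"

lemma add_subgroupD:
  assumes "add_subgroup H"
  shows "0 \<in> H" "x \<in> H \<Longrightarrow> y \<in> H \<Longrightarrow> x - y \<in> H" "x \<in> H \<Longrightarrow> - x \<in> H"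
    "x \<in> H \<Longrightarrow> y \<in> H \<Longrightarrow> x + y \<in> H"
proof -
  show 0: "0 \<in> H" and minus: "\<And>x y. x \<in> H \<Longrightarrow> y \<in> H \<Longrightarrow> x - y \<in> H"
    using assms by (auto simp: add_subgroup_def)
  show neg: "\<And>x. x \<in> H \<Longrightarrow> - x \<in> H" using minus[OF 0] by simp
  show "x \<in> H \<Longrightarrow> y \<in> H \<Longrightarrow> x + y \<in> H" using minus[of x "- y"] neg by simp
qed

lemma add_subgroup_int_multiple:
  assumes "add_subgroup \<Gamma>" "(x, y) \<in> \<Gamma>"
  shows "(frag_cmul n x, of_int n * y) \<in> (\<Gamma> :: (('a \<Rightarrow>\<^sub>0 int) \<times> real) set)"
proof (induction n rule: int_induct[where k = 0])
  case base
  then show ?case using add_subgroupD(1)[OF assms(1)] by (simp add: zero_prod_def)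
next
  case (step1 i)
  then show ?case using add_subgroupD(4)[OF assms(1) step1(2) assms(2)]
    by (simp add: frag_cmul_distrib distrib_right)
next
  case (step2 i)
  then show ?case using add_subgroupD(2)[OF assms(1) step2(2) assms(2)]
    by (simp add: left_diff_distrib frag_cmul_distrib[of i "-1", simplified])
qed

text \<open>Homomorphisms into \<open>\<real>/T\<close> extend, because this group is divisible.  Zorn's lemma is applied to
  their graphs, which are subgroups of the product.\<close>

lemma hom_mod_extension:
  fixes H :: "('a \<Rightarrow>\<^sub>0 int) set" and T :: "real set"
  assumes H: "add_subgroup H" and T: "add_subgroup T"
    and f: "\<And>x y. x \<in> H \<Longrightarrow> y \<in> H \<Longrightarrow> f (x - y) - (f x - f y) \<in> T"
  obtains F where "\<And>x y. F (x + y) - (F x + F y) \<in> T" "\<And>x. x \<in> H \<Longrightarrow> F x - f x \<in> T"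
proof -
  note Td = add_subgroupD[OF T] and Hd = add_subgroupD[OF H]
  \<comment> \<open>The graph contains every representative modulo \<open>T\<close>, which makes it
    a subgroup although \<open>f\<close> is additive only modulo \<open>T\<close>.\<close>
  define \<Gamma>0 where "\<Gamma>0 = {(x, y). x \<in> H \<and> y - f x \<in> T}"
  \<comment> \<open>For a subgroup, the condition on the pairs \<open>(0, y)\<close> says that the
    relation is single-valued modulo \<open>T\<close>.\<close>
  define \<A> where "\<A> = {\<Gamma>. add_subgroup \<Gamma> \<and> \<Gamma>0 \<subseteq> \<Gamma> \<and> (\<forall>y. (0, y) \<in> \<Gamma> \<longrightarrow> y \<in> T)}"
  have f0: "f 0 \<in> T" using f[of 0 0] Hd(1) by simp
  have "add_subgroup \<Gamma>0"
    unfolding add_subgroup_def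
  proof (intro conjI ballI)
    show "0 \<in> \<Gamma>0" using Hd(1) Td(3)[OF f0] by (simp add: \<Gamma>0_def zero_prod_def)
    fix a b assume "a \<in> \<Gamma>0" "b \<in> \<Gamma>0"
    then obtain x y x' y' where ab: "a = (x, y)" "b = (x', y')" "x \<in> H" "x' \<in> H" "y - f x \<in> T" "y' - f x' \<in> T"
      by (auto simp: \<Gamma>0_def)
    have "(y - f x) - (y' - f x') - (f (x - x') - (f x - f x')) \<in> T"
      by (rule Td(2)[OF Td(2)[OF ab(5,6)] f[OF ab(3,4)]])
    then have "(y - y') - f (x - x') \<in> T" by (simp add: algebra_simps)
    then show "a - b \<in> \<Gamma>0" using ab Hd(2) by (simp add: \<Gamma>0_def)
  qed
  moreover have "y \<in> T" if "(0, y) \<in> \<Gamma>0" for y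
    using that Td(4)[OF _ f0, of "y - f 0"] by (simp add: \<Gamma>0_def)
  ultimately have "\<Gamma>0 \<in> \<A>" by (simp add: \<A>_def)
  then have "\<A> \<noteq> {}" by blast
  moreover have "\<Union>\<C> \<in> \<A>" if C: "\<C> \<noteq> {}" "subset.chain \<A> \<C>" for \<C>
  proof -
    have CA: "\<And>\<Gamma>. \<Gamma> \<in> \<C> \<Longrightarrow> \<Gamma> \<in> \<A>" using C(2) by (auto simp: subset.chain_def)
    have "0 \<in> \<Union>\<C>" using C(1) CA by (auto simp: \<A>_def add_subgroup_def)
    moreover have "a - b \<in> \<Union>\<C>" if ab: "a \<in> \<Union>\<C>" "b \<in> \<Union>\<C>" for a b
    proof -
      obtain G G' where G: "G \<in> \<C>" "G' \<in> \<C>" "a \<in> G" "b \<in> G'" using ab by blast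
      then have "G \<subseteq> G' \<or> G' \<subseteq> G" using C(2) by (auto simp: subset_chain_def)
      then obtain K where "K \<in> \<C>" "a \<in> K" "b \<in> K" using G by blast
      then show ?thesis using CA[of K] by (auto simp: \<A>_def add_subgroup_def)
    qed
    ultimately have "add_subgroup (\<Union>\<C>)" by (simp add: add_subgroup_def)
    moreover have "\<Gamma>0 \<subseteq> \<Union>\<C>" using C(1) CA by (fastforce simp: \<A>_def)
    moreover have "\<forall>y. (0, y) \<in> \<Union>\<C> \<longrightarrow> y \<in> T" using CA by (auto simp: \<A>_def)
    ultimately show ?thesis unfolding \<A>_def by blast
  qed
  ultimately obtain \<Gamma> where \<Gamma>: "\<Gamma> \<in> \<A>" and max: "\<And>\<Gamma>'. \<Gamma>' \<in> \<A> \<Longrightarrow> \<Gamma> \<subseteq> \<Gamma>' \<Longrightarrow> \<Gamma>' = \<Gamma>"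
    using subset_Zorn_nonempty[of \<A>] by blast
  have sub: "add_subgroup \<Gamma>" and \<Gamma>0: "\<Gamma>0 \<subseteq> \<Gamma>" and \<Gamma>T: "\<And>y. (0, y) \<in> \<Gamma> \<Longrightarrow> y \<in> T"
    using \<Gamma> by (auto simp: \<A>_def)
  note \<Gamma>d = add_subgroupD[OF sub]
  have dom: "\<exists>r. (g, r) \<in> \<Gamma>" for g
  proof -
    \<comment> \<open>The condition under which \<open>(g, r)\<close> can be adjoined without
      producing a pair \<open>(0, z)\<close> with \<open>z\<close> outside \<open>T\<close>.\<close>
    have "\<exists>r. \<forall>m y. (frag_cmul m g, y) \<in> \<Gamma> \<longrightarrow> y - of_int m * r \<in> T"
    proof (cases "\<exists>n::nat. 0 < n \<and> (\<exists>s. (frag_cmul (int n) g, s) \<in> \<Gamma>)")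
      case True
      \<comment> \<open>The integers \<open>m\<close> for which \<open>m\<close> times
        \<open>g\<close> lies in the domain are the multiples of the least positive one,
        \<open>n\<close>. Divisibility enters here: \<open>s / n\<close> is taken as the value at
        \<open>g\<close>, where \<open>s\<close> is a value at \<open>n\<close> times
        \<open>g\<close>.\<close>
      define n where "n = (LEAST n. 0 < n \<and> (\<exists>s. (frag_cmul (int n) g, s) \<in> \<Gamma>))"
      have n: "0 < n \<and> (\<exists>s. (frag_cmul (int n) g, s) \<in> \<Gamma>)" using LeastI_ex[OF True] unfolding n_def .
      then obtain s where s: "(frag_cmul (int n) g, s) \<in> \<Gamma>" by blast
      have "y - of_int m * (s / real n) \<in> T" if my: "(frag_cmul m g, y) \<in> \<Gamma>" for m y
      proof -
        define q where "q = m div int n"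
        define r where "r = nat (m mod int n)"
        have m: "m = q * int n + int r" and "r < n"
          using n by (auto simp: q_def r_def nat_less_iff)
        have qs: "(frag_cmul (q * int n) g, of_int q * s) \<in> \<Gamma>"
          using add_subgroup_int_multiple[OF sub s, of q] by simp
        from \<Gamma>d(2)[OF my qs] have rg: "(frag_cmul (int r) g, y - of_int q * s) \<in> \<Gamma>"
          by (simp add: m frag_cmul_distrib)
        have "r = 0"
        proof (rule ccontr)
          assume "r \<noteq> 0"
          then have "n \<le> r" unfolding n_def using rg by (intro Least_le) auto
          then show False using \<open>r < n\<close> by simp
        qed
        then have "y - of_int q * s \<in> T" using rg \<Gamma>T by simp
        moreover have "of_int m * (s / real n) = of_int q * s" using n m \<open>r = 0\<close> by simp
        ultimately show ?thesis by simp
      qed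
      then show ?thesis by blast
    next
      case False
      \<comment> \<open>No nonzero multiple of \<open>g\<close> lies in the domain, so the value at
        \<open>g\<close> is free and 0 is taken.\<close>
      have "y \<in> T" if my: "(frag_cmul m g, y) \<in> \<Gamma>" for m y
      proof -
        have "m = 0"
        proof (rule ccontr)
          assume "m \<noteq> 0"
          have "(frag_cmul (int (nat \<bar>m\<bar>)) g, of_int (sgn m) * y) \<in> \<Gamma>"
          proof -
            have "int (nat \<bar>m\<bar>) = \<bar>m\<bar>" by simp
            also have "\<dots> = sgn m * m" by (simp add: abs_sgn mult.commute)
            finally show ?thesis
              using add_subgroup_int_multiple[OF sub my, of "sgn m"] by (simp only: frag_cmul_cmul)
          qed
          then show False using False \<open>m \<noteq> 0\<close> by (metis zero_less_abs_iff zero_less_nat_eq)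
        qed
        then show ?thesis using my \<Gamma>T by simp
      qed
      then show ?thesis by (intro exI[of _ 0]) simp
    qed
    then obtain r where r: "\<And>m y. (frag_cmul m g, y) \<in> \<Gamma> \<Longrightarrow> y - of_int m * r \<in> T" by blast
    define \<Gamma>' where "\<Gamma>' = {(x + frag_cmul m g, y + of_int m * r) | x y m. (x, y) \<in> \<Gamma>}"
    have \<Gamma>'I: "(x + frag_cmul m g, y + of_int m * r) \<in> \<Gamma>'" if "(x, y) \<in> \<Gamma>" for x y m
      using that unfolding \<Gamma>'_def by blast
    have "\<Gamma> \<subseteq> \<Gamma>'" using \<Gamma>'I[of _ _ 0] by auto
    moreover have "\<Gamma>' \<in> \<A>"
    proof -
      have "add_subgroup \<Gamma>'"
        unfolding add_subgroup_def
      proof (intro conjI ballI)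
        show "0 \<in> \<Gamma>'" using \<open>\<Gamma> \<subseteq> \<Gamma>'\<close> \<Gamma>d(1) by blast
        fix a b assume "a \<in> \<Gamma>'" "b \<in> \<Gamma>'"
        then obtain x y m x' y' m' where ab: "(x, y) \<in> \<Gamma>" "(x', y') \<in> \<Gamma>"
          "a = (x + frag_cmul m g, y + of_int m * r)" "b = (x' + frag_cmul m' g, y' + of_int m' * r)"
          unfolding \<Gamma>'_def by blast
        have "frag_cmul (m - m') g = frag_cmul m g - frag_cmul m' g"
          using frag_cmul_distrib[of m "- m'" g] by simp
        then have "a - b = ((x - x') + frag_cmul (m - m') g, (y - y') + of_int (m - m') * r)"
          using ab by (simp add: left_diff_distrib)
        then show "a - b \<in> \<Gamma>'" using \<Gamma>'I[OF \<Gamma>d(2)[OF ab(1,2), simplified], of "m - m'"] by simp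
      qed
      moreover have "z \<in> T" if z: "(0, z) \<in> \<Gamma>'" for z
      proof -
        obtain x y m where xy: "(x, y) \<in> \<Gamma>" "x + frag_cmul m g = 0" "z = y + of_int m * r"
          using z unfolding \<Gamma>'_def by auto
        have "frag_cmul (- m) g = - frag_cmul m g" using frag_cmul_cmul[of "-1" m g] by simp
        then have "x = frag_cmul (- m) g" using xy(2) by (metis eq_neg_iff_add_eq_0)
        then show ?thesis using r[of "- m" y] xy by simp
      qed
      ultimately show ?thesis using \<Gamma>0 \<open>\<Gamma> \<subseteq> \<Gamma>'\<close> by (auto simp: \<A>_def)
    qed
    ultimately have "\<Gamma>' = \<Gamma>" using max by blast
    moreover have "(g, r) \<in> \<Gamma>'" using \<Gamma>'I[of 0 0 1] \<Gamma>d(1) by (simp add: zero_prod_def)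
    ultimately show ?thesis by blast
  qed
  \<comment> \<open>By maximality the domain is the whole group. \<open>F\<close> picks
    representatives and is therefore additive only modulo \<open>T\<close>.\<close>
  define F where "F g = (SOME r. (g, r) \<in> \<Gamma>)" for g
  have F: "(g, F g) \<in> \<Gamma>" for g unfolding F_def by (rule someI_ex[OF dom])
  show thesis
  proof (rule that[of F])
    fix x y
    have "(x + y, F (x + y)) - ((x, F x) + (y, F y)) \<in> \<Gamma>" by (intro \<Gamma>d(2,4) F)
    then show "F (x + y) - (F x + F y) \<in> T" by (intro \<Gamma>T) simp
  next
    fix x assume "x \<in> H"
    then have "(x, f x) \<in> \<Gamma>" using \<Gamma>0 Td(1) by (auto simp: \<Gamma>0_def)
    from \<Gamma>d(2)[OF F[of x] this] show "F x - f x \<in> T" by (intro \<Gamma>T) simp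
  qed
qed

lemma add_subgroup_zero: "add_subgroup {0}"
  by (simp add: add_subgroup_def)

lemma add_subgroup_Ints: "add_subgroup (\<int> :: real set)"
  by (simp add: add_subgroup_def)

section \<open>Additive functions on free abelian groups\<close>

definition frag_sum :: "('a \<Rightarrow> real) \<Rightarrow> ('a \<Rightarrow>\<^sub>0 int) \<Rightarrow> real" where
  "frag_sum h c = (\<Sum>\<sigma>\<in>Poly_Mapping.keys c. of_int (Poly_Mapping.lookup c \<sigma>) * h \<sigma>)"

lemma frag_sum_superset:
  "finite F \<Longrightarrow> Poly_Mapping.keys c \<subseteq> F \<Longrightarrow> frag_sum h c = (\<Sum>\<sigma>\<in>F. of_int (Poly_Mapping.lookup c \<sigma>) * h \<sigma>)"
  unfolding frag_sum_def by (rule sum.mono_neutral_left) (auto simp: in_keys_iff)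

lemma frag_sum_add: "frag_sum h (a + b) = frag_sum h a + frag_sum h b"
proof -
  let ?F = "Poly_Mapping.keys a \<union> Poly_Mapping.keys b"
  have "Poly_Mapping.keys (a + b) \<subseteq> ?F" by (rule Poly_Mapping.keys_add)
  then show ?thesis
    using frag_sum_superset[of ?F "a + b" h] frag_sum_superset[of ?F a h] frag_sum_superset[of ?F b h]
    by (simp add: lookup_add distrib_right sum.distrib)
qed

lemma frag_sum_0 [simp]: "frag_sum h 0 = 0"
  by (simp add: frag_sum_def)

lemma additive_zero:
  fixes G :: "'c::ab_group_add \<Rightarrow> 'g::ab_group_add"
  assumes "\<And>x y. G (x + y) = G x + G y"
  shows "G 0 = 0" "G (- x) = - G x" "G (x - y) = G x - G y"
proof -
  show 0: "G 0 = 0" using assms[of 0 0] by simp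
  show neg: "G (- x) = - G x" for x using assms[of x "- x"] 0 by (simp add: eq_neg_iff_add_eq_0 add.commute)
  show "G (x - y) = G x - G y" using assms[of x "- y"] neg by simp
qed

lemmas frag_sum_diff = additive_zero(3)[of "frag_sum h" for h, OF frag_sum_add]
  and frag_sum_minus = additive_zero(2)[of "frag_sum h" for h, OF frag_sum_add]

lemma frag_sum_of [simp]: "frag_sum h (frag_of \<sigma>) = h \<sigma>"
  by (simp add: frag_sum_def)

lemma frag_sum_cmul: "frag_sum h (frag_cmul n c) = of_int n * frag_sum h c"
proof (induction n rule: int_induct[where k = 0])
  case (step1 i)
  then show ?case by (simp add: frag_cmul_distrib frag_sum_add distrib_right)
next
  case (step2 i)
  then show ?case
    using frag_cmul_distrib[of i "-1" c] by (simp add: frag_sum_diff left_diff_distrib)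
qed simp

lemma frag_sum_sum: "frag_sum h (sum c F) = (\<Sum>i\<in>F. frag_sum h (c i))"
  by (induction F rule: infinite_finite_induct) (simp_all add: frag_sum_add)

text \<open>Freeness of the group: keep the values of \<open>F\<close> on the generators and extend
  additively. The defect is integral on generators, hence everywhere.\<close>

lemma integral_lift:
  fixes F :: "('a \<Rightarrow>\<^sub>0 int) \<Rightarrow> real"
  assumes F: "\<And>x y. F (x + y) - (F x + F y) \<in> \<int>"
  obtains G where "\<And>x y. G (x + y) = G x + G y" "\<And>x. G x - F x \<in> \<int>"
proof
  show "frag_sum (\<lambda>\<sigma>. F (frag_of \<sigma>)) (x + y) = frag_sum (\<lambda>\<sigma>. F (frag_of \<sigma>)) x + frag_sum (\<lambda>\<sigma>. F (frag_of \<sigma>)) y" for x y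
    by (rule frag_sum_add)
  have "F 0 \<in> \<int>" using F[of 0 0] by simp
  show "frag_sum (\<lambda>\<sigma>. F (frag_of \<sigma>)) x - F x \<in> \<int>" for x
  proof (induction x rule: frag_induction[OF subset_UNIV, case_names zero one diff])
    case zero
    show ?case using \<open>F 0 \<in> \<int>\<close> by simp
  next
    case (diff a b)
    have "(frag_sum (\<lambda>\<sigma>. F (frag_of \<sigma>)) a - F a) - (frag_sum (\<lambda>\<sigma>. F (frag_of \<sigma>)) b - F b)
        + (F (a - b + b) - (F (a - b) + F b)) \<in> \<int>"
      by (rule Ints_add[OF Ints_diff[OF diff] F])
    then show ?case by (simp add: frag_sum_diff algebra_simps)
  qed simp
qed

section \<open>The circle group and extension of characters\<close>

lemma exp2pi_add: "exp2pi (a + b) = exp2pi a * exp2pi b"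
  by (simp add: exp2pi_def distrib_left exp_add)

lemma exp2pi_minus: "exp2pi (- a) = inverse (exp2pi a)"
  by (simp add: exp2pi_def exp_minus)

lemma exp2pi_diff: "exp2pi (a - b) = exp2pi a / exp2pi b"
  by (simp add: exp2pi_def exp_diff right_diff_distrib)

lemma cmod_exp2pi [simp]: "cmod (exp2pi a) = 1"
  by (simp add: exp2pi_def)

lemma exp2pi_nonzero [simp]: "exp2pi a \<noteq> 0"
  by (simp add: exp2pi_def)

lemma exp2pi_0 [simp]: "exp2pi 0 = 1"
  by (simp add: exp2pi_def)

lemma exp2pi_eq_1_iff: "exp2pi a = 1 \<longleftrightarrow> a \<in> \<int>"
proof -
  have "exp2pi a = 1 \<longleftrightarrow> (\<exists>n::int. 2 * pi * a = of_int (2 * n) * pi)"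
    by (simp add: exp2pi_def exp_eq_1)
  also have "\<dots> \<longleftrightarrow> (\<exists>n::int. a = of_int n)" by simp
  finally show ?thesis by (auto elim!: Ints_cases)
qed

lemma exp2pi_eq_iff: "exp2pi a = exp2pi b \<longleftrightarrow> a - b \<in> \<int>"
  unfolding exp2pi_eq_1_iff[symmetric] exp2pi_diff by simp

lemma exp2pi_surj: "cmod z = 1 \<Longrightarrow> \<exists>r. exp2pi r = z"
proof -
  assume z: "cmod z = 1"
  have "exp2pi (Arg z / (2 * pi)) = exp (\<i> * complex_of_real (Arg z))"
    by (simp add: exp2pi_def mult_ac)
  also have "\<dots> = z" using Arg_eq[of z] z by fastforce
  finally show ?thesis ..
qed

lemma U1_homsD:
  assumes "h \<in> U1_homs Z"
  shows "x \<in> Z \<Longrightarrow> cmod (h x) = 1" "x \<in> Z \<Longrightarrow> y \<in> Z \<Longrightarrow> h (x + y) = h x * h y" "x \<notin> Z \<Longrightarrow> h x = 1"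
  using assms by (auto simp: U1_homs_def)

lemma U1_homs_zero:
  assumes "h \<in> U1_homs Z" "add_subgroup Z"
  shows "h 0 = 1" "x \<in> Z \<Longrightarrow> h (- x) = inverse (h x)" "x \<in> Z \<Longrightarrow> y \<in> Z \<Longrightarrow> h (x - y) = h x / h y"
proof -
  note hD = U1_homsD[OF assms(1)] and Z = add_subgroupD[OF assms(2)]
  have nz: "h x \<noteq> 0" if "x \<in> Z" for x using hD(1)[OF that] by auto
  show 0: "h 0 = 1" using hD(2)[OF Z(1) Z(1)] nz[OF Z(1)] by simp
  show neg: "h (- x) = inverse (h x)" if "x \<in> Z" for x
    using hD(2)[OF that Z(3)[OF that]] nz[OF that] 0 by (simp add: field_simps)
  show "h (x - y) = h x / h y" if "x \<in> Z" "y \<in> Z"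
    using hD(2)[OF that(1) Z(3)[OF that(2)]] neg[OF that(2)] by (simp add: divide_inverse)
qed

lemma hom_Ints_extension:
  fixes H :: "('a \<Rightarrow>\<^sub>0 int) set"
  assumes "add_subgroup H" "\<And>x y. x \<in> H \<Longrightarrow> y \<in> H \<Longrightarrow> f (x - y) - (f x - f y) \<in> \<int>"
  obtains G where "\<And>x y. G (x + y) = G x + G y" "\<And>x. x \<in> H \<Longrightarrow> G x - f x \<in> (\<int> :: real set)"
proof -
  obtain F where F: "\<And>x y. F (x + y) - (F x + F y) \<in> \<int>" "\<And>x. x \<in> H \<Longrightarrow> F x - f x \<in> \<int>"
    by (rule hom_mod_extension[OF assms(1) add_subgroup_Ints assms(2)]) (assumption+, rule that)
  obtain G where G: "\<And>x y. G (x + y) = G x + G y" "\<And>x. G x - F x \<in> \<int>"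
    by (rule integral_lift[OF F(1)]) (rule that)
  show thesis
  proof (rule that[OF G(1)])
    show "G x - f x \<in> \<int>" if "x \<in> H" for x
      using Ints_add[OF G(2)[of x] F(2)[OF that]] by simp
  qed
qed

text \<open>The lift is additive on the entire free group and not merely on \<open>H\<close>. It may
  therefore be evaluated on single chains as well as on cycles, and restricting it to a larger
  subgroup extends the character \<open>h\<close>.\<close>

lemma U1_hom_lift:
  fixes H :: "('a \<Rightarrow>\<^sub>0 int) set"
  assumes H: "add_subgroup H" and h: "h \<in> U1_homs H"
  obtains G where "\<And>x y. G (x + y) = G x + G y" "\<And>x. x \<in> H \<Longrightarrow> h x = exp2pi (G x)"
proof -
  define f where "f x = (SOME r. exp2pi r = h x)" for x
  have f: "exp2pi (f x) = h x" if "x \<in> H" for x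
    unfolding f_def using exp2pi_surj[OF U1_homsD(1)[OF h that]] by (rule someI_ex)
  have "f (x - y) - (f x - f y) \<in> \<int>" if "x \<in> H" "y \<in> H" for x y
    using that f U1_homs_zero(3)[OF h H] add_subgroupD(2)[OF H]
    by (simp add: exp2pi_eq_iff[symmetric] exp2pi_diff)
  then obtain G where G: "\<And>x y. G (x + y) = G x + G y" "\<And>x. x \<in> H \<Longrightarrow> G x - f x \<in> \<int>"
    by (rule hom_Ints_extension[OF H]) (assumption+, rule that)
  show thesis
    by (rule that[OF G(1)]) (use G(2) f exp2pi_eq_iff in metis)
qed

text \<open>The divisible extension for \<open>T = {0}\<close>, where additivity modulo
  \<open>T\<close> is additivity.\<close>

lemma real_hom_extension:
  fixes H :: "('a \<Rightarrow>\<^sub>0 int) set" and f :: "('a \<Rightarrow>\<^sub>0 int) \<Rightarrow> real"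
  assumes H: "add_subgroup H" and f: "\<And>x y. x \<in> H \<Longrightarrow> y \<in> H \<Longrightarrow> f (x + y) = f x + f y"
  obtains G where "\<And>x y. G (x + y) = G x + G y" "\<And>x. x \<in> H \<Longrightarrow> G x = f x"
proof -
  have "f (x - y) - (f x - f y) \<in> {0}" if "x \<in> H" "y \<in> H" for x y
    using f[OF add_subgroupD(2)[OF H that] that(2)] by simp
  then obtain G where "\<And>x y. G (x + y) - (G x + G y) \<in> {0}" "\<And>x. x \<in> H \<Longrightarrow> G x - f x \<in> {0}"
    by (rule hom_mod_extension[OF H add_subgroup_zero]) (assumption+, rule that)
  then show thesis using that[of G] by simp
qed

text \<open>Cycles are a direct summand, as their quotient is a subgroup of a free abelian group.  This is
  circumvented here: extend to a real homomorphism and correct it modulo \<open>\<int>\<close> by one that factors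
  through the boundary.\<close>

lemma integral_hom_extension:
  fixes C :: "('a \<Rightarrow>\<^sub>0 int) set" and bd :: "('a \<Rightarrow>\<^sub>0 int) \<Rightarrow> ('b \<Rightarrow>\<^sub>0 int)"
  assumes C: "add_subgroup C" and bd: "\<And>x y. bd (x + y) = bd x + bd y"
    and d: "\<And>x y. x \<in> C \<Longrightarrow> bd x = 0 \<Longrightarrow> y \<in> C \<Longrightarrow> bd y = 0 \<Longrightarrow> d (x + y) = d x + d y"
    and d_int: "\<And>x. x \<in> C \<Longrightarrow> bd x = 0 \<Longrightarrow> d x \<in> \<int>"
  obtains n :: "('a \<Rightarrow>\<^sub>0 int) \<Rightarrow> real" where "\<And>x y. n (x + y) = n x + n y" "\<And>x. x \<in> C \<Longrightarrow> n x \<in> \<int>"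
    "\<And>x. x \<in> C \<Longrightarrow> bd x = 0 \<Longrightarrow> n x = d x"
proof -
  note Cd = add_subgroupD[OF C] and bd0 = additive_zero[of bd, OF bd]
  let ?H = "{x \<in> C. bd x = 0}"
  have H: "add_subgroup ?H" using Cd bd0 by (simp add: add_subgroup_def)
  obtain e where e: "\<And>x y. e (x + y) = e x + e y" "\<And>x. x \<in> ?H \<Longrightarrow> e x = d x"
    by (rule real_hom_extension[OF H, of d]) (use d in simp, rule that)
  note e0 = additive_zero[of e, OF e(1)]
  have eZ: "e x \<in> \<int>" if "x \<in> C" "bd x = 0" for x using e(2)[of x] d_int that by simp
  \<comment> \<open>\<open>e\<close> is integral on cycles, so modulo integers its value depends on
    the boundary alone. \<open>f\<close> is this function of the boundary, read off at some
    preimage.\<close>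
  define f where "f b = e (SOME x. x \<in> C \<and> bd x = b)" for b
  have f: "e x - f (bd x) \<in> \<int>" if "x \<in> C" for x
  proof -
    let ?y = "SOME y. y \<in> C \<and> bd y = bd x"
    have "?y \<in> C \<and> bd ?y = bd x" by (rule someI[of _ x]) (use that in simp)
    then have "e (x - ?y) \<in> \<int>" using Cd that bd0 by (intro eZ) auto
    then show ?thesis by (simp add: f_def e0)
  qed
  have B: "add_subgroup (bd ` C)"
    unfolding add_subgroup_def using Cd bd0 by (auto intro: image_eqI[of _ bd 0]) (metis image_eqI)
  have "f (b - b') - (f b - f b') \<in> \<int>" if bb': "b \<in> bd ` C" "b' \<in> bd ` C" for b b'
  proof -
    obtain x x' where x: "x \<in> C" "x' \<in> C" "b = bd x" "b' = bd x'" using bb' by blast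
    have "(e x - f (bd x)) - (e x' - f (bd x')) - (e (x - x') - f (bd (x - x'))) \<in> \<int>"
      using x Cd by (intro Ints_diff f) auto
    then show ?thesis using x by (simp add: e0 bd0 algebra_simps)
  qed
  then obtain m where m: "\<And>x y. m (x + y) = m x + m y" "\<And>b. b \<in> bd ` C \<Longrightarrow> m b - f b \<in> \<int>"
    by (rule hom_Ints_extension[OF B]) (assumption+, rule that)
  note m0 = additive_zero[of m, OF m(1)]
  \<comment> \<open>Subtracting \<open>m\<close> of the boundary makes \<open>e\<close> integral on
    \<open>C\<close> and changes nothing on cycles, because \<open>m 0 = 0\<close>.\<close>
  show thesis
  proof (rule that[of "\<lambda>x. e x - m (bd x)"])
    show "e (x + y) - m (bd (x + y)) = e x - m (bd x) + (e y - m (bd y))" for x y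
      by (simp add: e bd m)
    show "e x - m (bd x) \<in> \<int>" if "x \<in> C" for x
      using Ints_diff[OF f[OF that] m(2)[of "bd x"]] that by simp
    show "e x - m (bd x) = d x" if "x \<in> C" "bd x = 0" for x
      using that e(2)[of x] m0(1) by simp
  qed
qed

section \<open>Cohomology of complexes\<close>

definition is_complex :: "('c::ab_group_add) chain_complex \<Rightarrow> bool" where
  "is_complex K \<longleftrightarrow> (\<forall>p. add_subgroup (chains K p)) \<and>
     (\<forall>p. \<forall>x\<in>chains K p. \<forall>y\<in>chains K p. cbd K p (x + y) = cbd K p x + cbd K p y) \<and>
     (\<forall>p. \<forall>x\<in>chains K (Suc p). cbd K (Suc p) x \<in> chains K p) \<and>
     (\<forall>p. \<forall>x\<in>chains K (Suc p). cbd K p (cbd K (Suc p) x) = 0)"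

lemma is_complexD:
  assumes "is_complex K"
  shows "add_subgroup (chains K p)"
    "x \<in> chains K p \<Longrightarrow> y \<in> chains K p \<Longrightarrow> cbd K p (x + y) = cbd K p x + cbd K p y"
    "x \<in> chains K (Suc p) \<Longrightarrow> cbd K (Suc p) x \<in> chains K p"
    "x \<in> chains K (Suc p) \<Longrightarrow> cbd K p (cbd K (Suc p) x) = 0"
  using assms unfolding is_complex_def by simp_all

lemma cochainsI:
  "(\<And>x y. x \<in> chains K p \<Longrightarrow> y \<in> chains K p \<Longrightarrow> u (x + y) = u x + u y) \<Longrightarrow>
   (\<And>x. x \<notin> chains K p \<Longrightarrow> u x = 0) \<Longrightarrow> u \<in> cochains K p"
  unfolding cochains_def by simp

lemma cochainsD:
  assumes "u \<in> cochains K p"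
  shows "x \<in> chains K p \<Longrightarrow> y \<in> chains K p \<Longrightarrow> u (x + y) = u x + u y" "x \<notin> chains K p \<Longrightarrow> u x = 0"
  using assms unfolding cochains_def by simp_all

lemma cochains_zero: "(\<lambda>_. 0) \<in> cochains K p"
  by (rule cochainsI) auto

lemma cochains_add: "u \<in> cochains K p \<Longrightarrow> v \<in> cochains K p \<Longrightarrow> (\<lambda>c. u c + v c) \<in> cochains K p"
  by (rule cochainsI) (simp_all add: cochainsD[of u] cochainsD[of v] add_ac)

lemma cochains_minus: "u \<in> cochains K p \<Longrightarrow> (\<lambda>c. - u c) \<in> cochains K p"
  by (rule cochainsI) (simp_all add: cochainsD[of u])

lemma cochains_diff: "u \<in> cochains K p \<Longrightarrow> v \<in> cochains K p \<Longrightarrow> (\<lambda>c. u c - v c) \<in> cochains K p"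
  using cochains_add[OF _ cochains_minus, of u K p v] by simp

lemma cochain_on_zero: "is_complex K \<Longrightarrow> u \<in> cochains K p \<Longrightarrow> u 0 = 0"
  using cochainsD(1)[of u K p 0 0] add_subgroupD(1)[OF is_complexD(1)] by (metis add_cancel_left_left add_0)

lemma coboundary_cochains:
  assumes K: "is_complex K" and u: "u \<in> cochains K p"
  shows "coboundary K p u \<in> cochains K (Suc p)"
  by (rule cochainsI)
     (use is_complexD[OF K] add_subgroupD(4)[OF is_complexD(1)[OF K]] cochainsD[OF u] in \<open>auto simp: coboundary_def\<close>)

lemma coboundary_coboundary:
  assumes K: "is_complex K" and u: "u \<in> cochains K p"
  shows "coboundary K (Suc p) (coboundary K p u) = (\<lambda>_. 0)"
  using is_complexD(3,4)[OF K] cochain_on_zero[OF K u] by (auto simp: coboundary_def fun_eq_iff)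

lemma coboundary_add: "coboundary K p (\<lambda>c. u c + v c) = (\<lambda>c. coboundary K p u c + coboundary K p v c)"
  by (auto simp: coboundary_def)

lemma coboundary_minus: "coboundary K p (\<lambda>c. - u c) = (\<lambda>c. - coboundary K p u c)"
  by (auto simp: coboundary_def)

lemma coboundary_zero: "coboundary K p (\<lambda>_. 0) = (\<lambda>_. 0)"
  by (auto simp: coboundary_def)

lemma cocycles_zero: "(\<lambda>_. 0) \<in> cocycles K p"
  by (simp add: cocycles_def cochains_zero coboundary_zero)

lemma cocycles_add: "u \<in> cocycles K p \<Longrightarrow> v \<in> cocycles K p \<Longrightarrow> (\<lambda>c. u c + v c) \<in> cocycles K p"
  by (simp add: cocycles_def cochains_add coboundary_add fun_eq_iff)

lemma cocycles_minus: "u \<in> cocycles K p \<Longrightarrow> (\<lambda>c. - u c) \<in> cocycles K p"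
  by (simp add: cocycles_def cochains_minus coboundary_minus fun_eq_iff)

lemma coboundaries_0: "u \<in> coboundaries K 0 \<longleftrightarrow> u = (\<lambda>_. 0)"
  by (simp add: coboundaries_def)

lemma coboundaries_SucI: "v \<in> cochains K q \<Longrightarrow> u = coboundary K q v \<Longrightarrow> u \<in> coboundaries K (Suc q)"
  by (simp add: coboundaries_def)

lemma coboundaries_SucE:
  assumes "u \<in> coboundaries K (Suc q)"
  obtains v where "v \<in> cochains K q" "u = coboundary K q v"
  using assms by (auto simp: coboundaries_def)

lemma coboundaries_zero: "(\<lambda>_. 0) \<in> coboundaries K p"
  by (cases p) (auto simp: coboundaries_0 coboundary_zero intro: coboundaries_SucI[OF cochains_zero])

lemma coboundaries_add:
  assumes "u \<in> coboundaries K p" "v \<in> coboundaries K p"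
  shows "(\<lambda>c. u c + v c) \<in> coboundaries K p"
proof (cases p)
  case 0
  then show ?thesis using assms by (simp add: coboundaries_0)
next
  case (Suc q)
  obtain u' where u': "u' \<in> cochains K q" "u = coboundary K q u'"
    using assms(1) coboundaries_SucE unfolding Suc by blast
  obtain v' where v': "v' \<in> cochains K q" "v = coboundary K q v'"
    using assms(2) coboundaries_SucE unfolding Suc by blast
  show ?thesis
    unfolding Suc u'(2) v'(2) coboundary_add[symmetric]
    by (rule coboundaries_SucI[OF cochains_add[OF u'(1) v'(1)] refl])
qed

lemma coboundaries_minus:
  assumes "u \<in> coboundaries K p"
  shows "(\<lambda>c. - u c) \<in> coboundaries K p"
proof (cases p)
  case 0
  then show ?thesis using assms by (simp add: coboundaries_0)
next
  case (Suc q)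
  obtain u' where u': "u' \<in> cochains K q" "u = coboundary K q u'"
    using assms coboundaries_SucE unfolding Suc by blast
  show ?thesis
    unfolding Suc u'(2) coboundary_minus[symmetric]
    by (rule coboundaries_SucI[OF cochains_minus[OF u'(1)] refl])
qed

lemma coboundaries_subset_cocycles:
  assumes "is_complex K"
  shows "coboundaries K p \<subseteq> cocycles K p"
proof (cases p)
  case (Suc q)
  then show ?thesis
    using coboundary_cochains[OF assms] coboundary_coboundary[OF assms]
    by (auto simp: coboundaries_def cocycles_def)
qed (simp add: coboundaries_def cocycles_zero)

lemma cocycle_group_comm_group: "comm_group (cocycle_group K p)"
proof (rule comm_groupI)
  fix u assume "u \<in> carrier (cocycle_group K p)"
  then show "\<exists>v\<in>carrier (cocycle_group K p). v \<otimes>\<^bsub>cocycle_group K p\<^esub> u = \<one>\<^bsub>cocycle_group K p\<^esub>"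
    using cocycles_minus[of u K p] by (auto simp: cocycle_group_def intro!: bexI[of _ "\<lambda>c. - u c"])
qed (auto simp: cocycle_group_def cocycles_zero cocycles_add add_ac)

lemma cocycle_group_inv: "u \<in> cocycles K p \<Longrightarrow> inv\<^bsub>cocycle_group K p\<^esub> u = (\<lambda>c. - u c)"
  by (rule group.inv_equality[OF comm_group.axioms(2)[OF cocycle_group_comm_group]])
     (simp_all add: cocycle_group_def cocycles_minus)

lemma coboundaries_subgroup:
  assumes "is_complex K"
  shows "subgroup (coboundaries K p) (cocycle_group K p)"
proof (rule subgroup.intro)
  show "coboundaries K p \<subseteq> carrier (cocycle_group K p)"
    using coboundaries_subset_cocycles[OF assms] by (simp add: cocycle_group_def)
  show "u \<otimes>\<^bsub>cocycle_group K p\<^esub> v \<in> coboundaries K p"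
    if "u \<in> coboundaries K p" "v \<in> coboundaries K p" for u v
    using coboundaries_add[OF that] by (simp add: cocycle_group_def)
  show "\<one>\<^bsub>cocycle_group K p\<^esub> \<in> coboundaries K p" by (simp add: cocycle_group_def coboundaries_zero)
  show "inv\<^bsub>cocycle_group K p\<^esub> u \<in> coboundaries K p" if "u \<in> coboundaries K p" for u
    using that coboundaries_subset_cocycles[OF assms] coboundaries_minus[OF that]
    by (subst cocycle_group_inv) auto
qed

lemma cohomology_comm_group: "is_complex K \<Longrightarrow> comm_group (cohomology K p)"
  unfolding cohomology_def
  by (rule comm_group.abelian_FactGroup[OF cocycle_group_comm_group coboundaries_subgroup])

lemma cohomology_class_alt: "cohomology_class K p u = {(\<lambda>c. b c + u c) | b. b \<in> coboundaries K p}"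
  by (auto simp: cohomology_class_def r_coset_def cocycle_group_def)

lemma cohomology_class_memI:
  assumes "(\<lambda>c. v c - u c) \<in> coboundaries K p"
  shows "v \<in> cohomology_class K p u"
proof -
  have "v = (\<lambda>c. (v c - u c) + u c)" by simp
  with assms have "\<exists>b. v = (\<lambda>c. b c + u c) \<and> b \<in> coboundaries K p"
    by (intro exI[of _ "\<lambda>c. v c - u c"] conjI)
  then show ?thesis unfolding cohomology_class_alt by (simp only: mem_Collect_eq)
qed

lemma cohomology_class_self: "u \<in> cohomology_class K p u"
  by (rule cohomology_class_memI) (simp add: coboundaries_zero)

lemma cohomology_class_eqI:
  assumes "(\<lambda>c. u c - v c) \<in> coboundaries K p"
  shows "cohomology_class K p u = cohomology_class K p v"
proof -
  have sub: "cohomology_class K p u \<subseteq> cohomology_class K p v" if "(\<lambda>c. u c - v c) \<in> coboundaries K p" for u v :: "'a \<Rightarrow> 'b"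
  proof
    fix w assume "w \<in> cohomology_class K p u"
    then obtain b where b: "b \<in> coboundaries K p" "w = (\<lambda>c. b c + u c)" by (auto simp: cohomology_class_alt)
    show "w \<in> cohomology_class K p v"
      by (rule cohomology_class_memI) (use coboundaries_add[OF b(1) that] b(2) in \<open>simp add: add_diff_eq\<close>)
  qed
  have "(\<lambda>c. v c - u c) \<in> coboundaries K p" using coboundaries_minus[OF assms] by simp
  then show ?thesis using sub assms by blast
qed

lemma cohomology_class_memD: "v \<in> cohomology_class K p u \<Longrightarrow> (\<lambda>c. v c - u c) \<in> coboundaries K p"
  by (auto simp: cohomology_class_alt)

lemma cohomology_class_eq_iff:
  "cohomology_class K p u = cohomology_class K p v \<longleftrightarrow> (\<lambda>c. u c - v c) \<in> coboundaries K p"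
  using cohomology_class_eqI cohomology_class_memD cohomology_class_self by metis

lemma carrier_cohomology: "carrier (cohomology K p) = cohomology_class K p ` cocycles K p"
  by (auto simp: cohomology_def FactGroup_def RCOSETS_def cohomology_class_def cocycle_group_def)

lemma one_cohomology: "\<one>\<^bsub>cohomology K p\<^esub> = cohomology_class K p (\<lambda>_. 0)"
  by (simp add: cohomology_def FactGroup_def cohomology_class_alt)

lemma mult_cohomology:
  "cohomology_class K p u \<otimes>\<^bsub>cohomology K p\<^esub> cohomology_class K p v = cohomology_class K p (\<lambda>c. u c + v c)"
proof
  show "cohomology_class K p u \<otimes>\<^bsub>cohomology K p\<^esub> cohomology_class K p v \<subseteq> cohomology_class K p (\<lambda>c. u c + v c)"
  proof
    fix w assume "w \<in> cohomology_class K p u \<otimes>\<^bsub>cohomology K p\<^esub> cohomology_class K p v"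
    then obtain b b' where b: "b \<in> coboundaries K p" "b' \<in> coboundaries K p"
      "w = (\<lambda>c. (b c + u c) + (b' c + v c))"
      by (auto simp: cohomology_def FactGroup_def set_mult_def cohomology_class_alt cocycle_group_def)
    show "w \<in> cohomology_class K p (\<lambda>c. u c + v c)"
      by (rule cohomology_class_memI) (use coboundaries_add[OF b(1,2)] b(3) in \<open>simp add: algebra_simps\<close>)
  qed
  show "cohomology_class K p (\<lambda>c. u c + v c) \<subseteq> cohomology_class K p u \<otimes>\<^bsub>cohomology K p\<^esub> cohomology_class K p v"
  proof
    fix w assume "w \<in> cohomology_class K p (\<lambda>c. u c + v c)"
    then obtain b where b: "b \<in> coboundaries K p" "w = (\<lambda>c. b c + (u c + v c))"
      by (auto simp: cohomology_class_alt)
    then have "w = (\<lambda>c. (b c + u c) + v c)" by (simp add: add_ac)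
    moreover have "(\<lambda>c. b c + u c) \<in> cohomology_class K p u" using b by (auto simp: cohomology_class_alt)
    ultimately show "w \<in> cohomology_class K p u \<otimes>\<^bsub>cohomology K p\<^esub> cohomology_class K p v"
      using cohomology_class_self[of v K p]
      by (auto simp: cohomology_def FactGroup_def set_mult_def cocycle_group_def)
  qed
qed

section \<open>Chain maps and induced maps\<close>

definition is_chain_map ::
    "('c::ab_group_add) chain_complex \<Rightarrow> ('d::ab_group_add) chain_complex \<Rightarrow> (nat \<Rightarrow> 'c \<Rightarrow> 'd) \<Rightarrow> bool" where
  "is_chain_map K L m \<longleftrightarrow>
     (\<forall>p. \<forall>x\<in>chains K p. m p x \<in> chains L p) \<and>
     (\<forall>p. \<forall>x\<in>chains K p. \<forall>y\<in>chains K p. m p (x + y) = m p x + m p y) \<and>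
     (\<forall>p. \<forall>x\<in>chains K (Suc p). cbd L (Suc p) (m (Suc p) x) = m p (cbd K (Suc p) x))"

lemma is_chain_mapD:
  assumes "is_chain_map K L m"
  shows "x \<in> chains K p \<Longrightarrow> m p x \<in> chains L p"
    "x \<in> chains K p \<Longrightarrow> y \<in> chains K p \<Longrightarrow> m p (x + y) = m p x + m p y"
    "x \<in> chains K (Suc p) \<Longrightarrow> cbd L (Suc p) (m (Suc p) x) = m p (cbd K (Suc p) x)"
  using assms unfolding is_chain_map_def by simp_all

definition cochain_pullback ::
    "('c::ab_group_add) chain_complex \<Rightarrow> (nat \<Rightarrow> 'c \<Rightarrow> 'd::ab_group_add) \<Rightarrow> nat \<Rightarrow> ('d \<Rightarrow> 'g::ab_group_add) \<Rightarrow> 'c \<Rightarrow> 'g" where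
  "cochain_pullback K m p u = (\<lambda>c. if c \<in> chains K p then u (m p c) else 0)"

lemma cochain_pullback_cochains:
  assumes "is_complex K" "is_chain_map K L m" "u \<in> cochains L p"
  shows "cochain_pullback K m p u \<in> cochains K p"
  by (rule cochainsI)
     (use is_chain_mapD[OF assms(2)] cochainsD[OF assms(3)] add_subgroupD(4)[OF is_complexD(1)[OF assms(1)]]
      in \<open>auto simp: cochain_pullback_def\<close>)

lemma coboundary_cochain_pullback:
  assumes "is_complex K" "is_chain_map K L m"
  shows "coboundary K p (cochain_pullback K m p u) = cochain_pullback K m (Suc p) (coboundary L p u)"
  using is_chain_mapD[OF assms(2)] is_complexD(3)[OF assms(1)]
  by (auto simp: coboundary_def cochain_pullback_def fun_eq_iff)

lemma cochain_pullback_cocycles: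
  assumes "is_complex K" "is_chain_map K L m" "u \<in> cocycles L p"
  shows "cochain_pullback K m p u \<in> cocycles K p"
  using assms cochain_pullback_cochains[OF assms(1,2)] coboundary_cochain_pullback[OF assms(1,2), of p u]
  by (auto simp: cocycles_def) (auto simp: cochain_pullback_def fun_eq_iff)

lemma cochain_pullback_coboundaries:
  assumes "is_complex K" "is_chain_map K L m" "u \<in> coboundaries L p"
  shows "cochain_pullback K m p u \<in> coboundaries K p"
proof (cases p)
  case 0
  then show ?thesis using assms(3) by (auto simp: coboundaries_def cochain_pullback_def)
next
  case (Suc q)
  obtain v where v: "v \<in> cochains L q" "u = coboundary L q v"
    using assms(3) coboundaries_SucE unfolding Suc by blast
  show ?thesis
    unfolding Suc v(2) coboundary_cochain_pullback[OF assms(1,2), symmetric]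
    by (rule coboundaries_SucI[OF cochain_pullback_cochains[OF assms(1,2) v(1)] refl])
qed

text \<open>All representatives contribute one and the same coset, since the pullback of a
  coboundary is a coboundary; the union in the definition is therefore that coset.\<close>

lemma cohomology_map_class:
  assumes "is_complex K" "is_chain_map K L m"
  shows "cohomology_map K m p (cohomology_class L p u) = cohomology_class K p (cochain_pullback K m p u)"
proof -
  have "cohomology_class K p (cochain_pullback K m p v) = cohomology_class K p (cochain_pullback K m p u)"
    if "v \<in> cohomology_class L p u" for v
  proof (rule cohomology_class_eqI)
    have "(\<lambda>c. cochain_pullback K m p v c - cochain_pullback K m p u c) = cochain_pullback K m p (\<lambda>c. v c - u c)"
      by (auto simp: cochain_pullback_def)
    then show "(\<lambda>c. cochain_pullback K m p v c - cochain_pullback K m p u c) \<in> coboundaries K p"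
      using cochain_pullback_coboundaries[OF assms cohomology_class_memD[OF that]] by simp
  qed
  then show ?thesis
    unfolding cohomology_map_def cochain_pullback_def[symmetric]
    using cohomology_class_self[of u L p] by blast
qed

lemma cohomology_map_hom:
  fixes L :: "('d::ab_group_add) chain_complex"
  assumes K: "is_complex K" "is_chain_map K L m"
  shows "cohomology_map K m p \<in> hom (cohomology L p :: ('d \<Rightarrow> 'g::ab_group_add) set monoid) (cohomology K p)"
proof (rule homI)
  fix x :: "('d \<Rightarrow> 'g) set" assume "x \<in> carrier (cohomology L p)"
  then obtain u where u: "x = cohomology_class L p u" "u \<in> cocycles L p" by (auto simp: carrier_cohomology)
  show "cohomology_map K m p x \<in> carrier (cohomology K p)"
    unfolding u(1) cohomology_map_class[OF K] carrier_cohomology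
    by (rule imageI[OF cochain_pullback_cocycles[OF K u(2)]])
next
  fix x y :: "('d \<Rightarrow> 'g) set" assume "x \<in> carrier (cohomology L p)" "y \<in> carrier (cohomology L p)"
  then obtain u v where uv: "x = cohomology_class L p u" "y = cohomology_class L p v"
    by (auto simp: carrier_cohomology)
  have "cochain_pullback K m p (\<lambda>c. u c + v c) = (\<lambda>c. cochain_pullback K m p u c + cochain_pullback K m p v c)"
    by (auto simp: cochain_pullback_def)
  then show "cohomology_map K m p (x \<otimes>\<^bsub>cohomology L p\<^esub> y)
      = cohomology_map K m p x \<otimes>\<^bsub>cohomology K p\<^esub> cohomology_map K m p y"
    by (simp add: uv mult_cohomology cohomology_map_class[OF K])
qed

section \<open>Smooth chains and the de Rham theorem\<close>

abbreviation smooth_chains :: "'a dspace \<Rightarrow> nat \<Rightarrow> 'a chain set" where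
  "smooth_chains X p \<equiv> chains (smooth_complex X) p"

lemma smooth_chains_iff: "c \<in> smooth_chains X p \<longleftrightarrow> Poly_Mapping.keys c \<subseteq> Collect (smooth_simplex p X)"
  by (simp add: smooth_complex_def)

lemma cbd_smooth_complex [simp]: "cbd (smooth_complex X) = chain_boundary"
  by (simp add: smooth_complex_def)

lemma add_subgroup_smooth_chains: "add_subgroup (smooth_chains X p)"
  unfolding add_subgroup_def
proof (intro conjI ballI)
  fix a b assume "a \<in> smooth_chains X p" "b \<in> smooth_chains X p"
  then show "a - b \<in> smooth_chains X p" using keys_diff[of a b] unfolding smooth_chains_iff by blast
qed (simp add: smooth_chains_iff)

lemmas smooth_chainsD = add_subgroupD[OF add_subgroup_smooth_chains]

lemma smooth_chains_cmul: "c \<in> smooth_chains X p \<Longrightarrow> frag_cmul n c \<in> smooth_chains X p"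
  unfolding smooth_chains_iff using keys_cmul by blast

lemma smooth_chains_sum: "(\<And>i. i \<in> F \<Longrightarrow> c i \<in> smooth_chains X p) \<Longrightarrow> sum c F \<in> smooth_chains X p"
  by (induction F rule: infinite_finite_induct) (simp_all add: smooth_chainsD)

lemma smooth_chains_of: "frag_of \<sigma> \<in> smooth_chains X p \<longleftrightarrow> smooth_simplex p X \<sigma>"
  by (simp add: smooth_chains_iff)

lemma smooth_chains_induct [consumes 1, case_names zero one diff]:
  assumes "c \<in> smooth_chains X p" "P 0" "\<And>\<sigma>. smooth_simplex p X \<sigma> \<Longrightarrow> P (frag_of \<sigma>)"
    "\<And>a b. P a \<Longrightarrow> P b \<Longrightarrow> P (a - b)"
  shows "P c"
  using assms(1) unfolding smooth_chains_iff by (rule frag_induction) (use assms in auto)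

lemma chain_boundary_zero_degree [simp]: "chain_boundary 0 c = 0"
  by (simp add: chain_boundary_def)

lemma chain_boundary_smooth:
  assumes X: "differential_space X" and c: "c \<in> smooth_chains X (Suc p)"
  shows "chain_boundary (Suc p) c \<in> smooth_chains X p"
  using c
proof (induction rule: smooth_chains_induct)
  case (one \<sigma>)
  then show ?case
    unfolding chain_boundary_of
    using smooth_simplex_face[OF X one]
    by (auto intro!: smooth_chains_sum smooth_chains_cmul simp: smooth_chains_of simp del: sum.atMost_Suc)
qed (simp_all add: chain_boundary_diff smooth_chainsD)

lemma smooth_chains_singular: "c \<in> smooth_chains X p \<Longrightarrow> singular_chain p (dtop X) c"
  by (auto simp: smooth_chains_iff singular_chain_def smooth_simplex_def)

lemma smooth_chains_boundary_boundary:
  "c \<in> smooth_chains X (Suc p) \<Longrightarrow> chain_boundary p (chain_boundary (Suc p) c) = 0"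
  by (rule chain_boundary_boundary_alt[OF smooth_chains_singular])

lemma is_complex_smooth: "differential_space X \<Longrightarrow> is_complex (smooth_complex X)"
  unfolding is_complex_def
  by (auto simp: add_subgroup_smooth_chains chain_boundary_add chain_boundary_smooth smooth_chains_boundary_boundary)

lemma smooth_simplex_map:
  assumes A: "differential_space A" and X: "differential_space X" and \<phi>: "smooth_map A X \<phi>"
    and \<sigma>: "smooth_simplex p A \<sigma>"
  shows "smooth_simplex p X (simplex_map p \<phi> \<sigma>)"
proof -
  have sm: "smooth_map (euclidean_dspace (Suc p) (standard_simplex p)) A \<sigma>" and s: "singular_simplex p (dtop A) \<sigma>"
    using \<sigma> by (auto simp: smooth_simplex_def)
  note smE = smooth_map_euclidean[OF standard_simplex_eucl]
  have \<sigma>A: "\<sigma> \<in> standard_simplex p \<rightarrow> dpoints A" using sm unfolding smE by (rule conjunct1)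
  have "smooth_on (Suc p) (standard_simplex p) (f \<circ> simplex_map p \<phi> \<sigma>)" if "f \<in> dfun X" for f
  proof -
    have "restrict (f \<circ> \<phi>) (dpoints A) \<in> dfun A" using \<phi> that by (simp add: smooth_map_def)
    moreover have "\<forall>f\<in>dfun A. smooth_on (Suc p) (standard_simplex p) (f \<circ> \<sigma>)"
      using sm unfolding smE by (rule conjunct2)
    ultimately have "smooth_on (Suc p) (standard_simplex p) (restrict (f \<circ> \<phi>) (dpoints A) \<circ> \<sigma>)"
      by (rule bspec[rotated])
    then show ?thesis
      by (rule smooth_on_cong[THEN iffD1, rotated]) (use \<sigma>A in \<open>auto simp: simplex_map_def\<close>)
  qed
  moreover have "simplex_map p \<phi> \<sigma> \<in> standard_simplex p \<rightarrow> dpoints X"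
    using \<sigma>A \<phi> by (auto simp: simplex_map_def smooth_map_def)
  moreover have "singular_simplex p (dtop X) (simplex_map p \<phi> \<sigma>)"
    using s smooth_map_imp_continuous_map[OF A X \<phi>] by (rule singular_simplex_simplex_map)
  ultimately show ?thesis by (simp add: smooth_simplex_def smE)
qed

lemma chain_map_smooth:
  assumes "differential_space A" "differential_space X" "smooth_map A X \<phi>" "c \<in> smooth_chains A p"
  shows "chain_map p \<phi> c \<in> smooth_chains X p"
  using assms(4)
  by (induction rule: smooth_chains_induct)
     (simp_all add: smooth_chainsD chain_map_diff smooth_chains_of smooth_simplex_map[OF assms(1-3)])

lemma chain_boundary_chain_map_smooth:
  "c \<in> smooth_chains A p \<Longrightarrow> chain_boundary p (chain_map p \<phi> c) = chain_map (p - 1) \<phi> (chain_boundary p c)"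
  using chain_boundary_chain_map[OF smooth_chains_singular] by simp

lemma is_chain_map_smooth:
  assumes "differential_space A" "differential_space X" "smooth_map A X \<phi>"
  shows "is_chain_map (smooth_complex A) (smooth_complex X) (\<lambda>p. chain_map p \<phi>)"
  unfolding is_chain_map_def using chain_map_smooth[OF assms] chain_boundary_chain_map_smooth[of _ A "Suc _"]
  by (auto simp: chain_map_add)

lemma smooth_cycles_iff: "z \<in> cycles (smooth_complex X) p \<longleftrightarrow> z \<in> smooth_chains X p \<and> chain_boundary p z = 0"
  by (simp add: cycles_def)

lemma add_subgroup_cycles: "is_complex K \<Longrightarrow> add_subgroup (cycles K p)"
proof -
  assume K: "is_complex K"
  note ch = add_subgroupD[OF is_complexD(1)[OF K, of p]] and add = is_complexD(2)[OF K, of _ p]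
  have 0: "cbd K p 0 = 0" using add[of 0 0] ch(1) by simp
  have "cbd K p (x - y) = cbd K p x - cbd K p y" if "x \<in> chains K p" "y \<in> chains K p" for x y
    using add[OF ch(2)[OF that] that(2)] by simp
  then show ?thesis using ch 0 by (simp add: add_subgroup_def cycles_def)
qed

lemma add_subgroup_smooth_cycles: "differential_space X \<Longrightarrow> add_subgroup (cycles (smooth_complex X) p)"
  by (rule add_subgroup_cycles[OF is_complex_smooth])

lemma chain_boundary_cycle:
  "differential_space X \<Longrightarrow> c \<in> smooth_chains X (Suc p) \<Longrightarrow> chain_boundary (Suc p) c \<in> cycles (smooth_complex X) p"
  by (simp add: smooth_cycles_iff chain_boundary_smooth smooth_chains_boundary_boundary)

lemma chain_map_cycle:
  assumes "differential_space A" "differential_space X" "smooth_map A X \<phi>" "z \<in> cycles (smooth_complex A) p"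
  shows "chain_map p \<phi> z \<in> cycles (smooth_complex X) p"
  using assms(4) chain_map_smooth[OF assms(1-3)] chain_boundary_chain_map_smooth[of z A p \<phi>]
  by (simp add: smooth_cycles_iff)

section \<open>Integration over chains\<close>

lemma chain_integral_frag_sum: "chain_integral p \<omega> c = frag_sum (simplex_integral p \<omega>) c"
  by (simp add: chain_integral_def frag_sum_def)

lemma chain_integral_linear [simp]:
  "chain_integral p \<omega> 0 = 0"
  "chain_integral p \<omega> (a + b) = chain_integral p \<omega> a + chain_integral p \<omega> b"
  "chain_integral p \<omega> (a - b) = chain_integral p \<omega> a - chain_integral p \<omega> b"
  "chain_integral p \<omega> (- a) = - chain_integral p \<omega> a"
  by (simp_all add: chain_integral_frag_sum frag_sum_add frag_sum_diff frag_sum_minus)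

lemma chain_integral_of [simp]: "chain_integral p \<omega> (frag_of \<sigma>) = simplex_integral p \<omega> \<sigma>"
  by (simp add: chain_integral_frag_sum)

lemma chain_integral_natural_diff:
  assumes \<omega>: "natural_form X p \<omega>" and \<eta>: "natural_form X p \<eta>" and c: "c \<in> smooth_chains X p"
  shows "chain_integral p (\<lambda>n S q x I. \<omega> n S q x I - \<eta> n S q x I) c = chain_integral p \<omega> c - chain_integral p \<eta> c"
  using c
proof (induction rule: smooth_chains_induct)
  case (one \<sigma>)
  show ?case
    unfolding chain_integral_of simplex_integral_eq
    by (rule corner_integral_diff[OF simplex_integral_continuous_coefficient[OF \<omega> one]
          simplex_integral_continuous_coefficient[OF \<eta> one]])
qed simp_all

lemma chain_integral_form_add:
  assumes X: "differential_space X" and \<omega>: "\<omega> \<in> forms X p" and \<eta>: "\<eta> \<in> forms X p" and c: "c \<in> smooth_chains X p"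
  shows "chain_integral p (form_add \<omega> \<eta>) c = chain_integral p \<omega> c + chain_integral p \<eta> c"
  using c
proof (induction rule: smooth_chains_induct)
  case (one \<sigma>)
  show ?case
    unfolding chain_integral_of simplex_integral_eq form_add_def
    by (rule corner_integral_add[OF simplex_integral_continuous_coefficient[OF natural_form_form[OF X \<omega>] one]
          simplex_integral_continuous_coefficient[OF natural_form_form[OF X \<eta>] one]])
qed simp_all

lemma chain_integral_form_cmult: "chain_integral p (form_cmult a \<omega>) c = a * chain_integral p \<omega> c"
  by (simp add: chain_integral_def simplex_integral_eq form_cmult_def corner_integral_cmult sum_distrib_left mult_ac)

lemma chain_integral_zero_form: "chain_integral p zero_form c = 0"
  by (simp add: chain_integral_def simplex_integral_eq zero_form_def corner_integral_0)

lemma simplex_integral_pullback: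
  assumes "smooth_simplex p A \<sigma>"
  shows "simplex_integral p (form_pullback A \<phi> p \<omega>) \<sigma> = simplex_integral p \<omega> (simplex_map p \<phi> \<sigma>)"
  unfolding simplex_integral_eq
proof (rule corner_integral_cong)
  fix x assume x: "x \<in> corner_simplex p"
  have "restrict (\<phi> \<circ> restrict (\<sigma> \<circ> corner_param p) (corner_simplex p)) (corner_simplex p)
      = restrict (simplex_map p \<phi> \<sigma> \<circ> corner_param p) (corner_simplex p)"
    using corner_param_in by (auto simp: simplex_map_def fun_eq_iff restrict_def)
  then show "form_pullback A \<phi> p \<omega> p (corner_simplex p) (restrict (\<sigma> \<circ> corner_param p) (corner_simplex p)) x [0..<p]
      = \<omega> p (corner_simplex p) (restrict (simplex_map p \<phi> \<sigma> \<circ> corner_param p) (corner_simplex p)) x [0..<p]"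
    using smooth_simplex_plot[OF assms] x upt_indices[of p] by (simp add: form_pullback_def)
qed

lemma chain_integral_pullback:
  assumes "c \<in> smooth_chains A p"
  shows "chain_integral p (form_pullback A \<phi> p \<omega>) c = chain_integral p \<omega> (chain_map p \<phi> c)"
  using assms
  by (induction rule: smooth_chains_induct) (simp_all add: simplex_integral_pullback chain_map_diff)

theorem stokes:
  assumes X: "differential_space X" and \<omega>: "\<omega> \<in> forms X p" and c: "c \<in> smooth_chains X (Suc p)"
  shows "chain_integral (Suc p) (ext_deriv X p \<omega>) c = chain_integral p \<omega> (chain_boundary (Suc p) c)"
  using c
proof (induction rule: smooth_chains_induct)
  case (one \<sigma>)
  have "chain_boundary (Suc p) (frag_of \<sigma>)
      = (\<Sum>i\<le>Suc p. frag_cmul ((-1) ^ i) (frag_of (singular_face (Suc p) i \<sigma>)))"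
    by (simp add: chain_boundary_of del: sum.atMost_Suc)
  then have "chain_integral p \<omega> (chain_boundary (Suc p) (frag_of \<sigma>))
      = (\<Sum>i\<le>Suc p. (-1) ^ i * simplex_integral p \<omega> (singular_face (Suc p) i \<sigma>))"
    by (simp add: chain_integral_frag_sum frag_sum_sum frag_sum_cmul del: sum.atMost_Suc)
  then show ?case using simplex_stokes[OF X \<omega> one] by simp
qed (simp_all add: chain_boundary_diff)

lemma natural_form_eq_0:
  assumes X: "differential_space X" and \<omega>: "natural_form X k \<omega>" and k: "1 \<le> k"
    and int: "\<And>c. c \<in> smooth_chains X k \<Longrightarrow> chain_integral k \<omega> c \<in> \<int>"
    and out: "\<And>n S q x I. \<not> (plot X n S q \<and> x \<in> S \<and> I \<in> indices k n) \<Longrightarrow> \<omega> n S q x I = 0"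
  shows "\<omega> = zero_form"
proof -
  have "simplex_integral k \<omega> \<sigma> \<in> \<int>" if "smooth_simplex k X \<sigma>" for \<sigma>
    using int[of "frag_of \<sigma>"] that by (simp add: smooth_chains_of)
  then have "\<omega> n S q x I = 0" for n S q x I
    using natural_form_integral_eq_0[OF X \<omega> k] out by blast
  then show ?thesis by (simp add: zero_form_def fun_eq_iff)
qed

text \<open>Stated for natural forms because one side may be an exterior derivative, as when a
  pulled back curvature is compared with the derivative of a form on \<open>A\<close>.\<close>

lemma form_eq_of_integral_periods:
  assumes X: "differential_space X" and \<omega>: "natural_form X k \<omega>" and \<eta>: "natural_form X k \<eta>" and k: "1 \<le> k"
    and int: "\<And>c. c \<in> smooth_chains X k \<Longrightarrow> chain_integral k \<omega> c - chain_integral k \<eta> c \<in> \<int>"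
    and out: "\<And>n S q x I. \<not> (plot X n S q \<and> x \<in> S \<and> I \<in> indices k n) \<Longrightarrow> \<omega> n S q x I = \<eta> n S q x I"
  shows "\<omega> = \<eta>"
proof -
  have "(\<lambda>n S q x I. \<omega> n S q x I - \<eta> n S q x I) = zero_form"
    by (rule natural_form_eq_0[OF X natural_form_diff[OF \<omega> \<eta>] k])
       (use int out chain_integral_natural_diff[OF \<omega> \<eta>] in auto)
  then show ?thesis by (simp add: zero_form_def fun_eq_iff)
qed

lemma ext_deriv_outside: "\<not> (plot X n S q \<and> x \<in> S \<and> I \<in> indices (Suc k) n) \<Longrightarrow> ext_deriv X k \<omega> n S q x I = 0"
  by (auto simp: ext_deriv_def)

text \<open>By Stokes' theorem the hypothesis says that the exterior derivative has integral
  integrals over all smooth chains.\<close>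

lemma ext_deriv_eq_0:
  assumes X: "differential_space X" and \<omega>: "\<omega> \<in> forms X k"
    and int: "\<And>c. c \<in> smooth_chains X (Suc k) \<Longrightarrow> chain_integral k \<omega> (chain_boundary (Suc k) c) \<in> \<int>"
  shows "ext_deriv X k \<omega> = zero_form"
  by (rule natural_form_eq_0[OF X natural_form_ext_deriv[OF X \<omega>]])
     (use int stokes[OF X \<omega>] ext_deriv_outside[of X _ _ _ _ _ k \<omega>] in auto)

section \<open>The de Rham isomorphism on representatives\<close>

definition form_cochain :: "'a dspace \<Rightarrow> nat \<Rightarrow> 'a form \<Rightarrow> 'a chain \<Rightarrow> real" where
  "form_cochain X p \<omega> = (\<lambda>c. if c \<in> smooth_chains X p then chain_integral p \<omega> c else 0)"

lemma form_cochain_cochains: "form_cochain X p \<omega> \<in> cochains (smooth_complex X) p"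
  by (rule cochainsI) (auto simp: form_cochain_def smooth_chainsD)

lemma form_cochain_zero: "form_cochain X p zero_form = (\<lambda>_. 0)"
  by (auto simp: form_cochain_def chain_integral_zero_form)

lemma de_rham_iso:
  assumes "de_rham_theorem X"
  shows "(\<lambda>cls. \<Union>\<omega>\<in>cls. cohomology_class (smooth_complex X) p (form_cochain X p \<omega>))
    \<in> iso (de_rham_cohomology X p) (cohomology (smooth_complex X) p)"
  using assms unfolding de_rham_theorem_def form_cochain_def by blast

lemma exact_forms_zero: "zero_form \<in> exact_forms X k"
proof (cases k)
  case (Suc q)
  then show ?thesis
    using zero_form_forms[of X q] ext_deriv_zero_form[of X q] by (auto simp: exact_forms_def image_iff intro!: bexI[of _ zero_form])
qed (simp add: exact_forms_def)

definition form_class :: "'a dspace \<Rightarrow> nat \<Rightarrow> 'a form \<Rightarrow> 'a form set" where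
  "form_class X p \<omega> = exact_forms X p #>\<^bsub>closed_form_group X p\<^esub> \<omega>"

lemma form_class_self: "\<omega> \<in> form_class X p \<omega>"
  unfolding form_class_def r_coset_def closed_form_group_def
  using exact_forms_zero[of X p] by (force simp: zero_form_def)

lemma carrier_de_rham:
  "carrier (de_rham_cohomology X p) = form_class X p ` {\<omega> \<in> forms X p. ext_deriv X p \<omega> = zero_form}"
  by (auto simp: de_rham_cohomology_def FactGroup_def RCOSETS_def form_class_def closed_form_group_def)

text \<open>The value of the de Rham map on a class is a single coset, so it is determined by any of the
  forms in that class.\<close>

lemma de_rham_map_class:
  assumes dR: "de_rham_theorem X" and \<omega>: "\<omega> \<in> forms X p" "ext_deriv X p \<omega> = zero_form"
  shows "(\<Union>\<omega>\<in>form_class X p \<omega>. cohomology_class (smooth_complex X) p (form_cochain X p \<omega>))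
    = cohomology_class (smooth_complex X) p (form_cochain X p \<omega>)"
proof -
  let ?cl = "\<lambda>u :: 'a chain \<Rightarrow> real. cohomology_class (smooth_complex X) p u"
  let ?m = "\<Union>\<omega>\<in>form_class X p \<omega>. ?cl (form_cochain X p \<omega>)"
  have "form_class X p \<omega> \<in> carrier (de_rham_cohomology X p)" using \<omega> by (auto simp: carrier_de_rham)
  with de_rham_iso[OF dR, of p] have "?m \<in> carrier (cohomology (smooth_complex X) p)"
    by (auto simp: iso_def hom_def)
  then obtain u where u: "?m = ?cl u" by (auto simp: carrier_cohomology)
  have "form_cochain X p \<omega> \<in> ?m"
    using form_class_self[of \<omega> X p] cohomology_class_self by blast
  then have "?cl (form_cochain X p \<omega>) = ?cl u"
    unfolding u by (intro cohomology_class_eqI cohomology_class_memD)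
  then show ?thesis using u by simp
qed

lemma de_rham_surj:
  assumes dR: "de_rham_theorem X" and u: "u \<in> cocycles (smooth_complex X) p"
  obtains \<omega> where "\<omega> \<in> forms X p" "ext_deriv X p \<omega> = zero_form"
    "(\<lambda>c. u c - form_cochain X p \<omega> c) \<in> coboundaries (smooth_complex X) p"
proof -
  have "cohomology_class (smooth_complex X) p u \<in> carrier (cohomology (smooth_complex X) p)"
    using u by (auto simp: carrier_cohomology)
  also have "\<dots> = (\<lambda>cls. \<Union>\<omega>\<in>cls. cohomology_class (smooth_complex X) p (form_cochain X p \<omega>))
      ` carrier (de_rham_cohomology X p)"
    using de_rham_iso[OF dR, of p] by (auto simp: iso_def bij_betw_def)
  finally obtain \<omega> where \<omega>: "\<omega> \<in> forms X p" "ext_deriv X p \<omega> = zero_form"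
    "cohomology_class (smooth_complex X) p u
      = (\<Union>\<omega>\<in>form_class X p \<omega>. cohomology_class (smooth_complex X) p (form_cochain X p \<omega>))"
    unfolding carrier_de_rham by auto
  have "cohomology_class (smooth_complex X) p u = cohomology_class (smooth_complex X) p (form_cochain X p \<omega>)"
    unfolding \<omega>(3) by (rule de_rham_map_class[OF dR \<omega>(1,2)])
  then show thesis using that[OF \<omega>(1,2)] by (simp add: cohomology_class_eq_iff)
qed

lemma de_rham_inj:
  assumes dR: "de_rham_theorem X" and \<omega>: "\<omega> \<in> forms X p" "ext_deriv X p \<omega> = zero_form"
    and bd: "form_cochain X p \<omega> \<in> coboundaries (smooth_complex X) p"
  shows "\<omega> \<in> exact_forms X p"
proof -
  let ?m = "\<lambda>cls. \<Union>\<omega>\<in>cls. cohomology_class (smooth_complex X) p (form_cochain X p \<omega>)"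
  have inj: "inj_on ?m (carrier (de_rham_cohomology X p))"
    using de_rham_iso[OF dR, of p] by (auto simp: iso_def bij_betw_def)
  note z = zero_form_forms[of X p] ext_deriv_zero_form[of X p]
  have "?m (form_class X p \<omega>) = ?m (form_class X p zero_form)"
    unfolding de_rham_map_class[OF dR \<omega>] de_rham_map_class[OF dR z] cohomology_class_eq_iff
    using bd by (simp add: form_cochain_zero)
  then have "form_class X p \<omega> = form_class X p zero_form"
    by (rule inj_onD[OF inj]) (use \<omega> z in \<open>auto simp: carrier_de_rham\<close>)
  then have "\<omega> \<in> form_class X p zero_form" using form_class_self[of \<omega> X p] by simp
  then show ?thesis
    by (auto simp: form_class_def r_coset_def closed_form_group_def zero_form_def)
qed

section \<open>The mapping cone complex\<close>

lemma is_complex_cone: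
  assumes A: "differential_space A" and X: "differential_space X" and \<phi>: "smooth_map A X \<phi>"
  shows "is_complex (cone_complex \<phi> X A)"
  unfolding is_complex_def
proof (intro conjI allI ballI)
  let ?K = "cone_complex \<phi> X A"
  show "add_subgroup (chains ?K p)" for p
    by (cases p) (auto simp: add_subgroup_def cone_complex_def smooth_chainsD zero_prod_def)
  show "cbd ?K p (x + y) = cbd ?K p x + cbd ?K p y" for p x y
    by (cases x; cases y) (simp add: cone_complex_def chain_boundary_add chain_map_add)
  fix p x assume "x \<in> chains ?K (Suc p)"
  then obtain s t where x: "x = (s, t)" "s \<in> smooth_chains X (Suc p)" "t \<in> smooth_chains A p"
    by (auto simp: cone_complex_def)
  have b: "chain_boundary (Suc p) s + chain_map p \<phi> t \<in> smooth_chains X p"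
    using x chain_boundary_smooth[OF X x(2)] chain_map_smooth[OF A X \<phi> x(3)] by (simp add: smooth_chainsD)
  show "cbd ?K (Suc p) x \<in> chains ?K p"
    using x b chain_boundary_smooth[OF A] by (cases p) (auto simp: cone_complex_def smooth_chainsD)
  \<comment> \<open>The two terms coming from \<open>t\<close> cancel: the boundary of its image
    against the image of minus its boundary. For \<open>p = 0\<close> the truncated degree
    \<open>p - 1\<close> is 0 and both boundaries vanish.\<close>
  have "chain_boundary p (chain_map p \<phi> t) = chain_map (p - 1) \<phi> (chain_boundary p t)"
    by (rule chain_boundary_chain_map_smooth[OF x(3)])
  moreover have "chain_boundary (p - 1) (chain_boundary p t) = 0"
    using x(3) smooth_chains_boundary_boundary[of t A "p - 1"] by (cases p) auto
  ultimately show "cbd ?K p (cbd ?K (Suc p) x) = 0"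
    using smooth_chains_boundary_boundary[OF x(2)]
    by (simp add: x cone_complex_def zero_prod_def chain_boundary_add chain_map_minus chain_boundary_minus)
qed

lemma cone_chains_Suc: "(s, t) \<in> chains (cone_complex \<phi> X A) (Suc p) \<longleftrightarrow> s \<in> smooth_chains X (Suc p) \<and> t \<in> smooth_chains A p"
  by (simp add: cone_complex_def)

lemma cone_chains_0: "(s, t) \<in> chains (cone_complex \<phi> X A) 0 \<longleftrightarrow> s \<in> smooth_chains X 0 \<and> t = 0"
  by (simp add: cone_complex_def)

lemma cbd_cone: "cbd (cone_complex \<phi> X A) p (s, t)
    = (chain_boundary p s + chain_map (p - 1) \<phi> t, - chain_boundary (p - 1) t)"
  by (simp add: cone_complex_def)

lemma is_chain_map_cone: "is_chain_map (smooth_complex X) (cone_complex \<phi> X A) (\<lambda>_ s. (s, 0))"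
proof -
  have "(s, 0) \<in> chains (cone_complex \<phi> X A) p" if "s \<in> smooth_chains X p" for s p
    using that by (cases p) (simp_all add: cone_chains_0 cone_chains_Suc smooth_chainsD)
  then show ?thesis unfolding is_chain_map_def by (simp add: cbd_cone)
qed

section \<open>Differential characters\<close>

lemma cbd_cycle: "is_complex K \<Longrightarrow> x \<in> chains K (Suc p) \<Longrightarrow> cbd K (Suc p) x \<in> cycles K p"
  using is_complexD(3,4)[of K x p] by (simp add: cycles_def)

lemma subgroup_comm_group:
  assumes G: "comm_group G" and H: "subgroup H G"
  shows "comm_group (G\<lparr>carrier := H\<rparr>)"
proof (rule group.group_comm_groupI)
  show "Group.group (G\<lparr>carrier := H\<rparr>)"
    by (rule group.subgroup_imp_group[OF comm_group.axioms(2)[OF G] H])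
  fix x y assume "x \<in> carrier (G\<lparr>carrier := H\<rparr>)" "y \<in> carrier (G\<lparr>carrier := H\<rparr>)"
  then have "x \<in> carrier G" "y \<in> carrier G" using subgroup.mem_carrier[OF H] by simp_all
  then have "x \<otimes>\<^bsub>G\<^esub> y = y \<otimes>\<^bsub>G\<^esub> x" by (intro comm_monoid.m_comm comm_group.axioms(1)[OF G])
  then show "x \<otimes>\<^bsub>G\<lparr>carrier := H\<rparr>\<^esub> y = y \<otimes>\<^bsub>G\<lparr>carrier := H\<rparr>\<^esub> x" by simp
qed

lemma cocycle_boundary:
  assumes "u \<in> cocycles K p" "c \<in> chains K (Suc p)"
  shows "u (cbd K (Suc p) c) = 0"
proof -
  have "coboundary K p u = (\<lambda>_. 0)" using assms(1) by (simp add: cocycles_def)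
  from fun_cong[OF this, of c] assms(2) show ?thesis by (simp add: coboundary_def)
qed

section \<open>The group of differential characters\<close>

lemma U1_homsI:
  "(\<And>x. x \<in> Z \<Longrightarrow> cmod (h x) = 1) \<Longrightarrow> (\<And>x y. x \<in> Z \<Longrightarrow> y \<in> Z \<Longrightarrow> h (x + y) = h x * h y) \<Longrightarrow>
   (\<And>x. x \<notin> Z \<Longrightarrow> h x = 1) \<Longrightarrow> h \<in> U1_homs Z"
  by (simp add: U1_homs_def)

lemma U1_homs_mult: "h \<in> U1_homs Z \<Longrightarrow> h' \<in> U1_homs Z \<Longrightarrow> (\<lambda>z. h z * h' z) \<in> U1_homs Z"
  by (rule U1_homsI) (simp_all add: U1_homsD norm_mult mult_ac)

lemma U1_homs_inverse: "h \<in> U1_homs Z \<Longrightarrow> (\<lambda>z. inverse (h z)) \<in> U1_homs Z"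
  by (rule U1_homsI) (simp_all add: U1_homsD norm_inverse)

lemma U1_homs_one: "(\<lambda>_. 1) \<in> U1_homs Z"
  by (rule U1_homsI) simp_all

lemma U1_homs_nonzero: "h \<in> U1_homs Z \<Longrightarrow> h z \<noteq> 0"
  using U1_homsD(1,3)[of h Z z] by (cases "z \<in> Z") auto

lemma diff_chars_simps:
  "h \<in> carrier (diff_chars X k) \<longleftrightarrow>
     h \<in> U1_homs (cycles (smooth_complex X) (k - 1)) \<and> (\<exists>\<omega>. is_curvature X k h \<omega>)"
  "h \<otimes>\<^bsub>diff_chars X k\<^esub> h' = (\<lambda>z. h z * h' z)"
  "\<one>\<^bsub>diff_chars X k\<^esub> = (\<lambda>_. 1)"
  by (simp_all add: diff_chars_def)

lemma is_curvatureD: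
  assumes "is_curvature X k h \<omega>"
  shows "\<omega> \<in> forms X k" "c \<in> smooth_chains X k \<Longrightarrow> h (chain_boundary k c) = exp2pi (chain_integral k \<omega> c)"
  using assms by (simp_all add: is_curvature_def)

lemma is_curvature_mult:
  assumes "differential_space X" "is_curvature X k h \<omega>" "is_curvature X k h' \<omega>'"
  shows "is_curvature X k (\<lambda>z. h z * h' z) (form_add \<omega> \<omega>')"
  using form_add_forms[OF is_curvatureD(1)[OF assms(2)] is_curvatureD(1)[OF assms(3)]]
    chain_integral_form_add[OF assms(1) is_curvatureD(1)[OF assms(2)] is_curvatureD(1)[OF assms(3)]]
    is_curvatureD(2)[OF assms(2)] is_curvatureD(2)[OF assms(3)]
  by (simp add: is_curvature_def exp2pi_add)

lemma is_curvature_inverse: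
  assumes "differential_space X" "is_curvature X k h \<omega>"
  shows "is_curvature X k (\<lambda>z. inverse (h z)) (form_cmult (-1) \<omega>)"
  using form_cmult_forms[OF assms(1) is_curvatureD(1)[OF assms(2)], of "-1"] is_curvatureD(2)[OF assms(2)]
  by (simp add: is_curvature_def chain_integral_form_cmult exp2pi_minus)

lemma is_curvature_one: "is_curvature X k (\<lambda>_. 1) zero_form"
  by (simp add: is_curvature_def zero_form_forms chain_integral_zero_form)

lemma diff_chars_comm_group:
  assumes X: "differential_space X"
  shows "comm_group (diff_chars X k)"
proof (rule comm_groupI)
  fix h assume h: "h \<in> carrier (diff_chars X k)"
  show "\<exists>h'\<in>carrier (diff_chars X k). h' \<otimes>\<^bsub>diff_chars X k\<^esub> h = \<one>\<^bsub>diff_chars X k\<^esub>"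
  proof (rule bexI[of _ "\<lambda>z. inverse (h z)"])
    show "(\<lambda>z. inverse (h z)) \<in> carrier (diff_chars X k)"
      using h is_curvature_inverse[OF X] by (auto simp: diff_chars_simps(1) intro: U1_homs_inverse)
    show "(\<lambda>z. inverse (h z)) \<otimes>\<^bsub>diff_chars X k\<^esub> h = \<one>\<^bsub>diff_chars X k\<^esub>"
    proof -
      have "h z \<noteq> 0" for z using h U1_homs_nonzero by (auto simp: diff_chars_simps)
      then show ?thesis by (simp add: diff_chars_simps)
    qed
  qed
qed (auto simp: diff_chars_simps mult_ac intro: U1_homs_mult U1_homs_one is_curvature_mult[OF X] is_curvature_one)

section \<open>Curvature and characteristic class\<close>

lemma is_curvature_unique:
  assumes X: "differential_space X" and "is_curvature X (Suc m) h \<omega>" "is_curvature X (Suc m) h \<omega>'"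
  shows "\<omega> = \<omega>'"
proof -
  note \<omega> = is_curvatureD[OF assms(2)] and \<omega>' = is_curvatureD[OF assms(3)]
  show ?thesis
  proof (rule form_eq_of_integral_periods[OF X natural_form_form[OF X \<omega>(1)] natural_form_form[OF X \<omega>'(1)]])
    show "chain_integral (Suc m) \<omega> c - chain_integral (Suc m) \<omega>' c \<in> \<int>" if "c \<in> smooth_chains X (Suc m)" for c
      using \<omega>(2)[OF that] \<omega>'(2)[OF that] by (simp add: exp2pi_eq_iff[symmetric])
  qed (use forms_outside[OF \<omega>(1)] forms_outside[OF \<omega>'(1)] in auto)
qed

lemma curv_eq:
  assumes "differential_space X" "is_curvature X (Suc m) h \<omega>"
  shows "curv X (Suc m) h = \<omega>"
  unfolding curv_def using assms(2) is_curvature_unique[OF assms(1) _ assms(2)] by (rule the_equality)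

text \<open>The floor merely changes the type: it is applied where \<open>f\<close> takes integral
  values, and there it is the identity.\<close>

definition integer_cochain :: "'c set \<Rightarrow> ('c \<Rightarrow> real) \<Rightarrow> 'c \<Rightarrow> int" where
  "integer_cochain C f = (\<lambda>c. if c \<in> C then \<lfloor>f c\<rfloor> else 0)"

lemma of_int_integer_cochain:
  "c \<in> C \<Longrightarrow> f c \<in> \<int> \<Longrightarrow> real_of_int (integer_cochain C f c) = f c"
  by (auto simp: integer_cochain_def elim!: Ints_cases)

lemma integer_cochain_cochains:
  assumes K: "is_complex K" and f: "\<And>x. x \<in> chains K p \<Longrightarrow> f x \<in> \<int>"
    "\<And>x y. x \<in> chains K p \<Longrightarrow> y \<in> chains K p \<Longrightarrow> f (x + y) = f x + f y"
  shows "integer_cochain (chains K p) f \<in> cochains K p"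
proof (rule cochainsI)
  fix x y assume xy: "x \<in> chains K p" "y \<in> chains K p"
  then have "x + y \<in> chains K p" using add_subgroupD(4)[OF is_complexD(1)[OF K]] by blast
  with xy f have "real_of_int (integer_cochain (chains K p) f (x + y))
      = real_of_int (integer_cochain (chains K p) f x + integer_cochain (chains K p) f y)"
    by (simp add: of_int_integer_cochain)
  then show "integer_cochain (chains K p) f (x + y)
      = integer_cochain (chains K p) f x + integer_cochain (chains K p) f y"
    by (simp only: of_int_eq_iff)
qed (simp add: integer_cochain_def)

definition char_cocycle :: "'a dspace \<Rightarrow> nat \<Rightarrow> 'a form \<Rightarrow> ('a chain \<Rightarrow> real) \<Rightarrow> 'a chain \<Rightarrow> int" where
  "char_cocycle X m \<omega> G =
     integer_cochain (smooth_chains X (Suc m)) (\<lambda>c. chain_integral (Suc m) \<omega> c - G (chain_boundary (Suc m) c))"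

text \<open>The definition of the characteristic class asks for a lift that is additive on cycles.
  Here \<open>G\<close> is additive on all chains, so that the functions built from it are
  cochains.\<close>

definition is_lift ::
    "'a dspace \<Rightarrow> nat \<Rightarrow> ('a chain \<Rightarrow> complex) \<Rightarrow> 'a form \<Rightarrow> ('a chain \<Rightarrow> real) \<Rightarrow> bool" where
  "is_lift X m h \<omega> G \<longleftrightarrow> is_curvature X (Suc m) h \<omega> \<and> h \<in> U1_homs (cycles (smooth_complex X) m) \<and>
     (\<forall>x y. G (x + y) = G x + G y) \<and> (\<forall>z\<in>cycles (smooth_complex X) m. h z = exp2pi (G z))"

lemma is_liftD:
  assumes "is_lift X m h \<omega> G"
  shows "is_curvature X (Suc m) h \<omega>" "h \<in> U1_homs (cycles (smooth_complex X) m)"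
    "G (x + y) = G x + G y" "z \<in> cycles (smooth_complex X) m \<Longrightarrow> h z = exp2pi (G z)"
  using assms by (simp_all add: is_lift_def)

text \<open>Integrality holds because \<open>exp2pi\<close> of both terms is the value of
  \<open>h\<close> on the boundary. On a boundary the term with \<open>G\<close> drops out, so
  \<open>\<omega>\<close> has integral integrals over boundaries; hence \<open>\<omega>\<close> is
  closed, these integrals are 0 by Stokes' theorem, and the cochain is a cocycle.\<close>

lemma char_cocycle:
  assumes X: "differential_space X" and lift: "is_lift X m h \<omega> G"
  shows "c \<in> smooth_chains X (Suc m) \<Longrightarrow>
      real_of_int (char_cocycle X m \<omega> G c) = chain_integral (Suc m) \<omega> c - G (chain_boundary (Suc m) c)"
    and "char_cocycle X m \<omega> G \<in> cocycles (smooth_complex X) (Suc m)"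
proof -
  note \<omega> = is_liftD(1)[OF lift] and h = is_liftD(2)[OF lift] and G = is_liftD(3)[OF lift] and hG = is_liftD(4)[OF lift]
  let ?f = "\<lambda>c. chain_integral (Suc m) \<omega> c - G (chain_boundary (Suc m) c)"
  let ?u = "char_cocycle X m \<omega> G"
  note K = is_complex_smooth[OF X] and G0 = additive_zero[of G, OF G]
  have int: "?f c \<in> \<int>" if c: "c \<in> smooth_chains X (Suc m)" for c
    using is_curvatureD(2)[OF \<omega> c] hG[OF chain_boundary_cycle[OF X c]]
    by (simp add: exp2pi_eq_iff[symmetric])
  show u: "real_of_int (?u c) = ?f c" if "c \<in> smooth_chains X (Suc m)" for c
    unfolding char_cocycle_def using that int[OF that] by (rule of_int_integer_cochain)
  have cochain: "?u \<in> cochains (smooth_complex X) (Suc m)"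
    unfolding char_cocycle_def
    by (rule integer_cochain_cochains[OF K int]) (simp_all add: chain_boundary_add G)
  have bd: "?f (chain_boundary (Suc (Suc m)) c) = chain_integral (Suc m) \<omega> (chain_boundary (Suc (Suc m)) c)"
    if "c \<in> smooth_chains X (Suc (Suc m))" for c
    using smooth_chains_boundary_boundary[OF that] G0 by simp
  have closed: "ext_deriv X (Suc m) \<omega> = zero_form"
  proof (rule ext_deriv_eq_0[OF X is_curvatureD(1)[OF \<omega>]])
    show "chain_integral (Suc m) \<omega> (chain_boundary (Suc (Suc m)) c) \<in> \<int>"
      if "c \<in> smooth_chains X (Suc (Suc m))" for c
      using bd[OF that] int[OF chain_boundary_smooth[OF X that]] by simp
  qed
  have "?u (chain_boundary (Suc (Suc m)) c) = 0" if c: "c \<in> smooth_chains X (Suc (Suc m))" for c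
  proof -
    have "real_of_int (?u (chain_boundary (Suc (Suc m)) c)) = chain_integral (Suc (Suc m)) (ext_deriv X (Suc m) \<omega>) c"
      using u[OF chain_boundary_smooth[OF X c]] bd[OF c] stokes[OF X is_curvatureD(1)[OF \<omega>] c] by simp
    then show ?thesis by (simp add: closed chain_integral_zero_form)
  qed
  then show "?u \<in> cocycles (smooth_complex X) (Suc m)"
    using cochain by (auto simp: cocycles_def coboundary_def)
qed

text \<open>Another lift \<open>h'\<close> differs from \<open>G\<close> on cycles by an integral
  homomorphism. Its integral extension \<open>n\<close> to all chains has as coboundary the
  difference of the two cocycles, so the definite description denotes.\<close>

lemma char_class_eq:
  assumes X: "differential_space X" and lift: "is_lift X m h \<omega> G"
  shows "char_class X (Suc m) h = cohomology_class (smooth_complex X) (Suc m) (char_cocycle X m \<omega> G)"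
  unfolding char_class_def curv_eq[OF X is_liftD(1)[OF lift]] diff_Suc_1
proof (rule the_equality)
  note G = is_liftD(3)[OF lift] and hG = is_liftD(4)[OF lift] and u = char_cocycle[OF X lift]
  let ?K = "smooth_complex X"
  show "\<exists>h' u. (\<forall>x\<in>cycles ?K m. \<forall>y\<in>cycles ?K m. h' (x + y) = h' x + h' y) \<and>
      (\<forall>x\<in>cycles ?K m. h x = exp2pi (h' x)) \<and> u \<in> cocycles ?K (Suc m) \<and>
      (\<forall>x\<in>smooth_chains X (Suc m). real_of_int (u x) = chain_integral (Suc m) \<omega> x - h' (chain_boundary (Suc m) x)) \<and>
      cohomology_class ?K (Suc m) (char_cocycle X m \<omega> G) = cohomology_class ?K (Suc m) u"
    using u G hG by (intro exI[of _ G] exI[of _ "char_cocycle X m \<omega> G"]) auto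
  fix cls
  assume "\<exists>h' u. (\<forall>x\<in>cycles ?K m. \<forall>y\<in>cycles ?K m. h' (x + y) = h' x + h' y) \<and>
      (\<forall>x\<in>cycles ?K m. h x = exp2pi (h' x)) \<and> u \<in> cocycles ?K (Suc m) \<and>
      (\<forall>x\<in>smooth_chains X (Suc m). real_of_int (u x) = chain_integral (Suc m) \<omega> x - h' (chain_boundary (Suc m) x)) \<and>
      cls = cohomology_class ?K (Suc m) u"
  then obtain h' v where h': "\<And>x y. x \<in> cycles ?K m \<Longrightarrow> y \<in> cycles ?K m \<Longrightarrow> h' (x + y) = h' x + h' y"
      "\<And>x. x \<in> cycles ?K m \<Longrightarrow> h x = exp2pi (h' x)" and v: "v \<in> cocycles ?K (Suc m)"
      "\<And>x. x \<in> smooth_chains X (Suc m) \<Longrightarrow>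
          real_of_int (v x) = chain_integral (Suc m) \<omega> x - h' (chain_boundary (Suc m) x)"
      "cls = cohomology_class ?K (Suc m) v"
    by blast
  obtain n :: "'a chain \<Rightarrow> real" where n: "\<And>x y. n (x + y) = n x + n y" "\<And>x. x \<in> smooth_chains X m \<Longrightarrow> n x \<in> \<int>"
    "\<And>x. x \<in> smooth_chains X m \<Longrightarrow> chain_boundary m x = 0 \<Longrightarrow> n x = G x - h' x"
  proof (rule integral_hom_extension[OF add_subgroup_smooth_chains[of X m], of "chain_boundary m" "\<lambda>x. G x - h' x"])
    show "chain_boundary m (x + y) = chain_boundary m x + chain_boundary m y" for x y :: "'a chain"
      by (rule chain_boundary_add)
    show "G (x + y) - h' (x + y) = G x - h' x + (G y - h' y)"
      if "x \<in> smooth_chains X m" "chain_boundary m x = 0" "y \<in> smooth_chains X m" "chain_boundary m y = 0" for x y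
      using that h'(1)[of x y] G by (simp add: smooth_cycles_iff)
    show "G x - h' x \<in> \<int>" if "x \<in> smooth_chains X m" "chain_boundary m x = 0" for x
      using that h'(2)[of x] hG[of x] by (simp add: smooth_cycles_iff exp2pi_eq_iff[symmetric])
  qed (rule that)
  let ?n = "integer_cochain (smooth_chains X m) n"
  have "(\<lambda>c. v c - char_cocycle X m \<omega> G c) = coboundary ?K m ?n"
  proof
    fix c
    show "v c - char_cocycle X m \<omega> G c = coboundary ?K m ?n c"
    proof (cases "c \<in> smooth_chains X (Suc m)")
      case True
      note z = chain_boundary_cycle[OF X True, unfolded smooth_cycles_iff]
      have "real_of_int (v c - char_cocycle X m \<omega> G c) = n (chain_boundary (Suc m) c)"
        using v(2)[OF True] u(1)[OF True] n(3)[of "chain_boundary (Suc m) c"] z by simp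
      also have "\<dots> = real_of_int (?n (chain_boundary (Suc m) c))"
        using z n(2) by (simp add: of_int_integer_cochain)
      finally show ?thesis using True by (simp add: coboundary_def)
    next
      case False
      then show ?thesis
        using cochainsD(2)[of v ?K "Suc m" c] v(1) by (simp add: coboundary_def char_cocycle_def integer_cochain_def cocycles_def)
    qed
  qed
  moreover have "?n \<in> cochains ?K m" by (rule integer_cochain_cochains[OF is_complex_smooth[OF X] n(2) n(1)])
  ultimately show "cls = cohomology_class ?K (Suc m) (char_cocycle X m \<omega> G)"
    unfolding v(3) by (intro cohomology_class_eqI coboundaries_SucI)
qed

lemma is_liftE:
  assumes X: "differential_space X" and "h \<in> U1_homs (cycles (smooth_complex X) m)" "is_curvature X (Suc m) h \<omega>"
  obtains G where "is_lift X m h \<omega> G"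
proof -
  obtain G where "\<And>x y. G (x + y) = G x + G y" "\<And>z. z \<in> cycles (smooth_complex X) m \<Longrightarrow> h z = exp2pi (G z)"
    by (rule U1_hom_lift[OF add_subgroup_smooth_cycles[OF X] assms(2)]) (rule that)
  then have "is_lift X m h \<omega> G" using assms by (simp add: is_lift_def)
  then show thesis by (rule that)
qed

lemma diff_charsE:
  assumes X: "differential_space X" and h: "h \<in> carrier (diff_chars X (Suc m))"
  obtains \<omega> G where "is_lift X m h \<omega> G"
proof -
  from h obtain \<omega> where \<omega>: "h \<in> U1_homs (cycles (smooth_complex X) m)" "is_curvature X (Suc m) h \<omega>"
    by (auto simp: diff_chars_simps)
  show thesis by (rule is_liftE[OF X \<omega>]) (rule that)
qed

text \<open>Sums of lifts and of curvatures belong to the product of the characters, so already the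
  representing cocycles add.\<close>

lemma char_class_hom:
  assumes X: "differential_space X"
  shows "char_class X (Suc m) \<in> hom (diff_chars X (Suc m)) (integral_cohomology X (Suc m))"
proof (rule homI)
  fix h assume h: "h \<in> carrier (diff_chars X (Suc m))"
  obtain \<omega> G where *: "is_lift X m h \<omega> G"
    by (rule diff_charsE[OF X h]) (rule that)
  show "char_class X (Suc m) h \<in> carrier (integral_cohomology X (Suc m))"
    unfolding char_class_eq[OF X *] integral_cohomology_def carrier_cohomology
    by (rule imageI[OF char_cocycle(2)[OF X *]])
  fix h' assume h': "h' \<in> carrier (diff_chars X (Suc m))"
  obtain \<omega>' G' where **: "is_lift X m h' \<omega>' G'"
    by (rule diff_charsE[OF X h']) (rule that)
  let ?G = "\<lambda>z. G z + G' z" and ?\<omega> = "form_add \<omega> \<omega>'"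
  note lD = is_liftD[OF *] and lD' = is_liftD[OF **]
  have sum: "is_lift X m (\<lambda>z. h z * h' z) ?\<omega> ?G"
    using is_curvature_mult[OF X lD(1) lD'(1)] U1_homs_mult[OF lD(2) lD'(2)] lD(3,4) lD'(3,4)
    by (simp add: is_lift_def exp2pi_add)
  have "char_cocycle X m ?\<omega> ?G = (\<lambda>c. char_cocycle X m \<omega> G c + char_cocycle X m \<omega>' G' c)"
  proof
    fix c
    show "char_cocycle X m ?\<omega> ?G c = char_cocycle X m \<omega> G c + char_cocycle X m \<omega>' G' c"
    proof (cases "c \<in> smooth_chains X (Suc m)")
      case True
      have "real_of_int (char_cocycle X m ?\<omega> ?G c) = real_of_int (char_cocycle X m \<omega> G c + char_cocycle X m \<omega>' G' c)"
        using char_cocycle(1)[OF X sum True] char_cocycle(1)[OF X * True]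
          char_cocycle(1)[OF X ** True]
          chain_integral_form_add[OF X is_curvatureD(1)[OF lD(1)] is_curvatureD(1)[OF lD'(1)] True] by simp
      then show ?thesis by (simp only: of_int_eq_iff)
    qed (simp add: char_cocycle_def integer_cochain_def)
  qed
  then show "char_class X (Suc m) (h \<otimes>\<^bsub>diff_chars X (Suc m)\<^esub> h')
      = char_class X (Suc m) h \<otimes>\<^bsub>integral_cohomology X (Suc m)\<^esub> char_class X (Suc m) h'"
    unfolding diff_chars_simps(2) char_class_eq[OF X sum] char_class_eq[OF X *]
      char_class_eq[OF X **] integral_cohomology_def mult_cohomology by simp
qed

text \<open>Over the reals an integral cocycle \<open>u\<close> is cohomologous to integration over
  a closed form \<open>\<omega>\<close>. A primitive of the difference provides the lift of a
  character with curvature \<open>\<omega>\<close>, whose representing cocycle is \<open>u\<close>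
  itself.\<close>

lemma char_class_surj:
  assumes X: "differential_space X" and dR: "de_rham_theorem X"
  shows "char_class X (Suc m) ` carrier (diff_chars X (Suc m)) = carrier (integral_cohomology X (Suc m))"
proof
  show "char_class X (Suc m) ` carrier (diff_chars X (Suc m)) \<subseteq> carrier (integral_cohomology X (Suc m))"
    using char_class_hom[OF X] by (auto simp: hom_def)
  show "carrier (integral_cohomology X (Suc m)) \<subseteq> char_class X (Suc m) ` carrier (diff_chars X (Suc m))"
  proof
    let ?K = "smooth_complex X"
    fix cls assume "cls \<in> carrier (integral_cohomology X (Suc m))"
    then obtain u where u: "u \<in> cocycles ?K (Suc m)" "cls = cohomology_class ?K (Suc m) u"
      by (auto simp: integral_cohomology_def carrier_cohomology)
    let ?r = "\<lambda>c. real_of_int (u c)"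
    have "?r \<in> cocycles ?K (Suc m)"
    proof -
      have "u (chain_boundary (Suc (Suc m)) c) = 0" if "c \<in> smooth_chains X (Suc (Suc m))" for c
        using cocycle_boundary[OF u(1) that] by simp
      moreover have "u \<in> cochains ?K (Suc m)" using u(1) by (simp add: cocycles_def)
      ultimately show ?thesis by (simp add: cocycles_def cochains_def coboundary_def fun_eq_iff)
    qed
    then obtain \<omega> where \<omega>: "\<omega> \<in> forms X (Suc m)" "ext_deriv X (Suc m) \<omega> = zero_form"
      "(\<lambda>c. ?r c - form_cochain X (Suc m) \<omega> c) \<in> coboundaries ?K (Suc m)"
      by (rule de_rham_surj[OF dR]) (rule that)
    from \<omega>(3) obtain v where v: "v \<in> cochains ?K m" "(\<lambda>c. ?r c - form_cochain X (Suc m) \<omega> c) = coboundary ?K m v"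
      by (rule coboundaries_SucE) (rule that)
    \<comment> \<open>The sign turns \<open>u = \<integral>\<omega> + v \<circ> \<partial>\<close>
      into the shape \<open>\<integral>\<omega> - G \<circ> \<partial>\<close> of a characteristic
      cocycle.\<close>
    obtain G where G: "\<And>x y. G (x + y) = G x + G y" "\<And>x. x \<in> smooth_chains X m \<Longrightarrow> G x = - v x"
      by (rule real_hom_extension[OF add_subgroup_smooth_chains[of X m], of "\<lambda>x. - v x"])
        (use cochainsD(1)[OF v(1)] in simp, rule that)
    define h where "h z = (if z \<in> cycles ?K m then exp2pi (G z) else 1)" for z
    have h: "h \<in> U1_homs (cycles ?K m)"
      using add_subgroupD(4)[OF add_subgroup_smooth_cycles[OF X]] by (intro U1_homsI) (auto simp: h_def G exp2pi_add)
    have hG: "h z = exp2pi (G z)" if "z \<in> cycles ?K m" for z using that by (simp add: h_def)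
    have eq: "?r c = chain_integral (Suc m) \<omega> c - G (chain_boundary (Suc m) c)" if c: "c \<in> smooth_chains X (Suc m)" for c
      using fun_cong[OF v(2), of c] G(2)[OF chain_boundary_smooth[OF X c]] c
      by (simp add: form_cochain_def coboundary_def)
    have curv: "is_curvature X (Suc m) h \<omega>"
      unfolding is_curvature_def
    proof (intro conjI ballI \<omega>(1))
      fix c assume c: "c \<in> smooth_chains X (Suc m)"
      have "G (chain_boundary (Suc m) c) - chain_integral (Suc m) \<omega> c = real_of_int (- u c)" using eq[OF c] by simp
      then show "h (chain_boundary (Suc m) c) = exp2pi (chain_integral (Suc m) \<omega> c)"
        using hG[OF chain_boundary_cycle[OF X c]] by (simp only: exp2pi_eq_iff Ints_of_int)
    qed
    have lift: "is_lift X m h \<omega> G" using curv h G(1) hG by (simp add: is_lift_def)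
    have "char_cocycle X m \<omega> G = u"
    proof
      fix c
      show "char_cocycle X m \<omega> G c = u c"
      proof (cases "c \<in> smooth_chains X (Suc m)")
        case True
        then have "real_of_int (char_cocycle X m \<omega> G c) = real_of_int (u c)"
          using char_cocycle(1)[OF X lift True] eq[OF True] by simp
        then show ?thesis by simp
      next
        case False
        then show ?thesis using cochainsD(2)[of u ?K "Suc m" c] u(1)
          by (simp add: char_cocycle_def integer_cochain_def cocycles_def)
      qed
    qed
    then have "cls = char_class X (Suc m) h"
      using char_class_eq[OF X lift] u(2) by simp
    moreover have "h \<in> carrier (diff_chars X (Suc m))" using h curv by (auto simp: diff_chars_simps)
    ultimately show "cls \<in> char_class X (Suc m) ` carrier (diff_chars X (Suc m))" by blast
  qed
qed

section \<open>Relative differential characters\<close>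

lemma cone_cycles_iff:
  "(s, t) \<in> cycles (cone_complex \<phi> X A) p \<longleftrightarrow> (s, t) \<in> chains (cone_complex \<phi> X A) p \<and>
     chain_boundary p s + chain_map (p - 1) \<phi> t = 0 \<and> chain_boundary (p - 1) t = 0"
  by (simp add: cycles_def cbd_cone zero_prod_def)

lemma cone_cycles_Suc:
  "(s, t) \<in> cycles (cone_complex \<phi> X A) (Suc l) \<longleftrightarrow> s \<in> smooth_chains X (Suc l) \<and>
     t \<in> cycles (smooth_complex A) l \<and> chain_boundary (Suc l) s + chain_map l \<phi> t = 0"
  by (auto simp: cone_cycles_iff cone_chains_Suc smooth_cycles_iff)

lemma cone_cycles_0: "(s, t) \<in> cycles (cone_complex \<phi> X A) 0 \<longleftrightarrow> s \<in> cycles (smooth_complex X) 0 \<and> t = 0"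
  by (auto simp: cone_cycles_iff cone_chains_0 smooth_cycles_iff)

lemma cone_cycles_absolute:
  "(z, 0) \<in> cycles (cone_complex \<phi> X A) p \<longleftrightarrow> z \<in> cycles (smooth_complex X) p"
  by (cases p) (auto simp: cone_cycles_iff cone_chains_0 cone_chains_Suc smooth_cycles_iff smooth_chainsD)

definition is_relative_curvature ::
    "('a \<Rightarrow> 'b) \<Rightarrow> 'b dspace \<Rightarrow> 'a dspace \<Rightarrow> nat \<Rightarrow> ('b chain \<times> 'a chain \<Rightarrow> complex) \<Rightarrow> 'b form \<Rightarrow> 'a form \<Rightarrow> bool" where
  "is_relative_curvature \<phi> X A m f \<omega> \<theta> \<longleftrightarrow> \<omega> \<in> forms X (Suc m) \<and> \<theta> \<in> forms A m \<and>
     (\<forall>x\<in>smooth_chains X (Suc m). \<forall>y\<in>smooth_chains A m.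
        f (chain_boundary (Suc m) x + chain_map m \<phi> y, - chain_boundary m y)
          = exp2pi (chain_integral (Suc m) \<omega> x + chain_integral m \<theta> y))"

lemma is_relative_curvatureD:
  assumes "is_relative_curvature \<phi> X A m f \<omega> \<theta>"
  shows "\<omega> \<in> forms X (Suc m)" "\<theta> \<in> forms A m"
    "x \<in> smooth_chains X (Suc m) \<Longrightarrow> y \<in> smooth_chains A m \<Longrightarrow>
      f (chain_boundary (Suc m) x + chain_map m \<phi> y, - chain_boundary m y)
        = exp2pi (chain_integral (Suc m) \<omega> x + chain_integral m \<theta> y)"
  using assms by (simp_all add: is_relative_curvature_def)

lemma rel_diff_chars_simps:
  "f \<in> carrier (rel_diff_chars \<phi> X A (Suc m)) \<longleftrightarrow>
     f \<in> U1_homs (cycles (cone_complex \<phi> X A) m) \<and> (\<exists>\<omega> \<theta>. is_relative_curvature \<phi> X A m f \<omega> \<theta>)"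
  "f \<otimes>\<^bsub>rel_diff_chars \<phi> X A k\<^esub> f' = (\<lambda>z. f z * f' z)"
  "\<one>\<^bsub>rel_diff_chars \<phi> X A k\<^esub> = (\<lambda>_. 1)"
proof -
  have "(\<forall>(x, y)\<in>chains (cone_complex \<phi> X A) (Suc m).
          f (cbd (cone_complex \<phi> X A) (Suc m) (x, y)) = exp2pi (chain_integral (Suc m) \<omega> x + chain_integral m \<theta> y))
    \<longleftrightarrow> (\<forall>x\<in>smooth_chains X (Suc m). \<forall>y\<in>smooth_chains A m.
        f (chain_boundary (Suc m) x + chain_map m \<phi> y, - chain_boundary m y)
          = exp2pi (chain_integral (Suc m) \<omega> x + chain_integral m \<theta> y))" for \<omega> \<theta>
    unfolding cbd_cone by (auto simp: cone_complex_def)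
  then show "f \<in> carrier (rel_diff_chars \<phi> X A (Suc m)) \<longleftrightarrow>
     f \<in> U1_homs (cycles (cone_complex \<phi> X A) m) \<and> (\<exists>\<omega> \<theta>. is_relative_curvature \<phi> X A m f \<omega> \<theta>)"
    by (auto simp: rel_diff_chars_def is_relative_curvature_def)
qed (simp_all add: rel_diff_chars_def)

lemma rel_diff_chars_comm_group:
  assumes X: "differential_space X" and A: "differential_space A"
  shows "comm_group (rel_diff_chars \<phi> X A (Suc m))"
proof (rule comm_groupI)
  let ?R = "rel_diff_chars \<phi> X A (Suc m)"
  fix f assume f: "f \<in> carrier ?R"
  then obtain \<omega> \<theta> where \<omega>: "is_relative_curvature \<phi> X A m f \<omega> \<theta>" and fU: "f \<in> U1_homs (cycles (cone_complex \<phi> X A) m)"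
    by (auto simp: rel_diff_chars_simps)
  note D = is_relative_curvatureD[OF \<omega>]
  show "\<exists>f'\<in>carrier ?R. f' \<otimes>\<^bsub>?R\<^esub> f = \<one>\<^bsub>?R\<^esub>"
  proof (rule bexI[of _ "\<lambda>z. inverse (f z)"])
    have "is_relative_curvature \<phi> X A m (\<lambda>z. inverse (f z)) (form_cmult (-1) \<omega>) (form_cmult (-1) \<theta>)"
      using D form_cmult_forms[OF X D(1), of "-1"] form_cmult_forms[OF A D(2), of "-1"]
      by (simp add: is_relative_curvature_def chain_integral_form_cmult exp2pi_add exp2pi_diff exp2pi_minus divide_inverse)
    then show "(\<lambda>z. inverse (f z)) \<in> carrier ?R"
      using U1_homs_inverse[OF fU] by (auto simp: rel_diff_chars_simps)
    show "(\<lambda>z. inverse (f z)) \<otimes>\<^bsub>?R\<^esub> f = \<one>\<^bsub>?R\<^esub>"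
      using U1_homs_nonzero[OF fU] by (simp add: rel_diff_chars_simps)
  qed
  fix f' assume f': "f' \<in> carrier ?R"
  then obtain \<omega>' \<theta>' where \<omega>': "is_relative_curvature \<phi> X A m f' \<omega>' \<theta>'" and fU': "f' \<in> U1_homs (cycles (cone_complex \<phi> X A) m)"
    by (auto simp: rel_diff_chars_simps)
  note D' = is_relative_curvatureD[OF \<omega>']
  have "is_relative_curvature \<phi> X A m (\<lambda>z. f z * f' z) (form_add \<omega> \<omega>') (form_add \<theta> \<theta>')"
    using D D' form_add_forms[OF D(1) D'(1)] form_add_forms[OF D(2) D'(2)]
      chain_integral_form_add[OF X D(1) D'(1)] chain_integral_form_add[OF A D(2) D'(2)]
    by (simp add: is_relative_curvature_def exp2pi_add)
  then show "f \<otimes>\<^bsub>?R\<^esub> f' \<in> carrier ?R"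
    using U1_homs_mult[OF fU fU'] by (auto simp: rel_diff_chars_simps)
next
  have "is_relative_curvature \<phi> X A m (\<lambda>_. 1) zero_form zero_form"
    by (simp add: is_relative_curvature_def zero_form_forms chain_integral_zero_form)
  then show "\<one>\<^bsub>rel_diff_chars \<phi> X A (Suc m)\<^esub> \<in> carrier (rel_diff_chars \<phi> X A (Suc m))"
    by (auto simp: rel_diff_chars_simps U1_homs_one)
qed (auto simp: rel_diff_chars_simps mult_ac)

text \<open>Putting \<open>y = 0\<close> in the condition on the relative character leaves exactly
  the condition on a curvature.\<close>

lemma p_breve_curvature:
  assumes f: "f \<in> U1_homs (cycles (cone_complex \<phi> X A) m)" and X: "differential_space X"
    and \<omega>: "is_relative_curvature \<phi> X A m f \<omega> \<theta>"
  shows "p_breve X (Suc m) f \<in> U1_homs (cycles (smooth_complex X) m)"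
    and "is_curvature X (Suc m) (p_breve X (Suc m) f) \<omega>"
proof -
  note Z = add_subgroupD[OF add_subgroup_smooth_cycles[OF X, of m]]
  show "p_breve X (Suc m) f \<in> U1_homs (cycles (smooth_complex X) m)"
  proof (rule U1_homsI)
    fix x y assume xy: "x \<in> cycles (smooth_complex X) m" "y \<in> cycles (smooth_complex X) m"
    then show "p_breve X (Suc m) f (x + y) = p_breve X (Suc m) f x * p_breve X (Suc m) f y"
      using U1_homsD(2)[OF f, of "(x, 0)" "(y, 0)"] Z(4)[OF xy]
      by (simp add: p_breve_def cone_cycles_absolute)
  next
    fix x assume "x \<in> cycles (smooth_complex X) m"
    then show "cmod (p_breve X (Suc m) f x) = 1"
      using U1_homsD(1)[OF f, of "(x, 0)"] by (simp add: p_breve_def cone_cycles_absolute)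
  qed (simp add: p_breve_def)
  show "is_curvature X (Suc m) (p_breve X (Suc m) f) \<omega>"
    unfolding is_curvature_def
  proof (intro conjI ballI is_relative_curvatureD(1)[OF \<omega>])
    fix c assume c: "c \<in> smooth_chains X (Suc m)"
    show "p_breve X (Suc m) f (chain_boundary (Suc m) c) = exp2pi (chain_integral (Suc m) \<omega> c)"
      using is_relative_curvatureD(3)[OF \<omega> c, of 0] chain_boundary_cycle[OF X c]
      by (simp add: p_breve_def smooth_chainsD)
  qed
qed

lemma p_breve_hom:
  assumes "differential_space X"
  shows "p_breve X (Suc m) \<in> hom (rel_diff_chars \<phi> X A (Suc m)) (diff_chars X (Suc m))"
proof (rule homI)
  fix f assume "f \<in> carrier (rel_diff_chars \<phi> X A (Suc m))"
  then obtain \<omega> \<theta> where *: "f \<in> U1_homs (cycles (cone_complex \<phi> X A) m)" "is_relative_curvature \<phi> X A m f \<omega> \<theta>"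
    by (auto simp: rel_diff_chars_simps)
  show "p_breve X (Suc m) f \<in> carrier (diff_chars X (Suc m))"
    using p_breve_curvature[OF *(1) assms *(2)] by (auto simp only: diff_chars_simps diff_Suc_1)
qed (auto simp: rel_diff_chars_simps diff_chars_simps p_breve_def)

section \<open>Pulled back cohomology classes\<close>

lemma cohomology_pullback_class:
  assumes "differential_space A" "differential_space X" "smooth_map A X \<phi>"
  shows "cohomology_pullback A \<phi> k (cohomology_class (smooth_complex X) k u)
    = cohomology_class (smooth_complex A) k (cochain_pullback (smooth_complex A) (\<lambda>p. chain_map p \<phi>) k u)"
  unfolding cohomology_pullback_def
  by (rule cohomology_map_class[OF is_complex_smooth[OF assms(1)] is_chain_map_smooth[OF assms]])

lemma pulled_back_cohomology_simps:
  "carrier (pulled_back_cohomology X A \<phi> k) = cohomology_pullback A \<phi> k ` carrier (integral_cohomology X k)"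
  "x \<otimes>\<^bsub>pulled_back_cohomology X A \<phi> k\<^esub> y = x \<otimes>\<^bsub>integral_cohomology A k\<^esub> y"
  "\<one>\<^bsub>pulled_back_cohomology X A \<phi> k\<^esub> = \<one>\<^bsub>integral_cohomology A k\<^esub>"
  by (simp_all add: pulled_back_cohomology_def)

lemma cohomology_pullback_group_hom:
  assumes "differential_space A" "differential_space X" "smooth_map A X \<phi>"
  shows "group_hom (integral_cohomology X k) (integral_cohomology A k) (cohomology_pullback A \<phi> k)"
proof -
  have "comm_group (integral_cohomology X k)" "comm_group (integral_cohomology A k)"
    unfolding integral_cohomology_def by (intro cohomology_comm_group is_complex_smooth assms)+
  moreover have "cohomology_pullback A \<phi> k \<in> hom (integral_cohomology X k) (integral_cohomology A k)"
    unfolding integral_cohomology_def cohomology_pullback_def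
    by (rule cohomology_map_hom[OF is_complex_smooth[OF assms(1)] is_chain_map_smooth[OF assms]])
  ultimately show ?thesis
    by (simp add: group_hom_def group_hom_axioms_def comm_group.axioms(2))
qed

lemma pulled_back_cohomology_comm_group:
  assumes "differential_space A" "differential_space X" "smooth_map A X \<phi>"
  shows "comm_group (pulled_back_cohomology X A \<phi> k)"
proof -
  have "comm_group (integral_cohomology A k)"
    unfolding integral_cohomology_def by (intro cohomology_comm_group is_complex_smooth assms)
  moreover have "subgroup (cohomology_pullback A \<phi> k ` carrier (integral_cohomology X k)) (integral_cohomology A k)"
    by (rule group_hom.img_is_subgroup[OF cohomology_pullback_group_hom[OF assms]])
  ultimately show ?thesis
    unfolding pulled_back_cohomology_def by (rule subgroup_comm_group)
qed

lemma pullback_into_image_hom: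
  assumes "differential_space A" "differential_space X" "smooth_map A X \<phi>"
  shows "cohomology_pullback A \<phi> k \<in> hom (integral_cohomology X k) (pulled_back_cohomology X A \<phi> k)"
  using group_hom.homh[OF cohomology_pullback_group_hom[OF assms, of k]]
  by (auto simp: hom_def pulled_back_cohomology_simps)

lemma pulled_class_hom:
  assumes "differential_space A" "differential_space X" "smooth_map A X \<phi>"
  shows "cohomology_pullback A \<phi> (Suc m) \<circ> char_class X (Suc m)
    \<in> hom (diff_chars X (Suc m)) (pulled_back_cohomology X A \<phi> (Suc m))"
  by (rule hom_compose[OF char_class_hom[OF assms(2)] pullback_into_image_hom[OF assms]])

section \<open>Exactness at the characters of the target\<close>

lemma pulled_class_eq_one_iff:
  assumes A: "differential_space A" and X: "differential_space X" and \<phi>: "smooth_map A X \<phi>"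
    and *: "is_lift X m h \<omega> G"
  shows "(cohomology_pullback A \<phi> (Suc m) \<circ> char_class X (Suc m)) h = \<one>\<^bsub>pulled_back_cohomology X A \<phi> (Suc m)\<^esub>
    \<longleftrightarrow> cochain_pullback (smooth_complex A) (\<lambda>p. chain_map p \<phi>) (Suc m) (char_cocycle X m \<omega> G)
        \<in> coboundaries (smooth_complex A) (Suc m)"
  unfolding comp_def char_class_eq[OF X *] cohomology_pullback_class[OF A X \<phi>]
    pulled_back_cohomology_simps(3) integral_cohomology_def one_cohomology cohomology_class_eq_iff
  by simp

text \<open>Once the pullback of \<open>\<omega>\<close> is the derivative of
  \<open>\<theta>\<close>, the pulled back cocycle is the function
  \<open>\<integral>\<theta> - G \<circ> \<phi>_*\<close> evaluated on the boundary. This function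
  is integral on cycles, and its integral extension \<open>n\<close> is the primitive
  sought.\<close>

lemma p_breve_image_subset:
  assumes A: "differential_space A" and X: "differential_space X" and \<phi>: "smooth_map A X \<phi>"
    and f: "f \<in> carrier (rel_diff_chars \<phi> X A (Suc m))"
  shows "(cohomology_pullback A \<phi> (Suc m) \<circ> char_class X (Suc m)) (p_breve X (Suc m) f)
    = \<one>\<^bsub>pulled_back_cohomology X A \<phi> (Suc m)\<^esub>"
proof -
  from f obtain \<omega> \<theta> where \<omega>: "is_relative_curvature \<phi> X A m f \<omega> \<theta>" and fU: "f \<in> U1_homs (cycles (cone_complex \<phi> X A) m)"
    by (auto simp: rel_diff_chars_simps)
  note D = is_relative_curvatureD[OF \<omega>]
  let ?h = "p_breve X (Suc m) f"
  note h = p_breve_curvature[OF fU X \<omega>]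
  have hf: "?h z = f (z, 0)" if "z \<in> cycles (smooth_complex X) m" for z using that by (simp add: p_breve_def)
  obtain G where lift: "is_lift X m ?h \<omega> G"
    by (rule is_liftE[OF X h]) (rule that)
  note G = is_liftD(3)[OF lift] is_liftD(4)[OF lift]
  have f0: "f (0, 0) = 1"
    using U1_homs_zero(1)[OF fU add_subgroup_cycles[OF is_complex_cone[OF A X \<phi>]]] by (simp add: zero_prod_def)
  note \<phi>\<omega> = form_pullback_forms[OF A X \<phi> D(1)]
  have "form_pullback A \<phi> (Suc m) \<omega> = ext_deriv A m \<theta>"
  proof (rule form_eq_of_integral_periods[OF A natural_form_form[OF A \<phi>\<omega>] natural_form_ext_deriv[OF A D(2)]])
    fix y assume y: "y \<in> smooth_chains A (Suc m)"
    note dy = chain_boundary_smooth[OF A y]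
    \<comment> \<open>The pair of the image of \<open>y\<close> and minus the boundary of
      \<open>y\<close> is the cone boundary of \<open>(0, y)\<close>. Its own boundary is 0, where
      \<open>f\<close> takes the value 1.\<close>
    have "f (chain_boundary (Suc m) (chain_map (Suc m) \<phi> y) + chain_map m \<phi> (- chain_boundary (Suc m) y),
          - chain_boundary m (- chain_boundary (Suc m) y))
        = exp2pi (chain_integral (Suc m) \<omega> (chain_map (Suc m) \<phi> y) + chain_integral m \<theta> (- chain_boundary (Suc m) y))"
      using chain_map_smooth[OF A X \<phi> y] dy by (intro D(3)) (simp_all add: smooth_chainsD)
    then have "chain_integral (Suc m) \<omega> (chain_map (Suc m) \<phi> y) - chain_integral m \<theta> (chain_boundary (Suc m) y) \<in> \<int>"
      using chain_boundary_chain_map_smooth[OF y, of \<phi>] smooth_chains_boundary_boundary[OF y] f0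
      by (simp add: chain_map_minus chain_boundary_minus exp2pi_eq_1_iff[symmetric])
    then show "chain_integral (Suc m) (form_pullback A \<phi> (Suc m) \<omega>) y - chain_integral (Suc m) (ext_deriv A m \<theta>) y \<in> \<int>"
      by (simp add: chain_integral_pullback[OF y] stokes[OF A D(2) y])
  qed (use forms_outside[OF \<phi>\<omega>] ext_deriv_outside[of A _ _ _ _ _ m \<theta>] in auto)
  then have vanish: "chain_integral (Suc m) \<omega> (chain_map (Suc m) \<phi> y) = chain_integral m \<theta> (chain_boundary (Suc m) y)"
    if "y \<in> smooth_chains A (Suc m)" for y
    using chain_integral_pullback[OF that, of \<phi> \<omega>] stokes[OF A D(2) that] by simp
  \<comment> \<open>On a cycle \<open>x\<close> of \<open>A\<close> the value of \<open>f\<close> at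
    the image of \<open>x\<close>, paired with 0, can be computed from the lift \<open>G\<close> and
    from \<open>\<theta>\<close>; hence the two exponents differ by an integer.\<close>
  obtain n :: "'a chain \<Rightarrow> real" where n: "\<And>x y. n (x + y) = n x + n y" "\<And>x. x \<in> smooth_chains A m \<Longrightarrow> n x \<in> \<int>"
    "\<And>x. x \<in> smooth_chains A m \<Longrightarrow> chain_boundary m x = 0 \<Longrightarrow> n x = chain_integral m \<theta> x - G (chain_map m \<phi> x)"
  proof (rule integral_hom_extension[OF add_subgroup_smooth_chains[of A m], of "chain_boundary m"
        "\<lambda>x. chain_integral m \<theta> x - G (chain_map m \<phi> x)"])
    show "chain_boundary m (x + y) = chain_boundary m x + chain_boundary m y" for x y :: "'a chain"
      by (rule chain_boundary_add)
    show "chain_integral m \<theta> x - G (chain_map m \<phi> x) \<in> \<int>" if t: "x \<in> smooth_chains A m" "chain_boundary m x = 0" for x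
    proof -
      have "chain_map m \<phi> x \<in> cycles (smooth_complex X) m"
        using t by (intro chain_map_cycle[OF A X \<phi>]) (simp add: smooth_cycles_iff)
      then have "exp2pi (G (chain_map m \<phi> x)) = f (chain_map m \<phi> x, 0)" using G(2) hf by simp
      also have "\<dots> = exp2pi (chain_integral m \<theta> x)"
        using D(3)[of 0 x] t by (simp add: smooth_chainsD)
      finally show ?thesis by (metis exp2pi_eq_iff)
    qed
  qed (simp_all add: G chain_map_add, rule that)
  let ?n = "integer_cochain (smooth_chains A m) n"
  have "cochain_pullback (smooth_complex A) (\<lambda>p. chain_map p \<phi>) (Suc m) (char_cocycle X m \<omega> G) = coboundary (smooth_complex A) m ?n"
  proof
    fix y
    show "cochain_pullback (smooth_complex A) (\<lambda>p. chain_map p \<phi>) (Suc m) (char_cocycle X m \<omega> G) y = coboundary (smooth_complex A) m ?n y"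
    proof (cases "y \<in> smooth_chains A (Suc m)")
      case True
      note z = chain_boundary_cycle[OF A True, unfolded smooth_cycles_iff]
      have "real_of_int (char_cocycle X m \<omega> G (chain_map (Suc m) \<phi> y)) = n (chain_boundary (Suc m) y)"
        using char_cocycle(1)[OF X lift chain_map_smooth[OF A X \<phi> True]] vanish[OF True] z
          chain_boundary_chain_map_smooth[OF True, of \<phi>] n(3)[of "chain_boundary (Suc m) y"] by simp
      also have "\<dots> = real_of_int (?n (chain_boundary (Suc m) y))"
        using z n(2) by (simp add: of_int_integer_cochain)
      finally show ?thesis using True by (simp add: coboundary_def cochain_pullback_def)
    qed (simp add: coboundary_def cochain_pullback_def)
  qed
  moreover have "?n \<in> cochains (smooth_complex A) m"
    by (rule integer_cochain_cochains[OF is_complex_smooth[OF A] n(2) n(1)])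
  ultimately show ?thesis
    unfolding pulled_class_eq_one_iff[OF A X \<phi> lift] by (intro coboundaries_SucI)
qed

text \<open>If \<open>c h\<close> pulls back to zero, the real cochain \<open>r\<close> below has coboundary \<open>\<integral>\<phi>\<^sup>*curv h\<close>.  By the de Rham
  theorem it is then integration over a form \<open>\<theta>\<close>, up to the coboundary of a cochain \<open>W\<close>.\<close>

lemma p_breve_image_superset:
  assumes A: "differential_space A" and X: "differential_space X" and \<phi>: "smooth_map A X \<phi>"
    and dR: "de_rham_theorem A" and h: "h \<in> carrier (diff_chars X (Suc m))"
    and one: "(cohomology_pullback A \<phi> (Suc m) \<circ> char_class X (Suc m)) h = \<one>\<^bsub>pulled_back_cohomology X A \<phi> (Suc m)\<^esub>"
  shows "h \<in> p_breve X (Suc m) ` carrier (rel_diff_chars \<phi> X A (Suc m))"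
proof -
  let ?K = "smooth_complex A" and ?\<phi> = "\<lambda>p. chain_map p \<phi>" and ?C = "cone_complex \<phi> X A"
  note K = is_complex_smooth[OF A]
  obtain \<omega> G where *: "is_lift X m h \<omega> G"
    by (rule diff_charsE[OF X h]) (rule that)
  note lD = is_liftD[OF *] and u = char_cocycle[OF X *]
  note \<omega> = is_curvatureD(1)[OF lD(1)]
  let ?u = "char_cocycle X m \<omega> G"
  from one have "cochain_pullback ?K ?\<phi> (Suc m) ?u \<in> coboundaries ?K (Suc m)"
    unfolding pulled_class_eq_one_iff[OF A X \<phi> *] .
  then obtain v where v: "v \<in> cochains ?K m" "cochain_pullback ?K ?\<phi> (Suc m) ?u = coboundary ?K m v"
    by (rule coboundaries_SucE) (rule that)
  have v': "?u (chain_map (Suc m) \<phi> y) = v (chain_boundary (Suc m) y)" if "y \<in> smooth_chains A (Suc m)" for y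
    using fun_cong[OF v(2), of y] that by (simp add: cochain_pullback_def coboundary_def)
  \<comment> \<open>The pulled back cocycle is integration over the pulled back form minus the
    coboundary of \<open>G \<circ> \<phi>_*\<close>, and it is also the coboundary of
    \<open>v\<close>. Adding both primitives leaves a primitive of the integration cochain.\<close>
  define r where "r y = (if y \<in> smooth_chains A m then G (chain_map m \<phi> y) + real_of_int (v y) else 0)" for y
  have r: "r \<in> cochains ?K m"
    by (rule cochainsI) (simp_all add: r_def smooth_chainsD chain_map_add lD(3) cochainsD(1)[OF v(1)])
  let ?\<phi>\<omega> = "form_pullback A \<phi> (Suc m) \<omega>"
  note \<phi>\<omega> = form_pullback_forms[OF A X \<phi> \<omega>]
  have dr: "r (chain_boundary (Suc m) y) = chain_integral (Suc m) ?\<phi>\<omega> y" if y: "y \<in> smooth_chains A (Suc m)" for y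
  proof -
    have "chain_integral (Suc m) ?\<phi>\<omega> y
        = real_of_int (?u (chain_map (Suc m) \<phi> y)) + G (chain_boundary (Suc m) (chain_map (Suc m) \<phi> y))"
      unfolding chain_integral_pullback[OF y] u(1)[OF chain_map_smooth[OF A X \<phi> y]] by simp
    also have "\<dots> = r (chain_boundary (Suc m) y)"
      using v'[OF y] chain_boundary_chain_map_smooth[OF y, of \<phi>] chain_boundary_smooth[OF A y]
      by (simp add: r_def)
    finally show ?thesis by simp
  qed
  have exact: "?\<phi>\<omega> \<in> exact_forms A (Suc m)"
  proof (rule de_rham_inj[OF dR \<phi>\<omega>])
    show "ext_deriv A (Suc m) ?\<phi>\<omega> = zero_form"
    proof (rule ext_deriv_eq_0[OF A \<phi>\<omega>])
      fix c assume c: "c \<in> smooth_chains A (Suc (Suc m))"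
      have "chain_integral (Suc m) ?\<phi>\<omega> (chain_boundary (Suc (Suc m)) c) = r 0"
        using dr[OF chain_boundary_smooth[OF A c]] smooth_chains_boundary_boundary[OF c] by simp
      then show "chain_integral (Suc m) ?\<phi>\<omega> (chain_boundary (Suc (Suc m)) c) \<in> \<int>"
        using cochain_on_zero[OF K r] by simp
    qed
    show "form_cochain A (Suc m) ?\<phi>\<omega> \<in> coboundaries ?K (Suc m)"
      by (rule coboundaries_SucI[OF r]) (auto simp: form_cochain_def coboundary_def dr)
  qed
  then obtain \<eta> where \<eta>: "\<eta> \<in> forms A m" "?\<phi>\<omega> = ext_deriv A m \<eta>" by (auto simp: exact_forms_def)
  \<comment> \<open>Integration over \<open>\<eta>\<close> and \<open>r\<close> have the same
    coboundary, but their difference may represent a nonzero class; a closed form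
    \<open>\<eta>'\<close> accounts for it.\<close>
  have "(\<lambda>y. r y - form_cochain A m \<eta> y) \<in> cocycles ?K m"
  proof -
    have "(\<lambda>y. r y - form_cochain A m \<eta> y) \<in> cochains ?K m"
      by (rule cochains_diff[OF r form_cochain_cochains])
    moreover have "r (chain_boundary (Suc m) y) - form_cochain A m \<eta> (chain_boundary (Suc m) y) = 0"
      if y: "y \<in> smooth_chains A (Suc m)" for y
      using dr[OF y] \<eta>(2) stokes[OF A \<eta>(1) y] chain_boundary_smooth[OF A y] by (simp add: form_cochain_def)
    ultimately show ?thesis by (auto simp: cocycles_def coboundary_def)
  qed
  then obtain \<eta>' where \<eta>': "\<eta>' \<in> forms A m" "ext_deriv A m \<eta>' = zero_form"
    "(\<lambda>y. r y - form_cochain A m \<eta> y - form_cochain A m \<eta>' y) \<in> coboundaries ?K m"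
    by (rule de_rham_surj[OF dR]) (rule that)
  define \<theta> where "\<theta> = form_add \<eta> \<eta>'"
  have \<theta>: "\<theta> \<in> forms A m" unfolding \<theta>_def by (rule form_add_forms[OF \<eta>(1) \<eta>'(1)])
  let ?b = "\<lambda>y. r y - form_cochain A m \<eta> y - form_cochain A m \<eta>' y"
  have b: "?b y = r y - chain_integral m \<theta> y" if "y \<in> smooth_chains A m" for y
    using that chain_integral_form_add[OF A \<eta>(1) \<eta>'(1) that] by (simp add: form_cochain_def \<theta>_def)
  \<comment> \<open>The statement covers degree 0, where there are no cochains of lower degree:
    coboundaries are then zero and \<open>W = 0\<close> serves. In higher degrees the second
    components of cone cycles are smooth chains, on which a cochain is additive.\<close>
  have "\<exists>W. W 0 = 0 \<and> (\<forall>s t s' t'. (s, t) \<in> cycles ?C m \<longrightarrow> (s', t') \<in> cycles ?C m \<longrightarrow> W (t + t') = W t + W t') \<and>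
      (\<forall>y\<in>smooth_chains A m. W (- chain_boundary m y) = - ?b y)"
  proof (cases m)
    case 0
    then have "?b = (\<lambda>_. 0)" using \<eta>'(3) by (simp add: coboundaries_0)
    then show ?thesis by (intro exI[of _ "\<lambda>_. 0"]) (simp add: fun_eq_iff)
  next
    case (Suc l)
    obtain W where W: "W \<in> cochains ?K l" "?b = coboundary ?K l W"
      using \<eta>'(3) coboundaries_SucE unfolding Suc by blast
    have "W (- chain_boundary m y) = - ?b y" if y: "y \<in> smooth_chains A m" for y
    proof -
      have dy: "chain_boundary m y \<in> smooth_chains A l" using chain_boundary_smooth[OF A] y Suc by simp
      have "W (- chain_boundary m y) + W (chain_boundary m y) = 0"
        using cochainsD(1)[OF W(1) smooth_chainsD(3)[OF dy] dy] cochain_on_zero[OF K W(1)] by simp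
      moreover have "?b y = W (chain_boundary m y)"
        using fun_cong[OF W(2), of y] y Suc by (simp add: coboundary_def)
      ultimately show ?thesis by simp
    qed
    moreover have "W (t + t') = W t + W t'" if "(s, t) \<in> cycles ?C m" "(s', t') \<in> cycles ?C m" for s t s' t'
      using that unfolding Suc cone_cycles_Suc smooth_cycles_iff by (intro cochainsD(1)[OF W(1)]) auto
    ultimately show ?thesis using cochain_on_zero[OF K W(1)] by blast
  qed
  then obtain W where W: "W 0 = 0"
    "\<And>s t s' t'. (s, t) \<in> cycles ?C m \<Longrightarrow> (s', t') \<in> cycles ?C m \<Longrightarrow> W (t + t') = W t + W t'"
    "\<And>y. y \<in> smooth_chains A m \<Longrightarrow> W (- chain_boundary m y) = - ?b y"
    by blast
  \<comment> \<open>On the cone boundary of \<open>(0, y)\<close> the exponent is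
    \<open>G (\<phi>_* y) - (r y - \<integral>\<theta>)\<close>, with the integral taken over
    \<open>y\<close>. By the choice of \<open>r\<close> this is
    \<open>\<integral>\<theta> - v y\<close>, and \<open>v y\<close> is an integer.\<close>
  define f where "f z = (if z \<in> cycles ?C m then exp2pi (G (fst z) + W (snd z)) else 1)" for z
  note C = is_complex_cone[OF A X \<phi>]
  have fU: "f \<in> U1_homs (cycles ?C m)"
  proof (rule U1_homsI)
    fix x y assume xy: "x \<in> cycles ?C m" "y \<in> cycles ?C m"
    have "W (snd x + snd y) = W (snd x) + W (snd y)"
      using W(2)[of "fst x" "snd x" "fst y" "snd y"] xy by simp
    then show "f (x + y) = f x * f y"
      using xy add_subgroupD(4)[OF add_subgroup_cycles[OF C] xy] lD(3)[of "fst x" "fst y"]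
      by (simp add: f_def flip: exp2pi_add) (simp add: algebra_simps)
  qed (simp_all add: f_def)
  have "is_relative_curvature \<phi> X A m f \<omega> \<theta>"
    unfolding is_relative_curvature_def
  proof (intro conjI ballI \<omega> \<theta>)
    fix x y assume x: "x \<in> smooth_chains X (Suc m)" and y: "y \<in> smooth_chains A m"
    have "(chain_boundary (Suc m) x + chain_map m \<phi> y, - chain_boundary m y) \<in> cycles ?C m"
      using cbd_cycle[OF C, of "(x, y)" m] x y by (simp add: cone_chains_Suc cbd_cone)
    then have "f (chain_boundary (Suc m) x + chain_map m \<phi> y, - chain_boundary m y)
        = exp2pi (G (chain_boundary (Suc m) x) + G (chain_map m \<phi> y) + (chain_integral m \<theta> y - r y))"
      using W(3)[OF y] b[OF y] by (simp add: f_def lD(3))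
    also have "\<dots> = exp2pi (chain_integral (Suc m) \<omega> x + chain_integral m \<theta> y)"
      unfolding exp2pi_eq_iff
    proof -
      have "G (chain_boundary (Suc m) x) + G (chain_map m \<phi> y) + (chain_integral m \<theta> y - r y)
          - (chain_integral (Suc m) \<omega> x + chain_integral m \<theta> y) = real_of_int (- ?u x - v y)"
        using u(1)[OF x] y by (simp add: r_def)
      then show "G (chain_boundary (Suc m) x) + G (chain_map m \<phi> y) + (chain_integral m \<theta> y - r y)
          - (chain_integral (Suc m) \<omega> x + chain_integral m \<theta> y) \<in> \<int>"
        by (simp only: Ints_of_int)
    qed
    finally show "f (chain_boundary (Suc m) x + chain_map m \<phi> y, - chain_boundary m y)
        = exp2pi (chain_integral (Suc m) \<omega> x + chain_integral m \<theta> y)" .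
  qed
  with fU have "f \<in> carrier (rel_diff_chars \<phi> X A (Suc m))" by (auto simp: rel_diff_chars_simps)
  moreover have "h = p_breve X (Suc m) f"
    using U1_homsD(3)[OF lD(2)] lD(4) W(1) by (auto simp: p_breve_def f_def cone_cycles_absolute)
  ultimately show ?thesis by blast
qed

section \<open>Exactness at the relative characters\<close>

lemma i_breve_carrier:
  assumes A: "differential_space A" and X: "differential_space X" and \<phi>: "smooth_map A X \<phi>"
    and g: "g \<in> carrier (diff_chars A (Suc l))"
  shows "i_breve \<phi> X A (Suc (Suc l)) g \<in> carrier (rel_diff_chars \<phi> X A (Suc (Suc l)))"
proof -
  let ?C = "cone_complex \<phi> X A" and ?f = "i_breve \<phi> X A (Suc (Suc l)) g"
  note C = is_complex_cone[OF A X \<phi>]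
  from g obtain \<eta> where \<eta>: "g \<in> U1_homs (cycles (smooth_complex A) l)" "is_curvature A (Suc l) g \<eta>"
    by (auto simp: diff_chars_simps)
  have f: "?f (s, t) = g t" if "(s, t) \<in> cycles ?C (Suc l)" for s t
    using that by (simp add: i_breve_def)
  have "?f \<in> U1_homs (cycles ?C (Suc l))"
  proof (rule U1_homsI)
    fix x assume "x \<in> cycles ?C (Suc l)"
    then show "cmod (?f x) = 1"
      using f[of "fst x" "snd x"] U1_homsD(1)[OF \<eta>(1), of "snd x"] cone_cycles_Suc[of "fst x" "snd x"] by simp
  next
    fix x y assume xy: "x \<in> cycles ?C (Suc l)" "y \<in> cycles ?C (Suc l)"
    obtain s t s' t' where e: "x = (s, t)" "y = (s', t')" by (cases x, cases y)
    have sum: "(s + s', t + t') \<in> cycles ?C (Suc l)"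
      using add_subgroupD(4)[OF add_subgroup_cycles[OF C] xy] by (simp add: e)
    have t: "t \<in> cycles (smooth_complex A) l" "t' \<in> cycles (smooth_complex A) l"
      using xy by (simp_all add: e cone_cycles_Suc)
    show "?f (x + y) = ?f x * ?f y"
      using f[OF sum] f[OF xy(1)[unfolded e]] f[OF xy(2)[unfolded e]] U1_homsD(2)[OF \<eta>(1) t] by (simp add: e)
  qed (auto simp: i_breve_def)
  \<comment> \<open>The form on \<open>A\<close> is minus the curvature of \<open>g\<close>, because
    the second component of a cone boundary is minus the boundary.\<close>
  moreover have "is_relative_curvature \<phi> X A (Suc l) ?f zero_form (form_cmult (-1) \<eta>)"
    unfolding is_relative_curvature_def
  proof (intro conjI ballI zero_form_forms form_cmult_forms[OF A is_curvatureD(1)[OF \<eta>(2)]])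
    fix x y assume x: "x \<in> smooth_chains X (Suc (Suc l))" and y: "y \<in> smooth_chains A (Suc l)"
    have "(chain_boundary (Suc (Suc l)) x + chain_map (Suc l) \<phi> y, - chain_boundary (Suc l) y) \<in> cycles ?C (Suc l)"
      using cbd_cycle[OF C, of "(x, y)" "Suc l"] x y by (simp add: cone_chains_Suc cbd_cone)
    then have "?f (chain_boundary (Suc (Suc l)) x + chain_map (Suc l) \<phi> y, - chain_boundary (Suc l) y)
        = g (- chain_boundary (Suc l) y)" by (rule f)
    also have "\<dots> = exp2pi (- chain_integral (Suc l) \<eta> y)"
      using is_curvatureD(2)[OF \<eta>(2), of "- y"] y by (simp add: smooth_chainsD chain_boundary_minus)
    finally show "?f (chain_boundary (Suc (Suc l)) x + chain_map (Suc l) \<phi> y, - chain_boundary (Suc l) y)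
        = exp2pi (chain_integral (Suc (Suc l)) zero_form x + chain_integral (Suc l) (form_cmult (-1) \<eta>) y)"
      by (simp add: chain_integral_zero_form chain_integral_form_cmult)
  qed
  ultimately show ?thesis by (auto simp: rel_diff_chars_simps)
qed

lemma i_breve_hom:
  assumes A: "differential_space A" and X: "differential_space X" and \<phi>: "smooth_map A X \<phi>"
  shows "i_breve \<phi> X A (Suc (Suc l)) \<in> hom (diff_chars A (Suc l)) (rel_diff_chars \<phi> X A (Suc (Suc l)))"
  by (rule homI[OF i_breve_carrier[OF A X \<phi>]])
     (auto simp: i_breve_def diff_chars_simps rel_diff_chars_simps split: prod.split)

text \<open>If \<open>f\<close> is trivial on all \<open>(z, 0)\<close>, then
  \<open>f (s, t)\<close> depends on \<open>t\<close> alone. This defines a character on the group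
  of those \<open>t\<close> that occur in cone cycles; an extension to all cycles of
  \<open>A\<close> is a preimage of \<open>f\<close>.\<close>

lemma i_breve_image:
  assumes A: "differential_space A" and X: "differential_space X" and \<phi>: "smooth_map A X \<phi>"
  shows "i_breve \<phi> X A (Suc (Suc l)) ` carrier (diff_chars A (Suc l))
    = kernel (rel_diff_chars \<phi> X A (Suc (Suc l))) (diff_chars X (Suc (Suc l))) (p_breve X (Suc (Suc l)))"
proof
  let ?C = "cone_complex \<phi> X A" and ?R = "rel_diff_chars \<phi> X A (Suc (Suc l))"
  note C = is_complex_cone[OF A X \<phi>] and ZA = add_subgroup_smooth_cycles[OF A, of l]
  show "i_breve \<phi> X A (Suc (Suc l)) ` carrier (diff_chars A (Suc l))
    \<subseteq> kernel ?R (diff_chars X (Suc (Suc l))) (p_breve X (Suc (Suc l)))"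
  proof (rule image_subsetI)
    fix g assume g: "g \<in> carrier (diff_chars A (Suc l))"
    then have "g 0 = 1" using U1_homs_zero(1)[OF _ ZA] by (auto simp: diff_chars_simps)
    then have "p_breve X (Suc (Suc l)) (i_breve \<phi> X A (Suc (Suc l)) g) = (\<lambda>_. 1)"
      by (auto simp: p_breve_def i_breve_def)
    then show "i_breve \<phi> X A (Suc (Suc l)) g \<in> kernel ?R (diff_chars X (Suc (Suc l))) (p_breve X (Suc (Suc l)))"
      using i_breve_carrier[OF A X \<phi> g] by (simp add: kernel_def diff_chars_simps)
  qed
  show "kernel ?R (diff_chars X (Suc (Suc l))) (p_breve X (Suc (Suc l)))
    \<subseteq> i_breve \<phi> X A (Suc (Suc l)) ` carrier (diff_chars A (Suc l))"
  proof
    fix f assume "f \<in> kernel ?R (diff_chars X (Suc (Suc l))) (p_breve X (Suc (Suc l)))"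
    then have "f \<in> carrier ?R" and p1: "p_breve X (Suc (Suc l)) f = (\<lambda>_. 1)"
      by (simp_all add: kernel_def diff_chars_simps)
    then obtain \<omega> \<theta> where \<omega>: "is_relative_curvature \<phi> X A (Suc l) f \<omega> \<theta>" and fU: "f \<in> U1_homs (cycles ?C (Suc l))"
      by (auto simp: rel_diff_chars_simps)
    note D = is_relative_curvatureD[OF \<omega>] and Csub = add_subgroup_cycles[OF C, of "Suc l"]
    note Cd = add_subgroupD[OF Csub] and f0 = U1_homs_zero[OF fU Csub]
    have f1: "f (z, 0) = 1" if "z \<in> cycles (smooth_complex X) (Suc l)" for z
      using fun_cong[OF p1, of z] that by (simp add: p_breve_def)
    have indep: "f (s, t) = f (s', t)" if st: "(s, t) \<in> cycles ?C (Suc l)" "(s', t) \<in> cycles ?C (Suc l)" for s s' t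
    proof -
      have "(s - s', 0) \<in> cycles ?C (Suc l)" using Cd(2)[OF st] by simp
      then have "f (s - s', 0) = 1" using f1 by (simp add: cone_cycles_absolute)
      moreover have "f (s - s', 0) = f (s, t) / f (s', t)" using f0(3)[OF st] by simp
      ultimately show ?thesis using U1_homs_nonzero[OF fU, of "(s', t)"] by simp
    qed
    \<comment> \<open>The cycles of \<open>A\<close> whose images in \<open>X\<close> are
      boundaries; in general a proper subgroup, which is why an extension has to be chosen.\<close>
    define H where "H = snd ` cycles ?C (Suc l)"
    define g0 where "g0 t = (if t \<in> H then f (SOME s. (s, t) \<in> cycles ?C (Suc l), t) else 1)" for t
    have g0: "g0 t = f (s, t)" if "(s, t) \<in> cycles ?C (Suc l)" for s t
    proof -
      have "(SOME s. (s, t) \<in> cycles ?C (Suc l), t) \<in> cycles ?C (Suc l)" using that by (rule someI)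
      moreover have "t \<in> H" using imageI[OF that, of snd] by (simp add: H_def)
      ultimately show ?thesis unfolding g0_def using indep[OF _ that] by (simp only: if_True)
    qed
    have H: "add_subgroup H"
      unfolding add_subgroup_def
    proof (intro conjI ballI)
      show "0 \<in> H" unfolding H_def using imageI[OF Cd(1), of snd] by simp
      fix t t' assume "t \<in> H" "t' \<in> H"
      then obtain x x' where x: "x \<in> cycles ?C (Suc l)" "x' \<in> cycles ?C (Suc l)" "t = snd x" "t' = snd x'"
        by (auto simp: H_def)
      show "t - t' \<in> H" unfolding H_def x(3,4) using imageI[OF Cd(2)[OF x(1,2)], of snd] by simp
    qed
    have "g0 \<in> U1_homs H"
    proof (rule U1_homsI)
      fix t t' assume "t \<in> H" "t' \<in> H"
      then obtain s s' where st: "(s, t) \<in> cycles ?C (Suc l)" "(s', t') \<in> cycles ?C (Suc l)" by (auto simp: H_def)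
      have "(s + s', t + t') \<in> cycles ?C (Suc l)" using Cd(4)[OF st] by simp
      then show "g0 (t + t') = g0 t * g0 t'" using g0[of "s + s'" "t + t'"] g0 st U1_homsD(2)[OF fU st] by simp
    next
      fix t assume "t \<in> H"
      then obtain s where st: "(s, t) \<in> cycles ?C (Suc l)" by (auto simp: H_def)
      then show "cmod (g0 t) = 1" using g0[OF st] U1_homsD(1)[OF fU st] by simp
    qed (simp add: g0_def)
    then obtain G where G: "\<And>x y. G (x + y) = G x + G y" "\<And>t. t \<in> H \<Longrightarrow> g0 t = exp2pi (G t)"
      by (rule U1_hom_lift[OF H]) (assumption | rule that)+
    define g where "g t = (if t \<in> cycles (smooth_complex A) l then exp2pi (G t) else 1)" for t
    have gU: "g \<in> U1_homs (cycles (smooth_complex A) l)"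
      using add_subgroupD(4)[OF ZA] by (intro U1_homsI) (auto simp: g_def G exp2pi_add)
    have gf: "g t = f (s, t)" if st: "(s, t) \<in> cycles ?C (Suc l)" for s t
    proof -
      have "t \<in> cycles (smooth_complex A) l" using st by (simp add: cone_cycles_Suc)
      moreover have "t \<in> H" using imageI[OF st, of snd] by (simp add: H_def)
      ultimately show ?thesis using G(2)[of t] g0[OF st] by (simp add: g_def)
    qed
    have "is_curvature A (Suc l) g (form_cmult (-1) \<theta>)"
      unfolding is_curvature_def
    proof (intro conjI ballI form_cmult_forms[OF A D(2)])
      fix y assume y: "y \<in> smooth_chains A (Suc l)"
      \<comment> \<open>The cone boundary of \<open>(0, - y)\<close> has the boundary of
        \<open>y\<close> as second component, which brings in minus \<open>\<theta>\<close> as the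
        curvature of \<open>g\<close>.\<close>
      have "(chain_boundary (Suc (Suc l)) 0 + chain_map (Suc l) \<phi> (- y), - chain_boundary (Suc l) (- y)) \<in> cycles ?C (Suc l)"
        using cbd_cycle[OF C, of "(0, - y)" "Suc l"] y by (simp add: cone_chains_Suc cbd_cone smooth_chainsD)
      from gf[OF this] D(3)[of 0 "- y"] y
      show "g (chain_boundary (Suc l) y) = exp2pi (chain_integral (Suc l) (form_cmult (-1) \<theta>) y)"
        by (simp add: smooth_chainsD chain_boundary_minus chain_integral_form_cmult)
    qed
    with gU have "g \<in> carrier (diff_chars A (Suc l))" by (auto simp: diff_chars_simps)
    moreover have "f = i_breve \<phi> X A (Suc (Suc l)) g"
    proof
      fix x
      show "f x = i_breve \<phi> X A (Suc (Suc l)) g x"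
        using gf[of "fst x" "snd x"] U1_homsD(3)[OF fU, of x] by (cases x) (simp add: i_breve_def)
    qed
    ultimately show "f \<in> i_breve \<phi> X A (Suc (Suc l)) ` carrier (diff_chars A (Suc l))" by blast
  qed
qed

section \<open>Exactness at the characters of the source\<close>

lemma flat_chars_iff:
  assumes X: "differential_space X"
  shows "h \<in> flat_chars X (Suc l) \<longleftrightarrow>
    h \<in> U1_homs (cycles (smooth_complex X) l) \<and> (\<forall>c\<in>smooth_chains X (Suc l). h (chain_boundary (Suc l) c) = 1)"
proof -
  have "h \<in> flat_chars X (Suc l) \<longleftrightarrow> h \<in> U1_homs (cycles (smooth_complex X) l) \<and> is_curvature X (Suc l) h zero_form"
  proof (intro iffI conjI)
    assume "h \<in> flat_chars X (Suc l)"
    then obtain x where x: "h \<in> U1_homs (cycles (smooth_complex X) l)" "is_curvature X (Suc l) h x"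
      "curv X (Suc l) h = zero_form"
      by (auto simp: flat_chars_def diff_chars_simps)
    show "h \<in> U1_homs (cycles (smooth_complex X) l)" by (rule x(1))
    show "is_curvature X (Suc l) h zero_form" using x(2) curv_eq[OF X x(2)] x(3) by simp
  next
    assume h: "h \<in> U1_homs (cycles (smooth_complex X) l) \<and> is_curvature X (Suc l) h zero_form"
    then have "curv X (Suc l) h = zero_form" by (intro curv_eq[OF X]) simp
    with h show "h \<in> flat_chars X (Suc l)" by (auto simp: flat_chars_def diff_chars_simps)
  qed
  then show ?thesis by (simp add: is_curvature_def zero_form_forms chain_integral_zero_form)
qed

text \<open>The kernel consists of the \<open>g\<close> with \<open>g t = 1\<close> whenever the
  image of \<open>t\<close> bounds in \<open>X\<close>. For such \<open>g\<close>, sending the image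
  of \<open>t\<close> plus a boundary to \<open>g t\<close> is a well defined character on a
  subgroup of the cycles of \<open>X\<close>. It is trivial on boundaries, so any extension to all
  cycles is flat and pulls back to \<open>g\<close>.\<close>

lemma pulled_back_flat_chars_eq_kernel:
  assumes A: "differential_space A" and X: "differential_space X" and \<phi>: "smooth_map A X \<phi>"
  shows "char_pullback A \<phi> (Suc l) ` flat_chars X (Suc l)
    = kernel (diff_chars A (Suc l)) (rel_diff_chars \<phi> X A (Suc (Suc l))) (i_breve \<phi> X A (Suc (Suc l)))"
proof
  let ?K = "kernel (diff_chars A (Suc l)) (rel_diff_chars \<phi> X A (Suc (Suc l))) (i_breve \<phi> X A (Suc (Suc l)))"
  let ?ZA = "cycles (smooth_complex A) l" and ?ZX = "cycles (smooth_complex X) l"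
  note ZA = add_subgroup_smooth_cycles[OF A, of l] and ZX = add_subgroup_smooth_cycles[OF X, of l]
  show "char_pullback A \<phi> (Suc l) ` flat_chars X (Suc l) \<subseteq> ?K"
  proof (rule image_subsetI)
    fix h assume "h \<in> flat_chars X (Suc l)"
    then have hU: "h \<in> U1_homs ?ZX" and flat: "\<And>c. c \<in> smooth_chains X (Suc l) \<Longrightarrow> h (chain_boundary (Suc l) c) = 1"
      by (simp_all add: flat_chars_iff[OF X])
    let ?g = "char_pullback A \<phi> (Suc l) h"
    have g: "?g t = h (chain_map l \<phi> t)" if "t \<in> ?ZA" for t using that by (simp add: char_pullback_def)
    have "?g \<in> U1_homs ?ZA"
      using chain_map_cycle[OF A X \<phi>] add_subgroupD(4)[OF ZA]
      by (intro U1_homsI) (auto simp: char_pullback_def chain_map_add U1_homsD[OF hU])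
    moreover have "is_curvature A (Suc l) ?g zero_form"
      unfolding is_curvature_def
    proof (intro conjI ballI zero_form_forms)
      fix c assume c: "c \<in> smooth_chains A (Suc l)"
      show "?g (chain_boundary (Suc l) c) = exp2pi (chain_integral (Suc l) zero_form c)"
        using g[OF chain_boundary_cycle[OF A c]] chain_boundary_chain_map_smooth[OF c, of \<phi>]
          flat[OF chain_map_smooth[OF A X \<phi> c]] by (simp add: chain_integral_zero_form)
    qed
    ultimately have "?g \<in> carrier (diff_chars A (Suc l))" by (auto simp: diff_chars_simps)
    moreover have "i_breve \<phi> X A (Suc (Suc l)) ?g = (\<lambda>_. 1)"
    proof
      fix x :: "'b chain \<times> 'a chain"
      obtain s t where x: "x = (s, t)" by (cases x)
      show "i_breve \<phi> X A (Suc (Suc l)) ?g x = 1"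
      proof (cases "x \<in> cycles (cone_complex \<phi> X A) (Suc l)")
        case True
        then have st: "s \<in> smooth_chains X (Suc l)" "t \<in> ?ZA" "chain_boundary (Suc l) s + chain_map l \<phi> t = 0"
          by (simp_all add: x cone_cycles_Suc)
        then have "chain_map l \<phi> t = chain_boundary (Suc l) (- s)"
          by (simp add: chain_boundary_minus eq_neg_iff_add_eq_0 add.commute)
        then have "?g t = 1" using g[OF st(2)] flat[of "- s"] st(1) by (simp add: smooth_chainsD)
        then show ?thesis by (simp add: x i_breve_def)
      qed (simp add: x i_breve_def)
    qed
    ultimately show "?g \<in> ?K" by (simp add: kernel_def rel_diff_chars_simps)
  qed
  show "?K \<subseteq> char_pullback A \<phi> (Suc l) ` flat_chars X (Suc l)"
  proof
    fix g assume "g \<in> ?K"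
    then have gU: "g \<in> U1_homs ?ZA" and i1: "i_breve \<phi> X A (Suc (Suc l)) g = (\<lambda>_. 1)"
      by (simp_all add: kernel_def diff_chars_simps rel_diff_chars_simps)
    have g1: "g t = 1" if t: "t \<in> ?ZA" "s \<in> smooth_chains X (Suc l)" "chain_map l \<phi> t = chain_boundary (Suc l) s" for s t
    proof -
      have "(- s, t) \<in> cycles (cone_complex \<phi> X A) (Suc l)"
        using t by (simp add: cone_cycles_Suc smooth_chainsD chain_boundary_minus)
      then show ?thesis using fun_cong[OF i1, of "(- s, t)"] by (simp add: i_breve_def)
    qed
    obtain F where F: "\<And>x y. F (x + y) = F x + F y" "\<And>t. t \<in> ?ZA \<Longrightarrow> g t = exp2pi (F t)"
      by (rule U1_hom_lift[OF ZA gU]) (rule that)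
    note F0 = additive_zero[of F, OF F(1)]
    \<comment> \<open>The graph of this partial character, before passing from \<open>t\<close> to
      \<open>g t\<close>; that \<open>rel 0 t\<close> forces \<open>F t\<close> to be an integer is
      its well-definedness.\<close>
    define rel where "rel x t \<longleftrightarrow> t \<in> ?ZA \<and> (\<exists>s\<in>smooth_chains X (Suc l). x = chain_map l \<phi> t + chain_boundary (Suc l) s)" for x t
    define H where "H = {x. \<exists>t. rel x t}"
    have rel_diff: "rel (x - y) (t - t')" if xy: "rel x t" "rel y t'" for x y t t'
    proof -
      obtain s s' where "s \<in> smooth_chains X (Suc l)" "s' \<in> smooth_chains X (Suc l)"
        "x = chain_map l \<phi> t + chain_boundary (Suc l) s" "y = chain_map l \<phi> t' + chain_boundary (Suc l) s'"
        using xy by (auto simp: rel_def)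
      then have "s - s' \<in> smooth_chains X (Suc l) \<and> x - y = chain_map l \<phi> (t - t') + chain_boundary (Suc l) (s - s')"
        by (simp add: smooth_chainsD chain_map_diff chain_boundary_diff)
      then show ?thesis using xy add_subgroupD(2)[OF ZA] unfolding rel_def by blast
    qed
    have F_int: "F t \<in> \<int>" if t: "rel 0 t" for t
    proof -
      obtain s where s: "t \<in> ?ZA" "s \<in> smooth_chains X (Suc l)" "0 = chain_map l \<phi> t + chain_boundary (Suc l) s"
        using t by (auto simp: rel_def)
      have "chain_map l \<phi> t = chain_boundary (Suc l) (- s)"
        unfolding chain_boundary_minus eq_neg_iff_add_eq_0 by (rule s(3)[symmetric])
      then show ?thesis using g1[OF s(1) smooth_chainsD(3)[OF s(2)]] F(2)[OF s(1)] by (simp add: exp2pi_eq_1_iff)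
    qed
    have rel0: "rel (chain_boundary (Suc l) s) 0" if "s \<in> smooth_chains X (Suc l)" for s
      using that add_subgroupD(1)[OF ZA] by (auto simp: rel_def)
    have H: "add_subgroup H"
      unfolding add_subgroup_def H_def using rel_diff rel0[of 0] by (auto simp: smooth_chainsD) (use rel_diff in blast)
    define f where "f x = F (SOME t. rel x t)" for x
    have f: "f x - F t \<in> \<int>" if "rel x t" for x t
    proof -
      have "rel x (SOME t. rel x t)" using that by (rule someI)
      from rel_diff[OF this that] have "F ((SOME t. rel x t) - t) \<in> \<int>" by (intro F_int) simp
      then show ?thesis by (simp add: f_def F0)
    qed
    have "f (x - y) - (f x - f y) \<in> \<int>" if xy: "x \<in> H" "y \<in> H" for x y
    proof -
      obtain t t' where t: "rel x t" "rel y t'" using xy by (auto simp: H_def)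
      have "(f (x - y) - F (t - t')) - ((f x - F t) - (f y - F t')) \<in> \<int>"
        using f[OF rel_diff[OF t]] f[OF t(1)] f[OF t(2)] by (rule Ints_diff[OF _ Ints_diff])
      then show ?thesis by (simp add: F0 algebra_simps)
    qed
    then obtain G where G: "\<And>x y. G (x + y) = G x + G y" "\<And>x. x \<in> H \<Longrightarrow> G x - f x \<in> \<int>"
      by (rule hom_Ints_extension[OF H]) (assumption | rule that)+
    have GF: "exp2pi (G x) = exp2pi (F t)" if "rel x t" for x t
    proof -
      have "x \<in> H" using that by (auto simp: H_def)
      from Ints_add[OF G(2)[OF this] f[OF that]] show ?thesis by (simp add: exp2pi_eq_iff)
    qed
    define h where "h z = (if z \<in> ?ZX then exp2pi (G z) else 1)" for z
    have "h \<in> U1_homs ?ZX"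
      using add_subgroupD(4)[OF ZX] by (intro U1_homsI) (auto simp: h_def G exp2pi_add)
    moreover have "h (chain_boundary (Suc l) s) = 1" if s: "s \<in> smooth_chains X (Suc l)" for s
      using GF[OF rel0[OF s]] chain_boundary_cycle[OF X s] F0 by (simp add: h_def)
    ultimately have "h \<in> flat_chars X (Suc l)" by (simp add: flat_chars_iff[OF X])
    moreover have "g = char_pullback A \<phi> (Suc l) h"
    proof
      fix t
      show "g t = char_pullback A \<phi> (Suc l) h t"
      proof (cases "t \<in> ?ZA")
        case True
        then have "rel (chain_map l \<phi> t) t" by (auto simp: rel_def smooth_chainsD intro!: bexI[of _ 0])
        then show ?thesis
          using GF F(2)[OF True] True chain_map_cycle[OF A X \<phi> True] by (simp add: char_pullback_def h_def)
      qed (simp add: char_pullback_def U1_homsD(3)[OF gU])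
    qed
    ultimately show "g \<in> char_pullback A \<phi> (Suc l) ` flat_chars X (Suc l)" by blast
  qed
qed

text \<open>A cone cycle of degree 0 has second component 0, so the restriction to \<open>X\<close>
  determines the relative character.\<close>

lemma p_breve_kernel_degree_1:
  "kernel (rel_diff_chars \<phi> X A (Suc 0)) (diff_chars X (Suc 0)) (p_breve X (Suc 0)) \<subseteq> {\<one>\<^bsub>rel_diff_chars \<phi> X A (Suc 0)\<^esub>}"
proof
  fix f assume "f \<in> kernel (rel_diff_chars \<phi> X A (Suc 0)) (diff_chars X (Suc 0)) (p_breve X (Suc 0))"
  then have fU: "f \<in> U1_homs (cycles (cone_complex \<phi> X A) 0)" and p1: "p_breve X (Suc 0) f = (\<lambda>_. 1)"
    by (simp_all add: kernel_def diff_chars_simps rel_diff_chars_simps)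
  have "f = (\<lambda>_. 1)"
  proof
    fix x
    show "f x = 1"
    proof (cases "x \<in> cycles (cone_complex \<phi> X A) 0")
      case True
      then obtain s where "x = (s, 0)" "s \<in> cycles (smooth_complex X) 0"
        using cone_cycles_0[of "fst x" "snd x" \<phi> X A] by (cases x) auto
      then show ?thesis using fun_cong[OF p1, of s] by (simp add: p_breve_def)
    qed (simp add: U1_homsD(3)[OF fU])
  qed
  then show "f \<in> {\<one>\<^bsub>rel_diff_chars \<phi> X A (Suc 0)\<^esub>}" by (simp add: rel_diff_chars_simps)
qed

section \<open>Exactness\<close>

lemma trivial_comm_group: "comm_group trivial"
  by (simp add: trivial_def)

lemma exact_at_start:
  assumes "comm_group G" "comm_group H" "f \<in> hom G H" "kernel G H f \<subseteq> {\<one>\<^bsub>G\<^esub>}"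
  shows "exact_at trivial (from_trivial G) G f H"
proof -
  interpret group_hom G H f
    using assms by (simp add: group_hom_def group_hom_axioms_def comm_group.axioms(2))
  have "from_trivial G \<in> hom trivial G"
    by (rule homI) (simp_all add: from_trivial_def)
  moreover have "kernel G H f = {\<one>\<^bsub>G\<^esub>}" using assms(4) by (auto simp: kernel_def)
  ultimately show ?thesis
    using assms trivial_comm_group by (simp add: exact_at_def from_trivial_def) (simp add: trivial_def)
qed

lemma exact_at_end:
  assumes "comm_group G" "comm_group H" "f \<in> hom G H" "f ` carrier G = carrier H"
  shows "exact_at G f H to_trivial trivial"
proof -
  have "to_trivial \<in> hom H trivial" by (rule homI) (simp_all add: trivial_def to_trivial_def)
  then show ?thesis
    using assms trivial_comm_group by (simp add: exact_at_def kernel_def to_trivial_def trivial_def)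
qed

lemma exact_at_end_diff_chars:
  assumes A: "differential_space A" and X: "differential_space X" and \<phi>: "smooth_map A X \<phi>" and dR: "de_rham_theorem X"
  shows "exact_at (diff_chars X (Suc m)) (cohomology_pullback A \<phi> (Suc m) \<circ> char_class X (Suc m))
      (pulled_back_cohomology X A \<phi> (Suc m)) to_trivial trivial"
  by (rule exact_at_end[OF diff_chars_comm_group[OF X] pulled_back_cohomology_comm_group[OF A X \<phi>] pulled_class_hom[OF A X \<phi>]])
     (simp only: image_comp[symmetric] char_class_surj[OF X dR] pulled_back_cohomology_simps(1))

lemma exact_at_diff_chars:
  assumes A: "differential_space A" and X: "differential_space X" and \<phi>: "smooth_map A X \<phi>" and dR: "de_rham_theorem A"
  shows "exact_at (rel_diff_chars \<phi> X A (Suc m)) (p_breve X (Suc m)) (diff_chars X (Suc m))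
      (cohomology_pullback A \<phi> (Suc m) \<circ> char_class X (Suc m)) (pulled_back_cohomology X A \<phi> (Suc m))"
proof -
  let ?F = "cohomology_pullback A \<phi> (Suc m) \<circ> char_class X (Suc m)"
  have "p_breve X (Suc m) ` carrier (rel_diff_chars \<phi> X A (Suc m))
      = kernel (diff_chars X (Suc m)) (pulled_back_cohomology X A \<phi> (Suc m)) ?F"
  proof (intro equalityI subsetI)
    fix h assume "h \<in> p_breve X (Suc m) ` carrier (rel_diff_chars \<phi> X A (Suc m))"
    then obtain f where f: "f \<in> carrier (rel_diff_chars \<phi> X A (Suc m))" "h = p_breve X (Suc m) f" by blast
    have "h \<in> carrier (diff_chars X (Suc m))" unfolding f(2) by (rule hom_in_carrier[OF p_breve_hom[OF X] f(1)])
    then show "h \<in> kernel (diff_chars X (Suc m)) (pulled_back_cohomology X A \<phi> (Suc m)) ?F"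
      using p_breve_image_subset[OF A X \<phi> f(1)] unfolding kernel_def f(2) by blast
  next
    fix h assume "h \<in> kernel (diff_chars X (Suc m)) (pulled_back_cohomology X A \<phi> (Suc m)) ?F"
    then have "h \<in> carrier (diff_chars X (Suc m))" "?F h = \<one>\<^bsub>pulled_back_cohomology X A \<phi> (Suc m)\<^esub>"
      unfolding kernel_def by blast+
    then show "h \<in> p_breve X (Suc m) ` carrier (rel_diff_chars \<phi> X A (Suc m))"
      by (rule p_breve_image_superset[OF A X \<phi> dR])
  qed
  then show ?thesis
    unfolding exact_at_def
    by (intro conjI rel_diff_chars_comm_group[OF X A] diff_chars_comm_group[OF X]
        pulled_back_cohomology_comm_group[OF A X \<phi>] p_breve_hom[OF X] pulled_class_hom[OF A X \<phi>])
qed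

lemma exact_at_rel_diff_chars:
  assumes A: "differential_space A" and X: "differential_space X" and \<phi>: "smooth_map A X \<phi>"
  shows "exact_at (diff_chars A (Suc l)) (i_breve \<phi> X A (Suc (Suc l)))
      (rel_diff_chars \<phi> X A (Suc (Suc l))) (p_breve X (Suc (Suc l))) (diff_chars X (Suc (Suc l)))"
  unfolding exact_at_def
  by (intro conjI diff_chars_comm_group[OF A] rel_diff_chars_comm_group[OF X A] diff_chars_comm_group[OF X]
      i_breve_hom[OF A X \<phi>] p_breve_hom[OF X] i_breve_image[OF A X \<phi>])

lemma pulled_back_flat_chars_comm_group:
  assumes A: "differential_space A" and X: "differential_space X" and \<phi>: "smooth_map A X \<phi>"
  shows "comm_group (pulled_back_flat_chars X A \<phi> (Suc l))"
proof -
  have "group_hom (diff_chars A (Suc l)) (rel_diff_chars \<phi> X A (Suc (Suc l))) (i_breve \<phi> X A (Suc (Suc l)))"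
    using i_breve_hom[OF A X \<phi>, of l] diff_chars_comm_group[OF A, of "Suc l"] rel_diff_chars_comm_group[OF X A, of \<phi> "Suc l"]
    by (simp add: group_hom_def group_hom_axioms_def comm_group.axioms(2))
  from group_hom.subgroup_kernel[OF this] show ?thesis
    unfolding pulled_back_flat_chars_def pulled_back_flat_chars_eq_kernel[OF A X \<phi>]
    by (rule subgroup_comm_group[OF diff_chars_comm_group[OF A]])
qed

lemma pulled_back_flat_chars_inclusion:
  assumes A: "differential_space A" and X: "differential_space X" and \<phi>: "smooth_map A X \<phi>"
  shows "(\<lambda>g. g) \<in> hom (pulled_back_flat_chars X A \<phi> (Suc l)) (diff_chars A (Suc l))"
  by (rule homI) (auto simp: pulled_back_flat_chars_def pulled_back_flat_chars_eq_kernel[OF A X \<phi>] kernel_def)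

lemma exact_at_pulled_back_flat_chars:
  assumes A: "differential_space A" and X: "differential_space X" and \<phi>: "smooth_map A X \<phi>"
  shows "exact_at trivial (from_trivial (pulled_back_flat_chars X A \<phi> (Suc l)))
      (pulled_back_flat_chars X A \<phi> (Suc l)) (\<lambda>g. g) (diff_chars A (Suc l))"
  by (rule exact_at_start[OF pulled_back_flat_chars_comm_group[OF A X \<phi>] diff_chars_comm_group[OF A]
        pulled_back_flat_chars_inclusion[OF A X \<phi>]])
     (auto simp: kernel_def pulled_back_flat_chars_def)

lemma exact_at_diff_chars_source:
  assumes A: "differential_space A" and X: "differential_space X" and \<phi>: "smooth_map A X \<phi>"
  shows "exact_at (pulled_back_flat_chars X A \<phi> (Suc l)) (\<lambda>g. g)
      (diff_chars A (Suc l)) (i_breve \<phi> X A (Suc (Suc l))) (rel_diff_chars \<phi> X A (Suc (Suc l)))"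
proof -
  have "(\<lambda>g. g) ` carrier (pulled_back_flat_chars X A \<phi> (Suc l))
      = kernel (diff_chars A (Suc l)) (rel_diff_chars \<phi> X A (Suc (Suc l))) (i_breve \<phi> X A (Suc (Suc l)))"
    by (simp add: pulled_back_flat_chars_def pulled_back_flat_chars_eq_kernel[OF A X \<phi>])
  then show ?thesis
    unfolding exact_at_def
    by (intro conjI pulled_back_flat_chars_comm_group[OF A X \<phi>] diff_chars_comm_group[OF A]
        rel_diff_chars_comm_group[OF X A] pulled_back_flat_chars_inclusion[OF A X \<phi>] i_breve_hom[OF A X \<phi>])
qed

section \<open>The sequence in degree 0\<close>

lemma cohomology_class_0_eq_iff:
  "cohomology_class K 0 u = cohomology_class K 0 v \<longleftrightarrow> u = v"
  unfolding cohomology_class_eq_iff coboundaries_0 by (auto simp: fun_eq_iff)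

text \<open>In degree 0 a class is a single cocycle. The cone has the same chains of degree 0 as
  \<open>X\<close>, but its boundaries also contain the images of 0-chains of \<open>A\<close>;
  hence its cocycles are the cocycles of \<open>X\<close> that pull back to zero.\<close>

lemma degree_0_exact:
  assumes A: "differential_space A" and X: "differential_space X" and \<phi>: "smooth_map A X \<phi>"
  shows "exact_at trivial (from_trivial (rel_cohomology \<phi> X A 0)) (rel_cohomology \<phi> X A 0) (p_breve_0 X) (integral_cohomology X 0)"
    and "exact_at (rel_cohomology \<phi> X A 0) (p_breve_0 X) (integral_cohomology X 0) (cohomology_pullback A \<phi> 0)
           (pulled_back_cohomology X A \<phi> 0)"
    and "exact_at (integral_cohomology X 0) (cohomology_pullback A \<phi> 0) (pulled_back_cohomology X A \<phi> 0) to_trivial trivial"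
proof -
  let ?C = "cone_complex \<phi> X A" and ?K = "smooth_complex X"
  let ?j = "cochain_pullback ?K (\<lambda>_ s. (s, 0)) 0 :: ('b chain \<times> 'a chain \<Rightarrow> int) \<Rightarrow> 'b chain \<Rightarrow> int"
  note K = is_complex_smooth[OF X] and C = is_complex_cone[OF A X \<phi>] and m = is_chain_map_cone[of X \<phi> A]
  have R: "comm_group (rel_cohomology \<phi> X A 0)" unfolding rel_cohomology_def by (rule cohomology_comm_group[OF C])
  have I: "comm_group (integral_cohomology X 0)" unfolding integral_cohomology_def by (rule cohomology_comm_group[OF K])
  note P = pulled_back_cohomology_comm_group[OF A X \<phi>, of 0] and pb = pullback_into_image_hom[OF A X \<phi>, of 0]
  have p: "p_breve_0 X \<in> hom (rel_cohomology \<phi> X A 0) (integral_cohomology X 0)"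
    unfolding p_breve_0_def rel_cohomology_def integral_cohomology_def by (rule cohomology_map_hom[OF K m])
  have pc: "p_breve_0 X (cohomology_class ?C 0 u) = cohomology_class ?K 0 (?j u)" for u
    unfolding p_breve_0_def by (rule cohomology_map_class[OF K m])
  show "exact_at trivial (from_trivial (rel_cohomology \<phi> X A 0)) (rel_cohomology \<phi> X A 0) (p_breve_0 X) (integral_cohomology X 0)"
  proof (rule exact_at_start[OF R I p], rule subsetI)
    fix x assume "x \<in> kernel (rel_cohomology \<phi> X A 0) (integral_cohomology X 0) (p_breve_0 X)"
    then obtain u where u: "u \<in> cocycles ?C 0" "x = cohomology_class ?C 0 u"
      "p_breve_0 X x = cohomology_class ?K 0 (\<lambda>_. 0)"
      by (auto simp: kernel_def rel_cohomology_def integral_cohomology_def carrier_cohomology one_cohomology)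
    have ju: "?j u = (\<lambda>_. 0)" using u(3) unfolding u(2) pc cohomology_class_0_eq_iff .
    have "u z = 0" for z
    proof (cases "z \<in> chains ?C 0")
      case True
      then obtain s where s: "z = (s, 0)" "s \<in> smooth_chains X 0"
        using cone_chains_0[of "fst z" "snd z" \<phi> X A] by (cases z) auto
      then show ?thesis using fun_cong[OF ju, of s] by (simp add: cochain_pullback_def)
    next
      case False
      then show ?thesis using u(1) cochainsD(2)[of u ?C 0 z] by (simp add: cocycles_def)
    qed
    then have "u = (\<lambda>_. 0)" by auto
    then show "x \<in> {\<one>\<^bsub>rel_cohomology \<phi> X A 0\<^esub>}" by (simp add: u(2) rel_cohomology_def one_cohomology)
  qed
  have "p_breve_0 X ` carrier (rel_cohomology \<phi> X A 0)
      = kernel (integral_cohomology X 0) (pulled_back_cohomology X A \<phi> 0) (cohomology_pullback A \<phi> 0)"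
  proof (intro equalityI subsetI)
    fix y assume "y \<in> p_breve_0 X ` carrier (rel_cohomology \<phi> X A 0)"
    then obtain u where u: "u \<in> cocycles ?C 0" "y = cohomology_class ?K 0 (?j u)"
      by (auto simp: rel_cohomology_def carrier_cohomology pc)
    have "cochain_pullback (smooth_complex A) (\<lambda>p. chain_map p \<phi>) 0 (?j u) = (\<lambda>_. 0)"
    proof
      fix t
      show "cochain_pullback (smooth_complex A) (\<lambda>p. chain_map p \<phi>) 0 (?j u) t = 0"
      proof (cases "t \<in> smooth_chains A 0")
        case True
        \<comment> \<open>The cone boundary of \<open>(0, t)\<close> is the image of
          \<open>t\<close> paired with 0, since 0-chains have zero boundary.\<close>
        then have "u (cbd ?C (Suc 0) (0, t)) = 0"
          by (intro cocycle_boundary[OF u(1)]) (simp add: cone_chains_Suc smooth_chainsD)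
        then show ?thesis
          using True chain_map_smooth[OF A X \<phi> True] by (simp add: cochain_pullback_def cbd_cone)
      qed (simp add: cochain_pullback_def)
    qed
    then have "cohomology_pullback A \<phi> 0 y = \<one>\<^bsub>pulled_back_cohomology X A \<phi> 0\<^esub>"
      unfolding u(2) cohomology_pullback_class[OF A X \<phi>]
      by (simp add: pulled_back_cohomology_simps integral_cohomology_def one_cohomology)
    moreover have "y \<in> carrier (integral_cohomology X 0)"
      using cochain_pullback_cocycles[OF K m u(1)] by (simp add: u(2) integral_cohomology_def carrier_cohomology)
    ultimately show "y \<in> kernel (integral_cohomology X 0) (pulled_back_cohomology X A \<phi> 0) (cohomology_pullback A \<phi> 0)"
      by (simp add: kernel_def)
  next
    fix y assume "y \<in> kernel (integral_cohomology X 0) (pulled_back_cohomology X A \<phi> 0) (cohomology_pullback A \<phi> 0)"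
    then obtain v where v: "v \<in> cocycles ?K 0" "y = cohomology_class ?K 0 v"
      and y1: "cohomology_pullback A \<phi> 0 y = cohomology_class (smooth_complex A) 0 (\<lambda>_. 0)"
      by (auto simp: kernel_def integral_cohomology_def carrier_cohomology one_cohomology pulled_back_cohomology_simps)
    have v0: "cochain_pullback (smooth_complex A) (\<lambda>p. chain_map p \<phi>) 0 v = (\<lambda>_. 0)"
      using y1 unfolding v(2) cohomology_pullback_class[OF A X \<phi>] cohomology_class_0_eq_iff .
    have vA: "v (chain_map 0 \<phi> t) = 0" if "t \<in> smooth_chains A 0" for t
      using fun_cong[OF v0, of t] that by (simp add: cochain_pullback_def)
    have vc: "v \<in> cochains ?K 0" using v(1) by (simp add: cocycles_def)
    define u where "u z = (if z \<in> chains ?C 0 then v (fst z) else 0)" for z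
    have ch: "fst z \<in> smooth_chains X 0" if "z \<in> chains ?C 0" for z
      using that cone_chains_0[of "fst z" "snd z" \<phi> X A] by simp
    have "u \<in> cochains ?C 0"
      using add_subgroupD(4)[OF is_complexD(1)[OF C]] cochainsD(1)[OF vc] ch
      by (intro cochainsI) (auto simp: u_def)
    moreover have "u (cbd ?C (Suc 0) z) = 0" if z: "z \<in> chains ?C (Suc 0)" for z
    proof -
      obtain s t where st: "z = (s, t)" "s \<in> smooth_chains X (Suc 0)" "t \<in> smooth_chains A 0"
        using z cone_chains_Suc[of "fst z" "snd z" \<phi> X A 0] by (cases z) auto
      have "u (cbd ?C (Suc 0) z) = v (chain_boundary (Suc 0) s + chain_map 0 \<phi> t)"
        using is_complexD(3)[OF C z] by (simp add: u_def st(1) cbd_cone)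
      also have "\<dots> = v (chain_boundary (Suc 0) s) + v (chain_map 0 \<phi> t)"
        by (rule cochainsD(1)[OF vc chain_boundary_smooth[OF X st(2)] chain_map_smooth[OF A X \<phi> st(3)]])
      also have "\<dots> = 0" using cocycle_boundary[OF v(1)] st vA by simp
      finally show ?thesis .
    qed
    ultimately have u: "u \<in> cocycles ?C 0" by (auto simp: cocycles_def coboundary_def)
    have "?j u = v"
    proof
      fix s show "?j u s = v s"
        using cochainsD(2)[OF vc, of s] by (simp add: cochain_pullback_def u_def cone_chains_0)
    qed
    then have "y = p_breve_0 X (cohomology_class ?C 0 u)" by (simp add: pc v(2))
    moreover have "cohomology_class ?C 0 u \<in> carrier (rel_cohomology \<phi> X A 0)"
      using u by (simp add: rel_cohomology_def carrier_cohomology)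
    ultimately show "y \<in> p_breve_0 X ` carrier (rel_cohomology \<phi> X A 0)" by blast
  qed
  then show "exact_at (rel_cohomology \<phi> X A 0) (p_breve_0 X) (integral_cohomology X 0) (cohomology_pullback A \<phi> 0)
           (pulled_back_cohomology X A \<phi> 0)"
    using R I P p pb by (simp add: exact_at_def)
  show "exact_at (integral_cohomology X 0) (cohomology_pullback A \<phi> 0) (pulled_back_cohomology X A \<phi> 0) to_trivial trivial"
    by (rule exact_at_end[OF I P pb]) (simp add: pulled_back_cohomology_simps)
qed

theorem theorem8p6:
  fixes A :: "'a dspace" and X :: "'b dspace" and \<phi> :: "'a \<Rightarrow> 'b" and k :: nat
  assumes "smooth_space A" and "smooth_space X" and "smooth_map A X \<phi>"
  shows "(2 \<le> k \<longrightarrow>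
            exact_at trivial (from_trivial (pulled_back_flat_chars X A \<phi> (k - 1)))
              (pulled_back_flat_chars X A \<phi> (k - 1)) (\<lambda>g. g) (diff_chars A (k - 1)) \<and>
            exact_at (pulled_back_flat_chars X A \<phi> (k - 1)) (\<lambda>g. g)
              (diff_chars A (k - 1)) (i_breve \<phi> X A k) (rel_diff_chars \<phi> X A k) \<and>
            exact_at (diff_chars A (k - 1)) (i_breve \<phi> X A k)
              (rel_diff_chars \<phi> X A k) (p_breve X k) (diff_chars X k) \<and>
            exact_at (rel_diff_chars \<phi> X A k) (p_breve X k)
              (diff_chars X k) (cohomology_pullback A \<phi> k \<circ> char_class X k)
              (pulled_back_cohomology X A \<phi> k) \<and>
            exact_at (diff_chars X k) (cohomology_pullback A \<phi> k \<circ> char_class X k)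
              (pulled_back_cohomology X A \<phi> k) to_trivial trivial) \<and>
         (k = 1 \<longrightarrow>
            exact_at trivial (from_trivial (rel_diff_chars \<phi> X A k))
              (rel_diff_chars \<phi> X A k) (p_breve X k) (diff_chars X k) \<and>
            exact_at (rel_diff_chars \<phi> X A k) (p_breve X k)
              (diff_chars X k) (cohomology_pullback A \<phi> k \<circ> char_class X k)
              (pulled_back_cohomology X A \<phi> k) \<and>
            exact_at (diff_chars X k) (cohomology_pullback A \<phi> k \<circ> char_class X k)
              (pulled_back_cohomology X A \<phi> k) to_trivial trivial) \<and>
         (k = 0 \<longrightarrow>
            exact_at trivial (from_trivial (rel_cohomology \<phi> X A k))
              (rel_cohomology \<phi> X A k) (p_breve_0 X) (integral_cohomology X k) \<and>
            exact_at (rel_cohomology \<phi> X A k) (p_breve_0 X)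
              (integral_cohomology X k) (cohomology_pullback A \<phi> k)
              (pulled_back_cohomology X A \<phi> k) \<and>
            exact_at (integral_cohomology X k) (cohomology_pullback A \<phi> k)
              (pulled_back_cohomology X A \<phi> k) to_trivial trivial)"
proof -
  have A: "differential_space A" "de_rham_theorem A" and X: "differential_space X" "de_rham_theorem X"
    using assms(1,2) by (simp_all add: smooth_space_def)
  note maps = A(1) X(1) assms(3)
  consider "k = 0" | "k = Suc 0" | l where "k = Suc (Suc l)"
    by (metis not0_implies_Suc)
  then show ?thesis
  proof cases
    case 1
    then show ?thesis using degree_0_exact[OF maps] by simp
  next
    case 2
    have "exact_at trivial (from_trivial (rel_diff_chars \<phi> X A (Suc 0)))
        (rel_diff_chars \<phi> X A (Suc 0)) (p_breve X (Suc 0)) (diff_chars X (Suc 0))"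
      by (rule exact_at_start[OF rel_diff_chars_comm_group[OF X(1) A(1)] diff_chars_comm_group[OF X(1)]
            p_breve_hom[OF X(1)] p_breve_kernel_degree_1])
    then show ?thesis
      using exact_at_diff_chars[OF maps A(2), of 0] exact_at_end_diff_chars[OF maps X(2), of 0] 2 by simp
  next
    case 3
    show ?thesis
      using exact_at_pulled_back_flat_chars[OF maps, of l] exact_at_diff_chars_source[OF maps, of l]
        exact_at_rel_diff_chars[OF maps, of l] exact_at_diff_chars[OF maps A(2), of "Suc l"]
        exact_at_end_diff_chars[OF maps X(2), of "Suc l"] 3 by simp
  qed
qed

end
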